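(* Let $c>0$ and $n\geq1$; the following propositions are equivalent: (i) Inequality $\mathrm{IS}_n(c)$ holds. (ii) For all log-concave probability measures $\eta_1,\eta_2$ on $\mathbb{R}^n$ such that, for $i=1,2$, $d\eta_i=e^{-V_i}\,dx$ for some essentially continuous convex function $V_i:\mathbb{R}^n\to\mathbb{R}\cup\{+\infty\}$, it holds \[ \mathcal{T}(\nu_1,\eta_1)+H(\eta_1|\mathrm{Leb})+\mathcal{T}(\nu_2,\eta_2)+H(\eta_2|\mathrm{Leb})\leq-n\log c+\mathcal{T}(\nu_1,\nu_2),\qquad(\ast) \] where $\nu_1,\nu_2$ are the moment measures of $\eta_1$ and $\eta_2$. (iii) For all log-concave probability measures $\eta_1,\eta_2$ on $\mathbb{R}^n$ such that, for $i=1,2$, $d\eta_i=e^{-V_i}\,dx$ for some essentially continuous convex function $V_i:\mathbb{R}^n\to\mathbb{R}\cup\{+\infty\}$, it holds \[ \int V_1^*\,d\nu_1+\int V_2^*\,d\nu_2\leq-n\log c+\mathcal{T}(\nu_1,\nu_2), \] where $\nu_1,\nu_2$ are the moment measures of $\eta_1$ and $\eta_2$. Moreover, if $V_i:\mathbb{R}^n\to\mathbb{R}$ (is finite valued) for $i=1,2$, then $(\ast)$ reduces to \[ H(\eta_1|\mathrm{Leb})+H(\eta_2|\mathrm{Leb})\leq-n\log(e^2c)+\mathcal{T}(\nu_1,\nu_2). \] The same result holds for inequality $\mathrm{IS}_{n,u}(c)$ (resp. $\mathrm{IS}_{n,s}(c)$) with the extra condition that $\eta_1,\eta_2$ are unconditional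 (resp. symmetric).
   Context: $\mathcal{F}(\mathbb{R}^n)$ is the set of lower semicontinuous convex functions $f:\mathbb{R}^n\to\mathbb{R}\cup\{+\infty\}$ finite at at least one point; $\mathrm{dom}(f)=\{f<+\infty\}$; $f^*(y)=\sup_{x\in\mathbb{R}^n}\{x\cdot y-f(x)\}$. Functions/measures are symmetric if invariant under $x\mapsto-x$, unconditional if invariant under all maps $x\mapsto(\varepsilon_1x_1,\ldots,\varepsilon_nx_n)$, $\varepsilon\in\{-1,1\}^n$; $\mathcal{F}_s(\mathbb{R}^n),\mathcal{F}_u(\mathbb{R}^n)$ are the symmetric, resp. unconditional, elements of $\mathcal{F}(\mathbb{R}^n)$. $\mathrm{IS}_n(c)$ holds if $\int e^{-f}\,dx\int e^{-f^*}\,dx\geq c^n$ for all $f\in\mathcal{F}(\mathbb{R}^n)$ with $0<\int e^{-f}\,dx$ and $0<\int e^{-f^*}\,dx$; $\mathrm{IS}_{n,s}(c)$ (resp. $\mathrm{IS}_{n,u}(c)$) holds if the same is true for all such $f\in\mathcal{F}_s(\mathbb{R}^n)$ (resp. $\mathcal{F}_u(\mathbb{R}^n)$). A measure is log-concave if it is of the form $e^{-V}dx$ with $V:\mathbb{R}^n\to\mathbb{R}\cup\{+\infty\}$ convex. $V\in\mathcal{F}(\mathbb{R}^n)$ is essentially continuous if the set of points where it is discontinuous (as a function with values in $\mathbb{R}\cup\{+\infty\}$) is negligible for the $(n-1)$-dimensional Hausdorff measure; equivalently $\mathcal{H}_{n-1}(\{x\in\partial\,\mathrm{dom}(V):V(x)<\infty\})=0$.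 The moment measure of a probability measure $d\eta=e^{-V}dx$, $V\in\mathcal{F}(\mathbb{R}^n)$, is the push-forward $(\nabla V)_\#\eta$ (under the essential continuity assumption it has finite first moment). $\mathcal{P}_1(\mathbb{R}^n)$ is the set of Borel probability measures with finite first moment. For $d\eta=h\,dx\in\mathcal{P}_1(\mathbb{R}^n)$, $H(\eta|\mathrm{Leb})=\int h\log h\,dx$. For $\nu_1,\nu_2\in\mathcal{P}_1(\mathbb{R}^n)$, $\mathcal{T}(\nu_1,\nu_2)=\inf_{f\in\mathcal{F}(\mathbb{R}^n)}\left\{\int f\,d\nu_1+\int f^*\,d\nu_2\right\}$, the integrals being well defined in $\mathbb{R}\cup\{+\infty\}$. *)

theory Defs
  imports "HOL-Probability.Probability"
begin

section \<open>Convex functions with values in the extended reals\<close>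

definition convex_ereal :: "('a::real_vector \<Rightarrow> ereal) \<Rightarrow> bool" where
  "convex_ereal f \<longleftrightarrow>
     (\<forall>x y. \<forall>t\<in>{0..1}. f ((1 - t) *\<^sub>R x + t *\<^sub>R y) \<le> ereal (1 - t) * f x + ereal t * f y)"

definition lsc :: "('a::topological_space \<Rightarrow> ereal) \<Rightarrow> bool" where
  "lsc f \<longleftrightarrow> (\<forall>x. f x \<le> Liminf (at x) f)"

definition convex_lsc :: "('a::real_normed_vector \<Rightarrow> ereal) set" where
  "convex_lsc = {f. convex_ereal f \<and> lsc f \<and> (\<forall>x. f x \<noteq> -\<infinity>) \<and> (\<exists>x. f x \<noteq> \<infinity>)}"

definition effective_dom :: "('a \<Rightarrow> ereal) \<Rightarrow> 'a set" where
  "effective_dom f = {x. f x < \<infinity>}"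

definition conjugate :: "('a::real_inner \<Rightarrow> ereal) \<Rightarrow> 'a \<Rightarrow> ereal" where
  "conjugate f y = (SUP x. ereal (x \<bullet> y) - f x)"

definition sign_change :: "real^'n \<Rightarrow> real^'n \<Rightarrow> real^'n" where
  "sign_change \<epsilon> x = (\<chi> i. \<epsilon> $ i * x $ i)"

definition convex_lsc_sym :: "(real^'n \<Rightarrow> ereal) set" where
  "convex_lsc_sym = {f \<in> convex_lsc. \<forall>x. f (- x) = f x}"

definition convex_lsc_uncond :: "(real^'n \<Rightarrow> ereal) set" where
  "convex_lsc_uncond =
     {f \<in> convex_lsc. \<forall>\<epsilon>. (\<forall>i. \<epsilon> $ i \<in> {-1, 1}) \<longrightarrow> (\<forall>x. f (sign_change \<epsilon> x) = f x)}"


section \<open>Inverse Santalo inequalities\<close>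

definition exp_minus :: "ereal \<Rightarrow> ennreal" where
  "exp_minus a = (case a of ereal r \<Rightarrow> ennreal (exp (- r)) | PInfty \<Rightarrow> 0 | MInfty \<Rightarrow> \<infinity>)"

text \<open>The inequality with constant \<open>c\<close>, restricted to the functions of a class \<open>G\<close>.\<close>

definition inverse_santalo :: "(real^'n \<Rightarrow> ereal) set \<Rightarrow> real \<Rightarrow> bool" where
  "inverse_santalo G c \<longleftrightarrow>
     (\<forall>f\<in>G. 0 < (\<integral>\<^sup>+x. exp_minus (f x) \<partial>lborel) \<and> 0 < (\<integral>\<^sup>+x. exp_minus (conjugate f x) \<partial>lborel) \<longrightarrow>
        (\<integral>\<^sup>+x. exp_minus (f x) \<partial>lborel) * (\<integral>\<^sup>+x. exp_minus (conjugate f x) \<partial>lborel)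
          \<ge> ennreal (c ^ CARD('n)))"


section \<open>Essential continuity\<close>

text \<open>
  The Hausdorff outer measure of dimension \<open>k\<close>. Since \<open>0 ^ 0 = 1\<close>, a nonempty set contributes \<open>1\<close>
  when \<open>k = 0\<close>, which gives counting measure; the empty set has to contribute \<open>0\<close>. Covering sets
  are required to be bounded because \<^const>\<open>diameter\<close> is not meaningful for unbounded sets.
\<close>

definition hausdorff_weight :: "nat \<Rightarrow> 'a::metric_space set \<Rightarrow> ennreal" where
  "hausdorff_weight k U =
     (if U = {} then 0 else ennreal (unit_ball_vol (real k) * (diameter U / 2) ^ k))"

definition hausdorff_measure :: "nat \<Rightarrow> 'a::metric_space set \<Rightarrow> ennreal" where
  "hausdorff_measure k A =
     (SUP \<delta>\<in>{0<..}. INF U\<in>{U :: nat \<Rightarrow> 'a set. A \<subseteq> (\<Union>i. U i) \<and> (\<forall>i. bounded (U i) \<and> diameter (U i) \<le> \<delta>)}.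
        (\<Sum>i. hausdorff_weight k (U i)))"

definition essentially_continuous :: "(real^'n \<Rightarrow> ereal) \<Rightarrow> bool" where
  "essentially_continuous V \<longleftrightarrow> hausdorff_measure (CARD('n) - 1) {x. \<not> isCont V x} = 0"


section \<open>Log-concave measures and moment measures\<close>

text \<open>
  \<open>\<eta>\<close> is a probability measure with density \<open>exp (- V)\<close>; its log-concavity is witnessed by \<open>V\<close>.
\<close>

definition log_concave_prob :: "(real^'n) measure \<Rightarrow> (real^'n \<Rightarrow> ereal) \<Rightarrow> bool" where
  "log_concave_prob \<eta> V \<longleftrightarrow>
     V \<in> convex_lsc \<and> \<eta> = density lborel (\<lambda>x. exp_minus (V x)) \<and> prob_space \<eta>"

definition measures_sym :: "(real^'n) measure set" where
  "measures_sym = {\<eta>. distr \<eta> \<eta> uminus = \<eta>}"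

definition measures_uncond :: "(real^'n) measure set" where
  "measures_uncond = {\<eta>. \<forall>\<epsilon>. (\<forall>i. \<epsilon> $ i \<in> {-1, 1}) \<longrightarrow> distr \<eta> \<eta> (sign_change \<epsilon>) = \<eta>}"

text \<open>
  A convex \<open>V\<close> is differentiable at almost every point of its domain. The value \<open>0\<close> chosen at the
  other points only affects a null set for the measure with density \<open>exp (- V)\<close>.
\<close>

definition grad :: "('a::real_inner \<Rightarrow> ereal) \<Rightarrow> 'a \<Rightarrow> 'a" where
  "grad V x =
     (if x \<in> interior (effective_dom V) \<and> (\<exists>D. GDERIV (\<lambda>y. real_of_ereal (V y)) x :> D)
      then THE D. GDERIV (\<lambda>y. real_of_ereal (V y)) x :> D else 0)"

definition moment_measure :: "(real^'n \<Rightarrow> ereal) \<Rightarrow> (real^'n) measure" where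
  "moment_measure V = distr (density lborel (\<lambda>x. exp_minus (V x))) borel (grad V)"


section \<open>Entropy and transport cost\<close>

text \<open>
  Integral with values in the extended reals, meaningful as soon as the positive or the negative part
  has a finite integral. This is the case for all the integrals below: an element of
  \<^const>\<open>convex_lsc\<close> is bounded below by an affine function, so that its negative part is
  integrable for every probability measure with a finite first moment.
\<close>

definition ereal_integral :: "'a measure \<Rightarrow> ('a \<Rightarrow> ereal) \<Rightarrow> ereal" where
  "ereal_integral M f =
     enn2ereal (\<integral>\<^sup>+x. e2ennreal (f x) \<partial>M) - enn2ereal (\<integral>\<^sup>+x. e2ennreal (- f x) \<partial>M)"

text \<open>For \<open>\<eta>\<close> absolutely continuous; \<open>h\<close> is its Lebesgue density and \<open>h * ln h\<close> vanishes where \<open>h\<close> does.\<close>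

definition entropy_Leb :: "(real^'n) measure \<Rightarrow> ereal" where
  "entropy_Leb \<eta> =
     ereal_integral lborel (\<lambda>x. let h = enn2real (RN_deriv lborel \<eta> x) in ereal (h * ln h))"

definition transport :: "(real^'n) measure \<Rightarrow> (real^'n) measure \<Rightarrow> ereal" where
  "transport \<nu>\<^sub>1 \<nu>\<^sub>2 =
     (INF f\<in>convex_lsc. ereal_integral \<nu>\<^sub>1 f + ereal_integral \<nu>\<^sub>2 (conjugate f))"

end

theory Submission
  imports Defs
begin

text \<open>
  Write \<open>Z(f)\<close> for the integral of \<open>e\<^sup>-\<^sup>f\<close>, let \<open>d\<eta> = e\<^sup>-\<^sup>V dx\<close> be a probability measure with essentially
  continuous convex \<open>V\<close>, and let \<open>\<nu>\<close> be its moment measure, the image of \<open>\<eta>\<close> under \<open>\<nabla>V\<close>. Two facts about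
  such a \<open>V\<close> carry the equivalence.

  The first is an integration by parts without boundary term: \<open>\<integral> (x - x0) \<bullet> \<nabla>V d\<eta> = n\<close> for every point
  \<open>x0\<close> in the interior of the domain (\<open>integral_radial_derivative\<close>). Varying \<open>x0\<close> gives
  \<open>\<integral> \<nabla>V d\<eta> = 0\<close> and \<open>\<integral> x \<bullet> \<nabla>V d\<eta> = n\<close> (\<open>gibbs_moments\<close>). The Young inequality
  \<open>x \<bullet> y \<le> V x + V\<^sup>* y\<close> is an equality at \<open>y = \<nabla>V x\<close>, so \<open>V\<^sup>*\<close> is optimal in the transport cost between
  \<open>\<nu>\<close> and \<open>\<eta>\<close>, and that cost is \<open>n\<close>. Since the entropy of \<open>\<eta>\<close> is \<open>- \<integral> V d\<eta>\<close> and
  \<open>\<integral> V\<^sup>* d\<nu> = n - \<integral> V d\<eta>\<close>, the left-hand sides of the two transport inequalities are the same real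
  number. When the potentials are finite-valued, the two transport costs on the left contribute \<open>2 n\<close>,
  which is the passage from \<open>c\<close> to \<open>e\<^sup>2 c\<close> in the last claim.

  The second is the tangent inequality \<open>log Z(f) \<le> \<integral> f\<^sup>* d\<nu> - \<integral> V\<^sup>* d\<nu>\<close> for every convex lower
  semicontinuous \<open>f\<close> (\<open>exp_integral_le_moment_measure\<close>), with equality for \<open>f = V\<close>. It says that \<open>V\<^sup>*\<close>
  maximises \<open>\<phi> \<mapsto> log Z(\<phi>\<^sup>*) - \<integral> \<phi> d\<nu>\<close>, a functional that is concave by the Prekopa--Leindler
  inequality and critical at \<open>V\<^sup>*\<close> by the definition of \<open>\<nu>\<close>. If the inverse Santalo inequality holds, then
  adding the tangent inequalities for \<open>V\<^sub>1\<close> at \<open>f\<^sup>*\<close> and for \<open>V\<^sub>2\<close> at \<open>f\<close> bounds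
  \<open>\<integral> V\<^sub>1\<^sup>* d\<nu>\<^sub>1 + \<integral> V\<^sub>2\<^sup>* d\<nu>\<^sub>2 + n log c\<close> by \<open>\<integral> f d\<nu>\<^sub>1 + \<integral> f\<^sup>* d\<nu>\<^sub>2\<close>, and the infimum over \<open>f\<close> is the
  transport cost (\<open>transport_bound_of_santalo\<close>). Conversely, when \<open>f\<close> and \<open>f\<^sup>*\<close> are finite-valued, the transport
  inequality for \<open>V\<^sub>1 = f + log Z(f)\<close> and \<open>V\<^sub>2 = f\<^sup>* + log Z(f\<^sup>*)\<close>, tested with the competitor \<open>f\<^sup>*\<close>,
  collapses to \<open>n log c \<le> log (Z(f) Z(f\<^sup>*))\<close>; the general case follows by approximation
  (\<open>santalo_of_transport_bound\<close>).

  Essential continuity enters through rays only. A set of vanishing \<open>(n - 1)\<close>-dimensional Hausdorff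
  measure spans a Lebesgue null cone, so almost every ray from \<open>x0\<close> leaves the domain at a point where
  \<open>V\<close> is infinite, and \<open>e\<^sup>-\<^sup>V\<close> is absolutely continuous along it. In the tangent inequality \<open>V\<close> is first replaced
  by a Lipschitz regularisation, for which differentiating under the integral is harmless. The return
  to \<open>V\<close> is Fatou's lemma together with the exact value \<open>n\<close> above: it leaves no room for gradient mass
  to escape to infinity. The symmetric and unconditional classes are treated together with the
  general one, as functions and measures invariant under a finite group of isometric involutions, over
  which competitors can be averaged.
\<close>

section \<open>Lower semicontinuous convex functions\<close>

text \<open>
  Lower semicontinuity at \<open>x\<close> in the form that is applied along convergent sequences and
  nets; it makes no difference whether \<open>x\<close> itself is kept among the neighbours.
\<close>
lemma lsc_iff_eventually:
  "lsc f \<longleftrightarrow> (\<forall>x a. a < f x \<longrightarrow> (\<forall>\<^sub>F y in nhds x. a < f y))"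
  unfolding lsc_def le_Liminf_iff
  by (auto simp: eventually_nhds_conv_at)

lemma lsc_closed_sublevel:
  assumes "lsc f" shows "closed {x. f x \<le> a}"
proof -
  have "open {x. a < f x}"
    by (subst open_subopen) (use assms in \<open>fastforce simp: lsc_iff_eventually eventually_nhds\<close>)
  then show ?thesis
    by (auto simp: closed_def Compl_eq not_le)
qed

lemma borel_measurable_lsc:
  fixes f :: "'a::real_normed_vector \<Rightarrow> ereal"
  assumes "lsc f" shows "f \<in> borel_measurable borel"
  using lsc_closed_sublevel[OF assms] by (intro borel_measurableI_le) auto

lemma convex_lscD:
  assumes "f \<in> convex_lsc"
  shows "convex_ereal f" "lsc f" "f x \<noteq> -\<infinity>" "\<exists>x r. f x = ereal r"
proof -
  show "convex_ereal f" "lsc f" "f x \<noteq> -\<infinity>"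
    using assms by (auto simp: convex_lsc_def)
  obtain z where "f z \<noteq> \<infinity>" "f z \<noteq> -\<infinity>"
    using assms by (auto simp: convex_lsc_def)
  then show "\<exists>x r. f x = ereal r" by (cases "f z") auto
qed

lemma borel_measurable_convex_lsc [measurable (raw)]:
  "f \<in> convex_lsc \<Longrightarrow> f \<in> borel_measurable borel"
  by (simp add: borel_measurable_lsc convex_lscD)

lemma convex_erealD:
  assumes "convex_ereal f" "f x \<le> ereal a" "f y \<le> ereal b" "0 \<le> t" "t \<le> 1"
  shows "f ((1 - t) *\<^sub>R x + t *\<^sub>R y) \<le> ereal ((1 - t) * a + t * b)"
proof -
  have "f ((1 - t) *\<^sub>R x + t *\<^sub>R y) \<le> ereal (1 - t) * f x + ereal t * f y"
    using assms by (auto simp: convex_ereal_def)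
  also have "\<dots> \<le> ereal (1 - t) * ereal a + ereal t * ereal b"
    using assms by (intro add_mono ereal_mult_left_mono) auto
  finally show ?thesis by simp
qed

lemma convex_effective_dom:
  assumes "convex_ereal f" shows "convex (effective_dom f)"
proof (rule convexI)
  fix x y and u v :: real assume *: "x \<in> effective_dom f" "y \<in> effective_dom f" "0 \<le> u" "0 \<le> v" "u + v = 1"
  obtain a b where "f x \<le> ereal a" "f y \<le> ereal b"
    using * unfolding effective_dom_def
    by (metis (mono_tags, lifting) ereal_less_eq(1) ereal_less_PInfty less_imp_le mem_Collect_eq
          ereal_dense2)
  then have "f ((1 - v) *\<^sub>R x + v *\<^sub>R y) \<le> ereal ((1 - v) * a + v * b)"
    using * by (intro convex_erealD[OF assms]) auto
  moreover have "1 - v = u" using * by simp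
  ultimately show "u *\<^sub>R x + v *\<^sub>R y \<in> effective_dom f"
    by (auto simp: effective_dom_def)
qed

section \<open>Conjugates\<close>

text \<open>
  Upper bounds of the conjugate are affine minorants of the function. Nearly all estimates of conjugates
  below are checked through this equivalence, since it avoids arithmetic with infinite values.
\<close>
lemma conjugate_le_iff:
  "conjugate f y \<le> ereal c \<longleftrightarrow> (\<forall>x. ereal (x \<bullet> y - c) \<le> f x)"
proof -
  have "ereal (x \<bullet> y) - f x \<le> ereal c \<longleftrightarrow> ereal (x \<bullet> y - c) \<le> f x" for x
    by (cases "f x") auto
  then show ?thesis by (auto simp: conjugate_def SUP_le_iff)
qed

lemma conjugate_upper: "ereal (x \<bullet> y) - f x \<le> conjugate f y"
  unfolding conjugate_def by (rule SUP_upper) simp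

lemma conjugate_lower_bound:
  assumes "f x \<le> ereal a" shows "ereal (x \<bullet> y - a) \<le> conjugate f y"
proof -
  have "ereal (x \<bullet> y - a) \<le> ereal (x \<bullet> y) - f x"
    using assms by (cases "f x") auto
  then show ?thesis using conjugate_upper order_trans by blast
qed

lemma conjugate_mono:
  assumes "\<And>x. f x \<le> g x" shows "conjugate g y \<le> conjugate f y"
  unfolding conjugate_def by (intro SUP_mono' ereal_minus_mono assms order_refl)

lemma lsc_conjugate:
  fixes f :: "'a::real_inner \<Rightarrow> ereal"
  shows "lsc (conjugate f)"
  unfolding lsc_iff_eventually
proof (intro allI impI)
  fix y a assume "a < conjugate f y"
  then obtain x where x: "a < ereal (x \<bullet> y) - f x"
    by (auto simp: conjugate_def less_SUP_iff)
  have "\<forall>\<^sub>F z in nhds y. a < ereal (x \<bullet> z) - f x"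
  proof (cases "f x")
    case (real r)
    have "((\<lambda>z. ereal (x \<bullet> z - r)) \<longlongrightarrow> ereal (x \<bullet> y - r)) (nhds y)"
      by (intro tendsto_intros filterlim_ident)
    then show ?thesis using x real by (simp add: order_tendsto_iff)
  qed (use x in auto)
  then show "\<forall>\<^sub>F z in nhds y. a < conjugate f z"
    by eventually_elim (use conjugate_upper less_le_trans in blast)
qed

lemma convex_conjugate:
  fixes f :: "'a::real_inner \<Rightarrow> ereal"
  assumes "f x0 = ereal r0" "\<And>x. f x \<noteq> -\<infinity>"
  shows "convex_ereal (conjugate f)"
  unfolding convex_ereal_def
proof (intro allI ballI)
  fix y z :: 'a and t :: real assume t: "t \<in> {0..1}"
  have ninf: "conjugate f w \<noteq> -\<infinity>" for w
    using conjugate_lower_bound[of f x0 r0 w] assms by auto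
  show "conjugate f ((1 - t) *\<^sub>R y + t *\<^sub>R z) \<le> ereal (1 - t) * conjugate f y + ereal t * conjugate f z"
    unfolding conjugate_def[of f "(1 - t) *\<^sub>R y + t *\<^sub>R z"]
  proof (rule SUP_least)
    fix x
    show "ereal (x \<bullet> ((1 - t) *\<^sub>R y + t *\<^sub>R z)) - f x \<le> ereal (1 - t) * conjugate f y + ereal t * conjugate f z"
    proof (cases "f x")
      case (real r)
      have "ereal (x \<bullet> ((1 - t) *\<^sub>R y + t *\<^sub>R z)) - f x
          = ereal (1 - t) * ereal (x \<bullet> y - r) + ereal t * ereal (x \<bullet> z - r)"
        using real by (simp add: inner_add_right algebra_simps)
      also have "\<dots> \<le> ereal (1 - t) * conjugate f y + ereal t * conjugate f z"
        using t real by (intro add_mono ereal_mult_left_mono conjugate_lower_bound) auto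
      finally show ?thesis .
    qed (use assms in auto)
  qed
qed

text \<open>
  A conjugate is automatically convex and lower semicontinuous, whatever the function. Many auxiliary
  potentials are therefore introduced as conjugates, so that only properness has to be checked.
\<close>
lemma conjugate_convex_lscI:
  fixes f :: "'a::real_inner \<Rightarrow> ereal"
  assumes "f x0 = ereal r0" "\<And>x. ereal (x \<bullet> y0 - c) \<le> f x"
  shows "conjugate f \<in> convex_lsc"
proof -
  have n: "f x \<noteq> -\<infinity>" for x using assms(2)[of x] by auto
  have "conjugate f w \<noteq> -\<infinity>" for w
    using conjugate_lower_bound[of f x0 r0 w] assms by auto
  moreover have "conjugate f y0 \<noteq> \<infinity>"
    using assms(2) conjugate_le_iff[of f y0 c] by auto
  ultimately show ?thesis
    unfolding convex_lsc_def using convex_conjugate[of f, OF assms(1) n] lsc_conjugate by blast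
qed

lemma closed_ereal_epigraph:
  fixes f :: "'a::real_normed_vector \<Rightarrow> ereal"
  assumes "lsc f" shows "closed {p. f (fst p) \<le> ereal (snd p)}"
  unfolding closed_sequential_limits
proof (intro allI impI, elim conjE)
  fix X :: "nat \<Rightarrow> 'a \<times> real" and l assume X: "\<forall>n. X n \<in> {p. f (fst p) \<le> ereal (snd p)}" "X \<longlonglongrightarrow> l"
  show "l \<in> {p. f (fst p) \<le> ereal (snd p)}"
  proof (rule ccontr)
    assume "l \<notin> {p. f (fst p) \<le> ereal (snd p)}"
    then obtain a where a: "snd l < a" "ereal a < f (fst l)"
      by (auto simp: not_le dest: ereal_dense2)
    have "\<forall>\<^sub>F n in sequentially. ereal a < f (fst (X n))"
      using tendsto_fst[OF X(2)] assms a(2) unfolding lsc_iff_eventually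
      by (auto simp: filterlim_iff)
    moreover have "\<forall>\<^sub>F n in sequentially. snd (X n) < a"
      using tendsto_snd[OF X(2)] a(1) by (rule order_tendstoD)
    ultimately have "\<forall>\<^sub>F n in sequentially. False"
    proof eventually_elim
      case (elim n)
      have "f (fst (X n)) \<le> ereal (snd (X n))" using X(1) by simp
      then have "ereal a < ereal (snd (X n))" using elim(1) by (rule less_le_trans[rotated])
      then show ?case using elim by simp
    qed
    then show False by simp
  qed
qed

lemma convex_ereal_epigraph:
  assumes "convex_ereal f" shows "convex {p. f (fst p) \<le> ereal (snd p)}"
proof (rule convexI)
  fix p q and u v :: real
  assume *: "p \<in> {p. f (fst p) \<le> ereal (snd p)}" "q \<in> {p. f (fst p) \<le> ereal (snd p)}" "0 \<le> u" "0 \<le> v" "u + v = 1"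
  have "f ((1 - v) *\<^sub>R fst p + v *\<^sub>R fst q) \<le> ereal ((1 - v) * snd p + v * snd q)"
    using * by (intro convex_erealD[OF assms]) auto
  moreover have "1 - v = u" using * by simp
  ultimately show "u *\<^sub>R p + v *\<^sub>R q \<in> {p. f (fst p) \<le> ereal (snd p)}"
    by simp
qed

text \<open>
  Strict separation of a point below the graph from the closed convex epigraph. The coefficient
  \<open>q\<close> may vanish, which is the case of a vertical hyperplane.
\<close>
lemma epigraph_separation:
  fixes f :: "'a::euclidean_space \<Rightarrow> ereal"
  assumes f: "f \<in> convex_lsc" and a: "ereal a < f x"
  obtains p :: 'a and q b :: real where "0 \<le> q" "p \<bullet> x + q * a < b" "\<And>z r. f z \<le> ereal r \<Longrightarrow> b < p \<bullet> z + q * r"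
proof -
  let ?E = "{p. f (fst p) \<le> ereal (snd p)}"
  have "(x, a) \<notin> ?E" using a by auto
  then obtain pq b where pq: "pq \<bullet> (x, a) < b" "\<forall>z\<in>?E. pq \<bullet> z > b"
    using separating_hyperplane_closed_point[OF convex_ereal_epigraph[OF convex_lscD(1)[OF f]]
        closed_ereal_epigraph[OF convex_lscD(2)[OF f]], of "(x, a)"] by blast
  obtain p q where pqe: "pq = (p, q)" by (cases pq)
  have sep: "b < p \<bullet> z + q * r" if "f z \<le> ereal r" for z r
    using pq(2)[rule_format, of "(z, r)"] that by (simp add: pqe)
  have "0 \<le> q"
  proof (rule ccontr)
    assume "\<not> 0 \<le> q"
    obtain z r where zr: "f z = ereal r" using convex_lscD(4)[OF f] by blast
    \<comment> \<open>far up the epigraph a negative \<open>q\<close> would violate the separation\<close>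
    define s where "s = max r ((b - p \<bullet> z) / q)"
    have "b < p \<bullet> z + q * s" by (rule sep) (simp add: zr s_def)
    moreover have "q * s \<le> b - p \<bullet> z"
    proof -
      have "q * s \<le> q * ((b - p \<bullet> z) / q)"
        using \<open>\<not> 0 \<le> q\<close> by (intro mult_left_mono_neg) (auto simp: s_def)
      also have "\<dots> = b - p \<bullet> z" using \<open>\<not> 0 \<le> q\<close> by simp
      finally show ?thesis .
    qed
    ultimately show False by simp
  qed
  then show ?thesis using that[of q p b] pq(1) sep by (simp add: pqe)
qed

text \<open>A non-vertical separating hyperplane is the graph of an affine minorant.\<close>
lemma affine_minorant_of_separation:
  fixes f :: "'a::real_inner \<Rightarrow> ereal"
  assumes "f \<in> convex_lsc" "0 < q" "p \<bullet> x + q * a < b" "\<And>z r. f z \<le> ereal r \<Longrightarrow> b < p \<bullet> z + q * r"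
  shows "\<exists>y c. (\<forall>z. ereal (z \<bullet> y - c) \<le> f z) \<and> a < x \<bullet> y - c"
proof (intro exI conjI allI)
  fix z
  show "ereal (z \<bullet> (- (1 / q) *\<^sub>R p) - (- b / q)) \<le> f z"
  proof (cases "f z")
    case (real r)
    then have "b < p \<bullet> z + q * r" using assms by auto
    then have "b / q < (p \<bullet> z + q * r) / q" using \<open>0 < q\<close> by (rule divide_strict_right_mono)
    then show ?thesis using real \<open>0 < q\<close> by (simp add: inner_commute field_simps)
  qed (use convex_lscD(3)[OF assms(1)] in auto)
next
  have "(p \<bullet> x + q * a) / q < b / q" using assms by (intro divide_strict_right_mono) auto
  moreover have "(p \<bullet> x + q * a) / q = p \<bullet> x / q + a" using \<open>0 < q\<close> by (simp add: add_divide_distrib)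
  moreover have "x \<bullet> (- (1 / q) *\<^sub>R p) = - (p \<bullet> x / q)" by (simp add: inner_commute[of x])
  ultimately show "a < x \<bullet> (- (1 / q) *\<^sub>R p) - (- b / q)" by linarith
qed

text \<open>
  The key step of the Fenchel--Moreau theorem: affine minorants come arbitrarily close to the value at a
  point. If the separating hyperplane is vertical, then \<open>x\<close> lies outside the closed domain,
  and any affine minorant can be tilted along the hyperplane.
\<close>
lemma affine_minorant_above:
  fixes f :: "'a::euclidean_space \<Rightarrow> ereal"
  assumes f: "f \<in> convex_lsc" and a: "ereal a < f x"
  shows "\<exists>y c. (\<forall>z. ereal (z \<bullet> y - c) \<le> f z) \<and> a < x \<bullet> y - c"
proof -
  obtain p q b where pq: "0 \<le> q" "p \<bullet> x + q * a < b" "\<And>z r. f z \<le> ereal r \<Longrightarrow> b < p \<bullet> z + q * r"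
    by (rule epigraph_separation[OF f a], rule that)
  show ?thesis
  proof (cases "q = 0")
    case False
    then show ?thesis using affine_minorant_of_separation[OF f _ pq(2,3)] pq(1) by auto
  next
    case True
    obtain x1 r1 where x1: "f x1 = ereal r1" using convex_lscD(4)[OF f] by blast
    then have f1: "ereal (r1 - 1) < f x1" by simp
    obtain p1 q1 b1 where pq1: "0 \<le> q1" "p1 \<bullet> x1 + q1 * (r1 - 1) < b1"
      "\<And>z r. f z \<le> ereal r \<Longrightarrow> b1 < p1 \<bullet> z + q1 * r"
      by (rule epigraph_separation[OF f f1], rule that)
    have "0 < q1"
    proof -
      have "q1 \<noteq> 0" using pq1(2) pq1(3)[of x1 r1] x1 by auto
      then show ?thesis using pq1(1) by simp
    qed
    then obtain y c where yc: "\<And>z. ereal (z \<bullet> y - c) \<le> f z"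
      using affine_minorant_of_separation[OF f _ pq1(2,3)] by blast
    \<comment> \<open>add a large multiple of the affine function separating \<open>x\<close> from the domain\<close>
    define k where "k = (\<bar>a - (x \<bullet> y - c)\<bar> + 1) / (b - p \<bullet> x)"
    have bpos: "b - p \<bullet> x > 0" using pq(2) True by simp
    then have k: "k \<ge> 0" "k * (b - p \<bullet> x) = \<bar>a - (x \<bullet> y - c)\<bar> + 1" by (auto simp: k_def)
    have "ereal (z \<bullet> (y - k *\<^sub>R p) - (c - k * b)) \<le> f z" for z
    proof (cases "f z")
      case (real r)
      then have "b < p \<bullet> z" using pq(3)[of z r] True by simp
      then have "k * (b - p \<bullet> z) \<le> 0" using k by (intro mult_nonneg_nonpos) auto
      moreover have "z \<bullet> y - c \<le> r" using yc[of z] real by simp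
      ultimately show ?thesis using real by (simp add: inner_diff_right inner_commute algebra_simps)
    qed (use convex_lscD(3)[OF f] in auto)
    moreover have "a < x \<bullet> (y - k *\<^sub>R p) - (c - k * b)"
      using k(2) by (simp add: inner_diff_right inner_commute algebra_simps)
    ultimately show ?thesis by blast
  qed
qed

lemma affine_minorant:
  fixes f :: "'a::euclidean_space \<Rightarrow> ereal"
  assumes f: "f \<in> convex_lsc"
  obtains y c where "\<And>z. ereal (z \<bullet> y - c) \<le> f z"
proof -
  obtain x r where "f x = ereal r" using convex_lscD(4)[OF f] by blast
  then have "ereal (r - 1) < f x" by simp
  then show ?thesis using affine_minorant_above[OF f] that by blast
qed

lemma conjugate_convex_lsc:
  fixes f :: "'a::euclidean_space \<Rightarrow> ereal"
  assumes f: "f \<in> convex_lsc" shows "conjugate f \<in> convex_lsc"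
proof -
  obtain x r where "f x = ereal r" using convex_lscD(4)[OF f] by blast
  moreover obtain y c where "\<And>z. ereal (z \<bullet> y - c) \<le> f z" using affine_minorant[OF f] by blast
  ultimately show ?thesis by (rule conjugate_convex_lscI)
qed

lemma biconjugate_le: "conjugate (conjugate f) x \<le> f x"
proof -
  have "ereal (y \<bullet> x) - conjugate f y \<le> f x" for y
  proof (cases "f x")
    case (real r)
    then have "ereal (x \<bullet> y - r) \<le> conjugate f y" by (intro conjugate_lower_bound) simp
    then show ?thesis using real by (cases "conjugate f y") (auto simp: inner_commute)
  next
    case MInf
    then have "ereal (x \<bullet> y) - f x = \<infinity>" by simp
    then have "conjugate f y = \<infinity>" using conjugate_upper[of x y f] by simp
    then show ?thesis by simp
  qed simp
  then show ?thesis unfolding conjugate_def[of "conjugate f"] by (intro SUP_least)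
qed

text \<open>The Fenchel--Moreau theorem.\<close>
theorem biconjugate:
  fixes f :: "'a::euclidean_space \<Rightarrow> ereal"
  assumes f: "f \<in> convex_lsc" shows "conjugate (conjugate f) = f"
proof
  fix x
  have "f x \<le> conjugate (conjugate f) x"
  proof (rule ereal_le_real, rule ccontr)
    fix a assume a: "conjugate (conjugate f) x \<le> ereal a" "\<not> f x \<le> ereal a"
    then obtain y c where yc: "\<And>z. ereal (z \<bullet> y - c) \<le> f z" "a < x \<bullet> y - c"
      using affine_minorant_above[OF f, of a x] by (auto simp: not_le)
    have "conjugate f y \<le> ereal c" using yc(1) conjugate_le_iff by blast
    then have "ereal (y \<bullet> x - c) \<le> conjugate (conjugate f) x" by (rule conjugate_lower_bound)
    then show False using a(1) yc(2) by (simp add: inner_commute) (meson ereal_less_eq(3) not_le order_trans)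
  qed
  then show "conjugate (conjugate f) x = f x" using biconjugate_le by (intro antisym)
qed

section \<open>Exponential densities\<close>

text \<open>
  The norm dominates the average of the absolute coordinates, so the integrand is bounded by a product
  of one-dimensional exponentials.
\<close>
lemma nn_integral_exp_norm_finite:
  fixes a :: real assumes "a > 0"
  shows "(\<integral>\<^sup>+x. ennreal (exp (- a * norm (x::'a::euclidean_space))) \<partial>lborel) < \<infinity>"
proof -
  define n where "n = real DIM('a)"
  have n: "n > 0" by (simp add: n_def)
  \<comment> \<open>split the rate \<open>a\<close> evenly among the coordinates\<close>
  define k where "k = a / n"
  have k: "k > 0" using assms n by (simp add: k_def)
  have "ennreal (exp (- a * norm x)) \<le> (\<Prod>b\<in>Basis. ennreal (exp (- k * \<bar>x \<bullet> b\<bar>)))" for x :: 'a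
  proof -
    have "(\<Sum>b\<in>Basis. \<bar>x \<bullet> b\<bar>) \<le> (\<Sum>b\<in>(Basis::'a set). norm x)"
      by (intro sum_mono Basis_le_norm)
    also have "\<dots> = n * norm x" by (simp add: n_def)
    finally have "k * (\<Sum>b\<in>Basis. \<bar>x \<bullet> b\<bar>) \<le> k * (n * norm x)"
      using k by (intro mult_left_mono) auto
    also have "\<dots> = a * norm x" using n by (simp add: k_def)
    finally have "exp (- a * norm x) \<le> exp (\<Sum>b\<in>Basis. - k * \<bar>x \<bullet> b\<bar>)"
      by (simp add: sum_distrib_left sum_negf)
    then show ?thesis by (subst prod_ennreal) (auto simp: exp_sum intro!: ennreal_leI)
  qed
  then have "(\<integral>\<^sup>+x. ennreal (exp (- a * norm (x::'a))) \<partial>lborel)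
      \<le> (\<integral>\<^sup>+x. (\<Prod>b\<in>Basis. ennreal (exp (- k * \<bar>(x::'a) \<bullet> b\<bar>))) \<partial>lborel)"
    by (intro nn_integral_mono)
  also have "\<dots> = (\<Prod>b\<in>(Basis::'a set). \<integral>\<^sup>+t. ennreal (exp (- k * \<bar>t\<bar>)) \<partial>lborel)"
    by (subst nn_integral_lborel_prod) auto
  also have "(\<integral>\<^sup>+t. ennreal (exp (- k * \<bar>t\<bar>)) \<partial>lborel) < \<infinity>"
  proof -
    have pos: "(\<integral>\<^sup>+t. ennreal (exp (- k * t)) * indicator {0..} t \<partial>lborel) = ennreal (0 - (- 1 / k))"
    proof -
      have "(\<integral>\<^sup>+t. ennreal (exp (- k * t)) * indicator {0..} t \<partial>lborel) = ennreal (0 - (- exp (- k * 0) / k))"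
      proof (rule nn_integral_FTC_atLeast)
        show "DERIV (\<lambda>t. - exp (- k * t) / k) t :> exp (- k * t)" if "0 \<le> t" for t
          using k by (auto intro!: derivative_eq_intros)
        have "((\<lambda>t. - exp (- (k * t)) / k) \<longlongrightarrow> - 0 / k) at_top"
          by (intro tendsto_intros filterlim_compose[OF exp_at_bot]
              filterlim_compose[OF filterlim_uminus_at_bot_at_top] filterlim_tendsto_pos_mult_at_top[OF tendsto_const k] filterlim_ident)
             (use k in auto)
        then show "((\<lambda>t. - exp (- k * t) / k) \<longlongrightarrow> 0) at_top" by simp
      qed auto
      then show ?thesis by simp
    qed
    have "(\<integral>\<^sup>+t. ennreal (exp (- k * t)) * indicator {0..} t \<partial>lborel)
        = (\<integral>\<^sup>+t. ennreal (exp (- k * - t)) * indicator {0..} (- t) \<partial>lborel)"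
      by (subst nn_integral_real_affine[where c="-1" and t=0]) (auto simp: ac_simps)
    moreover have "(\<integral>\<^sup>+t. ennreal (exp (- k * \<bar>t\<bar>)) \<partial>lborel) \<le>
      (\<integral>\<^sup>+t. ennreal (exp (- k * t)) * indicator {0..} t + ennreal (exp (- k * - t)) * indicator {0..} (- t) \<partial>lborel)"
      by (intro nn_integral_mono) (auto simp: indicator_def)
    ultimately have "(\<integral>\<^sup>+t. ennreal (exp (- k * \<bar>t\<bar>)) \<partial>lborel) \<le>
       2 * (\<integral>\<^sup>+t. ennreal (exp (- k * t)) * indicator {0..} t \<partial>lborel)"
      by (subst (asm) nn_integral_add) (auto simp: mult_2)
    also have "\<dots> < \<infinity>" unfolding pos by (simp add: ennreal_mult_less_top)
    finally show ?thesis .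
  qed
  then have "(\<Prod>b\<in>(Basis::'a set). \<integral>\<^sup>+t. ennreal (exp (- k * \<bar>t\<bar>)) \<partial>lborel) < \<infinity>"
    by (simp add: power_less_top_ennreal)
  finally show ?thesis .
qed

lemma integrable_exp_norm:
  fixes a :: real assumes "a > 0"
  shows "integrable lborel (\<lambda>x::'a::euclidean_space. exp (- a * norm x))"
  using nn_integral_exp_norm_finite[OF assms] by (intro integrableI_nonneg) auto

text \<open>
  Real-valued form of \<^const>\<open>exp_minus\<close> of a potential, for use with Bochner integrals.
  It is faithful as long as the potential avoids \<open>-\<infinity>\<close>.
\<close>
definition gibbs :: "('a \<Rightarrow> ereal) \<Rightarrow> 'a \<Rightarrow> real" where
  "gibbs V x = enn2real (exp_minus (V x))"

lemma gibbs_nonneg [simp]: "0 \<le> gibbs V x" by (simp add: gibbs_def)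

lemma gibbs_simps:
  "V x = ereal r \<Longrightarrow> gibbs V x = exp (- r)" "V x = \<infinity> \<Longrightarrow> gibbs V x = 0"
  by (auto simp: gibbs_def exp_minus_def)

lemma exp_minus_eq_gibbs: "V x \<noteq> -\<infinity> \<Longrightarrow> exp_minus (V x) = ennreal (gibbs V x)"
  by (cases "V x") (auto simp: gibbs_def exp_minus_def)

lemma gibbs_pos_iff: "V x \<noteq> -\<infinity> \<Longrightarrow> 0 < gibbs V x \<longleftrightarrow> V x < \<infinity>"
  by (cases "V x") (auto simp: gibbs_simps)

lemma gibbs_le: "ereal r \<le> V x \<Longrightarrow> gibbs V x \<le> exp (- r)"
  by (cases "V x") (auto simp: gibbs_simps)

lemma gibbs_mono: "V x \<le> W x \<Longrightarrow> V x \<noteq> -\<infinity> \<Longrightarrow> gibbs W x \<le> gibbs V x"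
  by (cases "V x"; cases "W x") (auto simp: gibbs_simps)

lemma borel_measurable_exp_minus [measurable]: "exp_minus \<in> borel_measurable borel"
proof -
  have "exp_minus = (\<lambda>a. if a = \<infinity> then 0 else if a = -\<infinity> then \<infinity> else ennreal (exp (- real_of_ereal a)))"
  proof
    fix a show "exp_minus a = (if a = \<infinity> then 0 else if a = -\<infinity> then \<infinity> else ennreal (exp (- real_of_ereal a)))"
      by (cases a) (auto simp: exp_minus_def)
  qed
  then show ?thesis by (rule ssubst) measurable
qed

lemma borel_measurable_gibbs [measurable (raw)]:
  "V \<in> borel_measurable M \<Longrightarrow> gibbs V \<in> borel_measurable M"
  unfolding gibbs_def[abs_def] by measurable

lemma borel_measurable_exp_minus_convex_lsc:
  "f \<in> convex_lsc \<Longrightarrow> (\<lambda>x. exp_minus (f x)) \<in> borel_measurable borel"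
  "f \<in> convex_lsc \<Longrightarrow> (\<lambda>x. exp_minus (f x)) \<in> borel_measurable lborel"
  by (auto intro!: measurable_compose[OF borel_measurable_convex_lsc borel_measurable_exp_minus])

abbreviation exp_mass :: "('a::euclidean_space \<Rightarrow> ereal) \<Rightarrow> ennreal" where
  "exp_mass f \<equiv> \<integral>\<^sup>+x. exp_minus (f x) \<partial>lborel"

abbreviation gibbs_mass :: "('a::euclidean_space \<Rightarrow> ereal) \<Rightarrow> real" where
  "gibbs_mass f \<equiv> \<integral>x. gibbs f x \<partial>lborel"

section \<open>Local boundedness and coercivity\<close>

lemma convex_on_real_of_convex_lsc:
  assumes f: "f \<in> convex_lsc"
  shows "convex_on (interior (effective_dom f)) (\<lambda>x. real_of_ereal (f x))"
proof (rule convex_onI)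
  show "convex (interior (effective_dom f))"
    using convex_effective_dom[OF convex_lscD(1)[OF f]] by (rule convex_interior)
  fix t :: real and x y assume t: "0 < t" "t < 1" and xy: "x \<in> interior (effective_dom f)" "y \<in> interior (effective_dom f)"
  obtain a b where ab: "f x = ereal a" "f y = ereal b"
    using xy interior_subset[of "effective_dom f"] convex_lscD(3)[OF f]
    unfolding effective_dom_def by (metis (mono_tags, lifting) ereal_infty_less(1) in_mono mem_Collect_eq real_of_ereal.cases)
  have "f ((1 - t) *\<^sub>R x + t *\<^sub>R y) \<le> ereal ((1 - t) * a + t * b)"
    using t ab by (intro convex_erealD convex_lscD(1)[OF f]) auto
  then show "real_of_ereal (f ((1 - t) *\<^sub>R x + t *\<^sub>R y)) \<le> (1 - t) * real_of_ereal (f x) + t * real_of_ereal (f y)"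
    using ab convex_lscD(3)[OF f] by (cases "f ((1 - t) *\<^sub>R x + t *\<^sub>R y)") auto
qed

lemma effective_dom_real:
  assumes "f \<in> convex_lsc" "x \<in> effective_dom f"
  shows "f x = ereal (real_of_ereal (f x))"
  using assms convex_lscD(3)[OF assms(1), of x] by (cases "f x") (auto simp: effective_dom_def)

lemma continuous_on_real_of_convex_lsc:
  fixes f :: "'a::euclidean_space \<Rightarrow> ereal"
  assumes f: "f \<in> convex_lsc"
  shows "continuous_on (interior (effective_dom f)) (\<lambda>x. real_of_ereal (f x))"
  using convex_on_real_of_convex_lsc[OF f] by (intro convex_on_continuous) auto

lemma convex_lsc_bounded_near:
  fixes f :: "'a::euclidean_space \<Rightarrow> ereal"
  assumes f: "f \<in> convex_lsc" and x0: "x0 \<in> interior (effective_dom f)"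
  obtains r m where "0 < r" "cball x0 r \<subseteq> interior (effective_dom f)" "\<And>x. x \<in> cball x0 r \<Longrightarrow> f x \<le> ereal m"
proof -
  obtain r where r: "0 < r" "cball x0 r \<subseteq> interior (effective_dom f)"
    using x0 open_contains_cball[of "interior (effective_dom f)"] by auto
  have "compact ((\<lambda>x. real_of_ereal (f x)) ` cball x0 r)"
    using continuous_on_subset[OF continuous_on_real_of_convex_lsc[OF f] r(2)]
    by (intro compact_continuous_image) auto
  then obtain m where m: "\<And>x. x \<in> cball x0 r \<Longrightarrow> \<bar>real_of_ereal (f x)\<bar> \<le> m"
    unfolding bounded_iff[THEN iffD1, OF compact_imp_bounded] 
    by (meson bounded_real compact_imp_bounded imageI)
  have "f x \<le> ereal m" if "x \<in> cball x0 r" for x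
    using m[OF that] effective_dom_real[OF f, of x] that r(2) interior_subset[of "effective_dom f"]
    by (metis abs_le_D1 ereal_less_eq(3) subsetD)
  then show ?thesis using that r by blast
qed

text \<open>A convex set with empty interior is Lebesgue null.\<close>
lemma interior_dom_of_pos_integral:
  fixes f :: "'a::euclidean_space \<Rightarrow> ereal"
  assumes f: "f \<in> convex_lsc" and pos: "0 < exp_mass f"
  shows "interior (effective_dom f) \<noteq> {}"
proof
  assume "interior (effective_dom f) = {}"
  then have "negligible (effective_dom f)"
    using negligible_convex_interior[OF convex_effective_dom[OF convex_lscD(1)[OF f]]] by simp
  then have "AE x in lebesgue. x \<notin> effective_dom f"
    using negligible_iff_null_sets by (auto intro: AE_not_in)
  then have "AE x in lborel. x \<notin> effective_dom f"
    by (simp add: AE_completion_iff effective_dom_def)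
  then have "AE x in lborel. exp_minus (f x) = 0"
    by eventually_elim (auto simp: effective_dom_def exp_minus_def)
  then have "exp_mass f = 0"
    by (simp add: nn_integral_0_iff_AE borel_measurable_exp_minus_convex_lsc[OF f])
  then show False using pos by simp
qed

lemma pos_integral_of_interior_dom:
  fixes f :: "'a::euclidean_space \<Rightarrow> ereal"
  assumes f: "f \<in> convex_lsc" and r: "0 < r" "\<And>x. x \<in> cball x0 r \<Longrightarrow> f x < \<infinity>"
  shows "0 < exp_mass f"
proof (rule ccontr)
  assume "\<not> ?thesis"
  then have "exp_mass f = 0" by simp
  then have ae: "AE x in lborel. exp_minus (f x) = 0"
    by (subst (asm) nn_integral_0_iff_AE) (auto simp: borel_measurable_exp_minus_convex_lsc[OF f])
  have "exp_minus (f x) \<noteq> 0" if "x \<in> cball x0 r" for x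
    using r(2)[OF that] convex_lscD(3)[OF f, of x] by (cases "f x") (auto simp: exp_minus_def)
  then have "AE x in lborel. x \<notin> cball x0 r" using ae by (auto elim!: eventually_mono)
  then have "emeasure lborel (cball x0 r) = 0" 
    by (subst (asm) AE_iff_measurable[OF _ refl]) (auto simp: not_less cball_def)
  moreover have "emeasure lborel (ball x0 r) \<le> emeasure lborel (cball x0 r)" by (intro emeasure_mono) auto
  moreover have "emeasure lborel (ball x0 r) > 0" using r by (subst emeasure_ball) auto
  ultimately show False by simp
qed


text \<open>
  A convex function with \<open>0 < Z(f) < \<infinity>\<close> grows at least linearly. The sublevel set
  \<open>L\<close> just above the values on some ball is convex, contains the ball and has finite
  volume, hence is bounded; convexity along rays then forces linear growth outside of it.
\<close>
lemma convex_lsc_coercive: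
  fixes f :: "'a::euclidean_space \<Rightarrow> ereal"
  assumes f: "f \<in> convex_lsc" and pos: "0 < exp_mass f"
    and fin: "exp_mass f < \<infinity>"
  obtains a b where "0 < a" "\<And>x. ereal (a * norm x - b) \<le> f x"
proof -
  obtain x0 where "x0 \<in> interior (effective_dom f)"
    using interior_dom_of_pos_integral[OF f pos] by blast
  then obtain r m where r: "0 < r" and m: "\<And>x. x \<in> cball x0 r \<Longrightarrow> f x \<le> ereal m"
    using convex_lsc_bounded_near[OF f] by metis
  define L where "L = {x. f x \<le> ereal (m + 1)}"
  have L[measurable]: "L \<in> sets borel"
    unfolding L_def using lsc_closed_sublevel[OF convex_lscD(2)[OF f]] by simp
  have "ennreal (exp (- (m + 1))) * emeasure lborel L = (\<integral>\<^sup>+x. ennreal (exp (- (m + 1))) * indicator L x \<partial>lborel)"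
    by (simp add: nn_integral_cmult_indicator)
  also have "\<dots> \<le> exp_mass f"
  proof (rule nn_integral_mono)
    fix x show "ennreal (exp (- (m + 1))) * indicator L x \<le> exp_minus (f x)"
      using convex_lscD(3)[OF f, of x]
      by (cases "f x") (auto simp: L_def exp_minus_def indicator_def intro!: ennreal_leI)
  qed
  finally have "ennreal (exp (- (m + 1))) * emeasure lborel L < \<infinity>" using fin by (rule le_less_trans)
  then have Lfin: "emeasure lborel L < \<infinity>" by (auto simp: ennreal_mult_less_top less_top)
  define K where "K = measure lborel L"
  define \<kappa> where "\<kappa> = unit_ball_vol (DIM('a)) * (r / 2) ^ DIM('a)"
  have \<kappa>: "\<kappa> > 0" using r by (simp add: \<kappa>_def)
  obtain N :: nat where N: "real N * \<kappa> > K" using ex_less_of_nat_mult[OF \<kappa>] by blast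
  \<comment> \<open>a far away point of \<open>L\<close> would force \<open>N\<close> disjoint balls of radius \<open>r / 2\<close> into \<open>L\<close>\<close>
  have far: "dist x0 x \<le> 2 * r * N" if "x \<in> L" for x
  proof (rule ccontr)
    assume "\<not> dist x0 x \<le> 2 * r * N"
    define D where "D = dist x0 x"
    have D: "D > 2 * r * N" "D > 0"
      using \<open>\<not> _\<close> r zero_le_dist[of x0 x] by (auto simp: D_def)
    define c where "c j = x0 + (real j * r / D) *\<^sub>R (x - x0)" for j :: nat
    have sub: "ball (c j) (r / 2) \<subseteq> L" if "j < N" for j
    proof
      fix z assume z: "z \<in> ball (c j) (r / 2)"
      define t where "t = real j * r / D"
      have "real j * r \<le> N * r" using that r by simp
      then have "2 * (real j * r) < D" using D(1) by (simp add: algebra_simps)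
      then have t: "0 \<le> t" "t \<le> 1 / 2"
        using D r by (auto simp: t_def divide_le_eq)
      define u where "u = (1 / (1 - t)) *\<^sub>R (z - c j)"
      have "norm u = norm (z - c j) / (1 - t)" using t by (simp add: u_def)
      also have "\<dots> \<le> (r / 2) / (1 - t)" using z t
        by (intro divide_right_mono) (auto simp: dist_norm norm_minus_commute)
      also have "\<dots> \<le> r" using t r by (simp add: field_simps)
      finally have "f (x0 + u) \<le> ereal m" by (intro m) (simp add: dist_norm)
      then have "f ((1 - t) *\<^sub>R (x0 + u) + t *\<^sub>R x) \<le> ereal ((1 - t) * m + t * (m + 1))"
        using that \<open>x \<in> L\<close> t by (intro convex_erealD convex_lscD(1)[OF f]) (auto simp: L_def)
      also have "\<dots> \<le> ereal (m + 1)" using t by (simp add: algebra_simps)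
      also have "(1 - t) *\<^sub>R (x0 + u) + t *\<^sub>R x = z"
      proof -
        have "(1 - t) *\<^sub>R u = z - c j" using t by (simp add: u_def)
        moreover have "c j = x0 + t *\<^sub>R (x - x0)" by (simp add: c_def t_def)
        ultimately show ?thesis by (simp add: scaleR_add_right algebra_simps)
      qed
      finally show "z \<in> L" by (simp add: L_def)
    qed
    have disj: "disjoint_family_on (\<lambda>j. ball (c j) (r / 2)) {..<N}"
      unfolding disjoint_family_on_def
    proof (intro ballI impI)
      fix i j :: nat assume "i \<noteq> j"
      have "dist (c i) (c j) = \<bar>real i - real j\<bar> * r"
      proof -
        have "c i - c j = ((real i - real j) * r / D) *\<^sub>R (x - x0)"
          by (simp add: c_def diff_divide_distrib algebra_simps)
        then show ?thesis using D r
          by (simp add: dist_norm abs_mult D_def norm_minus_commute)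
      qed
      moreover have "\<bar>real i - real j\<bar> \<ge> 1" using \<open>i \<noteq> j\<close> by linarith
      ultimately have "dist (c i) (c j) \<ge> r / 2 + r / 2" using r by simp
      then show "ball (c i) (r / 2) \<inter> ball (c j) (r / 2) = {}"
        by (intro disjoint_ballI) auto
    qed
    have "(\<Sum>j<N. emeasure lborel (ball (c j) (r / 2))) = emeasure lborel (\<Union>j<N. ball (c j) (r / 2))"
      by (intro sum_emeasure disj) auto
    also have "\<dots> \<le> emeasure lborel L" by (intro emeasure_mono) (use sub in auto)
    also have "\<dots> = ennreal K" using Lfin by (simp add: K_def emeasure_eq_ennreal_measure less_top)
    also have "(\<Sum>j<N. emeasure lborel (ball (c j) (r / 2))) = ennreal (real N * \<kappa>)"
      using r \<kappa> by (simp add: emeasure_ball \<kappa>_def[symmetric] ennreal_of_nat_eq_real_of_nat ennreal_mult)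
    finally show False using N by (simp add: K_def)
  qed
  define \<rho> where "\<rho> = 2 * r * N + 1"
  have \<rho>: "\<rho> > 0" using r by (simp add: \<rho>_def add_nonneg_pos)
  obtain y c where yc: "\<And>z. ereal (z \<bullet> y - c) \<le> f z" using affine_minorant[OF f] by blast
  define B where "B = (norm x0 + \<rho>) * norm y + \<bar>c\<bar> + 1 + \<bar>m\<bar>"
  have main: "ereal (norm (x - x0) / \<rho> - B) \<le> f x" for x
  proof (cases "norm (x - x0) \<le> \<rho>")
    case True
    have "norm x \<le> norm x0 + norm (x - x0)" by (metis add.commute diff_add_cancel norm_triangle_ineq)
    then have "norm x * norm y \<le> (norm x0 + \<rho>) * norm y" using True by (intro mult_right_mono) auto
    then have "\<bar>x \<bullet> y\<bar> \<le> (norm x0 + \<rho>) * norm y" using Cauchy_Schwarz_ineq2[of x y] by linarith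
    moreover have "norm (x - x0) / \<rho> \<le> 1" using True \<rho> by simp
    ultimately have "norm (x - x0) / \<rho> - B \<le> x \<bullet> y - c" by (simp add: B_def)
    then show ?thesis using yc[of x] by (meson ereal_less_eq(3) order_trans)
  next
    case False
    define d where "d = norm (x - x0)"
    have d: "d > \<rho>" "d > 0" using False \<rho> by (auto simp: d_def)
    define t where "t = \<rho> / d"
    have t: "0 < t" "t < 1" using d \<rho> by (auto simp: t_def)
    have "x0 + t *\<^sub>R (x - x0) \<notin> L"
    proof
      assume "x0 + t *\<^sub>R (x - x0) \<in> L"
      from far[OF this] have "t * d \<le> 2 * r * N" using t by (simp add: dist_norm d_def)
      then show False using d by (simp add: t_def \<rho>_def)
    qed
    show ?thesis
    proof (cases "f x")
      case (real w)
      have "f ((1 - t) *\<^sub>R x0 + t *\<^sub>R x) \<le> ereal ((1 - t) * m + t * w)"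
        using m[of x0] r real t by (intro convex_erealD convex_lscD(1)[OF f]) auto
      moreover have "(1 - t) *\<^sub>R x0 + t *\<^sub>R x = x0 + t *\<^sub>R (x - x0)" by (simp add: algebra_simps)
      ultimately have "m + 1 < (1 - t) * m + t * w"
        using \<open>x0 + t *\<^sub>R (x - x0) \<notin> L\<close> unfolding L_def by (auto simp: not_le dest: less_le_trans)
      then have "1 < t * (w - m)" by (simp add: algebra_simps)
      then have "1 / t < w - m" using t by (simp add: field_simps)
      then have "d / \<rho> < w - m" by (simp add: t_def)
      moreover have "B \<ge> - m"
      proof -
        have "0 \<le> (norm x0 + \<rho>) * norm y" using \<rho> by simp
        then show ?thesis unfolding B_def by linarith
      qed
      ultimately show ?thesis using real by (simp add: d_def)
    qed (use convex_lscD(3)[OF f] in auto)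
  qed
  have "ereal ((1 / \<rho>) * norm x - (B + norm x0 / \<rho>)) \<le> f x" for x
  proof -
    have "norm x - norm x0 \<le> norm (x - x0)" by (rule norm_triangle_ineq2)
    then have "(norm x - norm x0) / \<rho> \<le> norm (x - x0) / \<rho>" using \<rho> by (intro divide_right_mono) auto
    then have "(1 / \<rho>) * norm x - (B + norm x0 / \<rho>) \<le> norm (x - x0) / \<rho> - B"
      by (simp add: diff_divide_distrib)
    then show ?thesis using main[of x] by (meson ereal_less_eq(3) order_trans)
  qed
  then show ?thesis using that[of "1 / \<rho>" "B + norm x0 / \<rho>"] \<rho> by simp
qed

lemma integrable_gibbs_coercive:
  fixes f :: "'a::euclidean_space \<Rightarrow> ereal"
  assumes [measurable]: "f \<in> borel_measurable borel" and "0 < a" "\<And>x. ereal (a * norm x - b) \<le> f x"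
  shows "integrable lborel (gibbs f)"
proof (rule Bochner_Integration.integrable_bound)
  show "integrable lborel (\<lambda>x::'a. exp b * exp (- a * norm x))"
    using integrable_exp_norm[OF assms(2)] by simp
  have "gibbs f x \<le> exp (- (a * norm x - b))" for x by (intro gibbs_le assms)
  then show "AE x in lborel. norm (gibbs f x) \<le> norm (exp b * exp (- a * norm x))"
    by (auto simp flip: exp_add)
qed simp

lemma nn_integral_exp_minus_eq:
  assumes "f \<in> convex_lsc"
  shows "exp_mass f = (\<integral>\<^sup>+x. ennreal (gibbs f x) \<partial>lborel)"
  using convex_lscD(3)[OF assms] by (simp add: exp_minus_eq_gibbs)

section \<open>Differentiability almost everywhere\<close>

lemma convex_lsc_segment:
  assumes f: "f \<in> convex_lsc" and "x \<in> effective_dom f" "y \<in> effective_dom f" "0 \<le> t" "t \<le> 1"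
  shows "(1 - t) *\<^sub>R x + t *\<^sub>R y \<in> effective_dom f"
    "real_of_ereal (f ((1 - t) *\<^sub>R x + t *\<^sub>R y)) \<le> (1 - t) * real_of_ereal (f x) + t * real_of_ereal (f y)"
proof -
  have *: "f ((1 - t) *\<^sub>R x + t *\<^sub>R y) \<le> ereal ((1 - t) * real_of_ereal (f x) + t * real_of_ereal (f y))"
    using assms effective_dom_real[OF f] by (intro convex_erealD convex_lscD(1)[OF f]) (metis order_refl)+
  show "(1 - t) *\<^sub>R x + t *\<^sub>R y \<in> effective_dom f"
    using * by (auto simp: effective_dom_def intro: le_less_trans)
  show "real_of_ereal (f ((1 - t) *\<^sub>R x + t *\<^sub>R y)) \<le> (1 - t) * real_of_ereal (f x) + t * real_of_ereal (f y)"
    using * convex_lscD(3)[OF f] by (cases "f ((1 - t) *\<^sub>R x + t *\<^sub>R y)") auto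
qed

lemma convex_lsc_slope_mono:
  assumes f: "f \<in> convex_lsc" and "x \<in> effective_dom f" "x + h' *\<^sub>R w \<in> effective_dom f" "0 < h" "h \<le> h'"
  shows "x + h *\<^sub>R w \<in> effective_dom f"
    "(real_of_ereal (f (x + h *\<^sub>R w)) - real_of_ereal (f x)) / h
      \<le> (real_of_ereal (f (x + h' *\<^sub>R w)) - real_of_ereal (f x)) / h'"
proof -
  have t: "0 \<le> h / h'" "h / h' \<le> 1" using assms by auto
  have e: "(1 - h / h') *\<^sub>R x + (h / h') *\<^sub>R (x + h' *\<^sub>R w) = x + h *\<^sub>R w"
    using assms by (simp add: algebra_simps)
  note seg = convex_lsc_segment[OF assms(1-3) t, unfolded e]
  show "x + h *\<^sub>R w \<in> effective_dom f" by (rule seg)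
  have "real_of_ereal (f (x + h *\<^sub>R w)) - real_of_ereal (f x)
      \<le> h * ((real_of_ereal (f (x + h' *\<^sub>R w)) - real_of_ereal (f x)) / h')"
    using seg(2) by (simp add: algebra_simps diff_divide_distrib)
  then show "(real_of_ereal (f (x + h *\<^sub>R w)) - real_of_ereal (f x)) / h
      \<le> (real_of_ereal (f (x + h' *\<^sub>R w)) - real_of_ereal (f x)) / h'"
    using assms by (simp add: divide_le_eq mult.commute)
qed

lemma GDERIV_imp_directional:
  assumes "GDERIV f x :> D"
  shows "((\<lambda>h. (f (x + h *\<^sub>R w) - f x) / h) \<longlongrightarrow> w \<bullet> D) (at (0::real))"
proof -
  have "((\<lambda>h. x + h *\<^sub>R w) has_derivative (\<lambda>h. h *\<^sub>R w)) (at (0::real))"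
    by (auto intro!: derivative_eq_intros)
  moreover have "(f has_derivative (\<lambda>h. h \<bullet> D)) (at (x + 0 *\<^sub>R w))"
    using assms by (simp add: gderiv_def)
  ultimately have "((\<lambda>h. f (x + h *\<^sub>R w)) has_derivative (\<lambda>h. (h *\<^sub>R w) \<bullet> D)) (at (0::real))"
    by (rule has_derivative_compose)
  moreover have "(\<lambda>h. (h *\<^sub>R w) \<bullet> D) = (*) (w \<bullet> D)" by (auto simp: mult.commute)
  ultimately have "DERIV (\<lambda>h. f (x + h *\<^sub>R w)) 0 :> w \<bullet> D"
    by (simp add: has_field_derivative_def)
  then show ?thesis by (simp add: DERIV_def)
qed

lemma GDERIV_unique:
  assumes "GDERIV f x :> D" "GDERIV f x :> D'" shows "D = D'"
proof -
  have "w \<bullet> D = w \<bullet> D'" for w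
    using GDERIV_imp_directional[OF assms(1)] GDERIV_imp_directional[OF assms(2)]
    by (rule tendsto_unique[OF trivial_limit_at])
  then show ?thesis using vector_eq_ldot by blast
qed

text \<open>
  The points at which \<^const>\<open>grad\<close> is a genuine gradient and not its default value
  \<open>0\<close>.
\<close>
definition grad_exists :: "('a::real_inner \<Rightarrow> ereal) \<Rightarrow> 'a \<Rightarrow> bool" where
  "grad_exists V x \<longleftrightarrow> x \<in> interior (effective_dom V) \<and> (\<exists>D. GDERIV (\<lambda>y. real_of_ereal (V y)) x :> D)"

lemma GDERIV_grad: "grad_exists V x \<Longrightarrow> GDERIV (\<lambda>y. real_of_ereal (V y)) x :> grad V x"
  unfolding grad_exists_def grad_def by (auto intro: theI2 GDERIV_unique)

lemma grad_not_exists: "\<not> grad_exists V x \<Longrightarrow> grad V x = 0"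
  unfolding grad_exists_def grad_def by auto

lemma subgradient_grad:
  assumes f: "f \<in> convex_lsc" and x: "grad_exists f x"
  shows "ereal (real_of_ereal (f x) + (z - x) \<bullet> grad f x) \<le> f z"
proof (cases "f z")
  case (real r)
  have z: "z \<in> effective_dom f" using real by (simp add: effective_dom_def)
  have xd: "x \<in> effective_dom f" using x interior_subset unfolding grad_exists_def by blast
  have "(z - x) \<bullet> grad f x \<le> real_of_ereal (f z) - real_of_ereal (f x)"
  proof (rule tendsto_upperbound)
    show "((\<lambda>h. (real_of_ereal (f (x + h *\<^sub>R (z - x))) - real_of_ereal (f x)) / h) \<longlongrightarrow> (z - x) \<bullet> grad f x) (at_right 0)"
      using GDERIV_imp_directional[OF GDERIV_grad[OF x], of "z - x"] tendsto_within_subset by blast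
    have "\<forall>\<^sub>F h in at_right 0. h < (1::real)"
      by (auto simp: eventually_at_right_field intro!: exI[of _ 1])
    then show "\<forall>\<^sub>F h in at_right 0. (real_of_ereal (f (x + h *\<^sub>R (z - x))) - real_of_ereal (f x)) / h
        \<le> real_of_ereal (f z) - real_of_ereal (f x)" using eventually_at_right_less[of "0::real"]
    proof eventually_elim
      case (elim h)
      then show ?case using convex_lsc_slope_mono(2)[OF f xd, of 1 "z - x" h] z by simp
    qed
  qed simp
  then show ?thesis using real by simp
qed (use convex_lscD(3)[OF f] in auto)

text \<open>The equality case of Young's inequality.\<close>
lemma conjugate_at_grad:
  assumes f: "f \<in> convex_lsc" and x: "grad_exists f x"
  shows "conjugate f (grad f x) = ereal (x \<bullet> grad f x - real_of_ereal (f x))"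
proof (rule antisym)
  have "x \<in> effective_dom f" using x interior_subset unfolding grad_exists_def by blast
  then show "ereal (x \<bullet> grad f x - real_of_ereal (f x)) \<le> conjugate f (grad f x)"
    using effective_dom_real[OF f] by (intro conjugate_lower_bound) (metis order_refl)
  show "conjugate f (grad f x) \<le> ereal (x \<bullet> grad f x - real_of_ereal (f x))"
    unfolding conjugate_le_iff
  proof
    fix z show "ereal (z \<bullet> grad f x - (x \<bullet> grad f x - real_of_ereal (f x))) \<le> f z"
      using subgradient_grad[OF f x, of z] by (simp add: inner_diff_left algebra_simps)
  qed
qed

lemma subgradient_unique:
  assumes f: "f \<in> convex_lsc" and x: "grad_exists f x"
    and y: "\<And>z. ereal (real_of_ereal (f x) + (z - x) \<bullet> y) \<le> f z"
  shows "y = grad f x"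
proof -
  have xi: "x \<in> interior (effective_dom f)" using x by (simp add: grad_exists_def)
  have "w \<bullet> y \<le> w \<bullet> grad f x" for w
  proof (rule tendsto_lowerbound)
    show "((\<lambda>h. (real_of_ereal (f (x + h *\<^sub>R w)) - real_of_ereal (f x)) / h) \<longlongrightarrow> w \<bullet> grad f x) (at_right 0)"
      using GDERIV_imp_directional[OF GDERIV_grad[OF x], of w] tendsto_within_subset by blast
    have "((\<lambda>h. x + h *\<^sub>R w) \<longlongrightarrow> x + 0 *\<^sub>R w) (at_right (0::real))"
      by (intro tendsto_intros)
    then have "\<forall>\<^sub>F h in at_right (0::real). x + h *\<^sub>R w \<in> interior (effective_dom f)"
      using xi by (intro topological_tendstoD) auto
    then show "\<forall>\<^sub>F h in at_right (0::real). w \<bullet> y \<le> (real_of_ereal (f (x + h *\<^sub>R w)) - real_of_ereal (f x)) / h"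
      using eventually_at_right_less[of "0::real"]
    proof eventually_elim
      case (elim h)
      have "f (x + h *\<^sub>R w) = ereal (real_of_ereal (f (x + h *\<^sub>R w)))"
        using effective_dom_real[OF f] elim interior_subset by blast
      then have "real_of_ereal (f x) + h * (w \<bullet> y) \<le> real_of_ereal (f (x + h *\<^sub>R w))"
        using y[of "x + h *\<^sub>R w"] by (metis add_diff_cancel_left' ereal_less_eq(3) inner_scaleR_left)
      then show ?case using elim by (simp add: le_divide_eq mult.commute)
    qed
  qed simp
  from this[of "y - grad f x"] have "(y - grad f x) \<bullet> (y - grad f x) \<le> 0" by (simp add: inner_diff_right)
  then have "(y - grad f x) \<bullet> (y - grad f x) = 0" using inner_ge_zero antisym by blast
  then show ?thesis by simp
qed

text \<open>
  For a convex function this is the gap between the slopes to the right and to the left at scale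
  \<open>h\<close>. It decreases with \<open>h\<close>, and its limit is the jump of the one-sided
  derivatives in direction \<open>e\<close>.
\<close>
definition second_diff :: "('a::real_vector \<Rightarrow> ereal) \<Rightarrow> 'a \<Rightarrow> real \<Rightarrow> 'a \<Rightarrow> real" where
  "second_diff f e h x = (real_of_ereal (f (x + h *\<^sub>R e)) + real_of_ereal (f (x - h *\<^sub>R e)) - 2 * real_of_ereal (f x)) / h"

lemma second_diff_eq:
  "h \<noteq> 0 \<Longrightarrow> second_diff f e h x = (real_of_ereal (f (x + h *\<^sub>R e)) - real_of_ereal (f x)) / h
     + (real_of_ereal (f (x + h *\<^sub>R (- e))) - real_of_ereal (f x)) / h"
  by (simp add: second_diff_def field_simps)

lemma second_diff_nonneg:
  assumes f: "f \<in> convex_lsc" and "x + h *\<^sub>R e \<in> effective_dom f" "x - h *\<^sub>R e \<in> effective_dom f" "h > 0"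
  shows "0 \<le> second_diff f e h x"
proof -
  have "(1 - 1/2) *\<^sub>R (x + h *\<^sub>R e) + (1/2) *\<^sub>R (x - h *\<^sub>R e) = x"
    by (simp flip: scaleR_add_right)
  then show ?thesis using convex_lsc_segment(2)[OF assms(1-3), of "1/2"] assms(4)
    by (simp add: second_diff_def)
qed

lemma second_diff_mono:
  assumes f: "f \<in> convex_lsc" and "x \<in> effective_dom f" "x + h' *\<^sub>R e \<in> effective_dom f" "x - h' *\<^sub>R e \<in> effective_dom f" "0 < h" "h \<le> h'"
  shows "second_diff f e h x \<le> second_diff f e h' x"
proof -
  have "h' > 0" using assms by simp
  then show ?thesis
    using convex_lsc_slope_mono(2)[OF f assms(2,3,5,6)] convex_lsc_slope_mono(2)[OF f assms(2) _ assms(5,6), of "- e"] assms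
    by (simp add: second_diff_eq)
qed

lemma eventually_in_interior_line:
  fixes x :: "'a::real_normed_vector"
  assumes "x \<in> interior S"
  obtains d where "d > 0" "\<And>h. \<bar>h\<bar> \<le> d \<Longrightarrow> x + h *\<^sub>R w \<in> interior S"
proof -
  obtain r where r: "r > 0" "ball x r \<subseteq> interior S"
    using assms open_contains_ball[of "interior S"] by auto
  define d where "d = r / 2 / (norm w + 1)"
  have nw: "norm w + 1 > 0" by (simp add: add_nonneg_pos)
  have d: "d > 0" using r nw by (simp add: d_def)
  have "x + h *\<^sub>R w \<in> interior S" if "\<bar>h\<bar> \<le> d" for h
  proof -
    have "\<bar>h\<bar> * norm w \<le> d * (norm w + 1)" using that d by (intro mult_mono) auto
    also have "\<dots> = r / 2" by (metis d_def less_irrefl nonzero_eq_divide_eq nw)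
    finally have "x + h *\<^sub>R w \<in> ball x r" using r by (simp add: dist_norm)
    then show ?thesis using r by blast
  qed
  then show ?thesis using that d by blast
qed

lemma grad_exists_imp_second_diff:
  assumes "grad_exists f x"
  shows "(\<lambda>m. second_diff f e (1 / real (Suc m)) x) \<longlonglongrightarrow> 0"
    "(\<lambda>m. (real_of_ereal (f (x + (1 / real (Suc m)) *\<^sub>R e)) - real_of_ereal (f x)) / (1 / real (Suc m))) \<longlonglongrightarrow> e \<bullet> grad f x"
proof -
  have *: "(\<lambda>m. (real_of_ereal (f (x + (1 / real (Suc m)) *\<^sub>R w)) - real_of_ereal (f x)) / (1 / real (Suc m))) \<longlonglongrightarrow> w \<bullet> grad f x" for w
  proof -
    have "filterlim (\<lambda>m. 1 / real (Suc m)) (at 0) sequentially"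
      unfolding filterlim_at using LIMSEQ_inverse_real_of_nat by (auto simp: inverse_eq_divide)
    then show ?thesis
      using filterlim_compose[OF GDERIV_imp_directional[OF GDERIV_grad[OF assms], of w]] by blast
  qed
  show "(\<lambda>m. (real_of_ereal (f (x + (1 / real (Suc m)) *\<^sub>R e)) - real_of_ereal (f x)) / (1 / real (Suc m))) \<longlonglongrightarrow> e \<bullet> grad f x"
    by (rule *)
  have "(\<lambda>m. second_diff f e (1 / real (Suc m)) x) \<longlonglongrightarrow> e \<bullet> grad f x + (- e) \<bullet> grad f x"
    using tendsto_add[OF *[of e] *[of "- e"]] by (simp add: second_diff_eq)
  then show "(\<lambda>m. second_diff f e (1 / real (Suc m)) x) \<longlonglongrightarrow> 0" by simp
qed


text \<open>
  Right slopes dominate left slopes by at least \<open>\<epsilon>\<close> at all scales simultaneously,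
  because both kinds of slope are monotone in the step; the infimum of the right slopes separates them.
  With \<open>\<epsilon> = 0\<close> this gives a candidate for the partial derivative, with
  \<open>\<epsilon> > 0\<close> room for a rational number between the two sides.
\<close>
lemma slope_between:
  assumes f: "f \<in> convex_lsc" and x: "x \<in> effective_dom f" and d: "0 < d"
    and xd: "x + d *\<^sub>R e \<in> effective_dom f" "x - d *\<^sub>R e \<in> effective_dom f"
    and \<epsilon>: "\<And>h. 0 < h \<Longrightarrow> h \<le> d \<Longrightarrow> \<epsilon> \<le> second_diff f e h x"
  obtains p where "\<And>h. 0 < h \<Longrightarrow> h \<le> d \<Longrightarrow> p \<le> (real_of_ereal (f (x + h *\<^sub>R e)) - real_of_ereal (f x)) / h"
    "\<And>h. 0 < h \<Longrightarrow> h \<le> d \<Longrightarrow> \<epsilon> - (real_of_ereal (f (x + h *\<^sub>R (- e))) - real_of_ereal (f x)) / h \<le> p"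
proof -
  define r where "r w h = (real_of_ereal (f (x + h *\<^sub>R w)) - real_of_ereal (f x)) / h" for w h
  have mono: "r e h \<le> r e h'" "r (- e) h \<le> r (- e) h'" if "0 < h" "h \<le> h'" "h' \<le> d" for h h'
  proof -
    have "0 < h'" using that by simp
    then have "x + h' *\<^sub>R e \<in> effective_dom f" "x + h' *\<^sub>R (- e) \<in> effective_dom f"
      using convex_lsc_slope_mono(1)[OF f x, of d e h'] convex_lsc_slope_mono(1)[OF f x, of d "- e" h'] xd that by auto
    then show "r e h \<le> r e h'" "r (- e) h \<le> r (- e) h'"
      unfolding r_def using convex_lsc_slope_mono(2)[OF f x] that by blast+
  qed
  have cross: "\<epsilon> - r (- e) h' \<le> r e h" if "0 < h" "h \<le> d" "0 < h'" "h' \<le> d" for h h'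
  proof -
    define k where "k = min h h'"
    have k: "0 < k" "k \<le> h" "k \<le> h'" "k \<le> d" using that by (auto simp: k_def)
    have "\<epsilon> \<le> r e k + r (- e) k" using \<epsilon>[of k] k by (simp add: second_diff_eq r_def)
    moreover have "r e k \<le> r e h" "r (- e) k \<le> r (- e) h'" using mono k that by auto
    ultimately show ?thesis by simp
  qed
  define p where "p = Inf (r e ` {0<..d})"
  have ne: "r e ` {0<..d} \<noteq> {}" using d by auto
  have bdd: "bdd_below (r e ` {0<..d})"
    using cross[of _ d] d by (intro bdd_belowI2[of _ "\<epsilon> - r (- e) d"]) auto
  show ?thesis
  proof (rule that[of p])
    fix h assume h: "0 < h" "h \<le> d"
    show "p \<le> (real_of_ereal (f (x + h *\<^sub>R e)) - real_of_ereal (f x)) / h"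
      unfolding p_def r_def[symmetric] using h by (intro cInf_lower bdd) auto
    show "\<epsilon> - (real_of_ereal (f (x + h *\<^sub>R (- e))) - real_of_ereal (f x)) / h \<le> p"
      unfolding p_def r_def[symmetric] using h cross by (intro cInf_greatest ne) auto
  qed
qed

text \<open>
  For convex functions, partial derivatives at a point give full differentiability. Subtracting the
  candidate for the derivative leaves a convex function \<open>g\<close> that is small along the axes; a
  small vector is an average of axis vectors, so \<open>g\<close> is small from above, and convexity at
  the origin turns this into a bound from below.
\<close>
lemma second_diff_imp_grad_exists:
  fixes f :: "'a::euclidean_space \<Rightarrow> ereal"
  assumes f: "f \<in> convex_lsc" and x: "x \<in> interior (effective_dom f)"
    and lim: "\<And>e. e \<in> Basis \<Longrightarrow> (\<lambda>m. second_diff f e (1 / real (Suc m)) x) \<longlonglongrightarrow> 0"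
  shows "grad_exists f x"
proof -
  define v where "v = (\<lambda>y. real_of_ereal (f y))"
  define n where "n = real DIM('a)"
  have n: "n > 0" by (simp add: n_def)
  obtain \<rho> where \<rho>: "\<rho> > 0" "ball x \<rho> \<subseteq> interior (effective_dom f)"
    using x open_contains_ball[of "interior (effective_dom f)"] by auto
  define d where "d = \<rho> / 2"
  have d: "d > 0" using \<rho> by (simp add: d_def)
  have inU: "x + u \<in> interior (effective_dom f)" if "norm u \<le> d" for u
    using that \<rho> d by (intro subsetD[OF \<rho>(2)]) (auto simp: dist_norm d_def)
  have indom: "x + u \<in> effective_dom f" if "norm u \<le> d" for u
    using inU[OF that] interior_subset by blast
  have xdom: "x \<in> effective_dom f" using x interior_subset by blast
  have "\<exists>p. \<forall>h. 0 < h \<longrightarrow> h \<le> d \<longrightarrow> p \<le> (v (x + h *\<^sub>R e) - v x) / h \<and> - ((v (x + h *\<^sub>R (- e)) - v x) / h) \<le> p"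
    if e: "e \<in> Basis" for e
  proof -
    have "x + d *\<^sub>R e \<in> effective_dom f" "x - d *\<^sub>R e \<in> effective_dom f"
      using indom[of "d *\<^sub>R e"] indom[of "- d *\<^sub>R e"] e d by auto
    moreover have "0 \<le> second_diff f e h x" if "0 < h" "h \<le> d" for h
      using indom[of "h *\<^sub>R e"] indom[of "- h *\<^sub>R e"] e that by (intro second_diff_nonneg f) auto
    ultimately obtain p where "\<And>h. 0 < h \<Longrightarrow> h \<le> d \<Longrightarrow> p \<le> (real_of_ereal (f (x + h *\<^sub>R e)) - real_of_ereal (f x)) / h"
      "\<And>h. 0 < h \<Longrightarrow> h \<le> d \<Longrightarrow> 0 - (real_of_ereal (f (x + h *\<^sub>R (- e))) - real_of_ereal (f x)) / h \<le> p"
      using slope_between[OF f xdom d] by metis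
    then show ?thesis by (intro exI[of _ p]) (auto simp: v_def)
  qed
  then obtain p where p: "\<And>e h. e \<in> Basis \<Longrightarrow> 0 < h \<Longrightarrow> h \<le> d \<Longrightarrow> p e \<le> (v (x + h *\<^sub>R e) - v x) / h"
    "\<And>e h. e \<in> Basis \<Longrightarrow> 0 < h \<Longrightarrow> h \<le> d \<Longrightarrow> - ((v (x + h *\<^sub>R (- e)) - v x) / h) \<le> p e"
    by metis
  define D where "D = (\<Sum>e\<in>Basis. p e *\<^sub>R e)"
  have De: "e \<bullet> D = p e" if "e \<in> Basis" for e
    using that by (simp add: D_def inner_sum_right inner_Basis if_distrib sum.delta cong: if_cong)
  define g where "g u = v (x + u) - v x - u \<bullet> D" for u
  have g_axis: "g (s *\<^sub>R e) \<le> \<bar>s\<bar> * second_diff f e \<bar>s\<bar> x" if e: "e \<in> Basis" and s: "\<bar>s\<bar> \<le> d" for e s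
  proof (cases "s = 0")
    case True then show ?thesis by (simp add: g_def)
  next
    case False
    define h where "h = \<bar>s\<bar>"
    have h: "0 < h" "h \<le> d" using False s by (auto simp: h_def)
    have b: "h * p e \<le> v (x + h *\<^sub>R e) - v x" "- (v (x + h *\<^sub>R (- e)) - v x) \<le> h * p e"
      using p(1)[OF e h] p(2)[OF e h] h by (auto simp: field_simps)
    have sd: "h * second_diff f e h x = (v (x + h *\<^sub>R e) - v x) + (v (x + h *\<^sub>R (- e)) - v x)"
      using h by (simp add: second_diff_def v_def)
    have "s = h \<or> s = - h" by (auto simp: h_def)
    then show ?thesis unfolding h_def[symmetric] sd
      using b De[OF e] by (auto simp: g_def)
  qed
  have conv: "convex_on (interior (effective_dom f)) v"
    unfolding v_def by (rule convex_on_real_of_convex_lsc[OF f])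
  have g_le: "g u \<le> (\<Sum>e\<in>Basis. 1 / n * g ((n * (u \<bullet> e)) *\<^sub>R e))" if u: "n * norm u \<le> d" for u
  proof -
    define y where "y e = x + (n * (u \<bullet> e)) *\<^sub>R e" for e
    have yU: "y e \<in> interior (effective_dom f)" if "e \<in> Basis" for e
    proof -
      have "n * \<bar>u \<bullet> e\<bar> \<le> n * norm u" using Basis_le_norm[OF that] n by (intro mult_left_mono) auto
      then have "n * \<bar>u \<bullet> e\<bar> \<le> d" using u by linarith
      then show ?thesis unfolding y_def using that n by (intro inU) (simp add: abs_mult)
    qed
    have "(\<Sum>e\<in>Basis. (1 / n) *\<^sub>R y e) = (\<Sum>e\<in>(Basis::'a set). (1 / n) *\<^sub>R x) + (\<Sum>e\<in>Basis. (u \<bullet> e) *\<^sub>R e)"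
      using n by (simp add: y_def scaleR_add_right sum.distrib)
    also have "\<dots> = x + u"
      using n by (simp add: euclidean_representation sum_constant_scaleR n_def)
    finally have "v (x + u) = v (\<Sum>e\<in>Basis. (1 / n) *\<^sub>R y e)" by simp
    also have "\<dots> \<le> (\<Sum>e\<in>Basis. 1 / n * v (y e))"
      using n yU by (intro convex_on_sum[OF _ _ conv]) (auto simp: n_def)
    finally have "g u \<le> (\<Sum>e\<in>Basis. 1 / n * v (y e)) - v x - u \<bullet> D" by (simp add: g_def)
    also have "u \<bullet> D = (\<Sum>e\<in>Basis. 1 / n * ((n * (u \<bullet> e)) * (e \<bullet> D)))"
      using n by (subst euclidean_inner) (simp add: inner_commute)
    also have "v x = (\<Sum>e\<in>(Basis::'a set). 1 / n * v x)" using n by (simp add: n_def)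
    finally show ?thesis
      by (simp add: g_def y_def sum_subtractf right_diff_distrib)
  qed
  have g_sym: "0 \<le> g u + g (- u)" if "norm u \<le> d" for u
  proof -
    have "0 \<le> second_diff f u 1 x"
      using indom[of u] indom[of "- u"] that by (intro second_diff_nonneg f) auto
    then show ?thesis by (simp add: second_diff_def g_def v_def)
  qed
  have "(v has_derivative (\<lambda>h. h \<bullet> D)) (at x)"
    unfolding has_derivative_at_alt
  proof (intro conjI allI impI)
    show "bounded_linear (\<lambda>h. h \<bullet> D)" by (rule bounded_linear_inner_left)
    fix \<epsilon> :: real assume \<epsilon>: "\<epsilon> > 0"
    define \<epsilon>' where "\<epsilon>' = \<epsilon> / n"
    have \<epsilon>': "\<epsilon>' > 0" using \<epsilon> n by (simp add: \<epsilon>'_def)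
    have "\<forall>\<^sub>F m in sequentially. \<forall>e\<in>Basis. second_diff f e (1 / real (Suc m)) x < \<epsilon>'"
      using order_tendstoD(2)[OF lim \<epsilon>'] by (auto simp: eventually_ball_finite_distrib)
    moreover have "\<forall>\<^sub>F m in sequentially. 1 / real (Suc m) < d"
      using order_tendstoD(2)[OF LIMSEQ_inverse_real_of_nat d] by (simp add: inverse_eq_divide)
    ultimately have "\<forall>\<^sub>F m in sequentially. (\<forall>e\<in>Basis. second_diff f e (1 / real (Suc m)) x < \<epsilon>') \<and> 1 / real (Suc m) < d"
      by (rule eventually_conj)
    then obtain m where m: "\<forall>e\<in>Basis. second_diff f e (1 / real (Suc m)) x < \<epsilon>'" "1 / real (Suc m) < d"
      using eventually_happens'[OF sequentially_bot] by blast
    define h0 where "h0 = 1 / real (Suc m)"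
    have h0: "h0 > 0" "h0 < d" using m by (auto simp: h0_def)
    have upper: "g u \<le> \<epsilon> * norm u" if u: "n * norm u \<le> h0" for u
    proof -
      have "g ((n * (u \<bullet> e)) *\<^sub>R e) \<le> n * norm u * \<epsilon>'" if e: "e \<in> Basis" for e
      proof (cases "u \<bullet> e = 0")
        case True then show ?thesis using n \<epsilon>' by (simp add: g_def)
      next
        case False
        define s where "s = n * (u \<bullet> e)"
        have "n * \<bar>u \<bullet> e\<bar> \<le> n * norm u" using Basis_le_norm[OF e] n by (intro mult_left_mono) auto
        then have s: "\<bar>s\<bar> \<le> n * norm u" using n by (simp add: s_def abs_mult)
        have s0: "0 < \<bar>s\<bar>" using False n by (simp add: s_def)
        have sh: "\<bar>s\<bar> \<le> h0" using s u by simp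
        have "second_diff f e \<bar>s\<bar> x \<le> second_diff f e h0 x"
          using indom[of "h0 *\<^sub>R e"] indom[of "- h0 *\<^sub>R e"] e h0 s0 sh
          by (intro second_diff_mono f xdom) auto
        also have "\<dots> \<le> \<epsilon>'" using m(1) e by (auto simp: h0_def intro: less_imp_le)
        finally have "\<bar>s\<bar> * second_diff f e \<bar>s\<bar> x \<le> \<bar>s\<bar> * \<epsilon>'" using s0 by (intro mult_left_mono) auto
        also have "\<dots> \<le> n * norm u * \<epsilon>'" using s \<epsilon>' by (intro mult_right_mono) auto
        finally show ?thesis using g_axis[OF e, of s] sh h0 unfolding s_def by linarith
      qed
      then have "(\<Sum>e\<in>Basis. 1 / n * g ((n * (u \<bullet> e)) *\<^sub>R e)) \<le> (\<Sum>e\<in>(Basis::'a set). 1 / n * (n * norm u * \<epsilon>'))"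
        using n by (intro sum_mono mult_left_mono) auto
      also have "\<dots> = \<epsilon> * norm u" using n by (simp add: \<epsilon>'_def n_def)
      finally show ?thesis using g_le[of u] u h0 by linarith
    qed
    show "\<exists>da>0. \<forall>y. norm (y - x) < da \<longrightarrow> norm (v y - v x - (y - x) \<bullet> D) \<le> \<epsilon> * norm (y - x)"
    proof (intro exI[of _ "h0 / n"] conjI allI impI)
      show "0 < h0 / n" using h0 n by simp
      fix y assume y: "norm (y - x) < h0 / n"
      define u where "u = y - x"
      have u: "n * norm u \<le> h0" using y n by (simp add: u_def field_simps)
      have "n \<ge> 1" by (simp add: n_def Suc_leI)
      then have "1 * norm u \<le> n * norm u" by (intro mult_right_mono) auto
      then have "norm u \<le> d" using u h0 by simp
      then have "0 \<le> g u + g (- u)" by (rule g_sym)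
      then have "\<bar>g u\<bar> \<le> \<epsilon> * norm u" using upper[OF u] upper[of "- u"] u by simp
      then show "norm (v y - v x - (y - x) \<bullet> D) \<le> \<epsilon> * norm (y - x)" by (simp add: g_def u_def)
    qed
  qed
  then show ?thesis using x unfolding grad_exists_def gderiv_def v_def by blast
qed

lemma grad_exists_iff:
  fixes f :: "'a::euclidean_space \<Rightarrow> ereal"
  assumes f: "f \<in> convex_lsc"
  shows "grad_exists f x \<longleftrightarrow> x \<in> interior (effective_dom f) \<and>
    (\<forall>e\<in>Basis. (\<lambda>m. second_diff f e (1 / real (Suc m)) x) \<longlonglongrightarrow> 0)"
proof
  assume "grad_exists f x"
  then show "x \<in> interior (effective_dom f) \<and> (\<forall>e\<in>Basis. (\<lambda>m. second_diff f e (1 / real (Suc m)) x) \<longlonglongrightarrow> 0)"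
    using grad_exists_imp_second_diff(1) unfolding grad_exists_def by blast
qed (use second_diff_imp_grad_exists[OF f] in blast)

lemma LIMSEQ_0_iff_countable:
  fixes X :: "nat \<Rightarrow> real"
  shows "X \<longlonglongrightarrow> 0 \<longleftrightarrow> (\<forall>j. \<exists>N. \<forall>m\<ge>N. \<bar>X m\<bar> < inverse (real (Suc j)))"
proof
  assume "X \<longlonglongrightarrow> 0"
  then show "\<forall>j. \<exists>N. \<forall>m\<ge>N. \<bar>X m\<bar> < inverse (real (Suc j))"
    unfolding lim_sequentially by (auto simp: dist_norm)
next
  assume *: "\<forall>j. \<exists>N. \<forall>m\<ge>N. \<bar>X m\<bar> < inverse (real (Suc j))"
  show "X \<longlonglongrightarrow> 0"
    unfolding lim_sequentially
  proof (intro allI impI)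
    fix r :: real assume "r > 0"
    then obtain j where j: "inverse (real (Suc j)) < r" using reals_Archimedean by blast
    obtain N where "\<forall>m\<ge>N. \<bar>X m\<bar> < inverse (real (Suc j))" using * by blast
    then show "\<exists>no. \<forall>n\<ge>no. dist (X n) 0 < r" using j by (intro exI[of _ N]) (auto intro: less_trans)
  qed
qed

lemma borel_measurable_second_diff:
  fixes f :: "'a::euclidean_space \<Rightarrow> ereal"
  assumes f: "f \<in> convex_lsc" shows "second_diff f e h \<in> borel_measurable borel"
proof -
  have [measurable]: "f \<in> borel_measurable borel" by (rule borel_measurable_convex_lsc[OF f])
  show ?thesis unfolding second_diff_def[abs_def] by measurable
qed

text \<open>
  The characterisation by second differences involves countably many conditions, hence the Borel
  measurability of the set of differentiability points and of the gradient.
\<close>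
lemma sets_grad_exists:
  fixes f :: "'a::euclidean_space \<Rightarrow> ereal"
  assumes f: "f \<in> convex_lsc" shows "{x. grad_exists f x} \<in> sets borel"
proof -
  have [measurable]: "second_diff f e h \<in> borel_measurable borel" for e h
    by (rule borel_measurable_second_diff[OF f])
  have [measurable]: "interior (effective_dom f) \<in> sets borel" by simp
  have "{x. grad_exists f x} = {x \<in> space borel. x \<in> interior (effective_dom f) \<and>
    (\<forall>e\<in>Basis. \<forall>j. \<exists>N. \<forall>m\<ge>N. \<bar>second_diff f e (1 / real (Suc m)) x\<bar> < inverse (real (Suc j)))}"
    unfolding grad_exists_iff[OF f] LIMSEQ_0_iff_countable by simp
  also have "\<dots> \<in> sets borel" by measurable
  finally show ?thesis .
qed

lemma borel_measurable_grad:
  fixes f :: "'a::euclidean_space \<Rightarrow> ereal"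
  assumes f: "f \<in> convex_lsc" shows "grad f \<in> borel_measurable borel"
proof (subst borel_measurable_euclidean_space, intro ballI)
  fix e :: 'a assume "e \<in> Basis"
  have [measurable]: "f \<in> borel_measurable borel" by (rule borel_measurable_convex_lsc[OF f])
  have [measurable]: "Measurable.pred borel (grad_exists f)" using sets_grad_exists[OF f] by (simp add: pred_def)
  show "(\<lambda>x. grad f x \<bullet> e) \<in> borel_measurable borel"
  proof (rule borel_measurable_LIMSEQ_real)
    fix x show "(\<lambda>m. if grad_exists f x then
         (real_of_ereal (f (x + (1 / real (Suc m)) *\<^sub>R e)) - real_of_ereal (f x)) / (1 / real (Suc m)) else 0)
         \<longlonglongrightarrow> grad f x \<bullet> e"
      using grad_exists_imp_second_diff(2)[of f x e] grad_not_exists[of f x]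
      by (cases "grad_exists f x") (auto simp: inner_commute)
  qed measurable
qed

lemma convex_lsc_measurable:
  fixes f :: "'a::euclidean_space \<Rightarrow> ereal"
  assumes "f \<in> convex_lsc"
  shows "f \<in> borel_measurable borel" "grad f \<in> borel_measurable borel" "gibbs f \<in> borel_measurable borel"
  using assms by (auto intro: borel_measurable_convex_lsc borel_measurable_grad borel_measurable_gibbs)

text \<open>
  Fubini without choosing coordinates: shift \<open>N\<close> by \<open>s e\<close>, average over
  \<open>s \<in> [0, 1]\<close>, and exchange the integrals.
\<close>
lemma null_set_of_countable_lines:
  fixes N :: "'a::euclidean_space set"
  assumes N[measurable]: "N \<in> sets borel" and c: "\<And>x. countable {s::real. x + s *\<^sub>R e \<in> N}"
  shows "emeasure lborel N = 0"
proof -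
  have "emeasure lborel N = (\<integral>\<^sup>+s. emeasure lborel N * indicator {0..1::real} s \<partial>lborel)"
    by (simp add: nn_integral_cmult_indicator)
  also have "\<dots> = (\<integral>\<^sup>+s. (\<integral>\<^sup>+x. indicator N (x + s *\<^sub>R e) * indicator {0..1::real} s \<partial>lborel) \<partial>lborel)"
  proof (intro nn_integral_cong)
    fix s :: real
    have "emeasure lborel N = (\<integral>\<^sup>+x. indicator N x \<partial>lborel)" by simp
    also have "\<dots> = (\<integral>\<^sup>+x. indicator N (x + s *\<^sub>R e) \<partial>lborel)"
      by (subst lborel_distr_plus[symmetric, of "s *\<^sub>R e"], subst nn_integral_distr) (auto simp: add.commute)
    finally show "emeasure lborel N * indicator {0..1::real} s
        = (\<integral>\<^sup>+x. indicator N (x + s *\<^sub>R e) * indicator {0..1::real} s \<partial>lborel)"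
      by (simp add: nn_integral_multc)
  qed
  also have "\<dots> = (\<integral>\<^sup>+x. (\<integral>\<^sup>+s. indicator N (x + s *\<^sub>R e) * indicator {0..1::real} s \<partial>lborel) \<partial>lborel)"
    by (rule lborel_pair.Fubini'[symmetric]) measurable
  also have "\<dots> = (\<integral>\<^sup>+x. 0 \<partial>(lborel::'a measure))"
  proof (intro nn_integral_cong)
    fix x :: 'a
    have "AE s in lborel. s \<notin> {s::real. x + s *\<^sub>R e \<in> N}"
      using countable_imp_null_set_lborel[OF c] by (rule AE_not_in)
    then have "AE s in lborel. indicator N (x + s *\<^sub>R e) * indicator {0..1::real} s = (0::ennreal)"
      by eventually_elim auto
    then show "(\<integral>\<^sup>+s. indicator N (x + s *\<^sub>R e) * indicator {0..1::real} s \<partial>lborel) = 0"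
      by (subst nn_integral_0_iff_AE) auto
  qed
  finally show ?thesis by simp
qed

text \<open>
  If the one-sided derivatives in direction \<open>e\<close> differ at \<open>x\<close>, some rational
  \<open>q\<close> lies strictly between them, and then \<open>x\<close> is the unique minimiser of
  \<open>f - q s\<close> along its line. So each line meets the exceptional set \<open>N e\<close> in at
  most one point for each rational \<open>q\<close>.
\<close>
lemma AE_grad_exists:
  fixes f :: "'a::euclidean_space \<Rightarrow> ereal"
  assumes f: "f \<in> convex_lsc"
  shows "AE x in lborel. x \<in> interior (effective_dom f) \<longrightarrow> grad_exists f x"
proof -
  define N where "N e = {x \<in> interior (effective_dom f). \<not> (\<lambda>m. second_diff f e (1 / real (Suc m)) x) \<longlonglongrightarrow> 0}" for e
  define T where "T e q = {x. x \<in> effective_dom f \<and> (\<forall>h. h \<noteq> 0 \<longrightarrow> ereal (real_of_ereal (f x) + q * h) < f (x + h *\<^sub>R e))}" for e and q :: real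
  have Nsub: "N e \<subseteq> (\<Union>q\<in>\<rat>. T e q)" for e
  proof
    fix x assume xN: "x \<in> N e"
    then have xU: "x \<in> interior (effective_dom f)" by (simp add: N_def)
    then have xdom: "x \<in> effective_dom f" using interior_subset by blast
    obtain d where d: "d > 0" "\<And>h. \<bar>h\<bar> \<le> d \<Longrightarrow> x + h *\<^sub>R e \<in> interior (effective_dom f)"
      using eventually_in_interior_line[OF xU] by metis
    have dd: "x + h *\<^sub>R e \<in> effective_dom f" "x - h *\<^sub>R e \<in> effective_dom f" if "\<bar>h\<bar> \<le> d" for h
      using d(2)[of h] d(2)[of "- h"] that interior_subset by auto
    have "\<exists>\<epsilon>>0. \<forall>h. 0 < h \<longrightarrow> h \<le> d \<longrightarrow> \<epsilon> \<le> second_diff f e h x"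
    proof (rule ccontr)
      assume neg: "\<not> ?thesis"
      have "(\<lambda>m. second_diff f e (1 / real (Suc m)) x) \<longlonglongrightarrow> 0"
      proof (rule LIMSEQ_I)
        fix r :: real assume "r > 0"
        then obtain h where h: "0 < h" "h \<le> d" "second_diff f e h x < r"
          using neg by (auto simp: not_le)
        obtain m0 where m0: "inverse (real (Suc m0)) < h" using reals_Archimedean[OF h(1)] by blast
        have "norm (second_diff f e (1 / real (Suc m)) x - 0) < r" if "m \<ge> m0" for m
        proof -
          have "1 / real (Suc m) \<le> 1 / real (Suc m0)" using that by (intro divide_left_mono) auto
          then have k: "0 < 1 / real (Suc m)" "1 / real (Suc m) \<le> h" using m0 by (auto simp: inverse_eq_divide)
          have "second_diff f e (1 / real (Suc m)) x \<le> second_diff f e h x"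
            using k h by (intro second_diff_mono f xdom dd) auto
          moreover have "0 \<le> second_diff f e (1 / real (Suc m)) x"
            using k h by (intro second_diff_nonneg f dd) auto
          ultimately show ?thesis using h by simp
        qed
        then show "\<exists>no. \<forall>m\<ge>no. norm (second_diff f e (1 / real (Suc m)) x - 0) < r" by blast
      qed
      then show False using xN by (simp add: N_def)
    qed
    then obtain \<epsilon> where \<epsilon>: "\<epsilon> > 0" "\<And>h. 0 < h \<Longrightarrow> h \<le> d \<Longrightarrow> \<epsilon> \<le> second_diff f e h x" by blast
    obtain p where p: "\<And>h. 0 < h \<Longrightarrow> h \<le> d \<Longrightarrow> p \<le> (real_of_ereal (f (x + h *\<^sub>R e)) - real_of_ereal (f x)) / h"
      "\<And>h. 0 < h \<Longrightarrow> h \<le> d \<Longrightarrow> \<epsilon> - (real_of_ereal (f (x + h *\<^sub>R (- e))) - real_of_ereal (f x)) / h \<le> p"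
      using slope_between[OF f xdom d(1) dd(1)[of d] dd(2)[of d] \<epsilon>(2)] d(1) by (metis abs_of_pos order_refl)
    obtain q where q: "q \<in> \<rat>" "p - \<epsilon> < q" "q < p" using Rats_dense_in_real[of "p - \<epsilon>" p] \<epsilon>(1) by auto
    have "ereal (real_of_ereal (f x) + q * h) < f (x + h *\<^sub>R e)" if "h \<noteq> 0" for h
    proof (cases "f (x + h *\<^sub>R e)")
      case (real r)
      have hdom: "x + h *\<^sub>R e \<in> effective_dom f" using real by (simp add: effective_dom_def)
      define k where "k = min \<bar>h\<bar> d"
      have k: "0 < k" "k \<le> d" "k \<le> \<bar>h\<bar>" using that d by (auto simp: k_def)
      show ?thesis
      proof (cases "h > 0")
        case True
        have "q < (real_of_ereal (f (x + k *\<^sub>R e)) - real_of_ereal (f x)) / k" using p(1)[OF k(1,2)] q by simp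
        also have "\<dots> \<le> (real_of_ereal (f (x + h *\<^sub>R e)) - real_of_ereal (f x)) / h"
          using convex_lsc_slope_mono(2)[OF f xdom hdom] k True by simp
        finally show ?thesis using True real by (simp add: field_simps)
      next
        case False
        have hdom': "x + (- h) *\<^sub>R (- e) \<in> effective_dom f" using hdom by simp
        have "- q < (real_of_ereal (f (x + k *\<^sub>R (- e))) - real_of_ereal (f x)) / k" using p(2)[OF k(1,2)] q by simp
        also have "\<dots> \<le> (real_of_ereal (f (x + (- h) *\<^sub>R (- e))) - real_of_ereal (f x)) / (- h)"
          using convex_lsc_slope_mono(2)[OF f xdom hdom'] k False by simp
        finally have "- q * (- h) < real_of_ereal (f (x + h *\<^sub>R e)) - real_of_ereal (f x)"
          using False that by (subst (asm) less_divide_eq) auto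
        then show ?thesis using real by simp
      qed
    qed (use convex_lscD(3)[OF f] in auto)
    then show "x \<in> (\<Union>q\<in>\<rat>. T e q)" using q xdom by (auto simp: T_def)
  qed
  have T1: "s = s'" if "x + s *\<^sub>R e \<in> T e q" "x + s' *\<^sub>R e \<in> T e q" for x e q s s'
  proof (rule ccontr)
    assume "s \<noteq> s'"
    define a b where "a = real_of_ereal (f (x + s *\<^sub>R e))" and "b = real_of_ereal (f (x + s' *\<^sub>R e))"
    have ab: "f (x + s *\<^sub>R e) = ereal a" "f (x + s' *\<^sub>R e) = ereal b"
      using that effective_dom_real[OF f] by (auto simp: T_def a_def b_def)
    have "(x + s *\<^sub>R e) + (s' - s) *\<^sub>R e = x + s' *\<^sub>R e" "(x + s' *\<^sub>R e) + (s - s') *\<^sub>R e = x + s *\<^sub>R e"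
      by (auto simp: algebra_simps)
    moreover have "s' - s \<noteq> 0" "s - s' \<noteq> 0" using \<open>s \<noteq> s'\<close> by auto
    ultimately have "ereal (a + q * (s' - s)) < ereal b" "ereal (b + q * (s - s')) < ereal a"
      using that ab unfolding T_def by (metis (mono_tags, lifting) mem_Collect_eq real_of_ereal.simps(1))+
    then show False by (simp add: algebra_simps)
  qed
  have sets: "N e \<in> sets borel" for e
  proof -
    have [measurable]: "second_diff f e h \<in> borel_measurable borel" for h
      by (rule borel_measurable_second_diff[OF f])
    have [measurable]: "interior (effective_dom f) \<in> sets borel" by simp
    have "N e = {x \<in> space borel. x \<in> interior (effective_dom f) \<and>
      \<not> (\<forall>j. \<exists>N. \<forall>m\<ge>N. \<bar>second_diff f e (1 / real (Suc m)) x\<bar> < inverse (real (Suc j)))}"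
      unfolding N_def LIMSEQ_0_iff_countable by simp
    also have "\<dots> \<in> sets borel" by measurable
    finally show ?thesis .
  qed
  have null: "emeasure lborel (N e) = 0" for e
  proof (rule null_set_of_countable_lines[OF sets, where e=e])
    fix x
    have "{s. x + s *\<^sub>R e \<in> N e} \<subseteq> (\<Union>q\<in>\<rat>. {s. x + s *\<^sub>R e \<in> T e q})" using Nsub by blast
    moreover have "countable {s. x + s *\<^sub>R e \<in> T e q}" for q
    proof -
      have "{s. x + s *\<^sub>R e \<in> T e q} = {} \<or> (\<exists>s. {s. x + s *\<^sub>R e \<in> T e q} = {s})" using T1 by blast
      then show ?thesis by (metis countable_empty countable_insert)
    qed
    ultimately show "countable {s. x + s *\<^sub>R e \<in> N e}"
      by (meson countable_UN countable_rat countable_subset)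
  qed
  have "AE x in lborel. \<forall>e\<in>Basis. x \<notin> N e"
    using null sets by (intro AE_finite_allI AE_not_in) (auto simp: null_sets_def)
  then show ?thesis
    by eventually_elim (auto simp: N_def grad_exists_iff[OF f])
qed

text \<open>The boundary of the convex domain is a null set, so nothing is lost on it.\<close>
lemma AE_grad_exists_gibbs:
  assumes V: "V \<in> convex_lsc"
  shows "AE x in lborel. 0 < gibbs V (x::'a::euclidean_space) \<longrightarrow> grad_exists V x"
proof -
  have "negligible (frontier (effective_dom V))"
    by (rule negligible_convex_frontier[OF convex_effective_dom[OF convex_lscD(1)[OF V]]])
  then have "AE x in lebesgue. x \<notin> frontier (effective_dom V)"
    using negligible_iff_null_sets by (auto intro: AE_not_in)
  then have "AE x in lborel. x \<notin> frontier (effective_dom V)" by (simp add: AE_completion_iff)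
  then show ?thesis using AE_grad_exists[OF V]
  proof eventually_elim
    case (elim x)
    show ?case
    proof
      assume "0 < gibbs V x"
      then have "x \<in> effective_dom V" using gibbs_pos_iff[of V x, OF convex_lscD(3)[OF V]] by (simp add: effective_dom_def)
      then show "grad_exists V x" using elim closure_subset by (auto simp: frontier_def)
    qed
  qed
qed

section \<open>Integration by parts along rays\<close>

text \<open>
  The fundamental theorem of calculus for Lipschitz functions, from dominated convergence of difference
  quotients. Clamping the argument to \<open>[a, b]\<close> makes the quotients defined everywhere.
\<close>
lemma lipschitz_FTC:
  fixes F F' :: "real \<Rightarrow> real"
  assumes ab: "a \<le> b" and lip: "\<And>s t. a \<le> s \<Longrightarrow> s \<le> t \<Longrightarrow> t \<le> b \<Longrightarrow> \<bar>F t - F s\<bar> \<le> K * (t - s)"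
    and F'[measurable]: "F' \<in> borel_measurable borel"
    and der: "AE t in lborel. a < t \<and> t < b \<longrightarrow> DERIV F t :> F' t"
  shows "integrable lborel (\<lambda>t. indicator {a..b} t * F' t)"
    "(\<integral>t. indicator {a..b} t * F' t \<partial>lborel) = F b - F a"
proof -
  define c where "c t = max a (min t b)" for t
  define G where "G t = F (c t)" for t
  have K: "0 \<le> K" if "a < b"
  proof -
    have "0 \<le> K * (b - a)" using lip[of a b] ab by linarith
    then show ?thesis using that by (simp add: zero_le_mult_iff)
  qed
  define L where "L = \<bar>K\<bar>"
  have G: "\<bar>G t - G s\<bar> \<le> L * \<bar>t - s\<bar>" for s t
  proof -
    have *: "\<bar>G t - G s\<bar> \<le> L * (t - s)" if "s \<le> t" for s t
    proof -
      have "\<bar>G t - G s\<bar> \<le> K * (c t - c s)" unfolding G_def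
        using that ab by (intro lip) (auto simp: c_def)
      also have "\<dots> \<le> L * (c t - c s)" using that by (intro mult_right_mono) (auto simp: c_def L_def)
      also have "\<dots> \<le> L * (t - s)" using that ab by (intro mult_left_mono) (auto simp: c_def L_def)
      finally show ?thesis .
    qed
    show ?thesis using *[of s t] *[of t s] by (cases "s \<le> t") (auto simp: abs_minus_commute)
  qed
  have Gcont: "isCont G t" for t
  proof -
    have "L-lipschitz_on UNIV G" using G by (intro lipschitz_onI) (auto simp: dist_real_def L_def abs_minus_commute)
    then show ?thesis using lipschitz_on_continuous_on continuous_on_eq_continuous_at open_UNIV by blast
  qed
  have "\<exists>I. \<forall>x::real. - \<infinity> < ereal x \<longrightarrow> ereal x < \<infinity> \<longrightarrow> (I has_vector_derivative G x) (at x)"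
    using Gcont by (intro einterval_antiderivative) auto
  then obtain I where I: "\<And>x. DERIV I x :> G x"
    by (auto simp: has_real_derivative_iff_has_vector_derivative)
  define h where "h m = 1 / real (Suc m)" for m
  have h: "h m > 0" for m by (simp add: h_def)
  have h0: "filterlim h (at 0) sequentially"
    unfolding filterlim_at h_def using LIMSEQ_inverse_real_of_nat by (auto simp: inverse_eq_divide)
  define q where "q m t = indicator {a..b} t * ((G (t + h m) - G t) / h m)" for m t
  have Gm[measurable]: "G \<in> borel_measurable borel"
    using Gcont by (intro borel_measurable_continuous_onI) (simp add: continuous_at_imp_continuous_on)
  have lim: "AE t in lborel. (\<lambda>m. q m t) \<longlonglongrightarrow> indicator {a..b} t * F' t"
  proof -
    have "AE t in lborel. t \<noteq> a" "AE t in lborel. t \<noteq> b" by (simp_all add: AE_lborel_singleton)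
    then show ?thesis using der
    proof eventually_elim
      case (elim t)
      show ?case
      proof (cases "a < t \<and> t < b")
        case True
        then have D: "DERIV F t :> F' t" using elim by blast
        have "((\<lambda>y. (F (t + y) - F t) / y) \<longlongrightarrow> F' t) (at 0)" using D by (simp add: DERIV_def)
        then have l: "(\<lambda>m. (F (t + h m) - F t) / h m) \<longlonglongrightarrow> F' t" by (rule filterlim_compose[OF _ h0])
        have "h \<longlonglongrightarrow> 0" using LIMSEQ_inverse_real_of_nat by (simp add: h_def[abs_def] inverse_eq_divide)
        then have "\<forall>\<^sub>F m in sequentially. h m < b - t" using True by (intro order_tendstoD) auto
        then have "\<forall>\<^sub>F m in sequentially. (F (t + h m) - F t) / h m = q m t"
        proof eventually_elim
          case (elim m)
          then show ?case using True h[of m] by (simp add: q_def G_def c_def)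
        qed
        with l have "(\<lambda>m. q m t) \<longlonglongrightarrow> F' t" by (rule Lim_transform_eventually)
        then show ?thesis using True by simp
      next
        case False
        then have "t \<notin> {a..b}" using elim by auto
        then show ?thesis by (simp add: q_def)
      qed
    qed
  qed
  have bnd: "norm (q m t) \<le> indicator {a..b} t * L" for m t
    using G[of "t + h m" t] h[of m] by (auto simp: q_def indicator_def divide_le_eq abs_mult)
  have w: "integrable lborel (\<lambda>t::real. indicator {a..b} t * L)" 
    by (intro integrable_mult_left integrable_real_indicator) (auto simp: emeasure_lborel_Icc_eq)
  have qm[measurable]: "q m \<in> borel_measurable lborel" for m unfolding q_def[abs_def] by measurable
  show "integrable lborel (\<lambda>t. indicator {a..b} t * F' t)"
    by (rule integrable_dominated_convergence[where s=q and w="\<lambda>t. indicator {a..b} t * L"]) (use w lim bnd in auto)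
  have lim1: "(\<lambda>m. \<integral>t. q m t \<partial>lborel) \<longlonglongrightarrow> (\<integral>t. indicator {a..b} t * F' t \<partial>lborel)"
    by (rule integral_dominated_convergence[where w="\<lambda>t. indicator {a..b} t * L"]) (use w lim bnd in auto)
  have "(\<integral>t. q m t \<partial>lborel) = (I (b + h m) - I b) / h m - (I (a + h m) - I a) / h m" for m
  proof -
    have "(\<integral>t. ((G (t + h m) - G t) / h m) * indicator {a..b} t \<partial>lborel)
        = (I (b + h m) - I b) / h m - (I (a + h m) - I a) / h m"
    proof (rule integral_FTC_Icc_real[OF ab])
      fix t
      have "DERIV (\<lambda>t. I (t + h m)) t :> G (t + h m)"
        using DERIV_shift[of I "G (t + h m)" t "h m"] I by simp
      then show "DERIV (\<lambda>t. (I (t + h m) - I t) / h m) t :> (G (t + h m) - G t) / h m"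
        by (intro DERIV_cdivide DERIV_diff I)
      show "isCont (\<lambda>t. (G (t + h m) - G t) / h m) t"
        using h[of m] by (intro continuous_intros Gcont isCont_o2[where f="\<lambda>t. t + h m" and g=G]) auto
    qed
    then show ?thesis by (simp add: q_def mult.commute)
  qed
  moreover have "(\<lambda>m. (I (b + h m) - I b) / h m - (I (a + h m) - I a) / h m) \<longlonglongrightarrow> G b - G a"
    using I[of a] I[of b] by (intro tendsto_diff filterlim_compose[OF _ h0]) (auto simp: DERIV_def)
  ultimately have "(\<integral>t. indicator {a..b} t * F' t \<partial>lborel) = G b - G a"
    using lim1 LIMSEQ_unique by simp
  then show "(\<integral>t. indicator {a..b} t * F' t \<partial>lborel) = F b - F a"
    using ab by (simp add: G_def c_def)
qed

text \<open>
  On a compact piece of a ray inside the domain the potential is Lipschitz, because its slopes there are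
  squeezed between slopes on a slightly larger piece.
\<close>
lemma gibbs_ray_FTC:
  fixes f :: "'a::euclidean_space \<Rightarrow> ereal"
  assumes f: "f \<in> convex_lsc" and x0: "x0 \<in> interior (effective_dom f)"
    and \<beta>: "1 \<le> \<beta>" "x0 + \<beta> *\<^sub>R w \<in> interior (effective_dom f)"
    and ae: "AE r in lborel. 1 < r \<longrightarrow> x0 + r *\<^sub>R w \<in> interior (effective_dom f) \<longrightarrow> grad_exists f (x0 + r *\<^sub>R w)"
  shows "integrable lborel (\<lambda>r. indicator {1..\<beta>} r * ((w \<bullet> grad f (x0 + r *\<^sub>R w)) * gibbs f (x0 + r *\<^sub>R w)))"
    "(\<integral>r. indicator {1..\<beta>} r * ((w \<bullet> grad f (x0 + r *\<^sub>R w)) * gibbs f (x0 + r *\<^sub>R w)) \<partial>lborel)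
       = gibbs f (x0 + w) - gibbs f (x0 + \<beta> *\<^sub>R w)"
proof -
  define v where "v = (\<lambda>y. real_of_ereal (f y))"
  let ?U = "interior (effective_dom f)"
  obtain d0 where d0: "d0 > 0" "\<And>h. \<bar>h\<bar> \<le> d0 \<Longrightarrow> (x0 + \<beta> *\<^sub>R w) + h *\<^sub>R w \<in> ?U"
    using eventually_in_interior_line[OF \<beta>(2)] by metis
  define d where "d = min d0 1"
  have d: "0 < d" "d \<le> 1" "x0 + (\<beta> + d) *\<^sub>R w \<in> ?U"
    using d0(1) d0(2)[of d] by (auto simp: d_def scaleR_add_left add.assoc)
  define \<beta>' where "\<beta>' = \<beta> + d"
  have \<beta>': "\<beta>' > 1" "x0 + \<beta>' *\<^sub>R w \<in> ?U" using d \<beta> by (auto simp: \<beta>'_def)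
  have convU: "convex ?U" using convex_effective_dom[OF convex_lscD(1)[OF f]] by (rule convex_interior)
  have inU: "x0 + r *\<^sub>R w \<in> ?U" if "0 \<le> r" "r \<le> \<beta>'" for r
  proof -
    have "(1 - r / \<beta>') *\<^sub>R x0 + (r / \<beta>') *\<^sub>R (x0 + \<beta>' *\<^sub>R w) \<in> ?U"
      using that \<beta>' by (intro convexD_alt[OF convU x0]) auto
    moreover have "(1 - r / \<beta>') *\<^sub>R x0 + (r / \<beta>') *\<^sub>R (x0 + \<beta>' *\<^sub>R w) = x0 + r *\<^sub>R w"
      using \<beta>' by (simp add: algebra_simps)
    ultimately show ?thesis by simp
  qed
  have indom: "x0 + r *\<^sub>R w \<in> effective_dom f" if "0 \<le> r" "r \<le> \<beta>'" for r
    using inU[OF that] interior_subset by blast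
  define \<phi> where "\<phi> r = v (x0 + r *\<^sub>R w)" for r
  have gibbs_eq: "gibbs f (x0 + r *\<^sub>R w) = exp (- \<phi> r)" if "0 \<le> r" "r \<le> \<beta>'" for r
    unfolding \<phi>_def v_def by (rule gibbs_simps(1), rule effective_dom_real[OF f indom[OF that]])
  have "continuous_on {0..\<beta>'} \<phi>"
    unfolding \<phi>_def[abs_def] v_def
    by (rule continuous_on_compose2[OF continuous_on_real_of_convex_lsc[OF f]])
       (auto intro!: continuous_intros inU)
  then have "bounded (\<phi> ` {0..\<beta>'})"
    by (intro compact_imp_bounded compact_continuous_image) auto
  then obtain A where "\<forall>r\<in>{0..\<beta>'}. \<bar>\<phi> r\<bar> \<le> A" by (auto simp: bounded_real)
  then have A: "\<And>r. 0 \<le> r \<Longrightarrow> r \<le> \<beta>' \<Longrightarrow> \<bar>\<phi> r\<bar> \<le> A" by simp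
  have A0: "A \<ge> 0" using A[of 0] \<beta>' by simp
  define K where "K = 2 * A / d"
  have K: "K \<ge> 2 * A"
  proof -
    have "2 * A / 1 \<le> 2 * A / d" using d A0 by (intro divide_left_mono) auto
    then show ?thesis by (simp add: K_def)
  qed
  have lip\<phi>: "\<bar>\<phi> t - \<phi> s\<bar> \<le> K * (t - s)" if st: "1 \<le> s" "s \<le> t" "t \<le> \<beta>" for s t
  proof (cases "s = t")
    case False
    then have "s < t" using st by simp
    have e1: "(x0 + s *\<^sub>R w) + (\<beta>' - s) *\<^sub>R w = x0 + \<beta>' *\<^sub>R w" "(x0 + s *\<^sub>R w) + (t - s) *\<^sub>R w = x0 + t *\<^sub>R w"
      "(x0 + t *\<^sub>R w) + t *\<^sub>R (- w) = x0 + 0 *\<^sub>R w" "(x0 + t *\<^sub>R w) + (t - s) *\<^sub>R (- w) = x0 + s *\<^sub>R w"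
      by (auto simp: algebra_simps)
    have "(\<phi> t - \<phi> s) / (t - s) \<le> (\<phi> \<beta>' - \<phi> s) / (\<beta>' - s)"
      using convex_lsc_slope_mono(2)[OF f indom[of s], of "\<beta>' - s" w "t - s"] indom[of \<beta>'] st \<open>s < t\<close> d
      unfolding e1 by (simp add: \<phi>_def v_def \<beta>'_def)
    also have "\<dots> \<le> 2 * A / (\<beta>' - s)"
      using A[of s] A[of \<beta>'] st d by (intro divide_right_mono) (auto simp: \<beta>'_def)
    also have "\<dots> \<le> 2 * A / d" using st d A0 by (intro divide_left_mono) (auto simp: \<beta>'_def)
    finally have up: "\<phi> t - \<phi> s \<le> K * (t - s)" using \<open>s < t\<close> by (simp add: K_def[symmetric] divide_le_eq)
    have "(\<phi> s - \<phi> t) / (t - s) \<le> (\<phi> 0 - \<phi> t) / t"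
      using convex_lsc_slope_mono(2)[OF f indom[of t], of t "- w" "t - s"] indom[of 0] st \<open>s < t\<close> d \<beta>'
      unfolding e1 by (simp add: \<phi>_def v_def \<beta>'_def)
    also have "\<dots> \<le> 2 * A / t"
      using A[of 0] A[of t] st d by (intro divide_right_mono) (auto simp: \<beta>'_def)
    also have "\<dots> \<le> 2 * A / 1" using st A0 by (intro divide_left_mono) auto
    also have "\<dots> \<le> K" using K by simp
    finally have "\<phi> s - \<phi> t \<le> K * (t - s)" using \<open>s < t\<close> by (simp add: divide_le_eq)
    then show ?thesis using up by simp
  qed simp
  define F where "F r = gibbs f (x0 + r *\<^sub>R w)" for r
  define F' where "F' r = - ((w \<bullet> grad f (x0 + r *\<^sub>R w)) * gibbs f (x0 + r *\<^sub>R w))" for r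
  note [measurable] = convex_lsc_measurable[OF f]
  have F'm: "F' \<in> borel_measurable borel" unfolding F'_def[abs_def] by measurable
  have lip: "\<bar>F t - F s\<bar> \<le> (exp A * K) * (t - s)" if st: "1 \<le> s" "s \<le> t" "t \<le> \<beta>" for s t
  proof -
    have r: "0 \<le> s" "s \<le> \<beta>'" "0 \<le> t" "t \<le> \<beta>'" using st d by (auto simp: \<beta>'_def)
    have ex: "\<bar>exp (- y) - exp (- z)\<bar> \<le> exp A * \<bar>y - z\<bar>" if "\<bar>y\<bar> \<le> A" "\<bar>z\<bar> \<le> A" for y z :: real
    proof -
      have *: "exp (- y) - exp (- z) \<le> exp A * (z - y)" if "\<bar>y\<bar> \<le> A" "y \<le> z" for y z :: real
      proof -
        have "exp (- y) - exp (- z) = exp (- y) * (1 - exp (y - z))" by (simp add: algebra_simps flip: exp_add)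
        also have "\<dots> \<le> exp (- y) * (z - y)"
        proof (rule mult_left_mono)
          show "1 - exp (y - z) \<le> z - y" using exp_ge_add_one_self[of "y - z"] by linarith
        qed simp
        also have "\<dots> \<le> exp A * (z - y)" using that by (intro mult_right_mono) auto
        finally show ?thesis .
      qed
      show ?thesis using *[of y z] *[of z y] that by (cases "y \<le> z") auto
    qed
    have "\<bar>F t - F s\<bar> \<le> exp A * \<bar>\<phi> t - \<phi> s\<bar>"
      unfolding F_def using gibbs_eq[OF r(1,2)] gibbs_eq[OF r(3,4)] ex[OF A[OF r(3,4)] A[OF r(1,2)]] by simp
    also have "\<dots> \<le> exp A * (K * (t - s))" using lip\<phi>[OF st] by (intro mult_left_mono) auto
    finally show ?thesis by (simp add: mult.assoc)
  qed
  have der: "AE r in lborel. 1 < r \<and> r < \<beta> \<longrightarrow> DERIV F r :> F' r"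
    using ae
  proof eventually_elim
    case (elim r)
    show ?case
    proof
      assume r: "1 < r \<and> r < \<beta>"
      then have ge: "grad_exists f (x0 + r *\<^sub>R w)" using elim inU[of r] d by (auto simp: \<beta>'_def)
      have "((\<lambda>h. (\<phi> (r + h) - \<phi> r) / h) \<longlongrightarrow> w \<bullet> grad f (x0 + r *\<^sub>R w)) (at 0)"
        using GDERIV_imp_directional[OF GDERIV_grad[OF ge], of w]
        by (simp add: \<phi>_def v_def algebra_simps)
      then have "DERIV \<phi> r :> w \<bullet> grad f (x0 + r *\<^sub>R w)" by (simp add: DERIV_def)
      then have "DERIV (\<lambda>r. exp (- \<phi> r)) r :> exp (- \<phi> r) * (- (w \<bullet> grad f (x0 + r *\<^sub>R w)))"
        by (auto intro!: derivative_eq_intros)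
      then have "DERIV (\<lambda>r. exp (- \<phi> r)) r :> F' r"
        using gibbs_eq[of r] r d by (simp add: F'_def \<beta>'_def mult.commute)
      moreover have "\<forall>\<^sub>F s in nhds r. exp (- \<phi> s) = F s"
      proof -
        have "\<forall>\<^sub>F s in nhds r. s \<in> {0<..<\<beta>}" using r by (intro eventually_nhds_in_open) auto
        then show ?thesis by eventually_elim (use gibbs_eq d in \<open>auto simp: F_def \<beta>'_def\<close>)
      qed
      ultimately show "DERIV F r :> F' r" using DERIV_cong_ev[of r r "\<lambda>s. exp (- \<phi> s)" F "F' r" "F' r"] by simp
    qed
  qed
  note ftc = lipschitz_FTC[OF \<beta>(1) lip F'm der]
  show "integrable lborel (\<lambda>r. indicator {1..\<beta>} r * ((w \<bullet> grad f (x0 + r *\<^sub>R w)) * gibbs f (x0 + r *\<^sub>R w)))"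
    using ftc(1) unfolding F'_def by simp
  show "(\<integral>r. indicator {1..\<beta>} r * ((w \<bullet> grad f (x0 + r *\<^sub>R w)) * gibbs f (x0 + r *\<^sub>R w)) \<partial>lborel)
       = gibbs f (x0 + w) - gibbs f (x0 + \<beta> *\<^sub>R w)"
    using ftc(2) unfolding F'_def F_def by simp
qed

lemma nn_integral_dilation:
  fixes h :: "'a::euclidean_space \<Rightarrow> ennreal"
  assumes [measurable]: "h \<in> borel_measurable borel" and r: "r > 0"
  shows "(\<integral>\<^sup>+x. h (x0 + r *\<^sub>R (x - x0)) \<partial>lborel) = ennreal (inverse r ^ DIM('a)) * (\<integral>\<^sup>+x. h x \<partial>lborel)"
proof -
  have "(\<integral>\<^sup>+x. h x \<partial>lborel) = (\<integral>\<^sup>+x. h x \<partial>density (distr lborel borel (\<lambda>x. (x0 - r *\<^sub>R x0) + r *\<^sub>R x)) (\<lambda>_. \<bar>r\<bar> ^ DIM('a)))"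
    using lborel_affine[of r "x0 - r *\<^sub>R x0"] r by simp
  also have "\<dots> = ennreal (r ^ DIM('a)) * (\<integral>\<^sup>+x. h ((x0 - r *\<^sub>R x0) + r *\<^sub>R x) \<partial>lborel)"
    using r by (subst nn_integral_density, simp, simp, subst nn_integral_distr) (auto simp: nn_integral_cmult)
  also have "(\<lambda>x. (x0 - r *\<^sub>R x0) + r *\<^sub>R x) = (\<lambda>x. x0 + r *\<^sub>R (x - x0))"
    by (auto simp: algebra_simps)
  finally have "(\<integral>\<^sup>+x. h x \<partial>lborel) = ennreal (r ^ DIM('a)) * (\<integral>\<^sup>+x. h (x0 + r *\<^sub>R (x - x0)) \<partial>lborel)" .
  then have "ennreal (inverse r ^ DIM('a)) * (\<integral>\<^sup>+x. h x \<partial>lborel)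
    = ennreal (inverse r ^ DIM('a) * r ^ DIM('a)) * (\<integral>\<^sup>+x. h (x0 + r *\<^sub>R (x - x0)) \<partial>lborel)"
    using r by (simp add: ennreal_mult mult.assoc)
  also have "inverse r ^ DIM('a) * r ^ DIM('a) = 1" using r by (simp add: power_mult_distrib[symmetric])
  finally show ?thesis by simp
qed

text \<open>
  The integral of \<open>r powr (- n - 1)\<close> over \<open>[1, 2]\<close>: the Jacobian \<open>r powr
  (- n)\<close> of the dilation by \<open>r\<close> times the factor \<open>1 / r\<close> that turns a
  derivative along a ray into the radial derivative \<open>(x - x0) \<bullet> grad f x\<close>.
\<close>
definition ray_const :: "nat \<Rightarrow> ennreal" where
  "ray_const n = (\<integral>\<^sup>+r. ennreal (inverse r ^ Suc n) * indicator {1..2::real} r \<partial>lborel)"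

lemma ray_const_eq: 
  assumes "n > 0" shows "ray_const n = ennreal ((1 - inverse 2 ^ n) / real n)"
proof -
  have "ray_const n = ennreal (- (inverse 2 ^ n) / real n - (- (inverse 1 ^ n) / real n))"
    unfolding ray_const_def
  proof (rule nn_integral_FTC_Icc)
    fix x :: real assume "x \<in> {1..2}"
    then have x: "x \<noteq> 0" "x > 0" by auto
    have "((\<lambda>r. inverse r ^ n) has_real_derivative (real n * (- (inverse x * inverse x)) * inverse x ^ (n - 1))) (at x)"
      using x by (auto intro!: derivative_eq_intros)
    then have "((\<lambda>r. - (inverse r ^ n) / real n) has_real_derivative - (real n * (- (inverse x * inverse x)) * inverse x ^ (n - 1)) / real n) (at x)"
      by (intro DERIV_cdivide DERIV_minus)
    moreover have "- (real n * (- (inverse x * inverse x)) * inverse x ^ (n - 1)) / real n = inverse x ^ Suc n"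
      using assms by (cases n) auto
    ultimately show "((\<lambda>r. - (inverse r ^ n) / real n) has_real_derivative inverse x ^ Suc n) (at x)" by simp
    show "0 \<le> inverse x ^ Suc n" using x by simp
  qed auto
  then show ?thesis by (simp add: diff_divide_distrib)
qed

text \<open>
  Integrating over all base points \<open>x\<close> the integral along the segment of the ray from
  \<open>x\<close> to \<open>x0 + 2 (x - x0)\<close> gives, by dilation, a multiple of the integral over
  the whole space.
\<close>
lemma nn_integral_rays:
  fixes h :: "'a::euclidean_space \<Rightarrow> real"
  assumes [measurable]: "h \<in> borel_measurable borel" and h0: "\<And>x. 0 \<le> h x"
  shows "(\<integral>\<^sup>+x. (\<integral>\<^sup>+r. ennreal (indicator {1..2} r * (h (x0 + r *\<^sub>R (x - x0)) / r)) \<partial>lborel) \<partial>lborel)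
    = ray_const DIM('a) * (\<integral>\<^sup>+x. ennreal (h x) \<partial>lborel)"
proof -
  have "(\<integral>\<^sup>+x. (\<integral>\<^sup>+r. ennreal (indicator {1..2} r * (h (x0 + r *\<^sub>R (x - x0)) / r)) \<partial>lborel) \<partial>lborel)
    = (\<integral>\<^sup>+r. (\<integral>\<^sup>+x. ennreal (indicator {1..2} r * (h (x0 + r *\<^sub>R (x - x0)) / r)) \<partial>lborel) \<partial>lborel)"
    by (rule lborel_pair.Fubini') measurable
  also have "\<dots> = (\<integral>\<^sup>+r. (ennreal (inverse r ^ Suc DIM('a)) * indicator {1..2} r) * (\<integral>\<^sup>+x. ennreal (h x) \<partial>lborel) \<partial>lborel)"
  proof (intro nn_integral_cong)
    fix r :: real
    show "(\<integral>\<^sup>+x. ennreal (indicator {1..2} r * (h (x0 + r *\<^sub>R (x - x0)) / r)) \<partial>lborel)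
      = (ennreal (inverse r ^ Suc DIM('a)) * indicator {1..2} r) * (\<integral>\<^sup>+x. ennreal (h x) \<partial>lborel)"
    proof (cases "r \<in> {1..2}")
      case True
      then have r: "r > 0" by auto
      have "(\<integral>\<^sup>+x. ennreal (indicator {1..2} r * (h (x0 + r *\<^sub>R (x - x0)) / r)) \<partial>lborel)
        = (\<integral>\<^sup>+x. ennreal (inverse r) * ennreal (h (x0 + r *\<^sub>R (x - x0))) \<partial>lborel)"
        using True r h0 by (intro nn_integral_cong) (simp add: ennreal_mult[symmetric] field_simps)
      also have "\<dots> = ennreal (inverse r) * (ennreal (inverse r ^ DIM('a)) * (\<integral>\<^sup>+x. ennreal (h x) \<partial>lborel))"
        using r by (subst nn_integral_cmult, simp, subst nn_integral_dilation[where h="\<lambda>x. ennreal (h x)"]) auto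
      finally show ?thesis using True r by (simp add: ennreal_mult mult.assoc)
    qed simp
  qed
  also have "\<dots> = ray_const DIM('a) * (\<integral>\<^sup>+x. ennreal (h x) \<partial>lborel)"
    unfolding ray_const_def by (subst nn_integral_multc) auto
  finally show ?thesis .
qed

text \<open>
  The form in which essential continuity is used: almost every ray from \<open>x0\<close> meets the
  boundary of the domain only at points where \<open>f\<close> is infinite. The bound \<open>r \<ge>
  1\<close> means that only the part of the ray beyond the base point \<open>x\<close> counts.
\<close>
definition ray_regular :: "('a::euclidean_space \<Rightarrow> ereal) \<Rightarrow> 'a \<Rightarrow> bool" where
  "ray_regular f x0 \<longleftrightarrow> (AE x in lborel. \<forall>r\<ge>1. x0 + r *\<^sub>R (x - x0) \<in> frontier (effective_dom f)
      \<longrightarrow> f (x0 + r *\<^sub>R (x - x0)) = \<infinity>)"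

lemma AE_grad_exists_rays:
  fixes f :: "'a::euclidean_space \<Rightarrow> ereal"
  assumes f: "f \<in> convex_lsc"
  shows "AE x in lborel. AE r in lborel. 1 < r \<longrightarrow> x0 + r *\<^sub>R (x - x0) \<in> interior (effective_dom f)
    \<longrightarrow> grad_exists f (x0 + r *\<^sub>R (x - x0))"
proof -
  define N where "N = interior (effective_dom f) - {x. grad_exists f x}"
  have N[measurable]: "N \<in> sets borel" using sets_grad_exists[OF f] by (simp add: N_def)
  have "AE x in lborel. x \<notin> N" using AE_grad_exists[OF f] by eventually_elim (auto simp: N_def)
  then have N0: "(\<integral>\<^sup>+x. indicator N x \<partial>lborel) = 0"
    by (subst nn_integral_0_iff_AE) (auto simp: indicator_def elim!: eventually_mono)
  have "(\<integral>\<^sup>+x. (\<integral>\<^sup>+r. indicator {1<..} r * indicator N (x0 + r *\<^sub>R (x - x0)) \<partial>lborel) \<partial>lborel)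
    = (\<integral>\<^sup>+r. (\<integral>\<^sup>+x. indicator {1<..} r * indicator N (x0 + r *\<^sub>R (x - x0)) \<partial>lborel) \<partial>(lborel :: real measure))"
    by (rule lborel_pair.Fubini') measurable
  also have "\<dots> = (\<integral>\<^sup>+r. 0 \<partial>(lborel :: real measure))"
  proof (intro nn_integral_cong)
    fix r :: real
    show "(\<integral>\<^sup>+x. indicator {1<..} r * indicator N (x0 + r *\<^sub>R (x - x0)) \<partial>lborel) = (0::ennreal)"
    proof (cases "1 < r")
      case True
      then show ?thesis using N0 by (subst nn_integral_cmult, simp, subst nn_integral_dilation) auto
    qed simp
  qed
  finally have "(\<integral>\<^sup>+x. (\<integral>\<^sup>+r. indicator {1<..} r * indicator N (x0 + r *\<^sub>R (x - x0)) \<partial>(lborel :: real measure)) \<partial>lborel) = 0"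
    by simp
  then have "AE x in lborel. (\<integral>\<^sup>+r. indicator {1<..} r * indicator N (x0 + r *\<^sub>R (x - x0)) \<partial>(lborel :: real measure)) = 0"
    by (subst (asm) nn_integral_0_iff_AE) auto
  then show ?thesis
  proof eventually_elim
    case (elim x)
    then have "AE r in (lborel :: real measure). indicator {1<..} r * indicator N (x0 + r *\<^sub>R (x - x0)) = (0::ennreal)"
      by (subst (asm) nn_integral_0_iff_AE) auto
    then show ?case by eventually_elim (auto simp: N_def indicator_def split: if_splits)
  qed
qed

text \<open>
  The radial derivative is bounded below but not above. Adding the constant \<open>\<mu>\<close> makes
  all terms nonnegative, so that they can be integrated over \<open>x\<close> before integrability is
  known.
\<close>
lemma gibbs_ray_FTC_ennreal:
  fixes f :: "'a::euclidean_space \<Rightarrow> ereal"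
  assumes f: "f \<in> convex_lsc" and x0: "x0 \<in> interior (effective_dom f)"
    and bnd: "\<And>x. gibbs f x \<le> B"
    and \<mu>: "0 \<le> \<mu>" "\<And>x. 0 \<le> (x - x0) \<bullet> grad f x + \<mu>"
    and \<beta>: "1 \<le> \<beta>" "x0 + \<beta> *\<^sub>R w \<in> interior (effective_dom f)"
    and ae: "AE r in lborel. 1 < r \<longrightarrow> x0 + r *\<^sub>R w \<in> interior (effective_dom f) \<longrightarrow> grad_exists f (x0 + r *\<^sub>R w)"
  defines "P \<equiv> \<lambda>x. ((x - x0) \<bullet> grad f x + \<mu>) * gibbs f x"
  shows "ennreal (gibbs f (x0 + w)) + (\<integral>\<^sup>+r. ennreal (indicator {1..\<beta>} r * (\<mu> * gibbs f (x0 + r *\<^sub>R w) / r)) \<partial>lborel)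
    = ennreal (gibbs f (x0 + \<beta> *\<^sub>R w)) + (\<integral>\<^sup>+r. ennreal (indicator {1..\<beta>} r * (P (x0 + r *\<^sub>R w) / r)) \<partial>lborel)"
proof -
  note [measurable] = convex_lsc_measurable[OF f]
  define a where "a r = indicator {1..\<beta>} r * (\<mu> * gibbs f (x0 + r *\<^sub>R w) / r)" for r
  define c where "c r = indicator {1..\<beta>} r * ((w \<bullet> grad f (x0 + r *\<^sub>R w)) * gibbs f (x0 + r *\<^sub>R w))" for r
  have B: "0 \<le> B" using bnd[of x0] gibbs_nonneg[of f x0] by linarith
  have a0: "0 \<le> a r" for r using \<mu> by (auto simp: a_def indicator_def)
  have ai: "integrable lborel a"
  proof (rule Bochner_Integration.integrable_bound)
    show "integrable lborel (\<lambda>r. indicator {1..\<beta>} r * (\<mu> * B))"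
      by (intro integrable_mult_left integrable_real_indicator) (auto simp: emeasure_lborel_Icc_eq)
    show "a \<in> borel_measurable lborel" unfolding a_def[abs_def] by measurable
    show "AE r in lborel. norm (a r) \<le> norm (indicator {1..\<beta>} r * (\<mu> * B))"
    proof (rule AE_I2)
      fix r :: real
      have "\<mu> * gibbs f (x0 + r *\<^sub>R w) / r \<le> \<mu> * B" if "1 \<le> r"
      proof -
        have "\<mu> * gibbs f (x0 + r *\<^sub>R w) \<le> \<mu> * B" using \<mu> bnd by (intro mult_left_mono) auto
        also have "\<dots> \<le> \<mu> * B * r"           using that mult_left_mono[of 1 r "\<mu> * B"] mult_nonneg_nonneg[OF \<mu>(1) B] by simp
        finally show ?thesis using that by (simp add: divide_le_eq)
      qed
      then show "norm (a r) \<le> norm (indicator {1..\<beta>} r * (\<mu> * B))"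
        using \<mu> B by (auto simp: a_def indicator_def)
    qed
  qed
  have P: "indicator {1..\<beta>} r * (P (x0 + r *\<^sub>R w) / r) = c r + a r" for r
    by (auto simp: P_def c_def a_def indicator_def field_simps)
  have P0: "0 \<le> P x" for x using \<mu> by (simp add: P_def)
  note ftc = gibbs_ray_FTC[OF f x0 \<beta> ae, folded c_def]
  have c1: "integrable lborel c" using ftc(1) by (simp add: c_def[abs_def])
  have c2: "(\<integral>r. c r \<partial>lborel) = gibbs f (x0 + w) - gibbs f (x0 + \<beta> *\<^sub>R w)" using ftc(2) by simp
  have "(\<integral>\<^sup>+r. ennreal (indicator {1..\<beta>} r * (P (x0 + r *\<^sub>R w) / r)) \<partial>lborel) = (\<integral>\<^sup>+r. ennreal (c r + a r) \<partial>lborel)"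
    unfolding P ..
  also have "\<dots> = ennreal (\<integral>r. c r + a r \<partial>lborel)"
  proof (rule nn_integral_eq_integral)
    show "integrable lborel (\<lambda>r. c r + a r)" using c1 ai by simp
    have "0 \<le> c r + a r" for r unfolding P[symmetric] using P0 by (auto simp: indicator_def)
    then show "AE r in lborel. 0 \<le> c r + a r" by simp
  qed
  also have "(\<integral>r. c r + a r \<partial>lborel) = (gibbs f (x0 + w) - gibbs f (x0 + \<beta> *\<^sub>R w)) + (\<integral>r. a r \<partial>lborel)"
    using c1 ai c2 by simp
  finally have e1: "(\<integral>\<^sup>+r. ennreal (indicator {1..\<beta>} r * (P (x0 + r *\<^sub>R w) / r)) \<partial>lborel)
    = ennreal ((gibbs f (x0 + w) - gibbs f (x0 + \<beta> *\<^sub>R w)) + (\<integral>r. a r \<partial>lborel))" .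
  have e2: "(\<integral>\<^sup>+r. ennreal (a r) \<partial>lborel) = ennreal (\<integral>r. a r \<partial>lborel)"
    using ai a0 by (intro nn_integral_eq_integral) auto
  have ge: "0 \<le> (\<integral>r. c r + a r \<partial>lborel)"
  proof (rule integral_nonneg_AE)
    have "0 \<le> c r + a r" for r unfolding P[symmetric] using P0 by (auto simp: indicator_def)
    then show "AE r in lborel. 0 \<le> c r + a r" by simp
  qed
  have ge': "0 \<le> (gibbs f (x0 + w) - gibbs f (x0 + \<beta> *\<^sub>R w)) + (\<integral>r. a r \<partial>lborel)"
    using ge c1 ai c2 by simp
  have ia: "0 \<le> (\<integral>r. a r \<partial>lborel)" using a0 by (intro integral_nonneg_AE) auto
  show ?thesis
    unfolding e1 a_def[symmetric] e2 using ge' ia by (simp flip: ennreal_plus)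
qed

text \<open>
  The previous identity up to the parameter \<open>2\<close>, also when the ray leaves the domain
  before. At the exit parameter \<open>b\<close> the potential is infinite by regularity, so
  \<open>e\<^sup>-\<^sup>f\<close> tends to \<open>0\<close> there by lower semicontinuity and no
  boundary term appears in the limit.
\<close>
lemma gibbs_ray_identity:
  fixes f :: "'a::euclidean_space \<Rightarrow> ereal"
  assumes f: "f \<in> convex_lsc" and x0: "x0 \<in> interior (effective_dom f)"
    and bnd: "\<And>x. gibbs f x \<le> B"
    and \<mu>: "0 \<le> \<mu>" "\<And>x. 0 \<le> (x - x0) \<bullet> grad f x + \<mu>"
    and ae: "AE r in lborel. 1 < r \<longrightarrow> x0 + r *\<^sub>R w \<in> interior (effective_dom f) \<longrightarrow> grad_exists f (x0 + r *\<^sub>R w)"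
    and reg: "\<And>r. r \<ge> 1 \<Longrightarrow> x0 + r *\<^sub>R w \<in> frontier (effective_dom f) \<Longrightarrow> f (x0 + r *\<^sub>R w) = \<infinity>"
  defines "P \<equiv> \<lambda>x. ((x - x0) \<bullet> grad f x + \<mu>) * gibbs f x"
  shows "ennreal (gibbs f (x0 + w)) + (\<integral>\<^sup>+r. ennreal (indicator {1..2} r * (\<mu> * gibbs f (x0 + r *\<^sub>R w) / r)) \<partial>lborel)
    = ennreal (gibbs f (x0 + 2 *\<^sub>R w)) + (\<integral>\<^sup>+r. ennreal (indicator {1..2} r * (P (x0 + r *\<^sub>R w) / r)) \<partial>lborel)"
proof (cases "x0 + 2 *\<^sub>R w \<in> interior (effective_dom f)")
  case True
  show ?thesis unfolding P_def
    using gibbs_ray_FTC_ennreal[OF f x0 bnd \<mu> _ True ae] by simp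
next
  case out: False
  let ?U = "interior (effective_dom f)"
  note [measurable] = convex_lsc_measurable[OF f]
  have Pm[measurable]: "P \<in> borel_measurable borel" unfolding P_def by measurable
  have convD: "convex (effective_dom f)" by (rule convex_effective_dom[OF convex_lscD(1)[OF f]])
  define R where "R = {r. 0 \<le> r \<and> x0 + r *\<^sub>R w \<in> ?U}"
  have shrink: "x0 + s *\<^sub>R w \<in> ?U" if "x0 + r *\<^sub>R w \<in> closure (effective_dom f)" "0 \<le> s" "s < r" for r s
  proof -
    have "(x0 + r *\<^sub>R w) - (1 - s / r) *\<^sub>R ((x0 + r *\<^sub>R w) - x0) \<in> ?U"
      using that x0 by (intro mem_interior_closure_convex_shrink[OF convD]) auto
    moreover have "(x0 + r *\<^sub>R w) - (1 - s / r) *\<^sub>R ((x0 + r *\<^sub>R w) - x0) = x0 + s *\<^sub>R w"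
      using that by (simp add: algebra_simps)
    ultimately show ?thesis by metis
  qed
  have R2: "r < 2" if "r \<in> R" for r
  proof (rule ccontr)
    assume "\<not> r < 2"
    then consider "r = 2" | "2 < r" by linarith
    then show False
    proof cases
      case 2
      have "x0 + r *\<^sub>R w \<in> closure (effective_dom f)"
        using that closure_subset interior_subset unfolding R_def by blast
      then show False using shrink[of r 2] 2 out by simp
    qed (use that out in \<open>auto simp: R_def\<close>)
  qed
  have R0: "0 \<in> R" using x0 by (simp add: R_def)
  have Rb: "bdd_above R" using R2 by (intro bdd_aboveI[of _ 2]) (auto intro: less_imp_le)
  define b where "b = Sup R"
  have b: "0 \<le> b" "b \<le> 2"
    using cSup_upper[OF R0 Rb] cSup_least[of R 2] R0 R2 by (auto simp: b_def intro: less_imp_le)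
  have below: "x0 + s *\<^sub>R w \<in> ?U" if s: "0 \<le> s" "s < b" for s
  proof -
    obtain r where "r \<in> R" "s < r" using less_cSup_iff[of R s] R0 Rb s unfolding b_def by blast
    then show ?thesis using shrink[of r s] s closure_subset interior_subset unfolding R_def by blast
  qed
  have above: "x0 + r *\<^sub>R w \<notin> ?U" if "r \<ge> b" for r
  proof
    assume *: "x0 + r *\<^sub>R w \<in> ?U"
    obtain d where d: "d > 0" "\<And>h. \<bar>h\<bar> \<le> d \<Longrightarrow> (x0 + r *\<^sub>R w) + h *\<^sub>R w \<in> ?U"
      using eventually_in_interior_line[OF *] by metis
    have "r + d \<in> R" using d(2)[of d] d(1) that b by (simp add: R_def scaleR_add_left add.assoc)
    then have "r + d \<le> b" using Rb unfolding b_def by (intro cSup_upper)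
    then show False using d that by simp
  qed
  \<comment> \<open>on the ray, the function is infinite from \<open>b\<close> on, as soon as the parameter is at least \<open>1\<close>\<close>
  have inf: "f (x0 + r *\<^sub>R w) = \<infinity>" if "r \<ge> 1" "r \<ge> b" for r
  proof (rule ccontr)
    assume "f (x0 + r *\<^sub>R w) \<noteq> \<infinity>"
    then have d: "x0 + r *\<^sub>R w \<in> effective_dom f" by (simp add: effective_dom_def less_top)
    then have "x0 + r *\<^sub>R w \<in> frontier (effective_dom f)"
      using above[OF that(2)] closure_subset by (auto simp: frontier_def)
    then show False using reg[OF that(1)] d by (simp add: effective_dom_def)
  qed
  have g0: "gibbs f (x0 + r *\<^sub>R w) = 0" if "r \<ge> 1" "r \<ge> b" for r
    using inf[OF that] by (rule gibbs_simps)
  have out0: "gibbs f (x0 + 2 *\<^sub>R w) = 0" using g0[of 2] b by simp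
  show ?thesis
  proof (cases "b \<le> 1")
    case True
    have z: "indicator {1..2} r * (\<mu> * gibbs f (x0 + r *\<^sub>R w) / r) = (0::real)"
      "indicator {1..2} r * (P (x0 + r *\<^sub>R w) / r) = (0::real)" for r
      using g0[of r] True by (auto simp: indicator_def P_def)
    show ?thesis unfolding z out0 using g0[of 1] True by simp
  next
    case False
    \<comment> \<open>approach the exit parameter from inside the domain, starting at \<open>1\<close>\<close>
    define \<beta> where "\<beta> j = b - (b - 1) / real (Suc j)" for j
    have \<beta>: "1 \<le> \<beta> j" "\<beta> j < b" for j
    proof -
      have "(b - 1) / real (Suc j) \<le> (b - 1) / 1" using False by (intro divide_left_mono) auto
      then show "1 \<le> \<beta> j" by (simp add: \<beta>_def)
      show "\<beta> j < b" using False by (simp add: \<beta>_def)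
    qed
    have \<beta>lim: "\<beta> \<longlonglongrightarrow> b"
    proof -
      have "(\<lambda>j. b - (b - 1) * inverse (real (Suc j))) \<longlonglongrightarrow> b - (b - 1) * 0"
        by (intro tendsto_intros LIMSEQ_inverse_real_of_nat)
      then show ?thesis by (simp add: \<beta>_def[abs_def] divide_inverse)
    qed
    have \<beta>mono: "\<beta> i \<le> \<beta> j" if "i \<le> j" for i j
      unfolding \<beta>_def using that False by (intro diff_left_mono divide_left_mono) auto
    have id: "ennreal (gibbs f (x0 + w)) + (\<integral>\<^sup>+r. ennreal (indicator {1..\<beta> j} r * (\<mu> * gibbs f (x0 + r *\<^sub>R w) / r)) \<partial>lborel)
      = ennreal (gibbs f (x0 + \<beta> j *\<^sub>R w)) + (\<integral>\<^sup>+r. ennreal (indicator {1..\<beta> j} r * (P (x0 + r *\<^sub>R w) / r)) \<partial>lborel)" for j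
      unfolding P_def using \<beta>[of j] by (intro gibbs_ray_FTC_ennreal[OF f x0 bnd \<mu> _ _ ae] below) auto
    have lim: "(\<lambda>j. \<integral>\<^sup>+r. ennreal (indicator {1..\<beta> j} r * (h (x0 + r *\<^sub>R w) / r)) \<partial>lborel)
      \<longlonglongrightarrow> (\<integral>\<^sup>+r. ennreal (indicator {1..2} r * (h (x0 + r *\<^sub>R w) / r)) \<partial>lborel)"
      if [measurable]: "h \<in> borel_measurable borel" and h: "\<And>x. 0 \<le> h x" "\<And>r. r \<ge> 1 \<Longrightarrow> r \<ge> b \<Longrightarrow> h (x0 + r *\<^sub>R w) = 0" for h :: "'a \<Rightarrow> real"
    proof (rule nn_integral_LIMSEQ)
      show "incseq (\<lambda>j r. ennreal (indicator {1..\<beta> j} r * (h (x0 + r *\<^sub>R w) / r)))"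
      proof (intro incseq_SucI le_funI ennreal_leI)
        fix j and r :: real
        show "indicator {1..\<beta> j} r * (h (x0 + r *\<^sub>R w) / r) \<le> indicator {1..\<beta> (Suc j)} r * (h (x0 + r *\<^sub>R w) / r)"
          using \<beta>mono[of j "Suc j"] h(1)[of "x0 + r *\<^sub>R w"] by (auto simp: indicator_def)
      qed
      show "(\<lambda>j. ennreal (indicator {1..\<beta> j} r * (h (x0 + r *\<^sub>R w) / r))) \<longlonglongrightarrow> ennreal (indicator {1..2} r * (h (x0 + r *\<^sub>R w) / r))" for r
      proof (rule tendsto_eventually)
        show "\<forall>\<^sub>F j in sequentially. ennreal (indicator {1..\<beta> j} r * (h (x0 + r *\<^sub>R w) / r)) = ennreal (indicator {1..2} r * (h (x0 + r *\<^sub>R w) / r))"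
        proof (cases "r < b")
          case True
          have "\<forall>\<^sub>F j in sequentially. r < \<beta> j" using \<beta>lim True by (rule order_tendstoD)
          then show ?thesis
            by eventually_elim (use True b in \<open>auto simp: indicator_def\<close>)
        next
          case False
          then show ?thesis using h(2)[of r] by (auto simp: indicator_def)
        qed
      qed
    qed measurable
    have limg: "(\<lambda>j. ennreal (gibbs f (x0 + \<beta> j *\<^sub>R w))) \<longlonglongrightarrow> ennreal 0"
    proof (rule tendsto_ennrealI, rule LIMSEQ_I)
      fix e :: real assume "e > 0"
      have "(\<lambda>j. x0 + \<beta> j *\<^sub>R w) \<longlonglongrightarrow> x0 + b *\<^sub>R w" by (intro tendsto_intros \<beta>lim)
      moreover have "ereal (- ln e) < f (x0 + b *\<^sub>R w)" using inf[of b] False by simp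
      ultimately have "\<forall>\<^sub>F j in sequentially. ereal (- ln e) < f (x0 + \<beta> j *\<^sub>R w)"
        using convex_lscD(2)[OF f] unfolding lsc_iff_eventually filterlim_iff by blast
      then have "\<forall>\<^sub>F j in sequentially. norm (gibbs f (x0 + \<beta> j *\<^sub>R w) - 0) < e"
      proof eventually_elim
        case (elim j)
        then show ?case using \<open>e > 0\<close>
        proof (cases "f (x0 + \<beta> j *\<^sub>R w)")
          case (real v)
          then have "exp (- v) < exp (ln e)" using elim by (subst exp_less_cancel_iff) simp
          then show ?thesis using real \<open>e > 0\<close> by (simp add: gibbs_simps)
        qed (auto simp: gibbs_simps)
      qed
      then show "\<exists>no. \<forall>j\<ge>no. norm (gibbs f (x0 + \<beta> j *\<^sub>R w) - 0) < e" by (simp add: eventually_sequentially)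
    qed
    have P0: "0 \<le> P x" for x using \<mu> by (simp add: P_def)
    have "(\<lambda>j. ennreal (gibbs f (x0 + w)) + (\<integral>\<^sup>+r. ennreal (indicator {1..\<beta> j} r * (\<mu> * gibbs f (x0 + r *\<^sub>R w) / r)) \<partial>lborel))
      \<longlonglongrightarrow> ennreal (gibbs f (x0 + w)) + (\<integral>\<^sup>+r. ennreal (indicator {1..2} r * (\<mu> * gibbs f (x0 + r *\<^sub>R w) / r)) \<partial>lborel)"
      using \<mu> g0 by (intro tendsto_add tendsto_const lim[where h="\<lambda>x. \<mu> * gibbs f x"]) auto
    moreover have "(\<lambda>j. ennreal (gibbs f (x0 + \<beta> j *\<^sub>R w)) + (\<integral>\<^sup>+r. ennreal (indicator {1..\<beta> j} r * (P (x0 + r *\<^sub>R w) / r)) \<partial>lborel))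
      \<longlonglongrightarrow> ennreal 0 + (\<integral>\<^sup>+r. ennreal (indicator {1..2} r * (P (x0 + r *\<^sub>R w) / r)) \<partial>lborel)"
      using P0 g0 by (intro tendsto_add limg lim) (auto simp: P_def)
    ultimately show ?thesis unfolding id out0 by (rule LIMSEQ_unique)
  qed
qed

text \<open>
  Integration by parts. Integrating the identity along rays over all base points, dilation invariance
  turns it into a linear equation between \<open>Z(f)\<close> and the integral of the radial derivative,
  in which the factor \<open>1 - 2 powr (- n)\<close> cancels against \<^const>\<open>ray_const\<close>.
\<close>
theorem integral_radial_derivative:
  fixes f :: "'a::euclidean_space \<Rightarrow> ereal"
  assumes f: "f \<in> convex_lsc" and x0: "x0 \<in> interior (effective_dom f)"
    and co: "0 < a" "\<And>x. ereal (a * norm x - b) \<le> f x"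
    and reg: "ray_regular f x0"
  shows "integrable lborel (\<lambda>x. ((x - x0) \<bullet> grad f x) * gibbs f x)"
    "(\<integral>x. ((x - x0) \<bullet> grad f x) * gibbs f x \<partial>lborel) = real DIM('a) * gibbs_mass f"
proof -
  note [measurable] = convex_lsc_measurable[OF f]
  have gi: "integrable lborel (gibbs f)" by (intro integrable_gibbs_coercive[OF _ co]) simp
  have lower: "ereal (- b) \<le> f x" for x
    by (rule order_trans[OF _ co(2)[of x]]) (use co(1) in simp)
  have bnd: "gibbs f x \<le> exp (- (- b))" for x by (intro gibbs_le lower)
  \<comment> \<open>the subgradient inequality at \<open>x0\<close> and \<open>f \<ge> - b\<close> bound the radial derivative below by \<open>- \<mu>\<close>\<close>
  define \<mu> where "\<mu> = max 0 (real_of_ereal (f x0) + b)"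
  have \<mu>: "0 \<le> \<mu>" by (simp add: \<mu>_def)
  have \<mu>2: "0 \<le> (x - x0) \<bullet> grad f x + \<mu>" for x
  proof (cases "grad_exists f x")
    case True
    have x0d: "x0 \<in> effective_dom f" using x0 interior_subset by blast
    have xd: "x \<in> effective_dom f" using True interior_subset unfolding grad_exists_def by blast
    have "real_of_ereal (f x) + (x0 - x) \<bullet> grad f x \<le> real_of_ereal (f x0)"
      using subgradient_grad[OF f True, of x0] effective_dom_real[OF f x0d] by (metis ereal_less_eq(3))
    moreover have "- b \<le> real_of_ereal (f x)"
      using lower[of x] effective_dom_real[OF f xd] by (metis ereal_less_eq(3))
    ultimately show ?thesis by (simp add: \<mu>_def inner_diff_left)
  qed (simp add: grad_not_exists \<mu>)
  define P where "P = (\<lambda>x. ((x - x0) \<bullet> grad f x + \<mu>) * gibbs f x)"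
  have Pm[measurable]: "P \<in> borel_measurable borel" unfolding P_def by measurable
  have P0: "0 \<le> P x" for x using \<mu>2 by (simp add: P_def)
  define Z where "Z = gibbs_mass f"
  have Z0: "0 \<le> Z" by (simp add: Z_def)
  have Zeq: "(\<integral>\<^sup>+x. ennreal (gibbs f x) \<partial>lborel) = ennreal Z"
    unfolding Z_def by (intro nn_integral_eq_integral gi) simp
  define n where "n = DIM('a)"
  have n: "n > 0" by (simp add: n_def)
  define \<kappa> where "\<kappa> = (1 - inverse 2 ^ n) / real n"
  have \<kappa>: "\<kappa> > 0"
  proof -
    have "inverse (2::real) ^ n < 1 ^ n" using n by (intro power_strict_mono) auto
    then show ?thesis using n by (simp add: \<kappa>_def)
  qed
  have rc: "ray_const DIM('a) = ennreal \<kappa>" using ray_const_eq[OF n] by (simp add: \<kappa>_def n_def)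
  have "AE x in lborel. ennreal (gibbs f x) + (\<integral>\<^sup>+r. ennreal (indicator {1..2} r * (\<mu> * gibbs f (x0 + r *\<^sub>R (x - x0)) / r)) \<partial>lborel)
    = ennreal (gibbs f (x0 + 2 *\<^sub>R (x - x0))) + (\<integral>\<^sup>+r. ennreal (indicator {1..2} r * (P (x0 + r *\<^sub>R (x - x0)) / r)) \<partial>lborel)"
    using AE_grad_exists_rays[OF f, of x0] reg[unfolded ray_regular_def]
  proof eventually_elim
    case (elim x)
    then show ?case
      using gibbs_ray_identity[OF f x0 bnd \<mu> \<mu>2, of "x - x0"] unfolding P_def by simp
  qed
  then have both: "(\<integral>\<^sup>+x. ennreal (gibbs f x) + (\<integral>\<^sup>+r. ennreal (indicator {1..2} r * (\<mu> * gibbs f (x0 + r *\<^sub>R (x - x0)) / r)) \<partial>lborel) \<partial>lborel)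
    = (\<integral>\<^sup>+x. ennreal (gibbs f (x0 + 2 *\<^sub>R (x - x0))) + (\<integral>\<^sup>+r. ennreal (indicator {1..2} r * (P (x0 + r *\<^sub>R (x - x0)) / r)) \<partial>lborel) \<partial>lborel)"
    by (rule nn_integral_cong_AE)
  have r1: "(\<integral>\<^sup>+x. (\<integral>\<^sup>+r. ennreal (indicator {1..2} r * (\<mu> * gibbs f (x0 + r *\<^sub>R (x - x0)) / r)) \<partial>lborel) \<partial>lborel)
      = ennreal \<kappa> * (\<integral>\<^sup>+x. ennreal (\<mu> * gibbs f x) \<partial>lborel)"
    unfolding rc[symmetric] using \<mu> by (intro nn_integral_rays) auto
  have r2: "(\<integral>\<^sup>+x. (\<integral>\<^sup>+r. ennreal (indicator {1..2} r * (P (x0 + r *\<^sub>R (x - x0)) / r)) \<partial>lborel) \<partial>lborel)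
      = ennreal \<kappa> * (\<integral>\<^sup>+x. ennreal (P x) \<partial>lborel)"
    unfolding rc[symmetric] using P0 by (intro nn_integral_rays) auto
  have r3: "(\<integral>\<^sup>+x. ennreal (gibbs f (x0 + 2 *\<^sub>R (x - x0))) \<partial>lborel) = ennreal (inverse 2 ^ n) * ennreal Z"
    unfolding Zeq[symmetric] n_def by (rule nn_integral_dilation) auto
  have l1: "(\<integral>\<^sup>+x. ennreal (gibbs f x) + (\<integral>\<^sup>+r. ennreal (indicator {1..2} r * (\<mu> * gibbs f (x0 + r *\<^sub>R (x - x0)) / r)) \<partial>lborel) \<partial>lborel)
      = (\<integral>\<^sup>+x. ennreal (gibbs f x) \<partial>lborel)
        + (\<integral>\<^sup>+x. (\<integral>\<^sup>+r. ennreal (indicator {1..2} r * (\<mu> * gibbs f (x0 + r *\<^sub>R (x - x0)) / r)) \<partial>lborel) \<partial>lborel)"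
    by (rule nn_integral_add) measurable
  have l2: "(\<integral>\<^sup>+x. ennreal (gibbs f (x0 + 2 *\<^sub>R (x - x0))) + (\<integral>\<^sup>+r. ennreal (indicator {1..2} r * (P (x0 + r *\<^sub>R (x - x0)) / r)) \<partial>lborel) \<partial>lborel)
      = (\<integral>\<^sup>+x. ennreal (gibbs f (x0 + 2 *\<^sub>R (x - x0))) \<partial>lborel)
        + (\<integral>\<^sup>+x. (\<integral>\<^sup>+r. ennreal (indicator {1..2} r * (P (x0 + r *\<^sub>R (x - x0)) / r)) \<partial>lborel) \<partial>lborel)"
    by (rule nn_integral_add) measurable
  have "ennreal Z + ennreal \<kappa> * (\<integral>\<^sup>+x. ennreal (\<mu> * gibbs f x) \<partial>lborel)
    = ennreal (inverse 2 ^ n) * ennreal Z + ennreal \<kappa> * (\<integral>\<^sup>+x. ennreal (P x) \<partial>lborel)"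
    using both unfolding l1 l2 r1 r2 r3 Zeq .
  also have "(\<integral>\<^sup>+x. ennreal (\<mu> * gibbs f x) \<partial>lborel) = ennreal (\<mu> * Z)"
    using \<mu> by (simp add: ennreal_mult' nn_integral_cmult Zeq)
  finally have "ennreal Z + ennreal \<kappa> * ennreal (\<mu> * Z) = ennreal (inverse 2 ^ n) * ennreal Z + ennreal \<kappa> * (\<integral>\<^sup>+x. ennreal (P x) \<partial>lborel)" .
  moreover have "ennreal (Z + \<kappa> * (\<mu> * Z)) = ennreal Z + ennreal \<kappa> * ennreal (\<mu> * Z)"
    using \<kappa> Z0 \<mu> by (subst ennreal_plus) (auto simp: ennreal_mult)
  moreover have "ennreal (inverse 2 ^ n * Z) = ennreal (inverse 2 ^ n) * ennreal Z"
    using Z0 by (intro ennreal_mult) auto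
  ultimately have main: "ennreal (Z + \<kappa> * (\<mu> * Z)) = ennreal (inverse 2 ^ n * Z) + ennreal \<kappa> * (\<integral>\<^sup>+x. ennreal (P x) \<partial>lborel)"
    by simp
  have Pfin: "(\<integral>\<^sup>+x. ennreal (P x) \<partial>lborel) < \<infinity>"
  proof (rule ccontr)
    assume "\<not> ?thesis"
    then have "(\<integral>\<^sup>+x. ennreal (P x) \<partial>lborel) = \<top>"
      unfolding infinity_ennreal_def less_top[symmetric] by simp
    then show False using main \<kappa> by (simp add: ennreal_mult_top)
  qed
  have Pint: "integrable lborel P" using Pfin P0 by (intro integrableI_nonneg) auto
  define I where "I = (\<integral>x. P x \<partial>lborel)"
  have I0: "0 \<le> I" using P0 by (simp add: I_def)
  have "(\<integral>\<^sup>+x. ennreal (P x) \<partial>lborel) = ennreal I"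
    unfolding I_def using P0 by (intro nn_integral_eq_integral Pint) auto
  then have "ennreal (Z + \<kappa> * (\<mu> * Z)) = ennreal (inverse 2 ^ n * Z + \<kappa> * I)"
    using main \<kappa> Z0 I0 by (simp flip: ennreal_plus ennreal_mult)
  then have "Z + \<kappa> * (\<mu> * Z) = inverse 2 ^ n * Z + \<kappa> * I"
    using \<kappa> Z0 I0 \<mu> by (subst (asm) ennreal_inj) auto
  then have "\<kappa> * I = \<kappa> * (\<mu> * Z) + (1 - inverse 2 ^ n) * Z" by (simp add: algebra_simps)
  also have "1 - inverse 2 ^ n = \<kappa> * real n" using n by (simp add: \<kappa>_def)
  finally have "\<kappa> * I = \<kappa> * (\<mu> * Z + real n * Z)" by (simp add: algebra_simps)
  then have I: "I = \<mu> * Z + real n * Z" using \<kappa> by simp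
  have eq: "((x - x0) \<bullet> grad f x) * gibbs f x = P x - \<mu> * gibbs f x" for x
    by (simp add: P_def algebra_simps)
  show "integrable lborel (\<lambda>x. ((x - x0) \<bullet> grad f x) * gibbs f x)"
    unfolding eq using Pint gi by simp
  show "(\<integral>x. ((x - x0) \<bullet> grad f x) * gibbs f x \<partial>lborel) = real DIM('a) * gibbs_mass f"
    unfolding eq using Pint gi I by (simp add: I_def Z_def n_def)
qed

section \<open>Null cones\<close>

text \<open>
  Covering sets may be points, but the covering balls of a cone need a positive radius; this enlarges
  the diameters at negligible cost. For \<open>k = 0\<close> both powers are \<open>1\<close>.
\<close>
lemma exists_slightly_larger_power:
  fixes d :: real assumes "0 \<le> d" "d \<le> 1" "0 < e"
  shows "\<exists>d'. d \<le> d' \<and> 0 < d' \<and> d' \<le> 2 \<and> d' ^ k \<le> d ^ k + e"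
proof -
  have "((\<lambda>x. x ^ k) \<longlongrightarrow> d ^ k) (at_right d)" by (intro tendsto_intros)
  then have "\<forall>\<^sub>F x in at_right d. x ^ k < d ^ k + e" using assms by (intro order_tendstoD) auto
  moreover have "\<forall>\<^sub>F x in at_right d. d < x \<and> x < 2"
    using assms by (auto simp: eventually_at_right_field intro!: exI[of _ 2])
  ultimately have "\<forall>\<^sub>F x in at_right d. x ^ k < d ^ k + e \<and> d < x \<and> x < 2" by (rule eventually_conj)
  then obtain x where "x ^ k < d ^ k + e" "d < x" "x < 2"
    using eventually_happens'[OF trivial_limit_at_right_real] by blast
  then show ?thesis using assms by (intro exI[of _ x]) auto
qed

lemma hausdorff_null_cover:
  fixes D :: "'a::metric_space set"
  assumes "hausdorff_measure k D = 0" "0 < (e::real)"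
  obtains U :: "nat \<Rightarrow> 'a set" where "D \<subseteq> (\<Union>i. U i)" "\<And>i. bounded (U i)" "\<And>i. diameter (U i) \<le> 1"
    "(\<Sum>i. hausdorff_weight k (U i)) < ennreal e"
proof -
  let ?C = "\<lambda>\<delta>. {U :: nat \<Rightarrow> 'a set. D \<subseteq> (\<Union>i. U i) \<and> (\<forall>i. bounded (U i) \<and> diameter (U i) \<le> \<delta>)}"
  have "(INF U\<in>?C 1. (\<Sum>i. hausdorff_weight k (U i))) \<le> hausdorff_measure k D"
    unfolding hausdorff_measure_def by (rule SUP_upper) simp
  also have "\<dots> < ennreal e" using assms by simp
  finally obtain U where "U \<in> ?C 1" "(\<Sum>i. hausdorff_weight k (U i)) < ennreal e"
    unfolding INF_less_iff by blast
  then show ?thesis using that by blast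
qed

text \<open>
  The cone over a set of diameter \<open>d\<close> at bounded distance is covered by about \<open>R /
  d\<close> balls of radius \<open>2 d\<close>, placed along a single ray. Their total volume is of
  order \<open>d ^ (n - 1)\<close>, comparable with the weight of the set in the Hausdorff measure.
\<close>
lemma cone_cover:
  fixes D :: "'a::euclidean_space set"
  assumes D: "hausdorff_measure (DIM('a) - 1) D = 0" and R: "0 < R" and e: "0 < (e::real)"
  defines "n \<equiv> DIM('a)"
  defines "A \<equiv> (R + 4) * unit_ball_vol (real n) * 2 ^ n"
  defines "k \<equiv> 2 ^ (n - 1) / unit_ball_vol (real (n - 1))"
  shows "\<exists>B\<in>sets lborel. {x0 + t *\<^sub>R (z - x0) | z t. z \<in> D \<and> dist x0 z \<le> R \<and> 0 \<le> t \<and> t \<le> 1} \<subseteq> B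
     \<and> emeasure lborel B \<le> ennreal (A * (k * e + e))"
proof -
  have n: "n > 0" by (simp add: n_def)
  have A: "A \<ge> 0" using R by (simp add: A_def)
  have ub: "unit_ball_vol (real (n - 1)) > 0" by simp
  have k: "k \<ge> 0" by (simp add: k_def)
  obtain U :: "nat \<Rightarrow> 'a set" where U: "D \<subseteq> (\<Union>i. U i)" "\<And>i. bounded (U i)" "\<And>i. diameter (U i) \<le> 1"
    and w: "(\<Sum>i. hausdorff_weight (n - 1) (U i)) < ennreal e"
    using hausdorff_null_cover[OF D e] unfolding n_def by metis
  define d where "d i = diameter (U i)" for i
  have d: "0 \<le> d i" "d i \<le> 1" for i using U diameter_ge_0 by (auto simp: d_def)
  have "\<exists>d'. d i \<le> d' \<and> 0 < d' \<and> d' \<le> 2 \<and> d' ^ (n - 1) \<le> d i ^ (n - 1) + e * (1/2) ^ Suc i" for i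
    using d e by (intro exists_slightly_larger_power) auto
  then obtain d' where d': "\<And>i. d i \<le> d' i" "\<And>i. 0 < d' i" "\<And>i. d' i \<le> 2"
    "\<And>i. d' i ^ (n - 1) \<le> d i ^ (n - 1) + e * (1/2) ^ Suc i" by metis
  define z where "z i = (SOME z. z \<in> U i)" for i
  \<comment> \<open>steps of length at most \<open>d' i\<close> along a ray of length \<open>R\<close>\<close>
  define N where "N i = nat \<lceil>R / d' i\<rceil>" for i
  have N: "real (N i) \<ge> R / d' i" "real (N i) \<le> R / d' i + 1" "N i > 0" for i
  proof -
    have p: "R / d' i > 0" using R d' by simp
    then show "real (N i) \<ge> R / d' i" unfolding N_def by linarith
    then show "N i > 0" using p by (metis gr0I not_le of_nat_0)
    show "real (N i) \<le> R / d' i + 1" unfolding N_def using p by linarith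
  qed
  define B where "B i = (if U i = {} then {} else (\<Union>j\<le>N i. cball (x0 + (real j / real (N i)) *\<^sub>R (z i - x0)) (2 * d' i)))" for i
  have Bs[measurable]: "B i \<in> sets lborel" for i by (simp add: B_def)
  have cover: "{x0 + t *\<^sub>R (y - x0) | y t. y \<in> D \<and> dist x0 y \<le> R \<and> 0 \<le> t \<and> t \<le> 1} \<subseteq> (\<Union>i. B i)"
  proof clarify
    fix y t assume y: "y \<in> D" "dist x0 y \<le> R" and t: "0 \<le> t" "t \<le> (1::real)"
    obtain i where i: "y \<in> U i" using U y by blast
    then have zi: "z i \<in> U i" unfolding z_def by (rule someI)
    define j where "j = nat \<lfloor>t * real (N i)\<rfloor>"
    have tN: "0 \<le> t * real (N i)" "t * real (N i) \<le> real (N i)" using t by (auto simp: mult_left_le_one_le)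
    then have j1: "real j \<le> t * real (N i)" "t * real (N i) \<le> real j + 1" unfolding j_def by linarith+
    have j: "j \<le> N i" using j1 tN by linarith
    have "real (N i) > 0" using N by simp
    then have "real j / real (N i) \<le> t" "t \<le> (real j + 1) / real (N i)"
      using j1 by (auto simp: pos_le_divide_eq pos_divide_le_eq)
    then have j2: "real j / real (N i) \<le> t" "t - real j / real (N i) \<le> 1 / real (N i)"
      by (auto simp: add_divide_distrib)
    have "1 / real (N i) \<le> 1 / (R / d' i)" using N[of i] R d' by (intro divide_left_mono) auto
    then have j3: "t - real j / real (N i) \<le> d' i / R" using j2 by simp
    have jN: "0 \<le> real j / real (N i)" "real j / real (N i) \<le> 1" using j N[of i] by auto
    have "norm (y - z i) \<le> d' i"
      using diameter_bounded_bound[OF U(2)[of i] i zi] d'(1)[of i] by (simp add: d_def dist_norm)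
    then have a1: "norm ((real j / real (N i)) *\<^sub>R (y - z i)) \<le> 1 * d' i"
      using jN unfolding norm_scaleR by (intro mult_mono) auto
    have a2: "norm ((t - real j / real (N i)) *\<^sub>R (y - x0)) \<le> (d' i / R) * R"
      unfolding norm_scaleR using j2 j3 y R d'(2)[of i]
      by (intro mult_mono) (auto simp: dist_norm norm_minus_commute less_imp_le)
    have "(x0 + t *\<^sub>R (y - x0)) - (x0 + (real j / real (N i)) *\<^sub>R (z i - x0))
       = (t - real j / real (N i)) *\<^sub>R (y - x0) + (real j / real (N i)) *\<^sub>R (y - z i)"
      by (simp add: algebra_simps)
    then have "norm ((x0 + t *\<^sub>R (y - x0)) - (x0 + (real j / real (N i)) *\<^sub>R (z i - x0))) \<le> 2 * d' i"
      using norm_triangle_le[of "(t - real j / real (N i)) *\<^sub>R (y - x0)" "(real j / real (N i)) *\<^sub>R (y - z i)" "2 * d' i"] a1 a2 R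
      by simp
    then have "x0 + t *\<^sub>R (y - x0) \<in> cball (x0 + (real j / real (N i)) *\<^sub>R (z i - x0)) (2 * d' i)"
      by (simp add: dist_norm norm_minus_commute)
    then have "x0 + t *\<^sub>R (y - x0) \<in> B i" using i j by (auto simp: B_def)
    then show "x0 + t *\<^sub>R (y - x0) \<in> (\<Union>i. B i)" by blast
  qed
  have Bm: "emeasure lborel (B i) \<le> ennreal A * (ennreal k * hausdorff_weight (n - 1) (U i) + ennreal (e * (1/2) ^ Suc i))" for i
  proof (cases "U i = {}")
    case False
    have "emeasure lborel (B i) \<le> (\<Sum>j\<le>N i. emeasure lborel (cball (x0 + (real j / real (N i)) *\<^sub>R (z i - x0)) (2 * d' i)))"
      using False unfolding B_def by (simp, intro emeasure_subadditive_finite) auto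
    also have "\<dots> = ennreal ((real (N i) + 1) * (unit_ball_vol (real n) * (2 * d' i) ^ n))"
      using d'(2)[of i]
      by (simp add: emeasure_cball n_def less_imp_le ennreal_of_nat_eq_real_of_nat ennreal_mult distrib_right add.commute)
    also have "(real (N i) + 1) * (unit_ball_vol (real n) * (2 * d' i) ^ n)
        \<le> ((R + 4) / d' i) * (unit_ball_vol (real n) * (2 * d' i) ^ n)"
    proof (rule mult_right_mono)
      have "2 \<le> 4 / d' i" using d'[of i] by (simp add: le_divide_eq)
      then show "real (N i) + 1 \<le> (R + 4) / d' i" using N(2)[of i] by (simp add: add_divide_distrib)
    qed (use d'(2)[of i] in simp)
    also have "\<dots> = A * d' i ^ (n - 1)"
      using d'(2)[of i] n by (cases n) (auto simp: A_def power_mult_distrib)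
    also have "\<dots> \<le> A * (d i ^ (n - 1) + e * (1/2) ^ Suc i)" using A d' by (intro mult_left_mono) auto
    also have "d i ^ (n - 1) = k * (unit_ball_vol (real (n - 1)) * (d i / 2) ^ (n - 1))"
      using less_imp_neq[OF ub] by (simp add: k_def power_divide del: One_nat_def)
    finally have "emeasure lborel (B i) \<le> ennreal (A * (k * (unit_ball_vol (real (n - 1)) * (d i / 2) ^ (n - 1)) + e * (1/2) ^ Suc i))"
      by (simp add: ennreal_leI)
    also have "\<dots> = ennreal A * (ennreal k * hausdorff_weight (n - 1) (U i) + ennreal (e * (1/2) ^ Suc i))"
    proof -
      have "hausdorff_weight (n - 1) (U i) = ennreal (unit_ball_vol (real (n - 1)) * (d i / 2) ^ (n - 1))"
        using False by (simp add: hausdorff_weight_def d_def)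
      then show ?thesis using A k e d[of i]
        by (simp add: ennreal_mult ennreal_plus del: power_Suc)
    qed
    finally show ?thesis .
  qed (simp add: B_def)
  have "emeasure lborel (\<Union>i. B i) \<le> (\<Sum>i. emeasure lborel (B i))"
    by (rule emeasure_subadditive_countably) (use Bs in blast)
  also have "\<dots> \<le> (\<Sum>i. ennreal A * (ennreal k * hausdorff_weight (n - 1) (U i) + ennreal (e * (1/2) ^ Suc i)))"
    by (intro suminf_le Bm) auto
  also have "\<dots> = ennreal A * (ennreal k * (\<Sum>i. hausdorff_weight (n - 1) (U i)) + (\<Sum>i. ennreal (e * (1/2) ^ Suc i)))"
    by (simp add: ennreal_suminf_cmult suminf_add[symmetric] del: power_Suc)
  also have "(\<Sum>i. ennreal (e * (1/2) ^ Suc i)) = ennreal (e * 1)"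
  proof -
    have "(\<lambda>i. e * (1/2) ^ Suc i) sums (e * 1)" by (intro sums_mult power_half_series)
    then show ?thesis using e by (intro suminf_ennreal_eq) auto
  qed
  also have "ennreal A * (ennreal k * (\<Sum>i. hausdorff_weight (n - 1) (U i)) + ennreal (e * 1))
     \<le> ennreal A * (ennreal k * ennreal e + ennreal (e * 1))"
    using w by (intro mult_left_mono add_mono) auto
  also have "\<dots> = ennreal (A * (k * e + e))"
    using A k e by (simp add: ennreal_mult ennreal_plus)
  finally show ?thesis using cover Bs by (intro bexI[of _ "\<Union>i. B i"]) auto
qed

lemma AE_not_in_cone:
  fixes D :: "'a::euclidean_space set"
  assumes D: "hausdorff_measure (DIM('a) - 1) D = 0"
  shows "AE x in lborel. \<forall>z\<in>D. \<forall>t. 0 \<le> t \<longrightarrow> t \<le> 1 \<longrightarrow> x \<noteq> x0 + t *\<^sub>R (z - x0)"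
proof -
  define C where "C R = {x0 + t *\<^sub>R (z - x0) | z t. z \<in> D \<and> dist x0 z \<le> R \<and> 0 \<le> t \<and> t \<le> 1}" for R
  have "AE x in lborel. x \<notin> C R" if R: "0 < R" for R
  proof -
    obtain K where K: "\<And>e. e > 0 \<Longrightarrow> \<exists>B\<in>sets lborel. C R \<subseteq> B \<and> emeasure lborel B \<le> ennreal (K * e)"
    proof -
      let ?K = "(R + 4) * unit_ball_vol (real DIM('a)) * 2 ^ DIM('a) * (2 ^ (DIM('a) - 1) / unit_ball_vol (real (DIM('a) - 1)) + 1)"
      have "\<exists>B\<in>sets lborel. C R \<subseteq> B \<and> emeasure lborel B \<le> ennreal (?K * e)" if "e > 0" for e
        using cone_cover[OF D R that, of x0] unfolding C_def by (simp add: algebra_simps)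
      then show ?thesis using that by blast
    qed
    have "\<forall>j::nat. \<exists>B\<in>sets lborel. C R \<subseteq> B \<and> emeasure lborel B \<le> ennreal (K * (1 / real (Suc j)))"
      by (intro allI K) simp
    then obtain B where B: "\<And>j. B j \<in> sets lborel" "\<And>j. C R \<subseteq> B j"
      "\<And>j::nat. emeasure lborel (B j) \<le> ennreal (K * (1 / real (Suc j)))" by metis
    have "emeasure lborel (\<Inter>j. B j) \<le> 0"
    proof (rule LIMSEQ_le_const)
      have "(\<lambda>j. K * inverse (real (Suc j))) \<longlonglongrightarrow> K * 0" by (intro tendsto_intros LIMSEQ_inverse_real_of_nat)
      then show "(\<lambda>j. ennreal (K * (1 / real (Suc j)))) \<longlonglongrightarrow> 0"
        using tendsto_ennrealI by (fastforce simp: inverse_eq_divide)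
      have "emeasure lborel (\<Inter>j. B j) \<le> emeasure lborel (B j)" for j
        by (intro emeasure_mono B) auto
      then show "\<exists>N. \<forall>j\<ge>N. emeasure lborel (\<Inter>j. B j) \<le> ennreal (K * (1 / real (Suc j)))"
        using B(3) order_trans by blast
    qed
    then have "(\<Inter>j. B j) \<in> null_sets lborel" using B(1) by (auto simp: null_sets_def intro: sets.countable_INT')
    then show ?thesis
      by (rule AE_I'[of "\<Inter>j. B j"]) (use B(2) in auto)
  qed
  then have "AE x in lborel. \<forall>j::nat. x \<notin> C (real (Suc j))" by (subst AE_all_countable) simp
  then show ?thesis
  proof eventually_elim
    case (elim x)
    show ?case
    proof (intro ballI allI impI notI)
      fix z t assume *: "z \<in> D" "0 \<le> t" "t \<le> 1" "x = x0 + t *\<^sub>R (z - x0)"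
      obtain j :: nat where "dist x0 z \<le> real j" using real_arch_simple by blast
      then have "dist x0 z \<le> real (Suc j)" by simp
      then have "x \<in> C (real (Suc j))" using * unfolding C_def by blast
      then show False using elim by blast
    qed
  qed
qed

lemma hausdorff_measure_mono:
  assumes "A \<subseteq> B" shows "hausdorff_measure k A \<le> hausdorff_measure k B"
  unfolding hausdorff_measure_def
  by (intro SUP_mono' INF_superset_mono) (use assms in auto)

text \<open>
  Near a boundary point of the domain the function takes the value \<open>\<infinity>\<close>.
\<close>
lemma frontier_dom_not_isCont:
  assumes "x \<in> frontier (effective_dom f)" "f x \<noteq> \<infinity>"
  shows "\<not> isCont f x"
proof
  assume "isCont f x"
  then have "(f \<longlongrightarrow> f x) (nhds x)" by (simp add: continuous_within tendsto_at_iff_tendsto_nhds)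
  then have "\<forall>\<^sub>F y in nhds x. f y < \<infinity>" using assms(2) by (intro order_tendstoD) (auto simp: less_top)
  then obtain S where "open S" "x \<in> S" "\<forall>y\<in>S. f y < \<infinity>" by (auto simp: eventually_nhds)
  then have "x \<in> interior (effective_dom f)" by (intro interiorI[of S]) (auto simp: effective_dom_def)
  then show False using assms(1) by (simp add: frontier_def)
qed

lemma essentially_continuous_imp_ray_regular:
  fixes V :: "real^'n \<Rightarrow> ereal"
  assumes "essentially_continuous V"
  shows "ray_regular V x0"
proof -
  define D where "D = {x \<in> frontier (effective_dom V). V x \<noteq> \<infinity>}"
  have "hausdorff_measure (CARD('n) - 1) D \<le> hausdorff_measure (CARD('n) - 1) {x. \<not> isCont V x}"
    using frontier_dom_not_isCont[of _ V] by (intro hausdorff_measure_mono) (auto simp: D_def)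
  then have "hausdorff_measure (DIM(real^'n) - 1) D = 0"
    using assms by (simp add: essentially_continuous_def)
  from AE_not_in_cone[OF this, of x0] show ?thesis
    unfolding ray_regular_def
  proof eventually_elim
    case (elim x)
    show ?case
    proof (intro allI impI, rule ccontr)
      fix r :: real assume r: "1 \<le> r" "x0 + r *\<^sub>R (x - x0) \<in> frontier (effective_dom V)" "V (x0 + r *\<^sub>R (x - x0)) \<noteq> \<infinity>"
      then have "x0 + r *\<^sub>R (x - x0) \<in> D" by (simp add: D_def)
      moreover have "x = x0 + (1 / r) *\<^sub>R ((x0 + r *\<^sub>R (x - x0)) - x0)" using r by simp
      moreover have "0 \<le> 1 / r" "1 / r \<le> 1" using r by auto
      ultimately show False using elim by blast
    qed
  qed
qed

lemma finite_imp_ray_regular: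
  assumes "\<And>x. V x \<noteq> \<infinity>" shows "ray_regular V x0"
proof -
  have "effective_dom V = UNIV" using assms by (auto simp: effective_dom_def less_top)
  then show ?thesis by (simp add: ray_regular_def)
qed

section \<open>First moments\<close>

text \<open>
  Evaluate the subgradient inequality at the point of the ball around \<open>x0\<close> in the direction
  of the gradient. The full gradient is thereby controlled by the radial derivative alone.
\<close>
lemma norm_grad_bound:
  fixes f :: "'a::euclidean_space \<Rightarrow> ereal"
  assumes f: "f \<in> convex_lsc" and r: "0 < r" "\<And>x. x \<in> cball x0 r \<Longrightarrow> f x \<le> ereal m"
    and low: "\<And>x. ereal (- b) \<le> f x"
  shows "r * norm (grad f x) \<le> (x - x0) \<bullet> grad f x + m + b"
proof (cases "grad_exists f x")
  case True
  define y where "y = grad f x"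
  define u where "u = (r / norm y) *\<^sub>R y"
  have "norm u \<le> r" using r by (simp add: u_def)
  then have fu: "f (x0 + u) \<le> ereal m" by (intro r) (simp add: dist_norm)
  have xd: "x \<in> effective_dom f" using True interior_subset unfolding grad_exists_def by blast
  have "ereal (real_of_ereal (f x) + ((x0 + u) - x) \<bullet> y) \<le> ereal m"
    using order_trans[OF subgradient_grad[OF f True, of "x0 + u"] fu] by (simp add: y_def)
  moreover have "u \<bullet> y = r * norm y" by (simp add: u_def dot_square_norm power2_eq_square)
  moreover have "- b \<le> real_of_ereal (f x)"
    using low[of x] effective_dom_real[OF f xd] by (metis ereal_less_eq(3))
  ultimately show ?thesis by (simp add: y_def[symmetric] inner_diff_left inner_add_left)
next
  case False
  have "ereal (- b) \<le> ereal m" using order_trans[OF low[of x0] r(2)[of x0]] r(1) by simp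
  then show ?thesis using False by (simp add: grad_not_exists)
qed

lemma coercive_lower:
  assumes "0 < a" "\<And>x. ereal (a * norm x - b) \<le> f x" shows "ereal (- b) \<le> f x"
  by (rule order_trans[OF _ assms(2)[of x]]) (use assms(1) in simp)

lemma integrable_norm_grad:
  fixes f :: "'a::euclidean_space \<Rightarrow> ereal"
  assumes f: "f \<in> convex_lsc" and x0: "x0 \<in> interior (effective_dom f)"
    and co: "0 < a" "\<And>x. ereal (a * norm x - b) \<le> f x" and reg: "ray_regular f x0"
  shows "integrable lborel (\<lambda>x. norm (grad f x) * gibbs f x)"
proof -
  note [measurable] = convex_lsc_measurable[OF f]
  obtain r m where r: "0 < r" "\<And>x. x \<in> cball x0 r \<Longrightarrow> f x \<le> ereal m"
    using convex_lsc_bounded_near[OF f x0] by metis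
  show ?thesis
  proof (rule Bochner_Integration.integrable_bound)
    show "integrable lborel (\<lambda>x. ((x - x0) \<bullet> grad f x * gibbs f x + (m + b) * gibbs f x) / r)"
      using integral_radial_derivative(1)[OF f x0 co reg] integrable_gibbs_coercive[OF _ co] by simp
    show "AE x in lborel. norm (norm (grad f x) * gibbs f x) \<le> norm (((x - x0) \<bullet> grad f x * gibbs f x + (m + b) * gibbs f x) / r)"
    proof (rule AE_I2)
      fix x
      have "r * norm (grad f x) \<le> (x - x0) \<bullet> grad f x + m + b"
        by (rule norm_grad_bound[OF f r coercive_lower[of a b f]]) (use co in auto)
      then have "(r * norm (grad f x)) * gibbs f x \<le> ((x - x0) \<bullet> grad f x + m + b) * gibbs f x"
        by (rule mult_right_mono) simp
      then have "norm (grad f x) * gibbs f x \<le> ((x - x0) \<bullet> grad f x * gibbs f x + (m + b) * gibbs f x) / r"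
        using r(1) by (simp add: le_divide_eq algebra_simps)
      moreover have "0 \<le> norm (grad f x) * gibbs f x" by simp
      ultimately show "norm (norm (grad f x) * gibbs f x) \<le> norm (((x - x0) \<bullet> grad f x * gibbs f x + (m + b) * gibbs f x) / r)"
        unfolding real_norm_def by linarith
    qed
  qed measurable
qed

lemma integrable_inner_grad:
  fixes f :: "'a::euclidean_space \<Rightarrow> ereal"
  assumes f: "f \<in> convex_lsc" and i: "integrable lborel (\<lambda>x. norm (grad f x) * gibbs f x)"
  shows "integrable lborel (\<lambda>x. (w \<bullet> grad f x) * gibbs f x)"
proof (rule Bochner_Integration.integrable_bound[OF integrable_mult_right[OF i, of "norm w"]])
  note [measurable] = convex_lsc_measurable[OF f]
  show "(\<lambda>x. (w \<bullet> grad f x) * gibbs f x) \<in> borel_measurable lborel" by measurable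
  show "AE x in lborel. norm ((w \<bullet> grad f x) * gibbs f x) \<le> norm (norm w * (norm (grad f x) * gibbs f x))"
    using Cauchy_Schwarz_ineq2[of w] by (intro AE_I2) (auto simp: abs_mult mult.assoc[symmetric] intro!: mult_right_mono)
qed

text \<open>
  The integral of the radial derivative does not depend on the centre \<open>x0\<close>, which may vary
  in an open set; hence the gradient has mean zero.
\<close>
theorem gibbs_moments:
  fixes f :: "'a::euclidean_space \<Rightarrow> ereal"
  assumes f: "f \<in> convex_lsc" and x0: "x0 \<in> interior (effective_dom f)"
    and co: "0 < a" "\<And>x. ereal (a * norm x - b) \<le> f x"
    and reg: "\<And>x0. ray_regular f x0"
  shows "(\<integral>x. (w \<bullet> grad f x) * gibbs f x \<partial>lborel) = 0"
    "integrable lborel (\<lambda>x. (x \<bullet> grad f x) * gibbs f x)"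
    "(\<integral>x. (x \<bullet> grad f x) * gibbs f x \<partial>lborel) = real DIM('a) * gibbs_mass f"
proof -
  note rad = integral_radial_derivative[OF f _ co reg]
  note ing = integrable_inner_grad[OF f integrable_norm_grad[OF f x0 co reg]]
  have zero: "(\<integral>x. (w \<bullet> grad f x) * gibbs f x \<partial>lborel) = 0" for w
  proof -
    obtain d where d: "d > 0" "\<And>h. \<bar>h\<bar> \<le> d \<Longrightarrow> x0 + h *\<^sub>R w \<in> interior (effective_dom f)"
      using eventually_in_interior_line[OF x0] by metis
    have x1: "x0 + d *\<^sub>R w \<in> interior (effective_dom f)" using d by simp
    have "(\<integral>x. ((x - x0) \<bullet> grad f x) * gibbs f x - ((x - (x0 + d *\<^sub>R w)) \<bullet> grad f x) * gibbs f x \<partial>lborel) = 0"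
      using rad[OF x0] rad[OF x1] by (subst Bochner_Integration.integral_diff) auto
    also have "(\<lambda>x. ((x - x0) \<bullet> grad f x) * gibbs f x - ((x - (x0 + d *\<^sub>R w)) \<bullet> grad f x) * gibbs f x)
      = (\<lambda>x. d * ((w \<bullet> grad f x) * gibbs f x))"
      by (auto simp: inner_diff_left inner_add_left algebra_simps)
    finally show ?thesis using d by simp
  qed
  show "(\<integral>x. (w \<bullet> grad f x) * gibbs f x \<partial>lborel) = 0" by (rule zero)
  have eq: "(x \<bullet> grad f x) * gibbs f x = ((x - x0) \<bullet> grad f x) * gibbs f x + (x0 \<bullet> grad f x) * gibbs f x" for x
    by (simp add: inner_diff_left algebra_simps)
  show "integrable lborel (\<lambda>x. (x \<bullet> grad f x) * gibbs f x)"
    unfolding eq using rad(1)[OF x0] ing by simp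
  show "(\<integral>x. (x \<bullet> grad f x) * gibbs f x \<partial>lborel) = real DIM('a) * gibbs_mass f"
    unfolding eq using rad[OF x0] ing zero by simp
qed

lemma abs_mult_exp_minus_le:
  fixes u b :: real assumes "- b \<le> u"
  shows "\<bar>u\<bar> * exp (- u) \<le> (2 + \<bar>b\<bar> * exp \<bar>b\<bar>) * exp (- u / 2)"
proof (cases "0 \<le> u")
  case True
  have "u / 2 \<le> exp (u / 2)" using exp_ge_add_one_self[of "u / 2"] by linarith
  then have "u * exp (- u) \<le> 2 * exp (u / 2) * exp (- u)" by (intro mult_right_mono) auto
  also have "\<dots> = 2 * exp (- u / 2)" by (simp flip: exp_add)
  also have "\<dots> \<le> (2 + \<bar>b\<bar> * exp \<bar>b\<bar>) * exp (- u / 2)" by (intro mult_right_mono) auto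
  finally show ?thesis using True by simp
next
  case False
  then have "\<bar>u\<bar> * exp (- u) \<le> \<bar>b\<bar> * exp \<bar>b\<bar>" using assms by (intro mult_mono) auto
  also have "\<dots> \<le> (2 + \<bar>b\<bar> * exp \<bar>b\<bar>) * 1" by simp
  also have "\<dots> \<le> (2 + \<bar>b\<bar> * exp \<bar>b\<bar>) * exp (- u / 2)"
    using False by (intro mult_left_mono) (auto intro: add_nonneg_nonneg)
  finally show ?thesis .
qed

lemma integrable_real_gibbs:
  fixes f :: "'a::euclidean_space \<Rightarrow> ereal"
  assumes f: "f \<in> convex_lsc" and co: "0 < a" "\<And>x. ereal (a * norm x - b) \<le> f x"
  shows "integrable lborel (\<lambda>x. real_of_ereal (f x) * gibbs f x)"
proof (rule Bochner_Integration.integrable_bound)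
  note [measurable] = convex_lsc_measurable[OF f]
  let ?C = "(2 + \<bar>b\<bar> * exp \<bar>b\<bar>) * exp (b / 2)"
  show "integrable lborel (\<lambda>x::'a. ?C * exp (- (a / 2) * norm x))"
    by (intro integrable_mult_right integrable_exp_norm) (use co(1) in simp)
  show "(\<lambda>x. real_of_ereal (f x) * gibbs f x) \<in> borel_measurable lborel" by measurable
  show "AE x in lborel. norm (real_of_ereal (f x) * gibbs f x) \<le> norm (?C * exp (- (a / 2) * norm x))"
  proof (rule AE_I2)
    fix x
    show "norm (real_of_ereal (f x) * gibbs f x) \<le> norm (?C * exp (- (a / 2) * norm x))"
    proof (cases "f x")
      case (real u)
      have u: "a * norm x - b \<le> u" using co(2)[of x] real by simp
      have "0 \<le> a * norm x" using co by simp
      then have "- b \<le> u" using u by linarith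
      then have "\<bar>u\<bar> * exp (- u) \<le> (2 + \<bar>b\<bar> * exp \<bar>b\<bar>) * exp (- u / 2)" by (rule abs_mult_exp_minus_le)
      also have "\<dots> \<le> (2 + \<bar>b\<bar> * exp \<bar>b\<bar>) * exp (b / 2 - (a / 2) * norm x)"
        using u by (intro mult_left_mono) (auto intro: add_nonneg_nonneg simp: field_simps)
      also have "\<dots> = ?C * exp (- (a / 2) * norm x)" by (simp add: mult.assoc flip: exp_add)
      finally show ?thesis using real by (simp add: gibbs_simps abs_mult)
    qed (auto simp: gibbs_simps convex_lscD(3)[OF f])
  qed
qed

section \<open>The Prekopa--Leindler inequality\<close>

text \<open>
  Cut \<open>A\<close> just below its supremum and \<open>B\<close> just above its infimum. The
  translates \<open>A + b\<close> and \<open>a + B\<close> of the remaining parts lie in \<open>A +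
  B\<close> and overlap in one point only.
\<close>
lemma brunn_minkowski_real:
  fixes A B C :: "real set"
  assumes [measurable]: "A \<in> sets borel" "B \<in> sets borel" "C \<in> sets borel"
    and ne: "A \<noteq> {}" "B \<noteq> {}" and bd: "bounded A" "bounded B"
    and sum: "\<And>a b. a \<in> A \<Longrightarrow> b \<in> B \<Longrightarrow> a + b \<in> C"
  shows "emeasure lborel A + emeasure lborel B \<le> emeasure lborel C"
proof (rule ennreal_le_epsilon)
  fix e :: real assume e: "0 < e"
  define d where "d = e / 2"
  have d: "0 < d" using e by (simp add: d_def)
  have bA: "bdd_above A" and bB: "bdd_below B" using bd bounded_imp_bdd_above bounded_imp_bdd_below by auto
  obtain a where a: "a \<in> A" "Sup A - d < a" using less_cSup_iff[OF ne(1) bA, of "Sup A - d"] d by auto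
  obtain b where b: "b \<in> B" "b < Inf B + d" using cInf_less_iff[OF ne(2) bB, of "Inf B + d"] d by auto
  define A1 where "A1 = A \<inter> {..a}"
  define B1 where "B1 = B \<inter> {b..}"
  have [measurable]: "A1 \<in> sets borel" "B1 \<in> sets borel" by (auto simp: A1_def B1_def)
  have "A \<subseteq> A1 \<union> {a..a + d}"
    using a cSup_upper[OF _ bA] by (force simp: A1_def)
  then have "emeasure lborel A \<le> emeasure lborel (A1 \<union> {a..a + d})" by (intro emeasure_mono) auto
  also have "\<dots> \<le> emeasure lborel A1 + emeasure lborel {a..a + d}" by (intro emeasure_subadditive) auto
  finally have eA: "emeasure lborel A \<le> emeasure lborel A1 + ennreal d" using d by simp
  have "B \<subseteq> B1 \<union> {b - d..b}"
    using b cInf_lower[OF _ bB] by (force simp: B1_def)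
  then have "emeasure lborel B \<le> emeasure lborel (B1 \<union> {b - d..b})" by (intro emeasure_mono) auto
  also have "\<dots> \<le> emeasure lborel B1 + emeasure lborel {b - d..b}" by (intro emeasure_subadditive) auto
  finally have eB: "emeasure lborel B \<le> emeasure lborel B1 + ennreal d" using d by simp
  \<comment> \<open>translates of \<open>A1\<close> and \<open>B1\<close> that meet at most in \<open>a + b\<close>\<close>
  define A2 where "A2 = (\<lambda>x. x - b) -` A1"
  define B2 where "B2 = (\<lambda>x. x - a) -` B1"
  have [measurable]: "A2 \<in> sets borel" "B2 \<in> sets borel"
    unfolding A2_def B2_def by (rule measurable_sets_borel[of _ borel]; simp)+
  have trans: "emeasure lborel ((\<lambda>x. x - c) -` S) = emeasure lborel S" if [measurable]: "S \<in> sets borel" for S and c :: real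
  proof -
    have "emeasure lborel S = emeasure (distr lborel borel ((+) (- c))) S" by (simp add: lborel_distr_plus)
    also have "\<dots> = emeasure lborel ((\<lambda>x. x - c) -` S)" by (subst emeasure_distr) (auto simp: vimage_def)
    finally show ?thesis by simp
  qed
  have "emeasure lborel A1 + emeasure lborel B1 = emeasure lborel A2 + emeasure lborel (B2 - {a + b})"
  proof -
    have "emeasure lborel (B2 - {a + b}) = emeasure lborel B2"
      by (rule emeasure_Diff_null_set) auto
    then show ?thesis by (simp add: A2_def B2_def trans)
  qed
  also have "\<dots> = emeasure lborel (A2 \<union> (B2 - {a + b}))"
    by (rule plus_emeasure) (auto simp: A2_def B2_def A1_def B1_def)
  also have "\<dots> \<le> emeasure lborel C"
  proof (intro emeasure_mono subsetI)
    fix x assume "x \<in> A2 \<union> (B2 - {a + b})"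
    then have "x - b \<in> A \<or> x - a \<in> B" by (auto simp: A2_def B2_def A1_def B1_def)
    then show "x \<in> C" using sum[of "x - b" b] sum[of a "x - a"] a b by auto
  qed simp
  finally have "emeasure lborel A1 + emeasure lborel B1 \<le> emeasure lborel C" .
  then have 1: "emeasure lborel A1 + emeasure lborel B1 + (ennreal d + ennreal d) \<le> emeasure lborel C + (ennreal d + ennreal d)"
    by (rule add_right_mono)
  have 2: "ennreal d + ennreal d = ennreal e" using d by (simp add: d_def flip: ennreal_plus)
  have 3: "emeasure lborel A + emeasure lborel B \<le> emeasure lborel A1 + emeasure lborel B1 + (ennreal d + ennreal d)"
    using add_mono[OF eA eB] by (simp add: ac_simps)
  show "emeasure lborel A + emeasure lborel B \<le> emeasure lborel C + ennreal e"
    using order_trans[OF 3 1] unfolding 2 .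
qed

lemma emeasure_scaled:
  fixes A :: "real set"
  assumes [measurable]: "A \<in> sets borel" and c: "c > 0"
  shows "emeasure lborel ((\<lambda>x. x / c) -` A) = ennreal c * emeasure lborel A"
proof -
  have m: "(\<lambda>x. x / c) -` A \<in> sets borel" by (intro measurable_sets_borel[of _ borel]) auto
  have "emeasure lborel ((\<lambda>x. x / c) -` A) = (\<integral>\<^sup>+x. indicator ((\<lambda>x. x / c) -` A) x \<partial>lborel)"
    using m by simp
  also have "\<dots> = ennreal c * (\<integral>\<^sup>+x. indicator ((\<lambda>x. x / c) -` A) (0 + c * x) \<partial>lborel)"
    using c m by (subst nn_integral_real_affine[where c=c and t=0]) auto
  also have "(\<lambda>x. indicator ((\<lambda>x. x / c) -` A) (0 + c * x)) = (indicator A :: real \<Rightarrow> ennreal)"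
    using c by (auto simp: indicator_def)
  finally show ?thesis by simp
qed

lemma brunn_minkowski_real_convex:
  fixes A B C :: "real set"
  assumes [measurable]: "A \<in> sets borel" "B \<in> sets borel" "C \<in> sets borel"
    and ne: "A \<noteq> {}" "B \<noteq> {}" and bd: "bounded A" "bounded B" and t: "0 < t" "t < 1"
    and sum: "\<And>a b. a \<in> A \<Longrightarrow> b \<in> B \<Longrightarrow> (1 - t) * a + t * b \<in> C"
  shows "ennreal (1 - t) * emeasure lborel A + ennreal t * emeasure lborel B \<le> emeasure lborel C"
proof -
  have img: "(\<lambda>x. x / c) -` S = (\<lambda>x. c * x) ` S" if "c > 0" for c :: real and S
    using that by (auto simp: image_iff) (metis nonzero_mult_div_cancel_left less_irrefl times_divide_eq_right)
  have m: "(\<lambda>x. x / c) -` S \<in> sets borel" if "S \<in> sets borel" for c :: real and S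
    using that by (intro measurable_sets_borel[of _ borel]) auto
  have "emeasure lborel ((\<lambda>x. x / (1 - t)) -` A) + emeasure lborel ((\<lambda>x. x / t) -` B) \<le> emeasure lborel C"
  proof (rule brunn_minkowski_real)
    show "bounded ((\<lambda>x. x / (1 - t)) -` A)" "bounded ((\<lambda>x. x / t) -` B)"
      using t bounded_scaling[OF bd(1), of "1 - t"] bounded_scaling[OF bd(2), of t] by (auto simp: img)
    show "(\<lambda>x. x / (1 - t)) -` A \<in> sets borel" "(\<lambda>x. x / t) -` B \<in> sets borel" by (auto intro: m)
    fix a b assume "a \<in> (\<lambda>x. x / (1 - t)) -` A" "b \<in> (\<lambda>x. x / t) -` B"
    then show "a + b \<in> C" using sum[of "a / (1 - t)" "b / t"] t by simp
  qed (use t ne in \<open>auto simp: img\<close>)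
  then show ?thesis using t by (simp add: emeasure_scaled)
qed

text \<open>
  The minimum with \<open>1\<close> accounts for the restriction to levels below \<open>S\<close>; it is
  vacuous when \<open>S\<close> bounds \<open>u\<close>.
\<close>
lemma layer_cake:
  fixes u :: "real \<Rightarrow> real"
  assumes [measurable]: "u \<in> borel_measurable borel" and u: "\<And>x. 0 \<le> u x" and S: "0 < S"
  shows "(\<integral>\<^sup>+s. indicator {0<..<1} s * emeasure lborel {x. s * S < u x} \<partial>lborel)
    = (\<integral>\<^sup>+x. ennreal (min (u x / S) 1) \<partial>lborel)"
proof -
  have [measurable]: "{x. s * S < u x} \<in> sets borel" for s by measurable
  have "(\<integral>\<^sup>+s. indicator {0<..<1} s * emeasure lborel {x. s * S < u x} \<partial>lborel)
    = (\<integral>\<^sup>+s. (\<integral>\<^sup>+x. indicator {0<..<1} s * indicator {p. snd p * S < u (fst p)} (x, s) \<partial>lborel) \<partial>lborel)"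
  proof (intro nn_integral_cong)
    fix s :: real
    have "emeasure lborel {x. s * S < u x} = (\<integral>\<^sup>+x. indicator {x. s * S < u x} x \<partial>lborel)" by simp
    then show "indicator {0<..<1} s * emeasure lborel {x. s * S < u x}
      = (\<integral>\<^sup>+x. indicator {0<..<1} s * indicator {p. snd p * S < u (fst p)} (x, s) \<partial>lborel)"
      by (simp add: nn_integral_cmult indicator_def del: nn_integral_indicator)
  qed
  also have "\<dots> = (\<integral>\<^sup>+x. (\<integral>\<^sup>+s. indicator {0<..<1} s * indicator {p. snd p * S < u (fst p)} (x, s) \<partial>lborel) \<partial>lborel)"
    by (rule lborel_pair.Fubini') measurable
  also have "\<dots> = (\<integral>\<^sup>+x. ennreal (min (u x / S) 1) \<partial>lborel)"
  proof (intro nn_integral_cong)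
    fix x
    have "(\<integral>\<^sup>+s. indicator {0<..<1} s * indicator {p. snd p * S < u (fst p)} (x, s) \<partial>lborel)
      = (\<integral>\<^sup>+s. indicator {0<..<min (u x / S) 1} s \<partial>lborel)"
      using S by (intro nn_integral_cong) (auto simp: indicator_def less_divide_eq)
    also have "\<dots> = ennreal (min (u x / S) 1)" using u[of x] S by simp
    finally show "(\<integral>\<^sup>+s. indicator {0<..<1} s * indicator {p. snd p * S < u (fst p)} (x, s) \<partial>lborel) = ennreal (min (u x / S) 1)" .
  qed
  finally show ?thesis .
qed

text \<open>
  After normalising both functions to have supremum \<open>1\<close>, all their superlevel sets below
  level \<open>1\<close> are nonempty. The Brunn--Minkowski inequality for these sets integrates to an
  arithmetic-mean inequality, which is stronger than the geometric one by Young's inequality.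
\<close>
lemma prekopa_leindler_real:
  fixes u w h :: "real \<Rightarrow> real"
  assumes [measurable]: "u \<in> borel_measurable borel" "w \<in> borel_measurable borel" "h \<in> borel_measurable borel"
    and nn: "\<And>x. 0 \<le> u x" "\<And>x. 0 \<le> w x" "\<And>x. 0 \<le> h x"
    and bnd: "\<And>x. u x \<le> M" "\<And>x. w x \<le> M" "\<And>x. h x \<le> M"
    and supp: "\<And>x. R < \<bar>x\<bar> \<Longrightarrow> u x = 0" "\<And>x. R < \<bar>x\<bar> \<Longrightarrow> w x = 0" "\<And>x. R < \<bar>x\<bar> \<Longrightarrow> h x = 0"
    and t: "0 < t" "t < 1"
    and pl: "\<And>x y. u x powr (1 - t) * w y powr t \<le> h ((1 - t) * x + t * y)"
  shows "enn2real (\<integral>\<^sup>+x. ennreal (u x) \<partial>lborel) powr (1 - t) * enn2real (\<integral>\<^sup>+x. ennreal (w x) \<partial>lborel) powr t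
    \<le> enn2real (\<integral>\<^sup>+x. ennreal (h x) \<partial>lborel)"
proof -
  have fin: "(\<integral>\<^sup>+x. ennreal (g x) \<partial>lborel) < \<infinity>"
    if "\<And>x. 0 \<le> g x" "\<And>x. g x \<le> M" "\<And>x. R < \<bar>x\<bar> \<Longrightarrow> g x = 0" for g :: "real \<Rightarrow> real"
  proof -
    have "(\<integral>\<^sup>+x. ennreal (g x) \<partial>lborel) \<le> (\<integral>\<^sup>+x. ennreal M * indicator {-R..R} x \<partial>lborel)"
    proof (rule nn_integral_mono)
      fix x show "ennreal (g x) \<le> ennreal M * indicator {-R..R} x"
      proof (cases "R < \<bar>x\<bar>")
        case False
        then have "x \<in> {-R..R}" by auto
        then show ?thesis using that(2) by (simp add: ennreal_leI)
      qed (simp add: that(3))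
    qed
    also have "\<dots> < \<infinity>" by (simp add: nn_integral_cmult_indicator emeasure_lborel_Icc_eq ennreal_mult_less_top)
    finally show ?thesis .
  qed
  define Su where "Su = (SUP x. u x)"
  define Sw where "Sw = (SUP x. w x)"
  have bu: "bdd_above (range u)" and bw: "bdd_above (range w)" using bnd by (auto intro: bdd_aboveI[of _ M])
  have uS: "u x \<le> Su" "w x \<le> Sw" for x by (auto simp: Su_def Sw_def intro: cSUP_upper bu bw)
  have S0: "0 \<le> Su" "0 \<le> Sw" using uS[of 0] nn(1)[of 0] nn(2)[of 0] by linarith+
  show ?thesis
  proof (cases "Su = 0 \<or> Sw = 0")
    case True
    then have "(\<forall>x. u x = 0) \<or> (\<forall>x. w x = 0)" using uS nn by (metis antisym)
    then show ?thesis by auto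
  next
    case False
    then have Sp: "0 < Su" "0 < Sw" using S0 by auto
    define H where "H = Su powr (1 - t) * Sw powr t"
    have H: "0 < H" using Sp by (simp add: H_def)
    have [measurable]: "{x. c < g x} \<in> sets borel" if "g \<in> borel_measurable borel" for g :: "real \<Rightarrow> real" and c
      using that by measurable
    have lev: "ennreal (1 - t) * emeasure lborel {x. s * Su < u x} + ennreal t * emeasure lborel {x. s * Sw < w x}
      \<le> emeasure lborel {x. s * H < h x}" if s: "0 < s" "s < 1" for s
    proof (rule brunn_minkowski_real_convex[OF _ _ _ _ _ _ _ t])
      have "s * Su < Su" "s * Sw < Sw" using s Sp by auto
      then show "{x. s * Su < u x} \<noteq> {}" "{x. s * Sw < w x} \<noteq> {}"
        using less_cSUP_iff[OF _ bu, of "s * Su"] less_cSUP_iff[OF _ bw, of "s * Sw"] by (auto simp: Su_def Sw_def)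
      have inR: "x \<in> {-R..R}" if "0 < u x \<or> 0 < w x" for x
        using supp(1,2)[of x] that by (cases "R < \<bar>x\<bar>") auto
      have "0 < s * Su" "0 < s * Sw" using s Sp by auto
      then have "{x. s * Su < u x} \<subseteq> {-R..R}" "{x. s * Sw < w x} \<subseteq> {-R..R}"
        using inR less_trans by fastforce+
      then show "bounded {x. s * Su < u x}" "bounded {x. s * Sw < w x}"
        using bounded_subset bounded_closed_interval by blast+
      fix a b assume "a \<in> {x. s * Su < u x}" "b \<in> {x. s * Sw < w x}"
      then have ab: "s * Su < u a" "s * Sw < w b" by auto
      have "s * H = (s * Su) powr (1 - t) * (s * Sw) powr t"
        using s Sp by (simp add: H_def powr_mult flip: powr_add)
      also have "\<dots> < u a powr (1 - t) * w b powr t"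
      proof (rule mult_strict_mono)
        have p: "0 < s * Su" "0 < s * Sw" using s Sp by auto
        show "(s * Su) powr (1 - t) < u a powr (1 - t)" by (rule powr_less_mono2) (use p ab t in linarith)+
        show "(s * Sw) powr t < w b powr t" by (rule powr_less_mono2) (use p ab t in linarith)+
        show "0 < u a powr (1 - t)" using p ab by (simp add: less_imp_neq[OF less_trans])
      qed simp
      also have "\<dots> \<le> h ((1 - t) * a + t * b)" by (rule pl)
      finally show "(1 - t) * a + t * b \<in> {x. s * H < h x}" by simp
    qed auto
    define \<alpha> where "\<alpha> = enn2real (\<integral>\<^sup>+x. ennreal (u x) \<partial>lborel)"
    define \<beta> where "\<beta> = enn2real (\<integral>\<^sup>+x. ennreal (w x) \<partial>lborel)"
    have \<alpha>: "(\<integral>\<^sup>+x. ennreal (u x) \<partial>lborel) = ennreal \<alpha>" and \<beta>: "(\<integral>\<^sup>+x. ennreal (w x) \<partial>lborel) = ennreal \<beta>"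
      using fin[of u] fin[of w] nn bnd supp by (auto simp: \<alpha>_def \<beta>_def)
    have \<alpha>0: "0 \<le> \<alpha>" "0 \<le> \<beta>" by (auto simp: \<alpha>_def \<beta>_def)
    have normalized: "(\<integral>\<^sup>+x. ennreal (min (g x / S) 1) \<partial>lborel) = ennreal (1 / S) * (\<integral>\<^sup>+x. ennreal (g x) \<partial>lborel)"
      if "\<And>x. g x \<le> S" "\<And>x. 0 \<le> g x" "0 < S" "g \<in> borel_measurable borel" for g :: "real \<Rightarrow> real" and S
    proof -
      have "ennreal (min (g x / S) 1) = ennreal (1 / S) * ennreal (g x)" for x
        using that(1,2)[of x] that(3) by (simp add: ennreal_mult[symmetric] min_def divide_le_eq)
      then show ?thesis using that(4) by (simp add: nn_integral_cmult)
    qed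
    have "ennreal (1 - t) * (ennreal (1 / Su) * ennreal \<alpha>) + ennreal t * (ennreal (1 / Sw) * ennreal \<beta>)
      = (\<integral>\<^sup>+s. ennreal (1 - t) * (indicator {0<..<1} s * emeasure lborel {x. s * Su < u x})
          + ennreal t * (indicator {0<..<1} s * emeasure lborel {x. s * Sw < w x}) \<partial>lborel)"
    proof -
      have m[measurable]: "(\<lambda>s. emeasure lborel {x. s * S < g x}) \<in> borel_measurable borel"
        if [measurable]: "g \<in> borel_measurable borel" for g :: "real \<Rightarrow> real" and S
      proof -
        have "(\<lambda>s. \<integral>\<^sup>+x. indicator {p. snd p * S < g (fst p)} (x, s) \<partial>lborel) \<in> borel_measurable borel"
          by measurable
        moreover have "(\<integral>\<^sup>+x. indicator {p. snd p * S < g (fst p)} (x, s) \<partial>lborel) = emeasure lborel {x. s * S < g x}" for s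
        proof -
          have "(\<integral>\<^sup>+x. indicator {p. snd p * S < g (fst p)} (x, s) \<partial>lborel) = (\<integral>\<^sup>+x. indicator {x. s * S < g x} x \<partial>lborel)"
            by (intro nn_integral_cong) (auto simp: indicator_def)
          then show ?thesis by simp
        qed
        ultimately show ?thesis by simp
      qed
      have "ennreal (1 / Su) * ennreal \<alpha> = (\<integral>\<^sup>+s. indicator {0<..<1} s * emeasure lborel {x. s * Su < u x} \<partial>lborel)"
        by (subst layer_cake, simp, rule nn, rule Sp, subst normalized) (use uS nn Sp \<alpha> in auto)
      moreover have "ennreal (1 / Sw) * ennreal \<beta> = (\<integral>\<^sup>+s. indicator {0<..<1} s * emeasure lborel {x. s * Sw < w x} \<partial>lborel)"
        by (subst layer_cake, simp, rule nn, rule Sp, subst normalized) (use uS nn Sp \<beta> in auto)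
      ultimately show ?thesis by (simp add: nn_integral_add nn_integral_cmult)
    qed
    also have "\<dots> \<le> (\<integral>\<^sup>+s. indicator {0<..<1} s * emeasure lborel {x. s * H < h x} \<partial>lborel)"
      using lev by (intro nn_integral_mono) (auto simp: indicator_def)
    also have "\<dots> = (\<integral>\<^sup>+x. ennreal (min (h x / H) 1) \<partial>lborel)" using nn H by (intro layer_cake) auto
    also have "\<dots> \<le> (\<integral>\<^sup>+x. ennreal (1 / H) * ennreal (h x) \<partial>lborel)"
      using H nn by (intro nn_integral_mono) (auto simp: ennreal_mult[symmetric] intro!: ennreal_leI)
    also have "\<dots> = ennreal (1 / H) * (\<integral>\<^sup>+x. ennreal (h x) \<partial>lborel)" by (simp add: nn_integral_cmult)
    also have "(\<integral>\<^sup>+x. ennreal (h x) \<partial>lborel) = ennreal (enn2real (\<integral>\<^sup>+x. ennreal (h x) \<partial>lborel))"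
      using fin[of h] nn bnd supp by auto
    finally have "ennreal ((1 - t) * (\<alpha> / Su) + t * (\<beta> / Sw)) \<le> ennreal (enn2real (\<integral>\<^sup>+x. ennreal (h x) \<partial>lborel) / H)"
      using \<alpha>0 Sp t H by (simp add: ennreal_mult[symmetric] ennreal_plus[symmetric] del: ennreal_plus)
    then have main: "(1 - t) * (\<alpha> / Su) + t * (\<beta> / Sw) \<le> enn2real (\<integral>\<^sup>+x. ennreal (h x) \<partial>lborel) / H"
      using H by (subst (asm) ennreal_le_iff) auto
    have "\<alpha> powr (1 - t) * \<beta> powr t \<le> enn2real (\<integral>\<^sup>+x. ennreal (h x) \<partial>lborel)"
    proof (cases "\<alpha> = 0 \<or> \<beta> = 0")
      case False
      then have pos: "0 < \<alpha>" "0 < \<beta>" using \<alpha>0 by auto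
      have "(\<alpha> / Su) powr (1 - t) * (\<beta> / Sw) powr t \<le> (1 - t) * (\<alpha> / Su) + t * (\<beta> / Sw)"
        using pos Sp t by (intro Youngs_inequality_0) auto
      also note main
      finally have "H * ((\<alpha> / Su) powr (1 - t) * (\<beta> / Sw) powr t) \<le> enn2real (\<integral>\<^sup>+x. ennreal (h x) \<partial>lborel)"
        using H by (simp add: le_divide_eq mult.commute)
      also have "H * ((\<alpha> / Su) powr (1 - t) * (\<beta> / Sw) powr t) = \<alpha> powr (1 - t) * \<beta> powr t"
        using pos Sp by (simp add: H_def powr_divide)
      finally show ?thesis .
    qed auto
    then show ?thesis by (simp add: \<alpha>_def \<beta>_def)
  qed
qed


interpretation lborel_product: product_sigma_finite "\<lambda>_::'i. lborel :: real measure" ..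

lemma nn_integral_box_le:
  fixes g :: "('i \<Rightarrow> real) \<Rightarrow> real"
  assumes "finite I" and bnd: "\<And>x. g x \<le> M" "0 \<le> M"
    and supp: "\<And>x i. i \<in> I \<Longrightarrow> R < \<bar>x i\<bar> \<Longrightarrow> g x = 0"
  shows "(\<integral>\<^sup>+x. ennreal (g x) \<partial>(\<Pi>\<^sub>M i\<in>I. lborel)) \<le> ennreal (M * (2 * \<bar>R\<bar>) ^ card I)"
proof -
  let ?B = "\<Pi>\<^sub>E i\<in>I. {-\<bar>R\<bar>..\<bar>R\<bar>}"
  have B: "?B \<in> sets (\<Pi>\<^sub>M i\<in>I. lborel)" using assms by (intro sets_PiM_I_finite) auto
  have "(\<integral>\<^sup>+x. ennreal (g x) \<partial>(\<Pi>\<^sub>M i\<in>I. lborel)) \<le> (\<integral>\<^sup>+x. ennreal M * indicator ?B x \<partial>(\<Pi>\<^sub>M i\<in>I. lborel))"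
  proof (rule nn_integral_mono)
    fix x :: "'i \<Rightarrow> real" assume x: "x \<in> space (\<Pi>\<^sub>M i\<in>I. lborel)"
    show "ennreal (g x) \<le> ennreal M * indicator ?B x"
    proof (cases "\<exists>i\<in>I. R < \<bar>x i\<bar>")
      case True then show ?thesis using supp by fastforce
    next
      case False
      have "x i \<in> {-\<bar>R\<bar>..\<bar>R\<bar>}" if "i \<in> I" for i
      proof -
        have "\<bar>x i\<bar> \<le> R" using False that by (meson not_less)
        then show ?thesis by auto
      qed
      then have "x \<in> ?B" using x by (auto simp: space_PiM PiE_iff)
      then show ?thesis using bnd by (simp add: ennreal_leI)
    qed
  qed
  also have "\<dots> = ennreal M * emeasure (\<Pi>\<^sub>M i\<in>I. lborel) ?B" using B by (rule nn_integral_cmult_indicator)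
  also have "emeasure (\<Pi>\<^sub>M i\<in>I. lborel) ?B = (\<Prod>i\<in>I. emeasure lborel {-\<bar>R\<bar>..\<bar>R\<bar>})"
    using assms by (intro lborel_product.emeasure_PiM) auto
  also have "\<dots> = ennreal ((2 * \<bar>R\<bar>) ^ card I)" by (simp add: ennreal_power)
  finally show ?thesis using bnd by (simp add: ennreal_mult)
qed

text \<open>
  Induction on the set of coordinates. By the induction hypothesis, the integrals over the other
  coordinates satisfy the hypothesis of the one-dimensional inequality in the remaining one. Boundedness
  and support in a box make all these partial integrals finite.
\<close>
lemma prekopa_leindler_PiM:
  fixes u w h :: "('i \<Rightarrow> real) \<Rightarrow> real"
  assumes "finite I"
    and "u \<in> borel_measurable (\<Pi>\<^sub>M i\<in>I. lborel)" "w \<in> borel_measurable (\<Pi>\<^sub>M i\<in>I. lborel)" "h \<in> borel_measurable (\<Pi>\<^sub>M i\<in>I. lborel)"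
    and "\<And>x. 0 \<le> u x" "\<And>x. 0 \<le> w x" "\<And>x. 0 \<le> h x"
    and "\<And>x. u x \<le> M" "\<And>x. w x \<le> M" "\<And>x. h x \<le> M"
    and "\<And>x i. i \<in> I \<Longrightarrow> R < \<bar>x i\<bar> \<Longrightarrow> u x = 0" "\<And>x i. i \<in> I \<Longrightarrow> R < \<bar>x i\<bar> \<Longrightarrow> w x = 0" "\<And>x i. i \<in> I \<Longrightarrow> R < \<bar>x i\<bar> \<Longrightarrow> h x = 0"
    and t: "0 < t" "t < 1"
    and "\<And>x y. x \<in> space (\<Pi>\<^sub>M i\<in>I. lborel) \<Longrightarrow> y \<in> space (\<Pi>\<^sub>M i\<in>I. lborel) \<Longrightarrow>
      u x powr (1 - t) * w y powr t \<le> h (\<lambda>i\<in>I. (1 - t) * x i + t * y i)"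
  shows "enn2real (\<integral>\<^sup>+x. ennreal (u x) \<partial>(\<Pi>\<^sub>M i\<in>I. lborel)) powr (1 - t)
      * enn2real (\<integral>\<^sup>+x. ennreal (w x) \<partial>(\<Pi>\<^sub>M i\<in>I. lborel)) powr t
    \<le> enn2real (\<integral>\<^sup>+x. ennreal (h x) \<partial>(\<Pi>\<^sub>M i\<in>I. lborel))"
  using assms(1-13,16)
proof (induction I arbitrary: u w h rule: finite_induct)
  case empty
  have "(\<lambda>i\<in>{}. (1 - t) * x i + t * y i) = (\<lambda>_. undefined)" for x y :: "'i \<Rightarrow> real" by auto
  then have "u (\<lambda>_. undefined) powr (1 - t) * w (\<lambda>_. undefined) powr t \<le> h (\<lambda>_. undefined)"
    using empty.prems(13)[of "\<lambda>_. undefined" "\<lambda>_. undefined"] by simp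
  then show ?case
    using empty.prems by (subst (1 2 3) lborel_product.nn_integral_empty) auto
next
  case (insert i I)
  note [measurable] = insert.prems(1-3)
  let ?P = "\<Pi>\<^sub>M i\<in>I. (lborel :: real measure)"
  have M: "0 \<le> M" using insert.prems(4,7) order_trans by blast
  define M' where "M' = M * (2 * \<bar>R\<bar>) ^ card I"
  have M': "0 \<le> M'" using M by (simp add: M'_def)
  define m where "m g a = (\<integral>\<^sup>+x. ennreal (g (x(i := a))) \<partial>?P)" for g :: "('i \<Rightarrow> real) \<Rightarrow> real" and a
  have supd: "R < \<bar>(x(i := a)) j\<bar>" if "j \<in> I" "R < \<bar>x j\<bar>" for x :: "'i \<Rightarrow> real" and a j
    using that insert.hyps by auto
  have bound: "m g a \<le> ennreal M'"
    if "\<And>x. g x \<le> M" "\<And>x j. j \<in> insert i I \<Longrightarrow> R < \<bar>x j\<bar> \<Longrightarrow> g x = 0" for g a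
    unfolding m_def M'_def
    by (rule nn_integral_box_le[OF insert.hyps(1) that(1) M]) (use that(2) supd in blast)
  have eqr: "m g a = ennreal (enn2real (m g a))"
    if "\<And>x. g x \<le> M" "\<And>x j. j \<in> insert i I \<Longrightarrow> R < \<bar>x j\<bar> \<Longrightarrow> g x = 0" for g a
    using le_less_trans[OF bound[of g a, OF that] ennreal_less_top] by simp
  have le: "enn2real (m g a) \<le> M'"
    if "\<And>x. g x \<le> M" "\<And>x j. j \<in> insert i I \<Longrightarrow> R < \<bar>x j\<bar> \<Longrightarrow> g x = 0" for g a
    using bound[of g a, OF that] M' by (simp add: enn2real_leI)
  have out: "enn2real (m g a) = 0"
    if "\<And>x j. j \<in> insert i I \<Longrightarrow> R < \<bar>x j\<bar> \<Longrightarrow> g x = 0" "R < \<bar>a\<bar>" for g a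
  proof -
    have "g (x(i := a)) = 0" for x using that(1)[of i "x(i := a)"] that(2) by simp
    then show ?thesis by (simp add: m_def)
  qed
  have slice[measurable]: "(\<lambda>x. g (x(i := a))) \<in> borel_measurable ?P"
    if [measurable]: "g \<in> borel_measurable (\<Pi>\<^sub>M i\<in>insert i I. lborel)" for g :: "('i \<Rightarrow> real) \<Rightarrow> real" and a
    using insert.hyps by measurable
  have meas: "(\<lambda>a. enn2real (m g a)) \<in> borel_measurable borel"
    if [measurable]: "g \<in> borel_measurable (\<Pi>\<^sub>M i\<in>insert i I. lborel)" for g :: "('i \<Rightarrow> real) \<Rightarrow> real"
  proof -
    interpret sigma_finite_measure ?P
      using insert.hyps(1) by (intro lborel_product.sigma_finite)
    have "(\<lambda>(a, x). ennreal (g (x(i := a)))) \<in> borel_measurable (borel \<Otimes>\<^sub>M ?P)"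
      using insert.hyps by measurable
    then have "m g \<in> borel_measurable borel"
      unfolding m_def[abs_def] by (rule borel_measurable_nn_integral)
    then show ?thesis by measurable
  qed
  have total: "(\<integral>\<^sup>+x. ennreal (g x) \<partial>(\<Pi>\<^sub>M i\<in>insert i I. lborel)) = (\<integral>\<^sup>+a. ennreal (enn2real (m g a)) \<partial>lborel)"
    if g: "g \<in> borel_measurable (\<Pi>\<^sub>M i\<in>insert i I. lborel)" "\<And>x. g x \<le> M" "\<And>x j. j \<in> insert i I \<Longrightarrow> R < \<bar>x j\<bar> \<Longrightarrow> g x = 0" for g
  proof -
    have [measurable]: "g \<in> borel_measurable (\<Pi>\<^sub>M i\<in>insert i I. lborel)" by (rule g)
    have "(\<integral>\<^sup>+x. ennreal (g x) \<partial>(\<Pi>\<^sub>M i\<in>insert i I. lborel)) = (\<integral>\<^sup>+a. m g a \<partial>lborel)"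
      unfolding m_def by (subst lborel_product.product_nn_integral_insert_rev[OF insert.hyps(1,2)]) auto
    then show ?thesis using eqr[OF g(2,3)] by simp
  qed
  have "enn2real (\<integral>\<^sup>+a. ennreal (enn2real (m u a)) \<partial>lborel) powr (1 - t) * enn2real (\<integral>\<^sup>+a. ennreal (enn2real (m w a)) \<partial>lborel) powr t
    \<le> enn2real (\<integral>\<^sup>+a. ennreal (enn2real (m h a)) \<partial>lborel)"
  proof (rule prekopa_leindler_real[where M=M' and R=R])
    fix a b
    show "enn2real (m u a) powr (1 - t) * enn2real (m w b) powr t \<le> enn2real (m h ((1 - t) * a + t * b))"
      unfolding m_def
    proof (rule insert.IH)
      fix x y assume xy: "x \<in> space ?P" "y \<in> space ?P"
      have "u (x(i := a)) powr (1 - t) * w (y(i := b)) powr t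
         \<le> h (\<lambda>j\<in>insert i I. (1 - t) * (x(i := a)) j + t * (y(i := b)) j)"
        using xy by (intro insert.prems(13)) (auto simp: space_PiM PiE_iff extensional_def)
      also have "(\<lambda>j\<in>insert i I. (1 - t) * (x(i := a)) j + t * (y(i := b)) j)
        = (\<lambda>j\<in>I. (1 - t) * x j + t * y j)(i := (1 - t) * a + t * b)"
        using insert.hyps(2) by (auto simp: fun_eq_iff)
      finally show "u (x(i := a)) powr (1 - t) * w (y(i := b)) powr t
        \<le> h ((\<lambda>j\<in>I. (1 - t) * x j + t * y j)(i := (1 - t) * a + t * b))" .
    next
      fix x j assume j: "j \<in> I" "R < \<bar>x j\<bar>"
      then have j': "j \<in> insert i I" "R < \<bar>(x(i := c)) j\<bar>" for c using supd by auto
      show "u (x(i := a)) = 0" "w (x(i := b)) = 0" "h (x(i := (1 - t) * a + t * b)) = 0"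
        by (fact insert.prems(10)[of j "x(i := a)", OF j'] insert.prems(11)[of j "x(i := b)", OF j']
          insert.prems(12)[of j "x(i := (1 - t) * a + t * b)", OF j'])+
    qed (rule slice insert.prems)+
  next
    fix a
    show "enn2real (m u a) \<le> M'" "enn2real (m w a) \<le> M'" "enn2real (m h a) \<le> M'"
      by (rule le; fact insert.prems)+
    assume a: "R < \<bar>a\<bar>"
    show "enn2real (m u a) = 0" "enn2real (m w a) = 0" "enn2real (m h a) = 0"
      by (rule out[OF _ a]; fact insert.prems)+
  qed (use t in \<open>auto intro!: meas insert.prems\<close>)
  moreover have "(\<integral>\<^sup>+x. ennreal (u x) \<partial>(\<Pi>\<^sub>M i\<in>insert i I. lborel)) = (\<integral>\<^sup>+a. ennreal (enn2real (m u a)) \<partial>lborel)"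
    "(\<integral>\<^sup>+x. ennreal (w x) \<partial>(\<Pi>\<^sub>M i\<in>insert i I. lborel)) = (\<integral>\<^sup>+a. ennreal (enn2real (m w a)) \<partial>lborel)"
    "(\<integral>\<^sup>+x. ennreal (h x) \<partial>(\<Pi>\<^sub>M i\<in>insert i I. lborel)) = (\<integral>\<^sup>+a. ennreal (enn2real (m h a)) \<partial>lborel)"
    by (rule total; fact insert.prems)+
  ultimately show ?case by (simp only:)
qed

lemma prekopa_leindler_bounded:
  fixes u w h :: "'a::euclidean_space \<Rightarrow> real"
  assumes [measurable]: "u \<in> borel_measurable borel" "w \<in> borel_measurable borel" "h \<in> borel_measurable borel"
    and nn: "\<And>x. 0 \<le> u x" "\<And>x. 0 \<le> w x" "\<And>x. 0 \<le> h x"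
    and bnd: "\<And>x. u x \<le> M" "\<And>x. w x \<le> M" "\<And>x. h x \<le> M"
    and supp: "\<And>x. R < norm x \<Longrightarrow> u x = 0" "\<And>x. R < norm x \<Longrightarrow> w x = 0" "\<And>x. R < norm x \<Longrightarrow> h x = 0"
    and t: "0 < t" "t < 1"
    and pl: "\<And>x y. u x powr (1 - t) * w y powr t \<le> h ((1 - t) *\<^sub>R x + t *\<^sub>R y)"
  shows "enn2real (\<integral>\<^sup>+x. ennreal (u x) \<partial>lborel) powr (1 - t) * enn2real (\<integral>\<^sup>+x. ennreal (w x) \<partial>lborel) powr t
    \<le> enn2real (\<integral>\<^sup>+x. ennreal (h x) \<partial>lborel)"
proof -
  let ?P = "\<Pi>\<^sub>M b\<in>(Basis::'a set). (lborel::real measure)"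
  define T :: "('a \<Rightarrow> real) \<Rightarrow> 'a" where "T f = (\<Sum>b\<in>Basis. f b *\<^sub>R b)" for f
  have [measurable]: "T \<in> ?P \<rightarrow>\<^sub>M borel" unfolding T_def[abs_def] by measurable
  have eq: "(\<integral>\<^sup>+x. ennreal (g x) \<partial>lborel) = (\<integral>\<^sup>+f. ennreal (g (T f)) \<partial>?P)"
    if [measurable]: "g \<in> borel_measurable borel" for g :: "'a \<Rightarrow> real"
    by (subst lborel_eq) (simp add: nn_integral_distr T_def)
  have Tb: "T f \<bullet> b = f b" if "b \<in> Basis" for f b
    using that by (simp add: T_def inner_sum_left inner_Basis if_distrib sum.delta cong: if_cong)
  have big: "R < norm (T f)" if "b \<in> Basis" "R < \<bar>f b\<bar>" for f b
    using Basis_le_norm[OF that(1), of "T f"] Tb[OF that(1)] that(2) by simp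
  have lin: "T (\<lambda>i\<in>Basis. (1 - t) * x i + t * y i) = (1 - t) *\<^sub>R T x + t *\<^sub>R T y" for x y
    by (simp add: T_def scaleR_sum_right scaleR_add_left sum.distrib)
  show ?thesis
    unfolding eq[OF assms(1)] eq[OF assms(2)] eq[OF assms(3)]
  proof (rule prekopa_leindler_PiM[where M=M and R=R, OF _ _ _ _ _ _ _ _ _ _ _ _ _ t])
    show "(\<lambda>x. u (T x)) \<in> borel_measurable ?P" "(\<lambda>x. w (T x)) \<in> borel_measurable ?P" "(\<lambda>x. h (T x)) \<in> borel_measurable ?P"
      by measurable
    show "u (T x) powr (1 - t) * w (T y) powr t \<le> h (T (\<lambda>i\<in>Basis. (1 - t) * x i + t * y i))" for x y
      unfolding lin by (rule pl)
  qed (use nn bnd supp big in auto)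
qed

lemma nn_integral_truncate_LIMSEQ:
  fixes u :: "'a::euclidean_space \<Rightarrow> real"
  assumes [measurable]: "u \<in> borel_measurable borel" and nn: "\<And>x. 0 \<le> u x"
  shows "(\<lambda>N. \<integral>\<^sup>+x. ennreal (min (u x) (real N) * indicator (cball 0 (real N)) x) \<partial>lborel) \<longlonglongrightarrow> (\<integral>\<^sup>+x. ennreal (u x) \<partial>lborel)"
proof (rule nn_integral_LIMSEQ)
  show "incseq (\<lambda>N x. ennreal (min (u x) (real N) * indicator (cball 0 (real N)) x))"
    using nn by (intro incseq_SucI le_funI ennreal_leI) (auto simp: indicator_def min_def)
  fix x
  obtain N0 :: nat where N0: "max (u x) (norm x) \<le> real N0" using real_arch_simple by blast
  show "(\<lambda>N. ennreal (min (u x) (real N) * indicator (cball 0 (real N)) x)) \<longlonglongrightarrow> ennreal (u x)"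
  proof (rule tendsto_eventually, unfold eventually_sequentially, intro exI[of _ N0] allI impI)
    fix N assume "N0 \<le> N"
    then have "u x \<le> real N" "norm x \<le> real N" using N0 by linarith+
    then show "ennreal (min (u x) (real N) * indicator (cball 0 (real N)) x) = ennreal (u x)" by simp
  qed
next
  fix N
  have [measurable]: "cball (0::'a) (real N) \<in> sets borel" by simp
  show "(\<lambda>x. ennreal (min (u x) (real N) * indicator (cball 0 (real N)) x)) \<in> borel_measurable lborel" by measurable
qed

text \<open>
  Truncation reduces the general case to bounded functions of bounded support; truncating
  \<open>h\<close> at the same level preserves the hypothesis because a geometric mean of numbers below
  \<open>N\<close> is below \<open>N\<close>.
\<close>
theorem prekopa_leindler:
  fixes u w h :: "'a::euclidean_space \<Rightarrow> real"
  assumes u: "integrable lborel u" and w: "integrable lborel w" and h: "integrable lborel h"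
    and nn: "\<And>x. 0 \<le> u x" "\<And>x. 0 \<le> w x" "\<And>x. 0 \<le> h x"
    and t: "0 < t" "t < 1"
    and pl: "\<And>x y. u x powr (1 - t) * w y powr t \<le> h ((1 - t) *\<^sub>R x + t *\<^sub>R y)"
  shows "(\<integral>x. u x \<partial>lborel) powr (1 - t) * (\<integral>x. w x \<partial>lborel) powr t \<le> (\<integral>x. h x \<partial>lborel)"
proof -
  have [measurable]: "u \<in> borel_measurable borel" "w \<in> borel_measurable borel" "h \<in> borel_measurable borel"
    using u w h by auto
  define tr where "tr g N x = min (g x) (real N) * indicator (cball 0 (real N)) x" for g :: "'a \<Rightarrow> real" and N x
  define J where "J g = enn2real (\<integral>\<^sup>+x. ennreal (g x) \<partial>lborel)" for g :: "'a \<Rightarrow> real"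
  have J: "J g = (\<integral>x. g x \<partial>lborel)" "(\<integral>\<^sup>+x. ennreal (g x) \<partial>lborel) = ennreal (\<integral>x. g x \<partial>lborel)"
    if "integrable lborel g" "\<And>x. 0 \<le> g x" for g
    using nn_integral_eq_integral[of lborel g] that integral_nonneg_AE[of g lborel] by (auto simp: J_def)
  have ineq: "J (tr u N) powr (1 - t) * J (tr w N) powr t \<le> J (tr h N)" for N
    unfolding J_def
  proof (rule prekopa_leindler_bounded[where M="real N" and R="real N"])
    have [measurable]: "cball (0::'a) (real N) \<in> sets borel" by simp
    show "tr u N \<in> borel_measurable borel" "tr w N \<in> borel_measurable borel" "tr h N \<in> borel_measurable borel"
      unfolding tr_def[abs_def] by measurable
    fix x y :: 'a
    show "tr u N x powr (1 - t) * tr w N y powr t \<le> tr h N ((1 - t) *\<^sub>R x + t *\<^sub>R y)"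
    proof (cases "x \<in> cball 0 (real N) \<and> y \<in> cball 0 (real N)")
      case True
      then have c: "(1 - t) *\<^sub>R x + t *\<^sub>R y \<in> cball 0 (real N)"
        using convexD_alt[OF convex_cball, of x 0 "real N" y t] t by auto
      have "min (u x) (real N) powr (1 - t) * min (w y) (real N) powr t \<le> u x powr (1 - t) * w y powr t"
        using nn t by (intro mult_mono powr_mono2) auto
      also have "\<dots> \<le> h ((1 - t) *\<^sub>R x + t *\<^sub>R y)" by (rule pl)
      finally have "min (u x) (real N) powr (1 - t) * min (w y) (real N) powr t \<le> h ((1 - t) *\<^sub>R x + t *\<^sub>R y)" .
      moreover have "min (u x) (real N) powr (1 - t) * min (w y) (real N) powr t \<le> real N powr (1 - t) * real N powr t"
        using nn t by (intro mult_mono powr_mono2) auto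
      moreover have "real N powr (1 - t) * real N powr t = real N"
        by (cases "N = 0") (auto simp flip: powr_add)
      ultimately show ?thesis using True c by (simp add: tr_def)
    next
      case False
      then have "tr u N x = 0 \<or> tr w N y = 0" by (auto simp: tr_def)
      moreover have "0 \<le> tr h N z" for z using nn by (simp add: tr_def)
      ultimately show ?thesis by auto
    qed
  qed (use nn t in \<open>auto simp: tr_def indicator_def\<close>)
  have lim: "(\<lambda>N. J (tr g N)) \<longlonglongrightarrow> (\<integral>x. g x \<partial>lborel)" if "integrable lborel g" "\<And>x. 0 \<le> g x" for g
  proof -
    have "(\<lambda>N. \<integral>\<^sup>+x. ennreal (tr g N x) \<partial>lborel) \<longlonglongrightarrow> ennreal (\<integral>x. g x \<partial>lborel)"
      unfolding J(2)[OF that, symmetric] tr_def using that by (intro nn_integral_truncate_LIMSEQ) auto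
    from tendsto_enn2real[OF this] show ?thesis using that by (simp add: J_def)
  qed
  have hle: "J (tr h N) \<le> (\<integral>x. h x \<partial>lborel)" for N
  proof -
    have "(\<integral>\<^sup>+x. ennreal (tr h N x) \<partial>lborel) \<le> (\<integral>\<^sup>+x. ennreal (h x) \<partial>lborel)"
      using nn by (intro nn_integral_mono ennreal_leI) (auto simp: tr_def indicator_def)
    then show ?thesis unfolding J(2)[OF h nn(3)] J_def using nn by (intro enn2real_leI) auto
  qed
  show ?thesis
  proof (cases "(\<integral>x. u x \<partial>lborel) = 0 \<or> (\<integral>x. w x \<partial>lborel) = 0")
    case True
    then show ?thesis using nn by auto
  next
    case False
    have "(\<lambda>N. J (tr u N) powr (1 - t) * J (tr w N) powr t) \<longlonglongrightarrow> (\<integral>x. u x \<partial>lborel) powr (1 - t) * (\<integral>x. w x \<partial>lborel) powr t"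
      using False by (intro tendsto_mult tendsto_powr lim u w nn tendsto_const) auto
    then show ?thesis
      by (rule LIMSEQ_le_const2) (use order_trans[OF ineq hle] in blast)
  qed
qed

section \<open>The tangent inequality for Lipschitz potentials\<close>

text \<open>
  Domination of the difference quotients of \<open>t \<mapsto> exp (t d)\<close> when \<open>d\<close>
  is bounded above only.
\<close>
lemma exp_difference_quotient_bound:
  fixes d t M :: real
  assumes "0 < t" "t \<le> 1" "d \<le> M" "0 \<le> M"
  shows "\<bar>(exp (t * d) - 1) / t\<bar> \<le> \<bar>d\<bar> * exp M"
proof -
  have e1: "1 \<le> exp M" using assms by simp
  have lower: "t * d \<le> exp (t * d) - 1" using exp_ge_add_one_self[of "t * d"] by linarith
  have upper: "exp (t * d) - 1 \<le> t * d * exp (t * d)"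
  proof -
    have "1 - t * d \<le> exp (- (t * d))" using exp_ge_add_one_self[of "- (t * d)"] by linarith
    then have "exp (t * d) * (1 - t * d) \<le> exp (t * d) * exp (- (t * d))" by (intro mult_left_mono) auto
    then show ?thesis by (simp add: exp_minus algebra_simps)
  qed
  have "\<bar>exp (t * d) - 1\<bar> \<le> t * (\<bar>d\<bar> * exp M)"
  proof (cases "0 \<le> d")
    case True
    have "t * d \<le> 1 * M" using assms True by (intro mult_mono) auto
    then have "t * d * exp (t * d) \<le> t * d * exp M" using True assms by (intro mult_left_mono) auto
    moreover have "0 \<le> t * d" using True assms by simp
    ultimately show ?thesis using upper lower True by (simp add: mult.assoc)
  next
    case False
    then have "t * d \<le> 0" using assms by (simp add: mult_nonneg_nonpos)
    then have "exp (t * d) \<le> 1" by simp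
    then have "\<bar>exp (t * d) - 1\<bar> \<le> t * \<bar>d\<bar>" using lower False by simp
    also have "t * \<bar>d\<bar> * 1 \<le> t * \<bar>d\<bar> * exp M" using assms e1 by (intro mult_left_mono) auto
    finally show ?thesis by (simp add: mult.assoc)
  qed
  then show ?thesis using assms by (simp add: divide_le_eq mult.commute)
qed

lemma exp_difference_quotient_LIMSEQ:
  fixes d :: real
  shows "(\<lambda>m. (exp (1 / real (m + 2) * d) - 1) / (1 / real (m + 2))) \<longlonglongrightarrow> d"
proof -
  have "DERIV (\<lambda>t. exp (t * d)) 0 :> exp (0 * d) * (1 * d)"
    by (intro derivative_eq_intros refl) auto
  then have "((\<lambda>h. (exp (h * d) - 1) / h) \<longlongrightarrow> d) (at 0)" by (simp add: DERIV_def)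
  moreover have "filterlim (\<lambda>m. 1 / real (m + 2)) (at 0) sequentially"
  proof -
    have "(\<lambda>m. 1 / real (m + 2)) \<longlonglongrightarrow> 0"
      using LIMSEQ_ignore_initial_segment[OF LIMSEQ_inverse_real_of_nat, of 1] by (simp add: inverse_eq_divide add.commute)
    then show ?thesis unfolding filterlim_at by (simp add: eventually_sequentially)
  qed
  ultimately show ?thesis by (rule filterlim_compose)
qed

lemma integral_gibbs_pos:
  fixes f :: "'a::euclidean_space \<Rightarrow> ereal"
  assumes f: "f \<in> convex_lsc" and i: "integrable lborel (gibbs f)" and r: "0 < r" "\<And>x. x \<in> cball x0 r \<Longrightarrow> f x < \<infinity>"
  shows "0 < gibbs_mass f"
proof -
  have "0 < (\<integral>\<^sup>+x. ennreal (gibbs f x) \<partial>lborel)"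
    using pos_integral_of_interior_dom[OF f r] nn_integral_exp_minus_eq[OF f] by simp
  also have "\<dots> = ennreal (gibbs_mass f)" using i by (intro nn_integral_eq_integral) auto
  finally show ?thesis by simp
qed

lemma conjugate_bounded_dom:
  fixes f :: "'a::euclidean_space \<Rightarrow> ereal"
  assumes f: "f \<in> convex_lsc" and R: "\<And>x. R < norm x \<Longrightarrow> f x = \<infinity>" and "0 \<le> R"
  obtains C where "0 \<le> C" "\<And>x. ereal (- C) \<le> f x" "\<And>y. conjugate f y \<le> ereal (R * norm y + C)"
proof -
  obtain y0 c where yc: "\<And>z. ereal (z \<bullet> y0 - c) \<le> f z" using affine_minorant[OF f] by blast
  define C where "C = R * norm y0 + \<bar>c\<bar>"
  have low: "ereal (- C) \<le> f x" for x
  proof (cases "R < norm x")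
    case False
    have "\<bar>x \<bullet> y0\<bar> \<le> norm x * norm y0" by (rule Cauchy_Schwarz_ineq2)
    also have "\<dots> \<le> R * norm y0" using False by (intro mult_right_mono) auto
    finally have "- C \<le> x \<bullet> y0 - c" unfolding C_def by linarith
    then show ?thesis using yc[of x] by (meson ereal_less_eq(3) order_trans)
  qed (simp add: R)
  have "conjugate f y \<le> ereal (R * norm y + C)" for y
    unfolding conjugate_le_iff
  proof
    fix x show "ereal (x \<bullet> y - (R * norm y + C)) \<le> f x"
    proof (cases "R < norm x")
      case False
      have "\<bar>x \<bullet> y\<bar> \<le> norm x * norm y" by (rule Cauchy_Schwarz_ineq2)
      also have "\<dots> \<le> R * norm y" using False by (intro mult_right_mono) auto
      finally have "x \<bullet> y - (R * norm y + C) \<le> - C" by linarith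
      then show ?thesis using low[of x] by (meson ereal_less_eq(3) order_trans)
    qed (simp add: R)
  qed
  moreover have "0 \<le> C" using assms(3) by (simp add: C_def)
  ultimately show ?thesis using low that by blast
qed

text \<open>
  The tangent inequality for a finite potential \<open>U\<close> whose conjugate has bounded domain.
  Along the segment \<open>(1 - t) U\<^sup>* + t f\<^sup>*\<close> of conjugates, Prekopa--Leindler
  bounds the mass from below, while evaluating the conjugate of the combination at \<open>grad U
  x\<close> bounds its density by \<open>exp (t D x)\<close> times \<open>gibbs U x\<close>. Here
  \<open>D x\<close> is \<open>f\<^sup>* - U\<^sup>*\<close> at the gradient. As
  \<open>f\<^sup>*\<close> is bounded above on the domain of \<open>U\<^sup>*\<close>, \<open>D\<close>
  is bounded above and \<open>t\<close> can tend to \<open>0\<close> by dominated convergence.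
\<close>
theorem tangent_inequality_lipschitz:
  fixes U f :: "'a::euclidean_space \<Rightarrow> ereal"
  assumes U: "U \<in> convex_lsc" and fin: "\<And>x. U x \<noteq> \<infinity>" and co: "0 < a" "\<And>x. ereal (a * norm x - b) \<le> U x"
    and k: "\<And>y. k < norm y \<Longrightarrow> conjugate U y = \<infinity>"
    and f: "f \<in> convex_lsc" and R: "\<And>x. R < norm x \<Longrightarrow> f x = \<infinity>" "0 \<le> R"
    and \<zeta>: "0 < gibbs_mass f" "integrable lborel (gibbs f)"
  defines "D \<equiv> \<lambda>x. real_of_ereal (conjugate f (grad U x)) - (x \<bullet> grad U x - real_of_ereal (U x))"
  shows "integrable lborel (\<lambda>x. D x * gibbs U x)"
    "gibbs_mass U * (ln (gibbs_mass f) - ln (gibbs_mass U)) \<le> (\<integral>x. D x * gibbs U x \<partial>lborel)"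
proof -
  obtain C where C: "0 \<le> C" "\<And>x. ereal (- C) \<le> f x" "\<And>y. conjugate f y \<le> ereal (R * norm y + C)"
    using conjugate_bounded_dom[OF f R] by metis
  have Udom: "effective_dom U = UNIV" using fin by (auto simp: effective_dom_def less_top)
  have Ureal: "U x = ereal (real_of_ereal (U x))" for x by (rule effective_dom_real[OF U]) (simp add: Udom)
  define W where "W = conjugate U"
  have W: "W \<in> convex_lsc" unfolding W_def by (rule conjugate_convex_lsc[OF U])
  have fc: "conjugate f \<in> convex_lsc" by (rule conjugate_convex_lsc[OF f])
  obtain c0 r0 where c0: "f c0 = ereal r0" using convex_lscD(4)[OF f] by blast
  define F where "F y = real_of_ereal (conjugate f y)" for y
  have Freal: "conjugate f y = ereal (F y)" for y
    using C(3)[of y] convex_lscD(3)[OF fc, of y] unfolding F_def by (cases "conjugate f y") auto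
  have Fup: "F y \<le> R * norm y + C" for y using C(3)[of y] by (simp add: Freal)
  have Flow: "c0 \<bullet> y - r0 \<le> F y" for y
    using conjugate_lower_bound[of f c0 r0 y] c0 by (simp add: Freal)
  have kpos: "0 \<le> k"
  proof (rule ccontr)
    assume "\<not> 0 \<le> k"
    then have "k < norm y" for y :: 'a using norm_ge_zero[of y] by linarith
    then have "conjugate U y = \<infinity>" for y using k by blast
    then show False using convex_lscD(4)[OF W] by (auto simp: W_def)
  qed
  define A0 where "A0 = \<bar>real_of_ereal (U 0)\<bar>"
  have A0: "0 \<le> A0" "real_of_ereal (U 0) \<le> A0" unfolding A0_def by linarith+
  \<comment> \<open>an upper bound of \<open>f\<^sup>* - U\<^sup>*\<close> on the ball of radius \<open>k\<close>, where \<open>U\<^sup>*\<close> can be finite\<close>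
  define M where "M = R * k + C + A0"
  have M0: "0 \<le> M" unfolding M_def
    by (intro add_nonneg_nonneg mult_nonneg_nonneg A0 R(2) kpos C(1))
  have Wlow: "ereal (- A0) \<le> W y" for y
  proof -
    have "ereal (0 \<bullet> y - real_of_ereal (U 0)) \<le> W y"
      unfolding W_def by (rule conjugate_lower_bound) (simp add: Ureal[symmetric])
    moreover have "- A0 \<le> 0 \<bullet> y - real_of_ereal (U 0)" using A0 by simp
    ultimately show ?thesis by (meson ereal_less_eq(3) order_trans)
  qed
  have FW: "ereal (F y - M) \<le> W y" for y
  proof (cases "k < norm y")
    case False
    have "R * norm y \<le> R * k" using False R(2) by (intro mult_left_mono) auto
    then have "F y - M \<le> - A0" using Fup[of y] by (simp add: M_def)
    then show ?thesis using Wlow[of y] by (meson ereal_less_eq(3) order_trans)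
  qed (simp add: k W_def)
  have [measurable]: "U \<in> borel_measurable borel" "grad U \<in> borel_measurable borel" "gibbs U \<in> borel_measurable borel"
    "f \<in> borel_measurable borel" "gibbs f \<in> borel_measurable borel" "F \<in> borel_measurable borel"
    using borel_measurable_convex_lsc[OF fc]
    by (auto intro: borel_measurable_convex_lsc[OF U] borel_measurable_convex_lsc[OF f] borel_measurable_grad[OF U] borel_measurable_gibbs
        simp: F_def[abs_def])
  have Dm[measurable]: "D \<in> borel_measurable borel"
    unfolding D_def F_def[symmetric] by measurable
  have gU: "integrable lborel (gibbs U)" by (rule integrable_gibbs_coercive[OF _ co]) simp
  \<comment> \<open>gradients of \<open>U\<close> lie in the bounded domain of its conjugate\<close>
  have gradW: "W (grad U x) = ereal (x \<bullet> grad U x - real_of_ereal (U x))" "norm (grad U x) \<le> k"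
    if "grad_exists U x" for x
  proof -
    show *: "W (grad U x) = ereal (x \<bullet> grad U x - real_of_ereal (U x))"
      unfolding W_def by (rule conjugate_at_grad[OF U that])
    show "norm (grad U x) \<le> k" using k[of "grad U x"] * by (force simp: W_def not_le)
  qed
  have gradk: "norm (grad U x) \<le> k" for x
    using gradW(2)[of x] grad_not_exists[of U x] kpos by (cases "grad_exists U x") auto
  have ae: "AE x in lborel. grad_exists U x"
    using AE_grad_exists[OF U] by (simp add: Udom)
  have DM: "D x \<le> M" if "grad_exists U x" for x
    using FW[of "grad U x"] gradW(1)[OF that] by (simp add: D_def F_def)
  show Di: "integrable lborel (\<lambda>x. D x * gibbs U x)"
  proof -
    have "integrable lborel (\<lambda>x. F (grad U x) * gibbs U x)"
    proof (rule Bochner_Integration.integrable_bound[OF integrable_mult_right[OF gU, of "R * k + C + norm c0 * k + \<bar>r0\<bar>"]])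
      show "AE x in lborel. norm (F (grad U x) * gibbs U x) \<le> norm ((R * k + C + norm c0 * k + \<bar>r0\<bar>) * gibbs U x)"
      proof (rule AE_I2)
        fix x
        have "R * norm (grad U x) \<le> R * k" "norm c0 * norm (grad U x) \<le> norm c0 * k"
          using gradk R(2) by (auto intro!: mult_left_mono)
        moreover have "\<bar>c0 \<bullet> grad U x\<bar> \<le> norm c0 * norm (grad U x)" by (rule Cauchy_Schwarz_ineq2)
        moreover have "0 \<le> R * k" "0 \<le> norm c0 * k" using R(2) kpos by auto
        ultimately have "\<bar>F (grad U x)\<bar> \<le> R * k + C + norm c0 * k + \<bar>r0\<bar>"
          using Fup[of "grad U x"] Flow[of "grad U x"] C(1) by linarith
        also have "\<dots> \<le> \<bar>R * k + C + norm c0 * k + \<bar>r0\<bar>\<bar>" by simp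
        finally show "norm (F (grad U x) * gibbs U x) \<le> norm ((R * k + C + norm c0 * k + \<bar>r0\<bar>) * gibbs U x)"
          by (simp add: abs_mult mult_right_mono)
      qed
    qed measurable
    moreover have "integrable lborel (\<lambda>x. (x \<bullet> grad U x) * gibbs U x)"
      using gibbs_moments(2)[OF U _ co finite_imp_ray_regular[OF fin], of 0] by (simp add: Udom)
    moreover have "integrable lborel (\<lambda>x. real_of_ereal (U x) * gibbs U x)"
      by (rule integrable_real_gibbs[OF U co])
    ultimately have "integrable lborel (\<lambda>x. F (grad U x) * gibbs U x - (x \<bullet> grad U x) * gibbs U x + real_of_ereal (U x) * gibbs U x)"
      by (intro Bochner_Integration.integrable_add Bochner_Integration.integrable_diff)
    then show ?thesis by (simp add: D_def F_def algebra_simps)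
  qed
  define Z where "Z = gibbs_mass U"
  define \<zeta>' where "\<zeta>' = gibbs_mass f"
  have Z: "0 < Z" unfolding Z_def by (rule integral_gibbs_pos[OF U gU, of 1 0]) (use fin in \<open>auto simp: less_top\<close>)
  have \<zeta>': "0 < \<zeta>'" using \<zeta> by (simp add: \<zeta>'_def)
  \<comment> \<open>Prekopa--Leindler along the segment of conjugates\<close>
  have pl: "Z powr (1 - t) * \<zeta>' powr t \<le> (\<integral>x. exp (t * D x) * gibbs U x \<partial>lborel)"
    and ti: "integrable lborel (\<lambda>x. exp (t * D x) * gibbs U x)"
    if t: "0 < t" "t < 1" for t
  proof -
    define q where "q y = ereal (1 - t) * W y + ereal (t * F y)" for y
    define \<psi> where "\<psi> = conjugate q"
    have \<psi>up: "\<psi> ((1 - t) *\<^sub>R x + t *\<^sub>R z) \<le> ereal ((1 - t) * real_of_ereal (U x) + t * r)" if "f z = ereal r" for x z r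
      unfolding \<psi>_def conjugate_le_iff
    proof
      fix y
      have 1: "ereal (x \<bullet> y - real_of_ereal (U x)) \<le> W y"
        unfolding W_def by (rule conjugate_lower_bound) (simp add: Ureal[symmetric])
      have 2: "z \<bullet> y - r \<le> F y" using conjugate_lower_bound[of f z r y] that by (simp add: Freal)
      show "ereal (y \<bullet> ((1 - t) *\<^sub>R x + t *\<^sub>R z) - ((1 - t) * real_of_ereal (U x) + t * r)) \<le> q y"
      proof (cases "W y")
        case (real s)
        have "(1 - t) * (x \<bullet> y - real_of_ereal (U x)) \<le> (1 - t) * s" using 1 real t by (intro mult_left_mono) auto
        moreover have "t * (z \<bullet> y - r) \<le> t * F y" using 2 t by (intro mult_left_mono) auto
        ultimately show ?thesis using real by (simp add: q_def inner_add_right inner_commute[of y] algebra_simps)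
      next
        case PInf
        then show ?thesis using t by (simp add: q_def)
      next
        case MInf
        then show ?thesis using 1 by simp
      qed
    qed
    have \<psi>low: "ereal (real_of_ereal (U x) - t * (F y - w)) \<le> \<psi> x"
      if "W y = ereal w" "real_of_ereal (U x) = x \<bullet> y - w" for x y w
    proof -
      have "ereal (x \<bullet> y) - q y = ereal (real_of_ereal (U x) - t * (F y - w))"
      proof -
        have "ereal (x \<bullet> y) - q y = ereal (x \<bullet> y - ((1 - t) * w + t * F y))" by (simp add: q_def that(1))
        also have "x \<bullet> y - ((1 - t) * w + t * F y) = real_of_ereal (U x) - t * (F y - w)"
          unfolding that(2) by (simp add: algebra_simps)
        finally show ?thesis .
      qed
      then show ?thesis using conjugate_upper[of y x q] unfolding \<psi>_def by (simp add: inner_commute)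
    qed
    have bound: "gibbs \<psi> x \<le> exp (t * D x) * gibbs U x" if ge: "grad_exists U x" for x
    proof -
      have "ereal (real_of_ereal (U x) - t * D x) \<le> \<psi> x"
        using \<psi>low[OF gradW(1)[OF ge], of x] by (simp add: D_def F_def)
      then have "gibbs \<psi> x \<le> exp (- (real_of_ereal (U x) - t * D x))" by (rule gibbs_le)
      also have "\<dots> = exp (t * D x) * exp (- real_of_ereal (U x))" by (simp flip: exp_add)
      also have "exp (- real_of_ereal (U x)) = gibbs U x" using gibbs_simps(1)[of U x] Ureal by metis
      finally show ?thesis .
    qed
    have \<psi>m[measurable]: "gibbs \<psi> \<in> borel_measurable borel"
      unfolding \<psi>_def by (intro borel_measurable_gibbs borel_measurable_lsc lsc_conjugate)
    show ti: "integrable lborel (\<lambda>x. exp (t * D x) * gibbs U x)"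
    proof (rule Bochner_Integration.integrable_bound[OF integrable_mult_right[OF gU, of "exp M"]])
      show "AE x in lborel. norm (exp (t * D x) * gibbs U x) \<le> norm (exp M * gibbs U x)"
        using ae
      proof eventually_elim
        case (elim x)
        have "t * D x \<le> M"
        proof (cases "0 \<le> D x")
          case True
          then have "t * D x \<le> 1 * M" using DM[OF elim] t by (intro mult_mono) auto
          then show ?thesis by simp
        next
          case False
          then show ?thesis using t M0 by (smt (verit) mult_pos_neg)
        qed
        then show ?case by (simp add: abs_mult mult_right_mono)
      qed
    qed measurable
    have \<psi>i: "integrable lborel (gibbs \<psi>)"
      by (rule Bochner_Integration.integrable_bound[OF ti]) (use ae bound in \<open>auto elim!: eventually_mono\<close>)
    have "Z powr (1 - t) * \<zeta>' powr t \<le> (\<integral>x. gibbs \<psi> x \<partial>lborel)"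
      unfolding Z_def \<zeta>'_def
    proof (rule prekopa_leindler[OF gU \<zeta>(2) \<psi>i _ _ _ t])
      fix x z
      show "gibbs U x powr (1 - t) * gibbs f z powr t \<le> gibbs \<psi> ((1 - t) *\<^sub>R x + t *\<^sub>R z)"
      proof (cases "f z")
        case (real r)
        define y where "y = (1 - t) *\<^sub>R x + t *\<^sub>R z"
        have up: "\<psi> y \<le> ereal ((1 - t) * real_of_ereal (U x) + t * r)" unfolding y_def by (rule \<psi>up[OF real])
        have nb: "\<psi> y \<noteq> -\<infinity>"
        proof -
          obtain y1 w1 where "W y1 = ereal w1" using convex_lscD(4)[OF W] by blast
          then have "q y1 = ereal ((1 - t) * w1 + t * F y1)" by (simp add: q_def)
          then have "ereal (y1 \<bullet> y - ((1 - t) * w1 + t * F y1)) \<le> \<psi> y"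
            unfolding \<psi>_def by (intro conjugate_lower_bound) simp
          then show ?thesis by auto
        qed
        have "gibbs U x = exp (- real_of_ereal (U x))" using gibbs_simps(1)[of U x] Ureal by metis
        then have "gibbs U x powr (1 - t) * gibbs f z powr t = exp (- ((1 - t) * real_of_ereal (U x) + t * r))"
          using real by (simp add: gibbs_simps powr_def algebra_simps flip: exp_add)
        also have "\<dots> \<le> gibbs \<psi> y"
          using up nb by (cases "\<psi> y") (auto simp: gibbs_simps)
        finally show ?thesis by (simp add: y_def)
      qed (use convex_lscD(3)[OF f] in \<open>auto simp: gibbs_simps\<close>)
    qed auto
    also have "\<dots> \<le> (\<integral>x. exp (t * D x) * gibbs U x \<partial>lborel)"
      using ae bound by (intro integral_mono_AE \<psi>i ti) (auto elim!: eventually_mono)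
    finally show "Z powr (1 - t) * \<zeta>' powr t \<le> (\<integral>x. exp (t * D x) * gibbs U x \<partial>lborel)" .
  qed
  \<comment> \<open>the shift by \<open>2\<close> keeps \<open>\<tau> m\<close> strictly below \<open>1\<close>\<close>
  define \<tau> where "\<tau> m = 1 / real (m + 2)" for m
  have \<tau>: "0 < \<tau> m" "\<tau> m < 1" for m by (auto simp: \<tau>_def)
  have step: "Z * (ln \<zeta>' - ln Z) \<le> (\<integral>x. (exp (\<tau> m * D x) - 1) / \<tau> m * gibbs U x \<partial>lborel)" for m
  proof -
    let ?t = "\<tau> m"
    define J where "J = (\<integral>x. exp (?t * D x) * gibbs U x \<partial>lborel)"
    have "Z powr (1 - ?t) * \<zeta>' powr ?t = Z * exp (?t * (ln \<zeta>' - ln Z))"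
    proof -
      have "Z powr (1 - ?t) * \<zeta>' powr ?t = exp (ln Z + ?t * (ln \<zeta>' - ln Z))"
        using Z \<zeta>' by (simp add: powr_def algebra_simps flip: exp_add)
      then show ?thesis using Z by (simp add: exp_add)
    qed
    then have "Z * exp (?t * (ln \<zeta>' - ln Z)) \<le> J" using pl[OF \<tau>, of m] by (simp add: J_def)
    moreover have "Z * (1 + ?t * (ln \<zeta>' - ln Z)) \<le> Z * exp (?t * (ln \<zeta>' - ln Z))"
      using Z exp_ge_add_one_self by (intro mult_left_mono) auto
    ultimately have "?t * (Z * (ln \<zeta>' - ln Z)) \<le> J - Z" by (simp add: algebra_simps)
    then have "Z * (ln \<zeta>' - ln Z) \<le> (J - Z) / ?t" using \<tau>[of m] by (simp add: le_divide_eq mult.commute)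
    also have "(J - Z) / ?t = (\<integral>x. (exp (?t * D x) * gibbs U x - gibbs U x) / ?t \<partial>lborel)"
      unfolding J_def Z_def using ti[OF \<tau>] gU by simp
    also have "(\<lambda>x. (exp (?t * D x) * gibbs U x - gibbs U x) / ?t) = (\<lambda>x. (exp (?t * D x) - 1) / ?t * gibbs U x)"
      by (auto simp: algebra_simps diff_divide_distrib)
    finally show ?thesis .
  qed
  have "(\<lambda>m. \<integral>x. (exp (\<tau> m * D x) - 1) / \<tau> m * gibbs U x \<partial>lborel) \<longlonglongrightarrow> (\<integral>x. D x * gibbs U x \<partial>lborel)"
  proof (rule integral_dominated_convergence[where w="\<lambda>x. exp M * \<bar>D x * gibbs U x\<bar>"])
    show "integrable lborel (\<lambda>x. exp M * \<bar>D x * gibbs U x\<bar>)" using Di by simp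
    show "AE x in lborel. (\<lambda>m. (exp (\<tau> m * D x) - 1) / \<tau> m * gibbs U x) \<longlonglongrightarrow> D x * gibbs U x"
      unfolding \<tau>_def by (intro AE_I2 tendsto_mult exp_difference_quotient_LIMSEQ tendsto_const)
    fix m
    show "AE x in lborel. norm ((exp (\<tau> m * D x) - 1) / \<tau> m * gibbs U x) \<le> exp M * \<bar>D x * gibbs U x\<bar>"
      using ae
    proof eventually_elim
      case (elim x)
      have "\<bar>(exp (\<tau> m * D x) - 1) / \<tau> m\<bar> \<le> \<bar>D x\<bar> * exp M"
        using \<tau>[of m] by (intro exp_difference_quotient_bound DM[OF elim] M0) auto
      then have "\<bar>(exp (\<tau> m * D x) - 1) / \<tau> m\<bar> * gibbs U x \<le> \<bar>D x\<bar> * exp M * gibbs U x"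
        by (rule mult_right_mono) simp
      then show ?case by (simp only: real_norm_def abs_mult abs_of_nonneg[OF gibbs_nonneg] mult.commute mult.left_commute)
    qed
  qed measurable
  then have "Z * (ln \<zeta>' - ln Z) \<le> (\<integral>x. D x * gibbs U x \<partial>lborel)"
    by (rule LIMSEQ_le_const) (use step in blast)
  then show "gibbs_mass U * (ln (gibbs_mass f) - ln (gibbs_mass U)) \<le> (\<integral>x. D x * gibbs U x \<partial>lborel)"
    by (simp add: Z_def \<zeta>'_def)
qed

section \<open>Truncation and Lipschitz regularisation\<close>

definition cutoff :: "real \<Rightarrow> ('a::real_normed_vector \<Rightarrow> ereal) \<Rightarrow> 'a \<Rightarrow> ereal" where
  "cutoff k g y = (if norm y \<le> k then g y else \<infinity>)"

lemma cutoff_ge: "g y \<le> cutoff k g y"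
  by (simp add: cutoff_def)

lemma cutoff_convex_lsc:
  fixes g :: "'a::real_normed_vector \<Rightarrow> ereal"
  assumes g: "g \<in> convex_lsc" and y0: "norm y0 \<le> k" "g y0 \<noteq> \<infinity>"
  shows "cutoff k g \<in> convex_lsc"
proof -
  have "convex_ereal (cutoff k g)"
    unfolding convex_ereal_def
  proof (intro allI ballI)
    fix x y :: 'a and t :: real assume t: "t \<in> {0..1}"
    show "cutoff k g ((1 - t) *\<^sub>R x + t *\<^sub>R y) \<le> ereal (1 - t) * cutoff k g x + ereal t * cutoff k g y"
    proof (cases "t = 0 \<or> t = 1")
      case True
      then show ?thesis by (auto simp flip: zero_ereal_def one_ereal_def)
    next
      case False
      then have t: "0 < t" "t < 1" using t by auto
      show ?thesis
      proof (cases "norm x \<le> k \<and> norm y \<le> k")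
        case True
        then have "(1 - t) *\<^sub>R x + t *\<^sub>R y \<in> cball 0 k"
          using convexD_alt[OF convex_cball, of x 0 k y t] t by auto
        moreover have "g ((1 - t) *\<^sub>R x + t *\<^sub>R y) \<le> ereal (1 - t) * g x + ereal t * g y"
          using convex_lscD(1)[OF g] t unfolding convex_ereal_def by auto
        ultimately show ?thesis using True by (simp add: cutoff_def)
      next
        case False
        then have "cutoff k g x = \<infinity> \<or> cutoff k g y = \<infinity>" by (auto simp: cutoff_def)
        moreover have "cutoff k g z \<noteq> -\<infinity>" for z using convex_lscD(3)[OF g] by (simp add: cutoff_def)
        ultimately have inf: "ereal (1 - t) * cutoff k g x + ereal t * cutoff k g y = \<infinity>"
          using t by (cases "cutoff k g x"; cases "cutoff k g y") auto
        show ?thesis unfolding inf by simp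
      qed
    qed
  qed
  moreover have "lsc (cutoff k g)"
    unfolding lsc_iff_eventually
  proof (intro allI impI)
    fix x a assume a: "a < cutoff k g x"
    show "\<forall>\<^sub>F y in nhds x. a < cutoff k g y"
    proof (cases "norm x \<le> k")
      case True
      then have "\<forall>\<^sub>F y in nhds x. a < g y"
        using a convex_lscD(2)[OF g] unfolding lsc_iff_eventually by (simp add: cutoff_def)
      then show ?thesis by eventually_elim (use cutoff_ge less_le_trans in blast)
    next
      case False
      have "((\<lambda>y. norm y) \<longlongrightarrow> norm x) (nhds x)" by (intro tendsto_intros filterlim_ident)
      then have "\<forall>\<^sub>F y in nhds x. k < norm y" using False by (intro order_tendstoD) auto
      then show ?thesis by eventually_elim (use a False in \<open>auto simp: cutoff_def\<close>)
    qed
  qed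
  moreover have "cutoff k g x \<noteq> -\<infinity>" for x using convex_lscD(3)[OF g] by (simp add: cutoff_def)
  moreover have "cutoff k g y0 \<noteq> \<infinity>" using y0 by (simp add: cutoff_def)
  ultimately show ?thesis unfolding convex_lsc_def by blast
qed

text \<open>
  If \<open>V\<close> has an affine minorant of slope at most \<open>k\<close>, this is its largest
  \<open>k\<close>-Lipschitz convex minorant, also known as the infimal convolution of \<open>V\<close>
  with \<open>k\<close> times the norm, in the dual description: slopes longer than \<open>k\<close> are
  forbidden.
\<close>
definition lipreg :: "real \<Rightarrow> ('a::euclidean_space \<Rightarrow> ereal) \<Rightarrow> 'a \<Rightarrow> ereal" where
  "lipreg k V = conjugate (cutoff k (conjugate V))"

lemma lipreg_le:
  assumes "V \<in> convex_lsc" shows "lipreg k V x \<le> V x"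
proof -
  have "conjugate (cutoff k (conjugate V)) x \<le> conjugate (conjugate V) x"
    by (rule conjugate_mono) (rule cutoff_ge)
  then show ?thesis by (simp add: lipreg_def biconjugate[OF assms])
qed

lemma lipreg_ge:
  assumes "norm y \<le> k" "conjugate V y \<le> ereal w"
  shows "ereal (x \<bullet> y - w) \<le> lipreg k V x"
  using conjugate_lower_bound[of "cutoff k (conjugate V)" y w x] assms
  by (simp add: lipreg_def cutoff_def inner_commute)

lemma conjugate_le_of_coercive:
  fixes V :: "'a::real_inner \<Rightarrow> ereal"
  assumes co: "0 < a" "\<And>x. ereal (a * norm x - b) \<le> V x" and y: "norm y \<le> a"
  shows "conjugate V y \<le> ereal b"
  unfolding conjugate_le_iff
proof
  fix x
  have "x \<bullet> y \<le> norm x * norm y" by (rule norm_cauchy_schwarz)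
  also have "\<dots> \<le> norm x * a" using y by (intro mult_left_mono) auto
  finally have "x \<bullet> y - b \<le> a * norm x - b" by (simp add: mult.commute)
  then show "ereal (x \<bullet> y - b) \<le> V x" using co(2)[of x] by (meson ereal_less_eq(3) order_trans)
qed

text \<open>
  The growth of \<open>V\<close> makes its conjugate finite on the ball of radius \<open>a\<close>,
  which is why the regularisation is proper and keeps the same linear growth as soon as \<open>k \<ge>
  a\<close>.
\<close>
lemma lipreg_properties:
  fixes V :: "'a::euclidean_space \<Rightarrow> ereal"
  assumes V: "V \<in> convex_lsc" and co: "0 < a" "\<And>x. ereal (a * norm x - b) \<le> V x" and k: "a \<le> k"
  shows "lipreg k V \<in> convex_lsc" "ereal (a * norm x - b) \<le> lipreg k V x" "lipreg k V x \<noteq> \<infinity>"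
    "conjugate (lipreg k V) = cutoff k (conjugate V)"
proof -
  have W: "conjugate V \<in> convex_lsc" by (rule conjugate_convex_lsc[OF V])
  have W0: "conjugate V 0 \<le> ereal b" using co by (intro conjugate_le_of_coercive) auto
  have cW: "cutoff k (conjugate V) \<in> convex_lsc"
    using W0 co(1) k by (intro cutoff_convex_lsc[OF W, of 0]) auto
  show "lipreg k V \<in> convex_lsc" unfolding lipreg_def by (rule conjugate_convex_lsc[OF cW])
  show "conjugate (lipreg k V) = cutoff k (conjugate V)" unfolding lipreg_def by (rule biconjugate[OF cW])
  show "ereal (a * norm x - b) \<le> lipreg k V x"
  proof -
    define y where "y = (a / norm x) *\<^sub>R x"
    have "norm y \<le> a" using co(1) by (simp add: y_def)
    then have "ereal (x \<bullet> y - b) \<le> lipreg k V x"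
      using k co by (intro lipreg_ge conjugate_le_of_coercive) auto
    moreover have "x \<bullet> y = a * norm x" by (simp add: y_def dot_square_norm power2_eq_square)
    ultimately show ?thesis by simp
  qed
  obtain x1 r1 where x1: "V x1 = ereal r1" using convex_lscD(4)[OF V] by blast
  have "lipreg k V x \<le> ereal (norm x * k + norm x1 * k + \<bar>r1\<bar>)"
    unfolding lipreg_def conjugate_le_iff
  proof
    fix y
    show "ereal (y \<bullet> x - (norm x * k + norm x1 * k + \<bar>r1\<bar>)) \<le> cutoff k (conjugate V) y"
    proof (cases "norm y \<le> k")
      case True
      have "\<bar>y \<bullet> x\<bar> \<le> norm y * norm x" "\<bar>x1 \<bullet> y\<bar> \<le> norm x1 * norm y" by (rule Cauchy_Schwarz_ineq2)+
      moreover have "norm y * norm x \<le> k * norm x" "norm x1 * norm y \<le> norm x1 * k"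
        using True by (auto intro: mult_right_mono mult_left_mono)
      ultimately have "y \<bullet> x - (norm x * k + norm x1 * k + \<bar>r1\<bar>) \<le> x1 \<bullet> y - r1" by (simp add: mult.commute)
      moreover have "ereal (x1 \<bullet> y - r1) \<le> conjugate V y" by (rule conjugate_lower_bound) (simp add: x1)
      ultimately show ?thesis using True by (simp add: cutoff_def) (meson ereal_less_eq(3) order_trans)
    qed (simp add: cutoff_def)
  qed
  then show "lipreg k V x \<noteq> \<infinity>" by auto
qed

text \<open>
  Where the gradient of \<open>V\<close> is shorter than \<open>k\<close>, the tangent plane of
  \<open>V\<close> survives the truncation of slopes, so regularisation changes neither the value nor
  the gradient.
\<close>
lemma lipreg_at_grad:
  fixes V :: "'a::euclidean_space \<Rightarrow> ereal"
  assumes V: "V \<in> convex_lsc" and x: "grad_exists V x" "norm (grad V x) \<le> k"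
  shows "lipreg k V x = V x" "lipreg k V \<in> convex_lsc \<Longrightarrow> grad_exists (lipreg k V) x \<Longrightarrow> grad (lipreg k V) x = grad V x"
proof -
  have xd: "x \<in> effective_dom V" using x(1) interior_subset unfolding grad_exists_def by blast
  note Vx = effective_dom_real[OF V xd]
  have low: "ereal (real_of_ereal (V x) + (z - x) \<bullet> grad V x) \<le> lipreg k V z" for z
  proof -
    have "ereal (z \<bullet> grad V x - (x \<bullet> grad V x - real_of_ereal (V x))) \<le> lipreg k V z"
      using conjugate_at_grad[OF V x(1)] x(2) by (intro lipreg_ge) auto
    then show ?thesis by (simp add: inner_diff_left algebra_simps)
  qed
  show eq: "lipreg k V x = V x"
    using low[of x] Vx by (intro antisym lipreg_le[OF V]) simp
  assume L: "lipreg k V \<in> convex_lsc" "grad_exists (lipreg k V) x"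
  have "grad V x = grad (lipreg k V) x"
    by (rule subgradient_unique[OF L]) (use low in \<open>simp add: eq\<close>)
  then show "grad (lipreg k V) x = grad V x" by simp
qed

text \<open>
  Continuity of \<open>a \<mapsto> e\<^sup>-\<^sup>a\<close> along sequences below their limit,
  including an infinite limit. The potential is \<open>id\<close> to speak of the values themselves.
\<close>
lemma gibbs_tendstoI:
  assumes V: "\<And>k. V k \<noteq> -\<infinity>" "V' \<noteq> -\<infinity>" and le: "\<And>k::nat. V k \<le> V'"
    and lim: "\<And>c. ereal c < V' \<Longrightarrow> \<forall>\<^sub>F k in sequentially. ereal c < V k"
  shows "(\<lambda>k. gibbs id (V k)) \<longlonglongrightarrow> gibbs id V'"
proof (rule order_tendstoI)
  fix c assume c: "c < gibbs id V'"
  have "gibbs id V' \<le> gibbs id (V k)" for k using le[of k] V(1)[of k] V(2)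
    by (cases "V k"; cases V') (auto simp: gibbs_simps)
  then have "c < gibbs id (V k)" for k using c by (rule less_le_trans[rotated])
  then show "\<forall>\<^sub>F k in sequentially. c < gibbs id (V k)" by simp
next
  fix c assume c: "gibbs id V' < c"
  then have cpos: "0 < c" using gibbs_nonneg[of id V'] by linarith
  have "ereal (- ln c) < V'"
  proof (cases V')
    case (real r)
    then have "exp (- r) < exp (ln c)" using c cpos by (simp add: gibbs_simps)
    then show ?thesis using real by (subst (asm) exp_less_cancel_iff) simp
  qed (use V in auto)
  from lim[OF this] show "\<forall>\<^sub>F k in sequentially. gibbs id (V k) < c"
  proof eventually_elim
    case (elim k)
    show ?case
    proof (cases "V k")
      case (real r)
      then have "exp (- r) < exp (ln c)" using elim by (subst exp_less_cancel_iff) simp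
      then show ?thesis using real cpos by (simp add: gibbs_simps)
    qed (use cpos elim in \<open>auto simp: gibbs_simps\<close>)
  qed
qed

lemma gibbs_lipreg_LIMSEQ:
  fixes V :: "'a::euclidean_space \<Rightarrow> ereal"
  assumes V: "V \<in> convex_lsc" and co: "0 < a" "\<And>x. ereal (a * norm x - b) \<le> V x" and k0: "a \<le> real k0"
  shows "(\<lambda>k. gibbs (lipreg (real (k + k0)) V) x) \<longlonglongrightarrow> gibbs V x"
proof -
  have "(\<lambda>k. gibbs id (lipreg (real (k + k0)) V x)) \<longlonglongrightarrow> gibbs id (V x)"
  proof (rule gibbs_tendstoI)
    show "lipreg (real (k + k0)) V x \<noteq> -\<infinity>" for k
      using k0 by (intro convex_lscD(3)[OF lipreg_properties(1)[OF V co]]) auto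
    show "V x \<noteq> -\<infinity>" by (rule convex_lscD(3)[OF V])
    show "lipreg (real (k + k0)) V x \<le> V x" for k by (rule lipreg_le[OF V])
    fix c assume "ereal c < V x"
    then have "ereal c < conjugate (conjugate V) x" by (simp add: biconjugate[OF V])
    then obtain y where y: "ereal c < ereal (y \<bullet> x) - conjugate V y"
      by (auto simp: conjugate_def[of "conjugate V"] less_SUP_iff)
    then obtain w where w: "conjugate V y = ereal w"
      using convex_lscD(3)[OF conjugate_convex_lsc[OF V], of y] by (cases "conjugate V y") auto
    obtain j :: nat where j: "norm y \<le> real j" using real_arch_simple by blast
    show "\<forall>\<^sub>F k in sequentially. ereal c < lipreg (real (k + k0)) V x"
      unfolding eventually_sequentially
    proof (intro exI[of _ j] allI impI)
      fix k assume "j \<le> k"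
      then have "ereal (x \<bullet> y - w) \<le> lipreg (real (k + k0)) V x"
        using j w by (intro lipreg_ge) auto
      moreover have "ereal c < ereal (x \<bullet> y - w)" using y w by (simp add: inner_commute)
      ultimately show "ereal c < lipreg (real (k + k0)) V x" by (rule less_le_trans[rotated])
    qed
  qed
  then show ?thesis by (simp add: gibbs_def)
qed

section \<open>The tangent inequality\<close>

lemma integral_gibbs_lipreg_LIMSEQ:
  fixes V :: "'a::euclidean_space \<Rightarrow> ereal"
  assumes V: "V \<in> convex_lsc" and co: "0 < a" "\<And>x. ereal (a * norm x - b) \<le> V x" and k0: "a \<le> real k0"
  shows "(\<lambda>k. \<integral>x. gibbs (lipreg (real (k + k0)) V) x \<partial>lborel) \<longlonglongrightarrow> gibbs_mass V"
proof (rule integral_dominated_convergence[where w="\<lambda>x. exp b * exp (- a * norm x)"])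
  show "integrable lborel (\<lambda>x::'a. exp b * exp (- a * norm x))"
    by (intro integrable_mult_right integrable_exp_norm co)
  show "AE x in lborel. (\<lambda>k. gibbs (lipreg (real (k + k0)) V) x) \<longlonglongrightarrow> gibbs V x"
    by (intro AE_I2 gibbs_lipreg_LIMSEQ[OF V co k0])
  show "gibbs V \<in> borel_measurable lborel"
    using borel_measurable_convex_lsc[OF V] by (simp add: borel_measurable_gibbs)
  fix k
  have ak: "a \<le> real (k + k0)" using k0 by simp
  note L = lipreg_properties[OF V co ak]
  show "gibbs (lipreg (real (k + k0)) V) \<in> borel_measurable lborel"
    using borel_measurable_convex_lsc[OF L(1)] by (simp add: borel_measurable_gibbs)
  show "AE x in lborel. norm (gibbs (lipreg (real (k + k0)) V) x) \<le> exp b * exp (- a * norm x)"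
  proof (rule AE_I2)
    fix x
    have "gibbs (lipreg (real (k + k0)) V) x \<le> exp (- (a * norm x - b))" by (rule gibbs_le) (rule L(2))
    then show "norm (gibbs (lipreg (real (k + k0)) V) x) \<le> exp b * exp (- a * norm x)"
      by (simp flip: exp_add)
  qed
qed

text \<open>
  Pass to the limit in the Lipschitz case. The quantity \<open>D\<close> is only bounded above by a
  multiple of the gradient, so its positive part could lose mass at infinity. It is subtracted from the
  dominating expression \<open>C1 + C3 P\<close>, where \<open>P\<close> bounds the norm of the gradient
  and its integral is known exactly, both for \<open>V\<close> and for the regularisations, from the
  integration by parts. The difference \<open>\<Gamma>\<close> is nonnegative, and a lower bound of its
  integral in the limit is enough.
\<close>
lemma tangent_inequality_bounded_dom:
  fixes V f :: "'a::euclidean_space \<Rightarrow> ereal"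
  assumes V: "V \<in> convex_lsc" and x0: "x0 \<in> interior (effective_dom V)"
    and co: "0 < a" "\<And>x. ereal (a * norm x - b) \<le> V x"
    and reg: "\<And>x0. ray_regular V x0" and one: "gibbs_mass V = 1"
    and f: "f \<in> convex_lsc" and R: "\<And>x. R < norm x \<Longrightarrow> f x = \<infinity>" "0 \<le> R"
    and \<zeta>: "0 < gibbs_mass f" "integrable lborel (gibbs f)"
  defines "D \<equiv> \<lambda>U x. real_of_ereal (conjugate f (grad U x)) - (x \<bullet> grad U x - real_of_ereal (U x))"
  assumes Fi: "integrable lborel (\<lambda>x. real_of_ereal (conjugate f (grad V x)) * gibbs V x)"
  shows "ln (gibbs_mass f) \<le> (\<integral>x. D V x * gibbs V x \<partial>lborel)"
proof -
  obtain C where C: "0 \<le> C" "\<And>x. ereal (- C) \<le> f x" "\<And>y. conjugate f y \<le> ereal (R * norm y + C)"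
    using conjugate_bounded_dom[OF f R] by metis
  define \<zeta>' where "\<zeta>' = gibbs_mass f"
  obtain r m where r: "0 < r" "\<And>x. x \<in> cball x0 r \<Longrightarrow> V x \<le> ereal m"
    using convex_lsc_bounded_near[OF V x0] by metis
  define n where "n = real DIM('a)"
  define C1 where "C1 = C + m"
  \<comment> \<open>\<open>f\<^sup>*\<close> grows at rate \<open>R\<close> and \<open>V\<^sup>*\<close> decreases at rate at most \<open>norm x0\<close>, while \<open>P\<close> is at least \<open>r\<close> times the norm of the gradient\<close>
  define C3 where "C3 = (R + norm x0) / r"
  have C3: "0 \<le> C3" using R(2) r(1) by (simp add: C3_def)
  define P where "P U x = (x - x0) \<bullet> grad U x + m + b" for U and x :: 'a
  define \<Gamma> where "\<Gamma> U x = C1 + C3 * P U x - D U x" for U and x :: 'a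
  \<comment> \<open>the next facts are needed both for \<open>V\<close> and for its Lipschitz regularisations\<close>
  have \<Gamma>0: "0 \<le> \<Gamma> U x"
    if U: "U \<in> convex_lsc" "\<And>x. ereal (a * norm x - b) \<le> U x" "\<And>x. U x \<le> V x" and ge: "grad_exists U x" for U x
  proof -
    define y where "y = grad U x"
    have m: "U z \<le> ereal m" if "z \<in> cball x0 r" for z using r(2)[OF that] U(3) order_trans by blast
    have rP: "r * norm y \<le> P U x"
      unfolding P_def y_def
      by (rule norm_grad_bound[OF U(1) r(1)]) (use m coercive_lower[OF co(1) U(2)] in auto)
    have up: "real_of_ereal (conjugate f y) \<le> R * norm y + C"
      using C(3)[of y] convex_lscD(3)[OF conjugate_convex_lsc[OF f], of y] by (cases "conjugate f y") auto
    have "ereal (x0 \<bullet> y - m) \<le> conjugate U y" using m[of x0] r(1) by (intro conjugate_lower_bound) simp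
    then have lo: "x0 \<bullet> y - m \<le> x \<bullet> y - real_of_ereal (U x)"
      using conjugate_at_grad[OF U(1) ge] by (simp add: y_def)
    have "\<bar>x0 \<bullet> y\<bar> \<le> norm x0 * norm y" by (rule Cauchy_Schwarz_ineq2)
    then have "D U x \<le> (R + norm x0) * norm y + C1"
      using up lo by (simp add: D_def y_def[symmetric] C1_def algebra_simps)
    also have "(R + norm x0) * norm y = C3 * (r * norm y)" using r(1) by (simp add: C3_def)
    also have "\<dots> \<le> C3 * P U x" using rP C3 by (rule mult_left_mono)
    finally show ?thesis by (simp add: \<Gamma>_def)
  qed
  have fm: "conjugate f \<in> borel_measurable borel" by (rule borel_measurable_convex_lsc[OF conjugate_convex_lsc[OF f]])
  have meas: "(\<lambda>x. \<Gamma> U x * gibbs U x) \<in> borel_measurable borel" if U: "U \<in> convex_lsc" for U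
  proof -
    have [measurable]: "U \<in> borel_measurable borel" "grad U \<in> borel_measurable borel" "gibbs U \<in> borel_measurable borel"
      "conjugate f \<in> borel_measurable borel"
      by (auto intro: borel_measurable_convex_lsc[OF U] borel_measurable_grad[OF U] borel_measurable_gibbs fm)
    show ?thesis unfolding \<Gamma>_def P_def D_def by measurable
  qed
  have tot: "integrable lborel (\<lambda>x. \<Gamma> U x * gibbs U x)"
    "(\<integral>x. \<Gamma> U x * gibbs U x \<partial>lborel) = (C1 + C3 * (n + m + b)) * gibbs_mass U - (\<integral>x. D U x * gibbs U x \<partial>lborel)"
    if U: "U \<in> convex_lsc" "\<And>x. ereal (a * norm x - b) \<le> U x" "x0 \<in> interior (effective_dom U)" "ray_regular U x0"
      and Di: "integrable lborel (\<lambda>x. D U x * gibbs U x)" for U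
  proof -
    note s = integral_radial_derivative[OF U(1,3) co(1) U(2,4)]
    have g: "integrable lborel (gibbs U)"
      using borel_measurable_convex_lsc[OF U(1)] by (intro integrable_gibbs_coercive[OF _ co(1) U(2)])
    have eq: "\<Gamma> U x * gibbs U x = (C1 + C3 * (m + b)) * gibbs U x + C3 * ((x - x0) \<bullet> grad U x * gibbs U x) - D U x * gibbs U x" for x
      by (simp add: \<Gamma>_def P_def algebra_simps)
    show "integrable lborel (\<lambda>x. \<Gamma> U x * gibbs U x)" unfolding eq using s g Di by simp
    show "(\<integral>x. \<Gamma> U x * gibbs U x \<partial>lborel) = (C1 + C3 * (n + m + b)) * gibbs_mass U - (\<integral>x. D U x * gibbs U x \<partial>lborel)"
    proof -
      have "(\<integral>x. \<Gamma> U x * gibbs U x \<partial>lborel)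
        = (C1 + C3 * (m + b)) * gibbs_mass U + C3 * (n * gibbs_mass U) - (\<integral>x. D U x * gibbs U x \<partial>lborel)"
        unfolding eq using s g Di by (simp add: n_def)
      then show ?thesis by (simp add: algebra_simps)
    qed
  qed
  obtain k0 :: nat where k0: "a \<le> real k0" using real_arch_simple by blast
  define L where "L k = lipreg (real (k + k0)) V" for k
  have ak: "a \<le> real (k + k0)" for k using k0 by simp
  note Lp = lipreg_properties[OF V co ak, folded L_def]
  have Ldom: "x \<in> interior (effective_dom (L k))" for x k
  proof -
    have "effective_dom (L k) = UNIV" using Lp(3) by (auto simp: effective_dom_def less_top)
    then show ?thesis by simp
  qed
  define Z where "Z k = gibbs_mass (L k)" for k
  have Zlim: "Z \<longlonglongrightarrow> 1"
    using integral_gibbs_lipreg_LIMSEQ[OF V co k0] one by (simp add: Z_def[abs_def] L_def)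
  have Lconj: "conjugate (L k) y = \<infinity>" if "real (k + k0) < norm y" for k y
    using that unfolding Lp(4) by (simp add: cutoff_def)
  note tang = tangent_inequality_lipschitz[OF Lp(1) Lp(3) co(1) Lp(2) Lconj f R \<zeta>, folded D_def \<zeta>'_def Z_def]
  have DLi: "integrable lborel (\<lambda>x. D (L k) x * gibbs (L k) x)" for k using tang(1) by (simp add: D_def)
  have DLt: "Z k * (ln \<zeta>' - ln (Z k)) \<le> (\<integral>x. D (L k) x * gibbs (L k) x \<partial>lborel)" for k
    using tang(2) by (simp add: D_def)
  have \<Gamma>L: "(\<integral>\<^sup>+x. ennreal (\<Gamma> (L k) x * gibbs (L k) x) \<partial>lborel)
      \<le> ennreal ((C1 + C3 * (n + m + b)) * Z k - Z k * (ln \<zeta>' - ln (Z k)))" and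
     \<Gamma>Lpos: "0 \<le> (C1 + C3 * (n + m + b)) * Z k - Z k * (ln \<zeta>' - ln (Z k))" for k
  proof -
    have ae: "AE x in lborel. 0 \<le> \<Gamma> (L k) x * gibbs (L k) x"
      using AE_grad_exists[OF Lp(1)[of k]]
    proof eventually_elim
      case (elim x)
      then have "0 \<le> \<Gamma> (L k) x" using Ldom
        by (intro \<Gamma>0 Lp) (auto simp: L_def lipreg_le[OF V])
      then show ?case by simp
    qed
    note t = tot[OF Lp(1) Lp(2) Ldom finite_imp_ray_regular[OF Lp(3)] DLi, folded Z_def]
    have "(\<integral>\<^sup>+x. ennreal (\<Gamma> (L k) x * gibbs (L k) x) \<partial>lborel) = ennreal (\<integral>x. \<Gamma> (L k) x * gibbs (L k) x \<partial>lborel)"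
      by (rule nn_integral_eq_integral[OF t(1) ae])
    also have le: "(\<integral>x. \<Gamma> (L k) x * gibbs (L k) x \<partial>lborel) \<le> (C1 + C3 * (n + m + b)) * Z k - Z k * (ln \<zeta>' - ln (Z k))"
      using DLt[of k] t(2) by simp
    finally show "(\<integral>\<^sup>+x. ennreal (\<Gamma> (L k) x * gibbs (L k) x) \<partial>lborel)
      \<le> ennreal ((C1 + C3 * (n + m + b)) * Z k - Z k * (ln \<zeta>' - ln (Z k)))" by (simp add: ennreal_leI)
    show "0 \<le> (C1 + C3 * (n + m + b)) * Z k - Z k * (ln \<zeta>' - ln (Z k))"
      using integral_nonneg_AE[OF ae] le by linarith
  qed
  \<comment> \<open>on the set where the gradient of \<open>V\<close> is short, \<open>V\<close> and its approximation agree to first order\<close>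
  define A where "A k = {x. grad_exists V x \<and> norm (grad V x) \<le> real (k + k0)}" for k
  have Am[measurable]: "A k \<in> sets borel" for k
  proof -
    have [measurable]: "grad V \<in> borel_measurable borel" "Measurable.pred borel (grad_exists V)"
      using borel_measurable_grad[OF V] sets_grad_exists[OF V] by (auto simp: pred_def)
    have "A k = {x \<in> space borel. grad_exists V x \<and> norm (grad V x) \<le> real (k + k0)}" by (simp add: A_def)
    also have "\<dots> \<in> sets borel" by measurable
    finally show ?thesis .
  qed
  have mV[measurable]: "(\<lambda>x. \<Gamma> V x * gibbs V x) \<in> borel_measurable borel" by (rule meas[OF V])
  have \<Gamma>V0: "0 \<le> \<Gamma> V x * gibbs V x" if "grad_exists V x" for x
    using \<Gamma>0[OF V co(2) order_refl that] by simp
  have part: "(\<integral>\<^sup>+x. ennreal (indicator (A k) x * (\<Gamma> V x * gibbs V x)) \<partial>lborel)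
      \<le> (\<integral>\<^sup>+x. ennreal (\<Gamma> (L k) x * gibbs (L k) x) \<partial>lborel)" for k
  proof (rule nn_integral_mono_AE)
    show "AE x in lborel. ennreal (indicator (A k) x * (\<Gamma> V x * gibbs V x)) \<le> ennreal (\<Gamma> (L k) x * gibbs (L k) x)"
      using AE_grad_exists[OF Lp(1)[of k]]
    proof eventually_elim
      case (elim x)
      then have ge: "grad_exists (L k) x" using Ldom by blast
      show ?case
      proof (cases "x \<in> A k")
        case True
        then have "L k x = V x" "grad (L k) x = grad V x"
          using lipreg_at_grad[OF V, of x "real (k + k0)"] ge Lp(1) by (auto simp: A_def L_def)
        then have "\<Gamma> (L k) x * gibbs (L k) x = \<Gamma> V x * gibbs V x"
          by (simp add: \<Gamma>_def P_def D_def gibbs_def)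
        then show ?thesis by (simp add: indicator_def)
      qed simp
    qed
  qed
  have lim1: "(\<lambda>k. \<integral>\<^sup>+x. ennreal (indicator (A k) x * (\<Gamma> V x * gibbs V x)) \<partial>lborel)
    \<longlonglongrightarrow> (\<integral>\<^sup>+x. ennreal (indicator {x. grad_exists V x} x * (\<Gamma> V x * gibbs V x)) \<partial>lborel)"
  proof (rule nn_integral_LIMSEQ)
    show "incseq (\<lambda>k x. ennreal (indicator (A k) x * (\<Gamma> V x * gibbs V x)))"
      using \<Gamma>V0 by (intro incseq_SucI le_funI ennreal_leI) (auto simp: indicator_def A_def)
    show "(\<lambda>x. ennreal (indicator (A k) x * (\<Gamma> V x * gibbs V x))) \<in> borel_measurable lborel" for k by measurable
    fix x
    obtain j :: nat where j: "norm (grad V x) \<le> real j" using real_arch_simple by blast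
    show "(\<lambda>k. ennreal (indicator (A k) x * (\<Gamma> V x * gibbs V x))) \<longlonglongrightarrow> ennreal (indicator {x. grad_exists V x} x * (\<Gamma> V x * gibbs V x))"
    proof (rule tendsto_eventually, unfold eventually_sequentially, intro exI[of _ j] allI impI)
      fix k assume "j \<le> k"
      then have "norm (grad V x) \<le> real (k + k0)" using j by simp
      then show "ennreal (indicator (A k) x * (\<Gamma> V x * gibbs V x)) = ennreal (indicator {x. grad_exists V x} x * (\<Gamma> V x * gibbs V x))"
        by (simp add: A_def indicator_def)
    qed
  qed
  have lim2: "(\<lambda>k. ennreal ((C1 + C3 * (n + m + b)) * Z k - Z k * (ln \<zeta>' - ln (Z k))))
    \<longlonglongrightarrow> ennreal ((C1 + C3 * (n + m + b)) * 1 - 1 * (ln \<zeta>' - ln 1))"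
    by (intro tendsto_ennrealI tendsto_intros Zlim) auto
  have lim2': "(\<lambda>k. (C1 + C3 * (n + m + b)) * Z k - Z k * (ln \<zeta>' - ln (Z k)))
    \<longlonglongrightarrow> (C1 + C3 * (n + m + b)) * 1 - 1 * (ln \<zeta>' - ln 1)"
    by (intro tendsto_intros Zlim) auto
  have E0: "0 \<le> C1 + C3 * (n + m + b) - ln \<zeta>'"
    using LIMSEQ_le_const[OF lim2', of 0] \<Gamma>Lpos by auto
  have "(\<integral>\<^sup>+x. ennreal (indicator {x. grad_exists V x} x * (\<Gamma> V x * gibbs V x)) \<partial>lborel)
    \<le> ennreal (C1 + C3 * (n + m + b) - ln \<zeta>')"
    using LIMSEQ_le[OF lim1 lim2] order_trans[OF part \<Gamma>L] by auto
  also have "(\<integral>\<^sup>+x. ennreal (indicator {x. grad_exists V x} x * (\<Gamma> V x * gibbs V x)) \<partial>lborel)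
    = (\<integral>\<^sup>+x. ennreal (\<Gamma> V x * gibbs V x) \<partial>lborel)"
  proof (rule nn_integral_cong_AE)
    show "AE x in lborel. ennreal (indicator {x. grad_exists V x} x * (\<Gamma> V x * gibbs V x)) = ennreal (\<Gamma> V x * gibbs V x)"
      using AE_grad_exists_gibbs[OF V]
    proof eventually_elim
      case (elim x)
      then show ?case using gibbs_nonneg[of V x] by (cases "gibbs V x = 0") auto
    qed
  qed
  finally have fin: "(\<integral>\<^sup>+x. ennreal (\<Gamma> V x * gibbs V x) \<partial>lborel) \<le> ennreal (C1 + C3 * (n + m + b) - ln \<zeta>')" .
  have DVi: "integrable lborel (\<lambda>x. D V x * gibbs V x)"
  proof -
    have "integrable lborel (\<lambda>x. real_of_ereal (conjugate f (grad V x)) * gibbs V x - (x \<bullet> grad V x) * gibbs V x + real_of_ereal (V x) * gibbs V x)"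
      using Fi gibbs_moments(2)[OF V x0 co reg] integrable_real_gibbs[OF V co]
      by (intro Bochner_Integration.integrable_add Bochner_Integration.integrable_diff)
    then show ?thesis by (simp add: D_def algebra_simps)
  qed
  note t = tot[OF V co(2) x0 reg DVi]
  have "(\<integral>x. \<Gamma> V x * gibbs V x \<partial>lborel) \<le> enn2real (\<integral>\<^sup>+x. ennreal (\<Gamma> V x * gibbs V x) \<partial>lborel)"
    by (subst real_lebesgue_integral_def[OF t(1)]) simp
  also have "\<dots> \<le> C1 + C3 * (n + m + b) - ln \<zeta>'" using E0 fin by (rule enn2real_leI)
  finally have "(\<integral>x. \<Gamma> V x * gibbs V x \<partial>lborel) \<le> C1 + C3 * (n + m + b) - ln \<zeta>'" .
  then show ?thesis unfolding t(2) one \<zeta>'_def by simp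
qed

text \<open>
  Restricting \<open>f\<close> to balls decreases its conjugate, so only the monotone limit on the
  left-hand side remains.
\<close>
theorem tangent_inequality:
  fixes V f :: "'a::euclidean_space \<Rightarrow> ereal"
  assumes V: "V \<in> convex_lsc" and x0: "x0 \<in> interior (effective_dom V)"
    and co: "0 < a" "\<And>x. ereal (a * norm x - b) \<le> V x"
    and reg: "\<And>x0. ray_regular V x0" and one: "gibbs_mass V = 1"
    and f: "f \<in> convex_lsc"
    and fin: "AE x in lborel. 0 < gibbs V x \<longrightarrow> conjugate f (grad V x) \<noteq> \<infinity>"
    and Fi: "integrable lborel (\<lambda>x. real_of_ereal (conjugate f (grad V x)) * gibbs V x)"
  shows "exp_mass f
    \<le> ennreal (exp (\<integral>x. (real_of_ereal (conjugate f (grad V x)) - (x \<bullet> grad V x - real_of_ereal (V x))) * gibbs V x \<partial>lborel))"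
proof -
  define E where "E g = (\<integral>x. (real_of_ereal (conjugate g (grad V x)) - (x \<bullet> grad V x - real_of_ereal (V x))) * gibbs V x \<partial>lborel)" for g
  obtain x1 r1 where x1: "f x1 = ereal r1" using convex_lscD(4)[OF f] by blast
  obtain j0 :: nat where j0: "norm x1 \<le> real j0" using real_arch_simple by blast
  define h where "h j = cutoff (real (j + j0)) f" for j
  have hx1: "h j x1 = ereal r1" for j using j0 x1 by (simp add: h_def cutoff_def)
  have h: "h j \<in> convex_lsc" for j unfolding h_def using j0 x1 by (intro cutoff_convex_lsc[OF f, of x1]) auto
  have hR: "h j x = \<infinity>" if "real (j + j0) < norm x" for j x using that by (simp add: h_def cutoff_def)
  have hc: "conjugate (h j) \<in> convex_lsc" for j by (rule conjugate_convex_lsc[OF h])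
  have [measurable]: "V \<in> borel_measurable borel" "grad V \<in> borel_measurable borel" "gibbs V \<in> borel_measurable borel"
    "conjugate (h j) \<in> borel_measurable borel" for j
    by (auto intro: borel_measurable_convex_lsc[OF V] borel_measurable_grad[OF V] borel_measurable_gibbs
        borel_measurable_convex_lsc[OF hc])
  have gV: "integrable lborel (gibbs V)" by (rule integrable_gibbs_coercive[OF _ co]) simp
  have nV: "integrable lborel (\<lambda>x. norm (grad V x) * gibbs V x)" by (rule integrable_norm_grad[OF V x0 co reg])
  have rest: "integrable lborel (\<lambda>x. (x \<bullet> grad V x - real_of_ereal (V x)) * gibbs V x)"
    using Bochner_Integration.integrable_diff[OF gibbs_moments(2)[OF V x0 co reg] integrable_real_gibbs[OF V co]]
    by (simp add: algebra_simps)
  have bound: "exp_mass (h j) \<le> ennreal (exp (E f))" for j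
  proof -
    obtain C where C: "0 \<le> C" "\<And>x. ereal (- C) \<le> h j x" "\<And>y. conjugate (h j) y \<le> ereal (real (j + j0) * norm y + C)"
      using conjugate_bounded_dom[OF h[of j] hR[of j]] by (metis of_nat_0_le_iff)
    define F where "F y = real_of_ereal (conjugate (h j) y)" for y
    have Fr: "conjugate (h j) y = ereal (F y)" for y
      using C(3)[of y] convex_lscD(3)[OF hc[of j], of y] unfolding F_def by (cases "conjugate (h j) y") auto
    have Fup: "F y \<le> real (j + j0) * norm y + C" for y using C(3)[of y] by (simp add: Fr)
    have Flow: "x1 \<bullet> y - r1 \<le> F y" for y
      using conjugate_lower_bound[of "h j" x1 r1 y] hx1[of j] by (simp add: Fr)
    have Fm[measurable]: "F \<in> borel_measurable borel" unfolding F_def[abs_def] by measurable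
    have hi: "integrable lborel (\<lambda>x. F (grad V x) * gibbs V x)"
    proof (rule Bochner_Integration.integrable_bound)
      show "integrable lborel (\<lambda>x. (real (j + j0) + norm x1) * (norm (grad V x) * gibbs V x) + (C + \<bar>r1\<bar>) * gibbs V x)"
        using gV nV by simp
      show "AE x in lborel. norm (F (grad V x) * gibbs V x)
        \<le> norm ((real (j + j0) + norm x1) * (norm (grad V x) * gibbs V x) + (C + \<bar>r1\<bar>) * gibbs V x)"
      proof (rule AE_I2)
        fix x
        let ?y = "grad V x"
        have "\<bar>x1 \<bullet> ?y\<bar> \<le> norm x1 * norm ?y" by (rule Cauchy_Schwarz_ineq2)
        moreover have "0 \<le> norm x1 * norm ?y" "0 \<le> real (j + j0) * norm ?y" by auto
        ultimately have "\<bar>F ?y\<bar> \<le> real (j + j0) * norm ?y + norm x1 * norm ?y + (C + \<bar>r1\<bar>)"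
          using Fup[of ?y] Flow[of ?y] C(1) by linarith
        then have "\<bar>F ?y\<bar> * gibbs V x \<le> (real (j + j0) * norm ?y + norm x1 * norm ?y + (C + \<bar>r1\<bar>)) * gibbs V x"
          by (rule mult_right_mono) simp
        also have "\<dots> = (real (j + j0) + norm x1) * (norm ?y * gibbs V x) + (C + \<bar>r1\<bar>) * gibbs V x"
          by (simp add: algebra_simps)
        also have "\<dots> \<le> norm \<dots>" by simp
        finally show "norm (F ?y * gibbs V x) \<le> norm ((real (j + j0) + norm x1) * (norm ?y * gibbs V x) + (C + \<bar>r1\<bar>) * gibbs V x)"
          by (simp add: abs_mult)
      qed
    qed measurable
    have gh: "integrable lborel (gibbs (h j))"
    proof (rule Bochner_Integration.integrable_bound)
      show "integrable lborel (\<lambda>x. exp C * indicator (cball (0::'a) (real (j + j0))) x)"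
        by (intro integrable_mult_right integrable_real_indicator) (auto simp: emeasure_cball)
      show "gibbs (h j) \<in> borel_measurable lborel"
        using borel_measurable_convex_lsc[OF h] by (simp add: borel_measurable_gibbs)
      have "gibbs (h j) x \<le> exp (- (- C))" for x by (rule gibbs_le) (rule C)
      then show "AE x in lborel. norm (gibbs (h j) x) \<le> norm (exp C * indicator (cball 0 (real (j + j0))) x)"
        using hR gibbs_simps(2)[of "h j"] by (intro AE_I2) (auto simp: indicator_def not_le)
    qed
    define \<zeta> where "\<zeta> = gibbs_mass (h j)"
    have "0 \<le> \<zeta>" by (simp add: \<zeta>_def)
    have nn: "exp_mass (h j) = ennreal \<zeta>"
      unfolding nn_integral_exp_minus_eq[OF h] \<zeta>_def by (intro nn_integral_eq_integral gh) simp
    show ?thesis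
    proof (cases "\<zeta> = 0")
      case False
      then have pos: "0 < \<zeta>" using \<open>0 \<le> \<zeta>\<close> by simp
      have "ln \<zeta> \<le> E (h j)"
        unfolding \<zeta>_def E_def
        by (rule tangent_inequality_bounded_dom[OF V x0 co reg one h hR _ _ gh])
           (use pos hi in \<open>auto simp: \<zeta>_def F_def\<close>)
      also have "E (h j) \<le> E f"
        unfolding E_def left_diff_distrib[of _ "_ - _"]
      proof (rule integral_mono_AE)
        show "integrable lborel (\<lambda>x. real_of_ereal (conjugate (h j) (grad V x)) * gibbs V x - (x \<bullet> grad V x - real_of_ereal (V x)) * gibbs V x)"
          using hi rest by (simp add: F_def)
        show "integrable lborel (\<lambda>x. real_of_ereal (conjugate f (grad V x)) * gibbs V x - (x \<bullet> grad V x - real_of_ereal (V x)) * gibbs V x)"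
          using Fi rest by simp
        show "AE x in lborel. real_of_ereal (conjugate (h j) (grad V x)) * gibbs V x - (x \<bullet> grad V x - real_of_ereal (V x)) * gibbs V x
          \<le> real_of_ereal (conjugate f (grad V x)) * gibbs V x - (x \<bullet> grad V x - real_of_ereal (V x)) * gibbs V x"
          using fin
        proof eventually_elim
          case (elim x)
          show ?case
          proof (cases "gibbs V x = 0")
            case False
            then have "conjugate f (grad V x) \<noteq> \<infinity>" using elim gibbs_nonneg[of V x] by linarith
            moreover have "conjugate (h j) (grad V x) \<le> conjugate f (grad V x)"
              by (rule conjugate_mono) (simp add: h_def cutoff_ge)
            ultimately have "F (grad V x) \<le> real_of_ereal (conjugate f (grad V x))"
              unfolding Fr by (cases "conjugate f (grad V x)") auto
            then show ?thesis by (simp add: F_def mult_right_mono)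
          qed simp
        qed
      qed
      finally have "\<zeta> \<le> exp (E f)" using pos by (metis exp_le_cancel_iff exp_ln)
      then show ?thesis unfolding nn by (rule ennreal_leI)
    qed (simp add: nn)
  qed
  have lim: "(\<lambda>j. \<integral>\<^sup>+x. exp_minus (h j x) \<partial>lborel) \<longlonglongrightarrow> exp_mass f"
  proof (rule nn_integral_LIMSEQ)
    show "incseq (\<lambda>j x. exp_minus (h j x))"
      by (intro incseq_SucI le_funI) (auto simp: h_def cutoff_def exp_minus_def)
    show "(\<lambda>x. exp_minus (h j x)) \<in> borel_measurable lborel" for j by (rule borel_measurable_exp_minus_convex_lsc[OF h])
    fix x :: 'a
    obtain j1 :: nat where j1: "norm x \<le> real j1" using real_arch_simple by blast
    show "(\<lambda>j. exp_minus (h j x)) \<longlonglongrightarrow> exp_minus (f x)"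
    proof (rule tendsto_eventually, unfold eventually_sequentially, intro exI[of _ j1] allI impI)
      fix j assume "j1 \<le> j"
      then have "norm x \<le> real (j + j0)" using j1 by simp
      then show "exp_minus (h j x) = exp_minus (f x)" by (simp add: h_def cutoff_def)
    qed
  qed
  show ?thesis unfolding E_def[symmetric]
    by (rule LIMSEQ_le_const2[OF lim]) (use bound in blast)
qed

section \<open>Extended integrals\<close>

lemma ereal_integral_eqI:
  assumes q: "integrable M q" and ae: "AE x in M. g x = ereal (q x)"
  shows "ereal_integral M g = ereal (\<integral>x. q x \<partial>M)"
proof -
  have 1: "(\<integral>\<^sup>+x. e2ennreal (g x) \<partial>M) = (\<integral>\<^sup>+x. ennreal (q x) \<partial>M)"
    using ae by (intro nn_integral_cong_AE) (auto elim!: eventually_mono)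
  have 2: "(\<integral>\<^sup>+x. e2ennreal (- g x) \<partial>M) = (\<integral>\<^sup>+x. ennreal (- q x) \<partial>M)"
    using ae by (intro nn_integral_cong_AE) (auto elim!: eventually_mono)
  have f: "(\<integral>\<^sup>+x. ennreal (q x) \<partial>M) \<noteq> \<infinity>" "(\<integral>\<^sup>+x. ennreal (- q x) \<partial>M) \<noteq> \<infinity>"
    using integrableD[OF q] by auto
  have e: "enn2ereal x = ereal (enn2real x)" if "x \<noteq> \<infinity>" for x
    using that by (cases x) auto
  show ?thesis
    unfolding ereal_integral_def 1 2 real_lebesgue_integral_def[OF q] using f by (simp add: e)
qed

lemma ereal_integral_mono:
  assumes "AE x in M. f x \<le> g x" shows "ereal_integral M f \<le> ereal_integral M g"
proof -
  have "(\<integral>\<^sup>+x. e2ennreal (f x) \<partial>M) \<le> (\<integral>\<^sup>+x. e2ennreal (g x) \<partial>M)"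
    using assms by (intro nn_integral_mono_AE) (auto elim!: eventually_mono intro: e2ennreal_mono)
  moreover have "(\<integral>\<^sup>+x. e2ennreal (- g x) \<partial>M) \<le> (\<integral>\<^sup>+x. e2ennreal (- f x) \<partial>M)"
    using assms by (intro nn_integral_mono_AE) (auto elim!: eventually_mono intro!: e2ennreal_mono)
  ultimately show ?thesis
    unfolding ereal_integral_def by (intro ereal_minus_mono) (auto simp: less_eq_ennreal.rep_eq)
qed

text \<open>
  With an integrable minorant the negative part is harmless, and finiteness of the extended integral is
  ordinary integrability.
\<close>
lemma ereal_integral_bounded_below:
  assumes g[measurable]: "g \<in> borel_measurable M" and l: "integrable M l" and le: "\<And>x. ereal (l x) \<le> g x"
  shows "ereal_integral M g \<noteq> -\<infinity>"
    "ereal_integral M g < \<infinity> \<Longrightarrow> AE x in M. g x \<noteq> \<infinity>"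
    "ereal_integral M g < \<infinity> \<Longrightarrow> integrable M (\<lambda>x. real_of_ereal (g x))"
    "ereal_integral M g < \<infinity> \<Longrightarrow> ereal_integral M g = ereal (\<integral>x. real_of_ereal (g x) \<partial>M)"
proof -
  have "(\<integral>\<^sup>+x. e2ennreal (- g x) \<partial>M) \<le> (\<integral>\<^sup>+x. ennreal (- l x) \<partial>M)"
  proof (rule nn_integral_mono)
    fix x show "e2ennreal (- g x) \<le> ennreal (- l x)"
    proof -
      have "- g x \<le> ereal (- l x)" using le[of x] by (cases "g x") auto
      then show ?thesis using e2ennreal_mono by fastforce
    qed
  qed
  also have "\<dots> < \<infinity>" using integrableD(3)[OF l] by (simp add: less_top)
  finally have neg: "(\<integral>\<^sup>+x. e2ennreal (- g x) \<partial>M) < \<infinity>" .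
  then show "ereal_integral M g \<noteq> -\<infinity>"
    unfolding ereal_integral_def
    by (cases "\<integral>\<^sup>+x. e2ennreal (- g x) \<partial>M"; cases "\<integral>\<^sup>+x. e2ennreal (g x) \<partial>M") auto
  assume lt: "ereal_integral M g < \<infinity>"
  have pos: "(\<integral>\<^sup>+x. e2ennreal (g x) \<partial>M) \<noteq> \<infinity>"
    using lt neg unfolding ereal_integral_def
    by (cases "\<integral>\<^sup>+x. e2ennreal (- g x) \<partial>M"; cases "\<integral>\<^sup>+x. e2ennreal (g x) \<partial>M") auto
  have "AE x in M. e2ennreal (g x) \<noteq> \<infinity>"
    by (rule nn_integral_PInf_AE) (use pos in auto)
  then show ae: "AE x in M. g x \<noteq> \<infinity>" by (auto elim!: eventually_mono)
  show int: "integrable M (\<lambda>x. real_of_ereal (g x))"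
  proof (rule integrableI_bounded)
    have "(\<integral>\<^sup>+x. ennreal (norm (real_of_ereal (g x))) \<partial>M) \<le> (\<integral>\<^sup>+x. e2ennreal (g x) + e2ennreal (- g x) \<partial>M)"
    proof (rule nn_integral_mono)
      fix x show "ennreal (norm (real_of_ereal (g x))) \<le> e2ennreal (g x) + e2ennreal (- g x)"
        by (cases "g x") (auto simp: abs_if ennreal_neg)
    qed
    also have "\<dots> = (\<integral>\<^sup>+x. e2ennreal (g x) \<partial>M) + (\<integral>\<^sup>+x. e2ennreal (- g x) \<partial>M)"
      by (rule nn_integral_add) measurable
    also have "\<dots> < \<infinity>" using pos neg by (simp add: less_top)
    finally show "(\<integral>\<^sup>+x. ennreal (norm (real_of_ereal (g x))) \<partial>M) < \<infinity>" .
  qed measurable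
  have "AE x in M. g x = ereal (real_of_ereal (g x))"
    using ae
  proof eventually_elim
    case (elim x) then show ?case using le[of x] by (cases "g x") auto
  qed
  then show "ereal_integral M g = ereal (\<integral>x. real_of_ereal (g x) \<partial>M)"
    by (rule ereal_integral_eqI[OF int])
qed

definition finite_first_moment :: "'a::euclidean_space measure \<Rightarrow> bool" where
  "finite_first_moment \<mu> \<longleftrightarrow> prob_space \<mu> \<and> sets \<mu> = sets borel \<and> integrable \<mu> norm"

lemma ereal_integral_convex_lsc:
  fixes g :: "'a::euclidean_space \<Rightarrow> ereal"
  assumes \<mu>: "finite_first_moment \<mu>" and g: "g \<in> convex_lsc"
  shows "ereal_integral \<mu> g \<noteq> -\<infinity>"
    "ereal_integral \<mu> g < \<infinity> \<Longrightarrow> AE x in \<mu>. g x \<noteq> \<infinity>"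
    "ereal_integral \<mu> g < \<infinity> \<Longrightarrow> integrable \<mu> (\<lambda>x. real_of_ereal (g x))"
    "ereal_integral \<mu> g < \<infinity> \<Longrightarrow> ereal_integral \<mu> g = ereal (\<integral>x. real_of_ereal (g x) \<partial>\<mu>)"
proof -
  interpret prob_space \<mu> using \<mu> by (simp add: finite_first_moment_def)
  have s: "sets \<mu> = sets borel" using \<mu> by (simp add: finite_first_moment_def)
  obtain y c where yc: "\<And>z. ereal (z \<bullet> y - c) \<le> g z" using affine_minorant[OF g] by blast
  have gm: "g \<in> borel_measurable \<mu>" using borel_measurable_convex_lsc[OF g] s measurable_cong_sets by blast
  have id: "(\<lambda>z. z) \<in> borel_measurable \<mu>" using s by (intro measurable_ident_sets) auto
  have "integrable \<mu> (\<lambda>z. z \<bullet> y)"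
  proof (rule Bochner_Integration.integrable_bound)
    show "integrable \<mu> (\<lambda>z. norm y * norm z)" using \<mu> by (simp add: finite_first_moment_def)
    show "(\<lambda>z. z \<bullet> y) \<in> borel_measurable \<mu>" using id by (intro borel_measurable_inner) auto
    show "AE z in \<mu>. norm (z \<bullet> y) \<le> norm (norm y * norm z)"
      using Cauchy_Schwarz_ineq2[of _ y] by (intro AE_I2) (auto simp: mult.commute)
  qed
  then have l: "integrable \<mu> (\<lambda>z. z \<bullet> y - c)" by simp
  note * = ereal_integral_bounded_below[OF gm l yc]
  show "ereal_integral \<mu> g \<noteq> -\<infinity>" "ereal_integral \<mu> g < \<infinity> \<Longrightarrow> AE x in \<mu>. g x \<noteq> \<infinity>"
    "ereal_integral \<mu> g < \<infinity> \<Longrightarrow> integrable \<mu> (\<lambda>x. real_of_ereal (g x))"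
    "ereal_integral \<mu> g < \<infinity> \<Longrightarrow> ereal_integral \<mu> g = ereal (\<integral>x. real_of_ereal (g x) \<partial>\<mu>)"
    by (rule *; assumption)+
qed

section \<open>Moment measures\<close>

lemma log_concave_probD:
  fixes V :: "real^'n \<Rightarrow> ereal"
  assumes "log_concave_prob \<eta> V"
  shows "V \<in> convex_lsc" "\<eta> = density lborel (\<lambda>x. ennreal (gibbs V x))" "prob_space \<eta>"
    "integrable lborel (gibbs V)" "gibbs_mass V = 1"
    "\<exists>a b. 0 < a \<and> (\<forall>x. ereal (a * norm x - b) \<le> V x)" "interior (effective_dom V) \<noteq> {}"
    "moment_measure V = distr \<eta> borel (grad V)"
proof -
  show V: "V \<in> convex_lsc" and p: "prob_space \<eta>" using assms by (auto simp: log_concave_prob_def)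
  have eq: "(\<lambda>x. exp_minus (V x)) = (\<lambda>x. ennreal (gibbs V x))"
    using convex_lscD(3)[OF V] by (auto simp: exp_minus_eq_gibbs)
  show \<eta>: "\<eta> = density lborel (\<lambda>x. ennreal (gibbs V x))"
    using assms unfolding log_concave_prob_def eq by simp
  show "moment_measure V = distr \<eta> borel (grad V)" unfolding moment_measure_def \<eta> eq ..
  have m: "gibbs V \<in> borel_measurable borel" by (intro borel_measurable_gibbs borel_measurable_convex_lsc[OF V])
  have one: "(\<integral>\<^sup>+x. ennreal (gibbs V x) \<partial>lborel) = 1"
    using prob_space.emeasure_space_1[OF p] m unfolding \<eta> by (simp add: emeasure_density)
  show i: "integrable lborel (gibbs V)" using one m by (intro integrableI_nonneg) auto
  show "gibbs_mass V = 1"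
    using nn_integral_eq_integral[OF i] one by simp
  have "0 < exp_mass V" "exp_mass V < \<infinity>"
    unfolding eq one by auto
  from convex_lsc_coercive[OF V this] interior_dom_of_pos_integral[OF V this(1)]
  show "\<exists>a b. 0 < a \<and> (\<forall>x. ereal (a * norm x - b) \<le> V x)" "interior (effective_dom V) \<noteq> {}" by blast+
qed

lemma integrable_norm_gibbs:
  fixes f :: "'a::euclidean_space \<Rightarrow> ereal"
  assumes f: "f \<in> convex_lsc" and co: "0 < a" "\<And>x. ereal (a * norm x - b) \<le> f x"
  shows "integrable lborel (\<lambda>x. norm x * gibbs f x)"
proof (rule Bochner_Integration.integrable_bound)
  have [measurable]: "gibbs f \<in> borel_measurable borel" by (intro borel_measurable_gibbs borel_measurable_convex_lsc[OF f])
  show "integrable lborel (\<lambda>x::'a. (2 / a * exp b) * exp (- (a / 2) * norm x))"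
    by (intro integrable_mult_right integrable_exp_norm) (use co(1) in simp)
  show "(\<lambda>x. norm x * gibbs f x) \<in> borel_measurable lborel" by measurable
  show "AE x in lborel. norm (norm x * gibbs f x) \<le> norm ((2 / a * exp b) * exp (- (a / 2) * norm x))"
  proof (rule AE_I2)
    fix x
    have 1: "gibbs f x \<le> exp (- (a * norm x - b))" by (rule gibbs_le) (rule co)
    have "(a / 2) * norm x \<le> exp ((a / 2) * norm x)" using exp_ge_add_one_self[of "(a / 2) * norm x"] by linarith
    then have 2: "norm x \<le> 2 / a * exp ((a / 2) * norm x)" using co(1) by (simp add: field_simps)
    have "norm x * gibbs f x \<le> (2 / a * exp ((a / 2) * norm x)) * exp (- (a * norm x - b))"
      using 1 2 co(1) by (intro mult_mono) auto
    also have "\<dots> = (2 / a * exp b) * exp (- (a / 2) * norm x)"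
      by (simp add: algebra_simps flip: exp_add)
    finally show "norm (norm x * gibbs f x) \<le> norm ((2 / a * exp b) * exp (- (a / 2) * norm x))"
      using co(1) by simp
  qed
qed

lemma integral_log_concave:
  fixes V :: "real^'n \<Rightarrow> ereal" and q :: "real^'n \<Rightarrow> real"
  assumes lc: "log_concave_prob \<eta> V" and [measurable]: "q \<in> borel_measurable borel"
  shows "integrable \<eta> q \<longleftrightarrow> integrable lborel (\<lambda>x. q x * gibbs V x)"
    "(\<integral>x. q x \<partial>\<eta>) = (\<integral>x. q x * gibbs V x \<partial>lborel)"
    "integrable (moment_measure V) q \<longleftrightarrow> integrable lborel (\<lambda>x. q (grad V x) * gibbs V x)"
    "(\<integral>y. q y \<partial>moment_measure V) = (\<integral>x. q (grad V x) * gibbs V x \<partial>lborel)"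
proof -
  note D = log_concave_probD[OF lc]
  note [measurable] = convex_lsc_measurable[OF D(1)]
  have \<eta>: "integrable \<eta> p \<longleftrightarrow> integrable lborel (\<lambda>x. p x * gibbs V x)" "(\<integral>x. p x \<partial>\<eta>) = (\<integral>x. p x * gibbs V x \<partial>lborel)"
    if [measurable]: "p \<in> borel_measurable borel" for p :: "real^'n \<Rightarrow> real"
    unfolding D(2) by (auto simp: integrable_real_density integral_real_density mult.commute)
  show "integrable \<eta> q \<longleftrightarrow> integrable lborel (\<lambda>x. q x * gibbs V x)" "(\<integral>x. q x \<partial>\<eta>) = (\<integral>x. q x * gibbs V x \<partial>lborel)"
    by (rule \<eta>; measurable)+
  have gm: "grad V \<in> \<eta> \<rightarrow>\<^sub>M borel" unfolding D(2) by measurable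
  show "integrable (moment_measure V) q \<longleftrightarrow> integrable lborel (\<lambda>x. q (grad V x) * gibbs V x)"
    unfolding D(8) by (subst integrable_distr_eq[OF gm]) (auto simp: \<eta>)
  show "(\<integral>y. q y \<partial>moment_measure V) = (\<integral>x. q (grad V x) * gibbs V x \<partial>lborel)"
    unfolding D(8) by (subst integral_distr[OF gm]) (auto simp: \<eta>)
qed

lemma AE_log_concave:
  fixes V :: "real^'n \<Rightarrow> ereal"
  assumes lc: "log_concave_prob \<eta> V" and [measurable]: "Measurable.pred borel P"
  shows "(AE x in \<eta>. P x) \<longleftrightarrow> (AE x in lborel. 0 < gibbs V x \<longrightarrow> P x)"
    "(AE y in moment_measure V. P y) \<longleftrightarrow> (AE x in lborel. 0 < gibbs V x \<longrightarrow> P (grad V x))"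
proof -
  note D = log_concave_probD[OF lc]
  note [measurable] = convex_lsc_measurable[OF D(1)]
  show 1: "(AE x in \<eta>. P x) \<longleftrightarrow> (AE x in lborel. 0 < gibbs V x \<longrightarrow> P x)"
    unfolding D(2) by (subst AE_density) auto
  have gm: "grad V \<in> \<eta> \<rightarrow>\<^sub>M borel" unfolding D(2) by measurable
  show "(AE y in moment_measure V. P y) \<longleftrightarrow> (AE x in lborel. 0 < gibbs V x \<longrightarrow> P (grad V x))"
  proof -
    have "(AE x in \<eta>. P (grad V x)) \<longleftrightarrow> (AE x in lborel. 0 < gibbs V x \<longrightarrow> P (grad V x))"
      unfolding D(2) by (subst AE_density) auto
    then show ?thesis unfolding D(8) by (subst AE_distr_iff[OF gm]) auto
  qed
qed

context
  fixes V :: "real^'n \<Rightarrow> ereal" and \<eta> :: "(real^'n) measure"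
  assumes lc: "log_concave_prob \<eta> V" and reg: "\<And>x0. ray_regular V x0"
begin

lemma finite_first_moment_log_concave: "finite_first_moment \<eta>"
proof -
  note D = log_concave_probD[OF lc]
  obtain a b where co: "0 < a" "\<And>x. ereal (a * norm x - b) \<le> V x" using D(6) by blast
  have "integrable \<eta> norm"
    using integral_log_concave(1)[OF lc, of norm] integrable_norm_gibbs[OF D(1) co] by simp
  then show ?thesis using D(2,3) by (simp add: finite_first_moment_def)
qed

lemma finite_first_moment_moment_measure: "finite_first_moment (moment_measure V)"
proof -
  note D = log_concave_probD[OF lc]
  obtain a b where co: "0 < a" "\<And>x. ereal (a * norm x - b) \<le> V x" using D(6) by blast
  obtain x0 where x0: "x0 \<in> interior (effective_dom V)" using D(7) by blast
  have gm: "grad V \<in> \<eta> \<rightarrow>\<^sub>M borel" unfolding D(2) using borel_measurable_grad[OF D(1)] by simp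
  have "integrable (moment_measure V) norm"
    using integral_log_concave(3)[OF lc, of norm] integrable_norm_grad[OF D(1) x0 co reg] by simp
  moreover have "prob_space (moment_measure V)"
    unfolding D(8) by (rule prob_space.prob_space_distr[OF D(3) gm])
  ultimately show ?thesis by (simp add: finite_first_moment_def D(8))
qed

lemma integral_inner_grad:
  shows "integrable lborel (\<lambda>x. (x \<bullet> grad V x) * gibbs V x)"
    "(\<integral>x. (x \<bullet> grad V x) * gibbs V x \<partial>lborel) = real CARD('n)"
    "integrable lborel (\<lambda>x. real_of_ereal (V x) * gibbs V x)"
proof -
  note D = log_concave_probD[OF lc]
  obtain a b where co: "0 < a" "\<And>x. ereal (a * norm x - b) \<le> V x" using D(6) by blast
  obtain x0 where x0: "x0 \<in> interior (effective_dom V)" using D(7) by blast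
  show "integrable lborel (\<lambda>x. (x \<bullet> grad V x) * gibbs V x)"
    "(\<integral>x. (x \<bullet> grad V x) * gibbs V x \<partial>lborel) = real CARD('n)"
    using gibbs_moments(2,3)[OF D(1) x0 co reg] D(5) by simp_all
  show "integrable lborel (\<lambda>x. real_of_ereal (V x) * gibbs V x)"
    by (rule integrable_real_gibbs[OF D(1) co])
qed

lemma ereal_integral_potential:
  "ereal_integral \<eta> V = ereal (\<integral>x. real_of_ereal (V x) * gibbs V x \<partial>lborel)"
proof -
  note D = log_concave_probD[OF lc]
  have [measurable]: "V \<in> borel_measurable borel" by (rule borel_measurable_convex_lsc[OF D(1)])
  have "integrable \<eta> (\<lambda>x. real_of_ereal (V x))"
    using integral_log_concave(1)[OF lc, of "\<lambda>x. real_of_ereal (V x)"] integral_inner_grad(3) by simp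
  moreover have "AE x in \<eta>. V x = ereal (real_of_ereal (V x))"
  proof (subst AE_log_concave(1)[OF lc])
    have "V x = ereal (real_of_ereal (V x))" if "0 < gibbs V x" for x
      using that convex_lscD(3)[OF D(1), of x] by (cases "V x") (auto simp: gibbs_simps)
    then show "AE x in lborel. 0 < gibbs V x \<longrightarrow> V x = ereal (real_of_ereal (V x))" by simp
  qed measurable
  ultimately have "ereal_integral \<eta> V = ereal (\<integral>x. real_of_ereal (V x) \<partial>\<eta>)" by (rule ereal_integral_eqI)
  then show ?thesis using integral_log_concave(2)[OF lc, of "\<lambda>x. real_of_ereal (V x)"] by simp
qed

text \<open>Young's equality at the gradient, integrated.\<close>
lemma ereal_integral_conjugate_moment_measure:
  "ereal_integral (moment_measure V) (conjugate V)
    = ereal (real CARD('n) - (\<integral>x. real_of_ereal (V x) * gibbs V x \<partial>lborel))"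
proof -
  note D = log_concave_probD[OF lc]
  have [measurable]: "conjugate V \<in> borel_measurable borel"
    by (rule borel_measurable_convex_lsc[OF conjugate_convex_lsc[OF D(1)]])
  note [measurable] = convex_lsc_measurable[OF D(1)]
  let ?q = "\<lambda>y. real_of_ereal (conjugate V y)"
  have ae: "AE x in lborel. ?q (grad V x) * gibbs V x = (x \<bullet> grad V x) * gibbs V x - real_of_ereal (V x) * gibbs V x"
    using AE_grad_exists_gibbs[OF D(1)]
  proof eventually_elim
    case (elim x)
    show ?case
    proof (cases "gibbs V x = 0")
      case False
      then have "grad_exists V x" using elim gibbs_nonneg[of V x] by linarith
      then show ?thesis by (simp add: conjugate_at_grad[OF D(1)] algebra_simps)
    qed simp
  qed
  have i: "integrable lborel (\<lambda>x. (x \<bullet> grad V x) * gibbs V x - real_of_ereal (V x) * gibbs V x)"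
    using integral_inner_grad by simp
  have "integrable lborel (\<lambda>x. ?q (grad V x) * gibbs V x)"
    using i ae by (subst integrable_cong_AE) auto
  then have qi: "integrable (moment_measure V) ?q"
    using integral_log_concave(3)[OF lc, of ?q] by simp
  have "AE y in moment_measure V. conjugate V y = ereal (?q y)"
  proof (subst AE_log_concave(2)[OF lc])
    show "AE x in lborel. 0 < gibbs V x \<longrightarrow> conjugate V (grad V x) = ereal (?q (grad V x))"
      using AE_grad_exists_gibbs[OF D(1)] by eventually_elim (auto simp: conjugate_at_grad[OF D(1)])
  qed measurable
  then have "ereal_integral (moment_measure V) (conjugate V) = ereal (\<integral>y. ?q y \<partial>moment_measure V)"
    by (rule ereal_integral_eqI[OF qi])
  also have "(\<integral>y. ?q y \<partial>moment_measure V) = (\<integral>x. ?q (grad V x) * gibbs V x \<partial>lborel)"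
    by (rule integral_log_concave(4)[OF lc]) measurable
  also have "\<dots> = (\<integral>x. (x \<bullet> grad V x) * gibbs V x - real_of_ereal (V x) * gibbs V x \<partial>lborel)"
    using ae by (intro integral_cong_AE) auto
  also have "\<dots> = real CARD('n) - (\<integral>x. real_of_ereal (V x) * gibbs V x \<partial>lborel)"
    using integral_inner_grad by simp
  finally show ?thesis .
qed

lemma entropy_Leb_log_concave:
  "entropy_Leb \<eta> = ereal (- (\<integral>x. real_of_ereal (V x) * gibbs V x \<partial>lborel))"
proof -
  note D = log_concave_probD[OF lc]
  note [measurable] = convex_lsc_measurable[OF D(1)]
  have "AE x in lborel. ennreal (gibbs V x) = RN_deriv lborel \<eta> x"
    by (rule sigma_finite_measure.RN_deriv_unique[OF sigma_finite_lborel]) (use D(2) in auto)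
  then have ae: "AE x in lborel. (let h = enn2real (RN_deriv lborel \<eta> x) in ereal (h * ln h)) = ereal (- (real_of_ereal (V x) * gibbs V x))"
  proof eventually_elim
    case (elim x)
    then have "enn2real (RN_deriv lborel \<eta> x) = gibbs V x" by (metis enn2real_ennreal gibbs_nonneg)
    moreover have "gibbs V x * ln (gibbs V x) = - (real_of_ereal (V x) * gibbs V x)"
      using convex_lscD(3)[OF D(1), of x] by (cases "V x") (auto simp: gibbs_simps)
    ultimately show ?case by (simp add: Let_def)
  qed
  have "integrable lborel (\<lambda>x. - (real_of_ereal (V x) * gibbs V x))" using integral_inner_grad(3) by simp
  from ereal_integral_eqI[OF this ae] show ?thesis by (simp add: entropy_Leb_def)
qed

text \<open>
  The Young inequality bounds every competitor from below by \<open>\<integral> x \<bullet> \<nabla>V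
  d\<eta>\<close>, and the conjugate of \<open>V\<close> attains this value.
\<close>
lemma transport_moment_measure: "transport (moment_measure V) \<eta> = ereal (real CARD('n))"
proof (rule antisym)
  note D = log_concave_probD[OF lc]
  have "transport (moment_measure V) \<eta>
      \<le> ereal_integral (moment_measure V) (conjugate V) + ereal_integral \<eta> (conjugate (conjugate V))"
    unfolding transport_def by (rule INF_lower[OF conjugate_convex_lsc[OF D(1)]])
  also have "\<dots> = ereal (real CARD('n))"
    by (simp add: biconjugate[OF D(1)] ereal_integral_conjugate_moment_measure ereal_integral_potential)
  finally show "transport (moment_measure V) \<eta> \<le> ereal (real CARD('n))" .
  show "ereal (real CARD('n)) \<le> transport (moment_measure V) \<eta>"
    unfolding transport_def
  proof (rule INF_greatest)
    fix f :: "real^'n \<Rightarrow> ereal" assume f: "f \<in> convex_lsc"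
    have fc: "conjugate f \<in> convex_lsc" by (rule conjugate_convex_lsc[OF f])
    note I1 = ereal_integral_convex_lsc[OF finite_first_moment_moment_measure f]
    note I2 = ereal_integral_convex_lsc[OF finite_first_moment_log_concave fc]
    show "ereal (real CARD('n)) \<le> ereal_integral (moment_measure V) f + ereal_integral \<eta> (conjugate f)"
    proof (cases "ereal_integral (moment_measure V) f < \<infinity> \<and> ereal_integral \<eta> (conjugate f) < \<infinity>")
      case False
      then have inf: "ereal_integral (moment_measure V) f + ereal_integral \<eta> (conjugate f) = \<infinity>"
        using I1(1) I2(1) by (auto simp: not_less)
      show ?thesis unfolding inf by simp
    next
      case True
      have [measurable]: "f \<in> borel_measurable borel" "conjugate f \<in> borel_measurable borel"
        by (auto intro: borel_measurable_convex_lsc[OF f] borel_measurable_convex_lsc[OF fc])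
      define p where "p y = real_of_ereal (f y)" for y
      define q where "q x = real_of_ereal (conjugate f x)" for x
      have pm: "p \<in> borel_measurable borel" and qm: "q \<in> borel_measurable borel"
        unfolding p_def[abs_def] q_def[abs_def] by measurable
      have pi: "integrable lborel (\<lambda>x. p (grad V x) * gibbs V x)" "ereal_integral (moment_measure V) f = ereal (\<integral>x. p (grad V x) * gibbs V x \<partial>lborel)"
        using I1(3,4) True integral_log_concave(3,4)[OF lc pm] unfolding p_def by auto
      have qi: "integrable lborel (\<lambda>x. q x * gibbs V x)" "ereal_integral \<eta> (conjugate f) = ereal (\<integral>x. q x * gibbs V x \<partial>lborel)"
        using I2(3,4) True integral_log_concave(1,2)[OF lc qm] unfolding q_def by auto
      have fin1: "AE x in lborel. 0 < gibbs V x \<longrightarrow> f (grad V x) \<noteq> \<infinity>"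
        using I1(2) True by (subst AE_log_concave(2)[OF lc, symmetric]) auto
      have fin2: "AE x in lborel. 0 < gibbs V x \<longrightarrow> conjugate f x \<noteq> \<infinity>"
        using I2(2) True by (subst AE_log_concave(1)[OF lc, symmetric]) auto
      have "real CARD('n) = (\<integral>x. (x \<bullet> grad V x) * gibbs V x \<partial>lborel)" by (simp add: integral_inner_grad)
      also have "\<dots> \<le> (\<integral>x. p (grad V x) * gibbs V x + q x * gibbs V x \<partial>lborel)"
      proof (rule integral_mono_AE)
        show "integrable lborel (\<lambda>x. (x \<bullet> grad V x) * gibbs V x)" by (rule integral_inner_grad)
        show "integrable lborel (\<lambda>x. p (grad V x) * gibbs V x + q x * gibbs V x)" using pi qi by simp
        show "AE x in lborel. (x \<bullet> grad V x) * gibbs V x \<le> p (grad V x) * gibbs V x + q x * gibbs V x"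
          using fin1 fin2
        proof eventually_elim
          case (elim x)
          show ?case
          proof (cases "gibbs V x = 0")
            case False
            then have "f (grad V x) \<noteq> \<infinity>" "conjugate f x \<noteq> \<infinity>" using elim gibbs_nonneg[of V x] by linarith+
            then have "x \<bullet> grad V x \<le> p (grad V x) + q x"
              using conjugate_upper[of "grad V x" x f] convex_lscD(3)[OF f, of "grad V x"] convex_lscD(3)[OF fc, of x]
              unfolding p_def q_def by (cases "f (grad V x)"; cases "conjugate f x") (auto simp: inner_commute)
            then have "(x \<bullet> grad V x) * gibbs V x \<le> (p (grad V x) + q x) * gibbs V x" by (rule mult_right_mono) simp
            then show ?thesis by (simp add: algebra_simps)
          qed simp
        qed
      qed
      also have "\<dots> = (\<integral>x. p (grad V x) * gibbs V x \<partial>lborel) + (\<integral>x. q x * gibbs V x \<partial>lborel)"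
        using pi qi by simp
      finally show ?thesis by (simp add: pi qi)
    qed
  qed
qed

text \<open>
  The tangent inequality in terms of the moment measure; the subtracted term is the integral of the
  conjugate of \<open>V\<close>.
\<close>
lemma exp_integral_le_moment_measure:
  assumes f: "f \<in> convex_lsc" and lt: "ereal_integral (moment_measure V) (conjugate f) \<le> ereal r"
  shows "exp_mass f
    \<le> ennreal (exp (r - (real CARD('n) - (\<integral>x. real_of_ereal (V x) * gibbs V x \<partial>lborel))))"
proof -
  note D = log_concave_probD[OF lc]
  obtain a b where co: "0 < a" "\<And>x. ereal (a * norm x - b) \<le> V x" using D(6) by blast
  obtain x0 where x0: "x0 \<in> interior (effective_dom V)" using D(7) by blast
  have fc: "conjugate f \<in> convex_lsc" by (rule conjugate_convex_lsc[OF f])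
  have [measurable]: "conjugate f \<in> borel_measurable borel" by (rule borel_measurable_convex_lsc[OF fc])
  have lt': "ereal_integral (moment_measure V) (conjugate f) < \<infinity>" using lt by (auto intro: le_less_trans)
  note I = ereal_integral_convex_lsc[OF finite_first_moment_moment_measure fc]
  let ?q = "\<lambda>y. real_of_ereal (conjugate f y)"
  have qi: "integrable lborel (\<lambda>x. ?q (grad V x) * gibbs V x)"
    and qe: "ereal_integral (moment_measure V) (conjugate f) = ereal (\<integral>x. ?q (grad V x) * gibbs V x \<partial>lborel)"
    using I(3,4)[OF lt'] integral_log_concave(3,4)[OF lc, of ?q] by auto
  have fin: "AE x in lborel. 0 < gibbs V x \<longrightarrow> conjugate f (grad V x) \<noteq> \<infinity>"
    using I(2)[OF lt'] by (subst AE_log_concave(2)[OF lc, symmetric]) auto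
  have "exp_mass f
    \<le> ennreal (exp (\<integral>x. (?q (grad V x) - (x \<bullet> grad V x - real_of_ereal (V x))) * gibbs V x \<partial>lborel))"
    by (rule tangent_inequality[OF D(1) x0 co reg D(5) f fin qi])
  also have "(\<integral>x. (?q (grad V x) - (x \<bullet> grad V x - real_of_ereal (V x))) * gibbs V x \<partial>lborel)
    = (\<integral>x. ?q (grad V x) * gibbs V x - ((x \<bullet> grad V x) * gibbs V x - real_of_ereal (V x) * gibbs V x) \<partial>lborel)"
    by (simp add: left_diff_distrib)
  also have "\<dots> = (\<integral>x. ?q (grad V x) * gibbs V x \<partial>lborel) - (real CARD('n) - (\<integral>x. real_of_ereal (V x) * gibbs V x \<partial>lborel))"
    using qi integral_inner_grad by simp
  also have "ennreal (exp \<dots>) \<le> ennreal (exp (r - (real CARD('n) - (\<integral>x. real_of_ereal (V x) * gibbs V x \<partial>lborel))))"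
    using lt unfolding qe by (intro ennreal_leI) simp
  finally show ?thesis .
qed

end

section \<open>Symmetry groups\<close>

text \<open>
  A common setting for the three symmetry classes. Involutions suffice for them, and make each map its
  own inverse and adjoint, so that invariance passes to conjugates and gradients without inverses
  appearing.
\<close>
definition involution_group :: "('a::euclidean_space \<Rightarrow> 'a) set \<Rightarrow> bool" where
  "involution_group \<Gamma> \<longleftrightarrow> finite \<Gamma> \<and> id \<in> \<Gamma> \<and> (\<forall>g\<in>\<Gamma>. \<forall>h\<in>\<Gamma>. g \<circ> h \<in> \<Gamma>) \<and>
     (\<forall>g\<in>\<Gamma>. linear g \<and> (\<forall>x. g (g x) = x) \<and> (\<forall>x y. g x \<bullet> y = x \<bullet> g y) \<and> distr lborel borel g = lborel)"

definition invariant_fun :: "('a \<Rightarrow> 'a) set \<Rightarrow> ('a \<Rightarrow> 'b) \<Rightarrow> bool" where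
  "invariant_fun \<Gamma> f \<longleftrightarrow> (\<forall>g\<in>\<Gamma>. \<forall>x. f (g x) = f x)"

lemma involution_groupD:
  assumes "involution_group \<Gamma>" "g \<in> \<Gamma>"
  shows "linear g" "g (g x) = x" "g x \<bullet> y = x \<bullet> g y" "distr lborel borel g = lborel"
    "norm (g x) = norm x" "g \<in> borel_measurable borel" "continuous_on UNIV g" "g 0 = 0"
proof -
  show l: "linear g" and i: "g (g x) = x" and s: "g x \<bullet> y = x \<bullet> g y" and "distr lborel borel g = lborel" for x y
    using assms by (auto simp: involution_group_def)
  show "norm (g x) = norm x" using s[of x "g x"] i[of x] by (simp add: norm_eq_sqrt_inner)
  show c: "continuous_on UNIV g" using l by (rule linear_continuous_on[OF linear_conv_bounded_linear[THEN iffD1]])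
  show "g \<in> borel_measurable borel" using c by (rule borel_measurable_continuous_onI)
  show "g 0 = 0" using l by (rule linear_0)
qed

lemma invariant_conjugate:
  assumes \<Gamma>: "involution_group \<Gamma>" and f: "invariant_fun \<Gamma> f"
  shows "invariant_fun \<Gamma> (conjugate f)"
  unfolding invariant_fun_def
proof (intro ballI allI)
  fix g y assume g: "g \<in> \<Gamma>"
  note G = involution_groupD[OF \<Gamma> g]
  have le: "conjugate f (g y) \<le> conjugate f y" for y
    unfolding conjugate_def[of f "g y"]
  proof (rule SUP_least)
    fix x
    have "ereal (x \<bullet> g y) - f x = ereal (g x \<bullet> y) - f (g x)" using f g by (simp add: G(3) invariant_fun_def)
    then show "ereal (x \<bullet> g y) - f x \<le> conjugate f y" by (simp add: conjugate_upper)
  qed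
  show "conjugate f (g y) = conjugate f y" using le[of y] le[of "g y"] by (simp add: G(2))
qed

lemma invariant_cutoff:
  "involution_group \<Gamma> \<Longrightarrow> invariant_fun \<Gamma> f \<Longrightarrow> invariant_fun \<Gamma> (cutoff k f)"
  using involution_groupD(5) by (fastforce simp: invariant_fun_def cutoff_def)

lemma convex_lsc_comp_linear:
  fixes V :: "'a::euclidean_space \<Rightarrow> ereal"
  assumes V: "V \<in> convex_lsc" and \<Gamma>: "involution_group \<Gamma>" "g \<in> \<Gamma>"
  shows "(\<lambda>x. V (g x)) \<in> convex_lsc"
proof -
  note G = involution_groupD[OF \<Gamma>]
  have "convex_ereal (\<lambda>x. V (g x))"
    using convex_lscD(1)[OF V] by (simp add: convex_ereal_def linear_add[OF G(1)] linear_scale[OF G(1)])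
  moreover have "lsc (\<lambda>x. V (g x))"
    unfolding lsc_iff_eventually
  proof (intro allI impI)
    fix x a assume "a < V (g x)"
    then have "\<forall>\<^sub>F y in nhds (g x). a < V y" using convex_lscD(2)[OF V] unfolding lsc_iff_eventually by blast
    moreover have "filterlim g (nhds (g x)) (nhds x)"
      using G(7) by (simp add: continuous_on_eq_continuous_at isCont_def tendsto_at_iff_tendsto_nhds)
    ultimately show "\<forall>\<^sub>F y in nhds x. a < V (g y)" by (rule eventually_compose_filterlim)
  qed
  moreover have "\<exists>x. V (g x) \<noteq> \<infinity>"
  proof -
    obtain x r where "V x = ereal r" using convex_lscD(4)[OF V] by blast
    then have "V (g (g x)) \<noteq> \<infinity>" by (simp add: G(2))
    then show ?thesis by blast
  qed
  ultimately show ?thesis using convex_lscD(3)[OF V] by (simp add: convex_lsc_def)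
qed

text \<open>
  A closed convex function is determined by its values almost everywhere: shrinking a ball in the domain
  of \<open>W\<close> towards \<open>x\<close> gives small balls near \<open>x\<close> on which
  \<open>W\<close> is at most slightly larger than \<open>W x\<close>, and each contains a point at
  which \<open>V = W\<close>.
\<close>
lemma convex_lsc_le_of_AE_eq:
  fixes V W :: "'a::euclidean_space \<Rightarrow> ereal"
  assumes V: "V \<in> convex_lsc" and W: "W \<in> convex_lsc" and ae: "AE x in lborel. V x = W x"
    and int: "interior (effective_dom W) \<noteq> {}"
  shows "V x \<le> W x"
proof (cases "W x")
  case (real w)
  obtain x0 where "x0 \<in> interior (effective_dom W)" using int by blast
  then obtain r m where r: "0 < r" "\<And>z. z \<in> cball x0 r \<Longrightarrow> W z \<le> ereal m"
    using convex_lsc_bounded_near[OF W] by metis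
  show ?thesis
  proof (rule ccontr)
    assume "\<not> V x \<le> W x"
    then obtain c where c: "w < c" "ereal c < V x" using real by (auto simp: not_le dest: ereal_dense2)
    have "\<forall>\<^sub>F y in nhds x. ereal c < V y" using convex_lscD(2)[OF V] c(2) unfolding lsc_iff_eventually by blast
    then obtain d where d: "d > 0" "\<And>y. dist y x < d \<Longrightarrow> ereal c < V y" by (auto simp: eventually_nhds_metric)
    define q where "q = norm (x0 - x) + r"
    have q: "q > 0" using r by (simp add: q_def add_nonneg_pos)
    obtain t where t: "0 < t" "t < 1" "t * (m - w) < c - w" "t * q < d"
    proof -
      have l: "((\<lambda>t. t * (m - w)) \<longlongrightarrow> 0 * (m - w)) (at_right 0)" "((\<lambda>t. t * q) \<longlongrightarrow> 0 * q) (at_right 0)"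
        by (intro tendsto_intros)+
      have "\<forall>\<^sub>F t in at_right 0. t * (m - w) < c - w" using order_tendstoD(2)[OF l(1), of "c - w"] c by simp
      moreover have "\<forall>\<^sub>F t in at_right 0. t * q < d" using order_tendstoD(2)[OF l(2), of d] d by simp
      moreover have "\<forall>\<^sub>F t in at_right 0. 0 < t \<and> t < (1::real)"
        by (auto simp: eventually_at_right_field intro!: exI[of _ 1])
      ultimately have "\<forall>\<^sub>F t in at_right 0. 0 < t \<and> t < 1 \<and> t * (m - w) < c - w \<and> t * q < d"
        by eventually_elim simp
      then show ?thesis using that eventually_happens'[OF trivial_limit_at_right_real] by blast
    qed
    let ?B = "ball (x + t *\<^sub>R (x0 - x)) (t * r)"
    have "\<exists>z\<in>?B. V z = W z"
    proof (rule ccontr)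
      assume "\<not> ?thesis"
      then have "AE z in lborel. z \<notin> ?B" using ae by (auto elim!: eventually_mono)
      then have "emeasure lborel ?B = 0"
        by (subst (asm) AE_iff_measurable[OF _ refl]) (auto simp: ball_def)
      moreover have "0 < emeasure lborel ?B" using t r by (subst emeasure_ball) auto
      ultimately show False by simp
    qed
    then obtain z where z: "z \<in> ?B" "V z = W z" by blast
    \<comment> \<open>the point of the large ball that is shrunk to \<open>z\<close>\<close>
    define u where "u = x + (1 / t) *\<^sub>R (z - x)"
    have zu: "z = (1 - t) *\<^sub>R x + t *\<^sub>R u" using t by (simp add: u_def algebra_simps)
    have "u - x0 = (1 / t) *\<^sub>R (z - (x + t *\<^sub>R (x0 - x)))" using t by (simp add: u_def algebra_simps)
    then have "norm (u - x0) = (1 / t) * dist z (x + t *\<^sub>R (x0 - x))" using t by (simp add: dist_norm)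
    also have "\<dots> \<le> (1 / t) * (t * r)" using z(1) t by (intro mult_left_mono) (auto simp: dist_commute less_imp_le)
    also have "\<dots> = r" using t by simp
    finally have ur: "norm (u - x0) \<le> r" .
    then have "W u \<le> ereal m" by (intro r) (simp add: dist_norm norm_minus_commute)
    then have "W z \<le> ereal ((1 - t) * w + t * m)"
      unfolding zu using t real by (intro convex_erealD convex_lscD(1)[OF W]) auto
    also have "\<dots> < ereal c" using t by (simp add: algebra_simps)
    finally have "V z < ereal c" using z by simp
    moreover have "dist z x < d"
    proof -
      have "z - x = t *\<^sub>R (u - x)" by (simp add: zu algebra_simps)
      then have "dist z x = t * norm (u - x)" using t by (simp add: dist_norm)
      also have "norm (u - x) \<le> norm (u - x0) + norm (x0 - x)" using norm_triangle_ineq[of "u - x0" "x0 - x"] by simp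
      also have "\<dots> \<le> q" using ur by (simp add: q_def)
      finally have "dist z x \<le> t * q" using t by simp
      then show ?thesis using t by simp
    qed
    ultimately show False using d(2)[of z] by simp
  qed
qed (use convex_lscD(3)[OF W] in auto)

lemma distr_density_involution:
  assumes \<Gamma>: "involution_group \<Gamma>" "g \<in> \<Gamma>" and u[measurable]: "u \<in> borel_measurable borel"
  shows "distr (density lborel u) borel g = density lborel (\<lambda>x. u (g x))"
proof -
  note G = involution_groupD[OF \<Gamma>]
  have [measurable]: "g \<in> borel_measurable borel" by (rule G(6))
  have "density (distr lborel borel g) (\<lambda>x. u (g x)) = distr (density lborel (\<lambda>x. u (g (g x)))) borel g"
    by (rule density_distr) measurable
  then show ?thesis by (simp add: G(2,4))
qed

text \<open>
  An invariant measure has an invariant potential: the density is invariant almost everywhere, and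
  closed convex functions that agree almost everywhere are equal.
\<close>
lemma invariant_potential:
  fixes V :: "real^'n \<Rightarrow> ereal"
  assumes \<Gamma>: "involution_group \<Gamma>" and lc: "log_concave_prob \<eta> V" and inv: "\<And>g. g \<in> \<Gamma> \<Longrightarrow> distr \<eta> \<eta> g = \<eta>"
  shows "invariant_fun \<Gamma> V"
  unfolding invariant_fun_def
proof (intro ballI allI)
  fix g x assume g: "g \<in> \<Gamma>"
  note D = log_concave_probD[OF lc]
  note G = involution_groupD[OF \<Gamma> g]
  have gm[measurable]: "gibbs V \<in> borel_measurable borel" "g \<in> borel_measurable borel"
    by (auto intro: borel_measurable_gibbs borel_measurable_convex_lsc[OF D(1)] G(6))
  have Vg: "(\<lambda>x. V (g x)) \<in> convex_lsc" by (rule convex_lsc_comp_linear[OF D(1) \<Gamma> g])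
  have "distr \<eta> borel g = distr \<eta> \<eta> g" by (rule distr_cong) (simp_all add: D(2))
  then have "density lborel (\<lambda>x. ennreal (gibbs V (g x))) = density lborel (\<lambda>x. ennreal (gibbs V x))"
    using distr_density_involution[OF \<Gamma> g, of "\<lambda>x. ennreal (gibbs V x)"] inv[OF g] D(2) by simp
  then have "AE x in lborel. ennreal (gibbs V (g x)) = ennreal (gibbs V x)"
    by (subst (asm) sigma_finite_measure.density_unique_iff[OF sigma_finite_lborel]) auto
  then have ae: "AE x in lborel. V (g x) = V x"
  proof eventually_elim
    case (elim x)
    then have "gibbs V (g x) = gibbs V x" by simp
    then show ?case using convex_lscD(3)[OF D(1), of x] convex_lscD(3)[OF D(1), of "g x"]
      by (cases "V x"; cases "V (g x)") (auto simp: gibbs_simps)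
  qed
  have le: "V (g x) \<le> V x" for x
    by (rule convex_lsc_le_of_AE_eq[OF Vg D(1) ae D(7)])
  show "V (g x) = V x" using le[of x] le[of "g x"] by (simp add: G(2))
qed

lemma grad_equivariant:
  fixes V :: "'a::euclidean_space \<Rightarrow> ereal"
  assumes \<Gamma>: "involution_group \<Gamma>" "g \<in> \<Gamma>" and inv: "invariant_fun \<Gamma> V"
  shows "grad V (g x) = g (grad V x)"
proof -
  note G = involution_groupD[OF \<Gamma>]
  have Vg: "V (g x) = V x" for x using inv \<Gamma>(2) by (simp add: invariant_fun_def)
  have ge: "grad_exists V (g x) \<and> grad V (g x) = g (grad V x)" if "grad_exists V x" for x
  proof -
    let ?U = "interior (effective_dom V)"
    have "g -` ?U \<subseteq> ?U"
    proof (rule interior_maximal)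
      show "g -` ?U \<subseteq> effective_dom V" using interior_subset[of "effective_dom V"] by (auto simp: effective_dom_def Vg)
      show "open (g -` ?U)" using G(7) by (rule open_vimage[rotated]) simp
    qed
    then have int: "g x \<in> ?U" using that by (auto simp: grad_exists_def G(2))
    have "((\<lambda>y. real_of_ereal (V y)) has_derivative (\<lambda>h. h \<bullet> grad V x)) (at (g (g x)))"
      using GDERIV_grad[OF that] by (simp add: gderiv_def G(2))
    moreover have "(g has_derivative g) (at (g x))"
      using G(1) by (intro bounded_linear_imp_has_derivative) (simp add: linear_conv_bounded_linear)
    ultimately have "((\<lambda>y. real_of_ereal (V (g y))) has_derivative (\<lambda>h. g h \<bullet> grad V x)) (at (g x))"
      by (rule has_derivative_compose[rotated])
    then have d: "GDERIV (\<lambda>y. real_of_ereal (V y)) (g x) :> g (grad V x)"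
      by (simp add: gderiv_def Vg G(3))
    have e: "grad_exists V (g x)" using int d by (auto simp: grad_exists_def)
    then show ?thesis using GDERIV_unique[OF GDERIV_grad[OF e] d] by simp
  qed
  show ?thesis
  proof (cases "grad_exists V x")
    case False
    have "\<not> grad_exists V (g x)" using ge[of "g x"] False by (auto simp: G(2))
    then show ?thesis using False by (simp add: grad_not_exists G(8))
  qed (use ge in blast)
qed

lemma invariant_moment_measure:
  fixes V :: "real^'n \<Rightarrow> ereal"
  assumes \<Gamma>: "involution_group \<Gamma>" and lc: "log_concave_prob \<eta> V" and inv: "\<And>g. g \<in> \<Gamma> \<Longrightarrow> distr \<eta> \<eta> g = \<eta>"
    and g: "g \<in> \<Gamma>"
  shows "distr (moment_measure V) borel g = moment_measure V"
proof -
  note D = log_concave_probD[OF lc]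
  note G = involution_groupD[OF \<Gamma> g]
  have gm: "grad V \<in> \<eta> \<rightarrow>\<^sub>M borel" "g \<in> \<eta> \<rightarrow>\<^sub>M borel" unfolding D(2) using borel_measurable_grad[OF D(1)] G(6) by auto
  have gm': "grad V \<in> borel_measurable borel" by (rule borel_measurable_grad[OF D(1)])
  have "distr \<eta> borel g = distr \<eta> \<eta> g" by (rule distr_cong) (simp_all add: D(2))
  then have e: "distr \<eta> borel g = \<eta>" using inv[OF g] by simp
  have "distr (moment_measure V) borel g = distr \<eta> borel (g \<circ> grad V)"
    unfolding D(8) by (rule distr_distr[OF G(6) gm(1)])
  also have "g \<circ> grad V = grad V \<circ> g"
    using grad_equivariant[OF \<Gamma> g invariant_potential[OF \<Gamma> lc inv]] by (auto simp: comp_def)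
  also have "distr \<eta> borel (grad V \<circ> g) = distr (distr \<eta> borel g) borel (grad V)"
    by (rule distr_distr[OF gm' gm(2), symmetric])
  finally show ?thesis unfolding e D(8) .
qed

section \<open>Averaging and regularising competitors\<close>

text \<open>
  The mean over the group, with the value \<open>\<infinity>\<close> as soon as one term is infinite.
  Computing with real parts avoids sums of extended reals.
\<close>
definition average :: "('a \<Rightarrow> 'a) set \<Rightarrow> ('a \<Rightarrow> ereal) \<Rightarrow> 'a \<Rightarrow> ereal" where
  "average \<Gamma> f x = (if \<forall>g\<in>\<Gamma>. f (g x) \<noteq> \<infinity> then ereal ((\<Sum>g\<in>\<Gamma>. real_of_ereal (f (g x))) / card \<Gamma>) else \<infinity>)"

lemma invariant_average:
  assumes \<Gamma>: "involution_group \<Gamma>" shows "invariant_fun \<Gamma> (average \<Gamma> f)"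
  unfolding invariant_fun_def
proof (intro ballI allI)
  fix h x assume h: "h \<in> \<Gamma>"
  have bij: "bij_betw (\<lambda>g. g \<circ> h) \<Gamma> \<Gamma>"
  proof (rule bij_betw_byWitness[where f'="\<lambda>g. g \<circ> h"])
    show "\<forall>g\<in>\<Gamma>. (g \<circ> h) \<circ> h = g" "\<forall>g\<in>\<Gamma>. (g \<circ> h) \<circ> h = g"
      using involution_groupD(2)[OF \<Gamma> h] by (auto simp: fun_eq_iff)
    show "(\<lambda>g. g \<circ> h) ` \<Gamma> \<subseteq> \<Gamma>" "(\<lambda>g. g \<circ> h) ` \<Gamma> \<subseteq> \<Gamma>" using \<Gamma> h by (auto simp: involution_group_def)
  qed
  have "(\<forall>g\<in>\<Gamma>. f (g (h x)) \<noteq> \<infinity>) \<longleftrightarrow> (\<forall>g\<in>(\<lambda>g. g \<circ> h) ` \<Gamma>. f (g x) \<noteq> \<infinity>)" by simp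
  then have 1: "(\<forall>g\<in>\<Gamma>. f (g (h x)) \<noteq> \<infinity>) \<longleftrightarrow> (\<forall>g\<in>\<Gamma>. f (g x) \<noteq> \<infinity>)"
    unfolding bij_betw_imp_surj_on[OF bij] .
  have "(\<Sum>g\<in>\<Gamma>. real_of_ereal (f (g (h x)))) = (\<Sum>g\<in>\<Gamma>. real_of_ereal (f (g x)))"
    using sum.reindex_bij_betw[OF bij, of "\<lambda>g. real_of_ereal (f (g x))"] by simp
  then show "average \<Gamma> f (h x) = average \<Gamma> f x" unfolding average_def 1 by simp
qed

text \<open>
  Averaging a function and its conjugate separately preserves Young's inequality, because the group acts
  by isometries.
\<close>
lemma average_young:
  fixes f :: "'a::euclidean_space \<Rightarrow> ereal"
  assumes \<Gamma>: "involution_group \<Gamma>" and f: "f \<in> convex_lsc" and a: "average \<Gamma> f x = ereal a"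
  shows "ereal (x \<bullet> y - a) \<le> average \<Gamma> (conjugate f) y"
proof (cases "\<forall>g\<in>\<Gamma>. conjugate f (g y) \<noteq> \<infinity>")
  case False
  then show ?thesis by (simp only: average_def if_False ereal_less_eq)
next
  case True
  have ff: "\<forall>g\<in>\<Gamma>. f (g x) \<noteq> \<infinity>" using a by (simp add: average_def split: if_splits)
  have N: "0 < real (card \<Gamma>)" using \<Gamma> by (auto simp: involution_group_def card_gt_0_iff)
  have "x \<bullet> y \<le> real_of_ereal (f (g x)) + real_of_ereal (conjugate f (g y))" if g: "g \<in> \<Gamma>" for g
  proof -
    have "g x \<bullet> g y = x \<bullet> y" using involution_groupD(2,3)[OF \<Gamma> g] by simp
    then show ?thesis
      using conjugate_upper[of "g x" "g y" f] ff True g convex_lscD(3)[OF f, of "g x"]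
        convex_lscD(3)[OF conjugate_convex_lsc[OF f], of "g y"]
      by (cases "f (g x)"; cases "conjugate f (g y)") auto
  qed
  then have "(\<Sum>g\<in>\<Gamma>. x \<bullet> y) \<le> (\<Sum>g\<in>\<Gamma>. real_of_ereal (f (g x)) + real_of_ereal (conjugate f (g y)))"
    by (rule sum_mono)
  then have "x \<bullet> y \<le> ((\<Sum>g\<in>\<Gamma>. real_of_ereal (f (g x))) + (\<Sum>g\<in>\<Gamma>. real_of_ereal (conjugate f (g y)))) / card \<Gamma>"
    using N by (simp add: sum.distrib le_divide_eq mult.commute)
  moreover have "a = (\<Sum>g\<in>\<Gamma>. real_of_ereal (f (g x))) / card \<Gamma>" using a ff by (simp add: average_def)
  ultimately show ?thesis using True by (simp add: average_def add_divide_distrib)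
qed

lemma ereal_integral_average:
  fixes f :: "'a::euclidean_space \<Rightarrow> ereal"
  assumes \<Gamma>: "involution_group \<Gamma>" and \<mu>: "finite_first_moment \<mu>" "\<And>g. g \<in> \<Gamma> \<Longrightarrow> distr \<mu> borel g = \<mu>"
    and f: "f \<in> convex_lsc" and r: "ereal_integral \<mu> f = ereal r"
  shows "ereal_integral \<mu> (\<lambda>x. average \<Gamma> f x + ereal (e * norm x)) = ereal (r + e * (\<integral>x. norm x \<partial>\<mu>))"
    "\<exists>x a. average \<Gamma> f x = ereal a"
proof -
  have lt: "ereal_integral \<mu> f < \<infinity>" using r by simp
  note I = ereal_integral_convex_lsc[OF \<mu>(1) f]
  have s: "sets \<mu> = sets borel" and p: "prob_space \<mu>" and n: "integrable \<mu> norm"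
    using \<mu>(1) by (auto simp: finite_first_moment_def)
  have [measurable]: "f \<in> borel_measurable borel" by (rule borel_measurable_convex_lsc[OF f])
  have N: "0 < real (card \<Gamma>)" and fin: "finite \<Gamma>" using \<Gamma> by (auto simp: involution_group_def card_gt_0_iff)
  have gm: "g \<in> \<mu> \<rightarrow>\<^sub>M borel" if "g \<in> \<Gamma>" for g
    using involution_groupD(6)[OF \<Gamma> that] measurable_cong_sets[OF s refl] by blast
  have ae: "AE x in \<mu>. \<forall>g\<in>\<Gamma>. f (g x) \<noteq> \<infinity>"
  proof (rule AE_finite_allI[OF fin])
    fix g assume g: "g \<in> \<Gamma>"
    have "AE x in distr \<mu> borel g. f x \<noteq> \<infinity>" unfolding \<mu>(2)[OF g] by (rule I(2)[OF lt])
    then show "AE x in \<mu>. f (g x) \<noteq> \<infinity>" by (subst (asm) AE_distr_iff[OF gm[OF g]]) auto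
  qed
  let ?q = "\<lambda>x. real_of_ereal (f x)"
  have qi: "integrable \<mu> (\<lambda>x. ?q (g x))" and qe: "(\<integral>x. ?q (g x) \<partial>\<mu>) = r" if g: "g \<in> \<Gamma>" for g
  proof -
    have "integrable (distr \<mu> borel g) ?q" unfolding \<mu>(2)[OF g] by (rule I(3)[OF lt])
    then show "integrable \<mu> (\<lambda>x. ?q (g x))" by (subst (asm) integrable_distr_eq[OF gm[OF g]]) auto
    have "(\<integral>x. ?q x \<partial>distr \<mu> borel g) = r" unfolding \<mu>(2)[OF g] using I(4)[OF lt] r by simp
    then show "(\<integral>x. ?q (g x) \<partial>\<mu>) = r" by (subst (asm) integral_distr[OF gm[OF g]]) auto
  qed
  have avi: "integrable \<mu> (\<lambda>x. (\<Sum>g\<in>\<Gamma>. ?q (g x)) / card \<Gamma> + e * norm x)"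
    using qi n by (intro Bochner_Integration.integrable_add integrable_divide Bochner_Integration.integrable_sum integrable_mult_right) auto
  have "ereal_integral \<mu> (\<lambda>x. average \<Gamma> f x + ereal (e * norm x)) = ereal (\<integral>x. (\<Sum>g\<in>\<Gamma>. ?q (g x)) / card \<Gamma> + e * norm x \<partial>\<mu>)"
    by (rule ereal_integral_eqI[OF avi]) (use ae in eventually_elim, auto simp: average_def)
  also have "(\<integral>x. (\<Sum>g\<in>\<Gamma>. ?q (g x)) / card \<Gamma> + e * norm x \<partial>\<mu>) = (\<Sum>g\<in>\<Gamma>. r) / card \<Gamma> + e * (\<integral>x. norm x \<partial>\<mu>)"
    using qi n qe by (subst Bochner_Integration.integral_add) auto
  also have "(\<Sum>g\<in>\<Gamma>. r) / card \<Gamma> = r" using N by simp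
  finally show "ereal_integral \<mu> (\<lambda>x. average \<Gamma> f x + ereal (e * norm x)) = ereal (r + e * (\<integral>x. norm x \<partial>\<mu>))" .
  obtain x where "\<forall>g\<in>\<Gamma>. f (g x) \<noteq> \<infinity>"
    using eventually_happens'[OF _ ae] prob_space.ae_filter_bot[OF p] by blast
  then have "average \<Gamma> f x = ereal ((\<Sum>g\<in>\<Gamma>. ?q (g x)) / card \<Gamma>)" by (simp add: average_def)
  then show "\<exists>x a. average \<Gamma> f x = ereal a" by blast
qed

text \<open>
  Every competitor in a transport cost between invariant measures can be made invariant, with positive
  masses \<open>Z(h)\<close> and \<open>Z(h\<^sup>*)\<close>, at an arbitrarily small cost. Averaging
  gives invariance. Adding \<open>e\<close> times the norm to the conjugate, and then to the function
  itself, spreads each of the two domains over a ball. Each time the conjugate restores convexity and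
  semicontinuity, and a biconjugate can only be smaller than the function, so the integrals stay under
  control.
\<close>
lemma regular_symmetric_competitor:
  fixes f :: "'a::euclidean_space \<Rightarrow> ereal"
  assumes \<Gamma>: "involution_group \<Gamma>"
    and \<mu>: "finite_first_moment \<mu>" "\<And>g. g \<in> \<Gamma> \<Longrightarrow> distr \<mu> borel g = \<mu>"
    and \<nu>: "finite_first_moment \<nu>" "\<And>g. g \<in> \<Gamma> \<Longrightarrow> distr \<nu> borel g = \<nu>"
    and f: "f \<in> convex_lsc" and r: "ereal_integral \<mu> f = ereal r" and s: "ereal_integral \<nu> (conjugate f) = ereal s"
    and e: "0 < e"
  obtains h where "h \<in> convex_lsc" "invariant_fun \<Gamma> h"
    "0 < exp_mass h" "0 < exp_mass (conjugate h)"
    "ereal_integral \<mu> h \<le> ereal (r + e * (\<integral>x. norm x \<partial>\<mu>))"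
    "ereal_integral \<nu> (conjugate h) \<le> ereal (s + e * (\<integral>x. norm x \<partial>\<nu>))"
proof -
  have fc: "conjugate f \<in> convex_lsc" by (rule conjugate_convex_lsc[OF f])
  define A where "A = average \<Gamma> f"
  \<comment> \<open>the perturbed mean of the conjugate; its own conjugate \<open>f1\<close> lies below the mean \<open>A\<close> of \<open>f\<close>\<close>
  define B where "B y = average \<Gamma> (conjugate f) y + ereal (e * norm y)" for y
  obtain x0 a0 where x0: "A x0 = ereal a0" using ereal_integral_average(2)[OF \<Gamma> \<mu> f r] by (auto simp: A_def)
  obtain y0 b1 where y0: "average \<Gamma> (conjugate f) y0 = ereal b1" using ereal_integral_average(2)[OF \<Gamma> \<nu> fc s] by blast
  define b0 where "b0 = b1 + e * norm y0"
  have By0: "B y0 = ereal b0" by (simp add: B_def y0 b0_def)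
  have AB: "ereal (y \<bullet> (x + u) - a) \<le> B y" if "A x = ereal a" "norm u \<le> e" for x a u y
  proof -
    have "ereal (x \<bullet> y - a) \<le> average \<Gamma> (conjugate f) y"
      using that(1) unfolding A_def by (rule average_young[OF \<Gamma> f])
    moreover have "y \<bullet> u \<le> e * norm y"
      using norm_cauchy_schwarz[of y u] mult_left_mono[OF that(2), of "norm y"] by (simp add: mult.commute)
    ultimately have "ereal (x \<bullet> y - a) + ereal (y \<bullet> u) \<le> B y" unfolding B_def by (intro add_mono) auto
    then show ?thesis by (simp add: inner_add_right inner_commute[of y x] algebra_simps)
  qed
  define f1 where "f1 = conjugate B"
  have f1A: "f1 x \<le> A x" for x
  proof (cases "A x")
    case (real a)
    then have "f1 x \<le> ereal a"
      unfolding f1_def conjugate_le_iff using AB[OF real, of 0] e by simp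
    then show ?thesis using real by simp
  next
    case MInf
    then show ?thesis by (simp add: A_def average_def split: if_splits)
  qed simp
  have f1ball: "f1 (x0 + u) \<le> ereal a0" if "norm u \<le> e" for u
    unfolding f1_def conjugate_le_iff using AB[OF x0 that] by blast
  have f1low: "ereal (x \<bullet> y0 - b0) \<le> f1 x" for x
    unfolding f1_def using conjugate_lower_bound[of B y0 b0 x] By0 by (simp add: inner_commute)
  define A' where "A' x = f1 x + ereal (e * norm x)" for x
  have A'f1: "f1 x \<le> A' x" for x using e by (cases "f1 x") (auto simp: A'_def)
  \<comment> \<open>\<open>p\<close> is the conjugate of the competitor, and \<open>h\<close> the competitor itself\<close>
  define p where "p = conjugate A'"
  have f1x0: "f1 x0 = ereal (real_of_ereal (f1 x0))"
    using f1ball[of 0] f1low[of x0] e by (cases "f1 x0") auto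
  have p: "p \<in> convex_lsc"
    unfolding p_def
  proof (rule conjugate_convex_lscI)
    show "A' x0 = ereal (real_of_ereal (f1 x0) + e * norm x0)" unfolding A'_def by (subst f1x0) simp
    show "ereal (x \<bullet> y0 - b0) \<le> A' x" for x using f1low A'f1 order_trans by blast
  qed
  define h where "h = conjugate p"
  have h: "h \<in> convex_lsc" unfolding h_def by (rule conjugate_convex_lsc[OF p])
  have hc: "conjugate h = p" unfolding h_def by (rule biconjugate[OF p])
  have hA': "h x \<le> A' x" for x unfolding h_def p_def by (rule biconjugate_le)
  have Asym: "invariant_fun \<Gamma> B"
    using invariant_average[OF \<Gamma>, of "conjugate f"] involution_groupD(5)[OF \<Gamma>] by (simp add: invariant_fun_def B_def)
  have "invariant_fun \<Gamma> A'"
    using invariant_conjugate[OF \<Gamma> Asym] involution_groupD(5)[OF \<Gamma>] by (simp add: invariant_fun_def A'_def f1_def)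
  then have hsym: "invariant_fun \<Gamma> h" unfolding h_def p_def by (intro invariant_conjugate[OF \<Gamma>])
  have pos1: "0 < exp_mass h"
  proof (rule pos_integral_of_interior_dom[OF h e])
    fix x assume "x \<in> cball x0 e"
    then have "f1 x \<le> ereal a0" using f1ball[of "x - x0"] by (simp add: dist_norm norm_minus_commute)
    then have "f1 x < \<infinity>" by (rule le_less_trans) simp
    then have "A' x < \<infinity>" by (simp add: A'_def)
    then show "h x < \<infinity>" using hA'[of x] by (rule le_less_trans[rotated])
  qed
  have pos2: "0 < exp_mass (conjugate h)"
    unfolding hc
  proof (rule pos_integral_of_interior_dom[OF p e])
    fix y assume "y \<in> cball y0 e"
    then have u: "norm (y - y0) \<le> e" by (simp add: dist_norm norm_minus_commute)
    have "p y \<le> ereal b0"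
      unfolding p_def conjugate_le_iff
    proof
      fix x
      have "x \<bullet> (y - y0) \<le> e * norm x"
        using norm_cauchy_schwarz[of x "y - y0"] mult_left_mono[OF u, of "norm x"] by (simp add: mult.commute)
      then have "ereal (x \<bullet> y0 - b0) + ereal (x \<bullet> (y - y0)) \<le> A' x"
        unfolding A'_def using f1low[of x] by (intro add_mono) auto
      then show "ereal (x \<bullet> y - b0) \<le> A' x" by (simp add: inner_diff_right)
    qed
    then show "p y < \<infinity>" by (rule le_less_trans) simp
  qed
  have int1: "ereal_integral \<mu> h \<le> ereal (r + e * (\<integral>x. norm x \<partial>\<mu>))"
  proof -
    have "h x \<le> average \<Gamma> f x + ereal (e * norm x)" for x
      using hA'[of x] add_right_mono[OF f1A[of x], of "ereal (e * norm x)"] by (simp add: A'_def A_def)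
    then have "ereal_integral \<mu> h \<le> ereal_integral \<mu> (\<lambda>x. average \<Gamma> f x + ereal (e * norm x))"
      by (intro ereal_integral_mono) simp
    then show ?thesis using ereal_integral_average(1)[OF \<Gamma> \<mu> f r] by simp
  qed
  have int2: "ereal_integral \<nu> (conjugate h) \<le> ereal (s + e * (\<integral>x. norm x \<partial>\<nu>))"
  proof -
    have "p y \<le> average \<Gamma> (conjugate f) y + ereal (e * norm y)" for y
    proof -
      have "p y \<le> conjugate f1 y" unfolding p_def by (rule conjugate_mono) (rule A'f1)
      also have "\<dots> \<le> B y" unfolding f1_def by (rule biconjugate_le)
      finally show ?thesis by (simp add: B_def)
    qed
    then have "ereal_integral \<nu> (conjugate h) \<le> ereal_integral \<nu> (\<lambda>y. average \<Gamma> (conjugate f) y + ereal (e * norm y))"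
      unfolding hc by (intro ereal_integral_mono) simp
    then show ?thesis using ereal_integral_average(1)[OF \<Gamma> \<nu> fc s] by simp
  qed
  show ?thesis by (rule that[OF h hsym pos1 pos2 int1 int2])
qed

section \<open>Smoothing\<close>

text \<open>
  A finite regularisation with finite conjugate: the Lipschitz regularisation makes the function finite,
  the quadratic term makes the conjugate finite. The biconjugate is only there to make convexity and
  semicontinuity automatic. The factor \<open>k ^ 3\<close> makes the quadratic term at most \<open>1 /
  (2 k)\<close> on the ball of radius \<open>k\<close>, where the slopes of the regularised conjugate
  live.
\<close>
definition smoothing :: "real \<Rightarrow> ('a::euclidean_space \<Rightarrow> ereal) \<Rightarrow> 'a \<Rightarrow> ereal" where
  "smoothing k f = conjugate (conjugate (\<lambda>x. lipreg k f x + ereal (norm x ^ 2 / (2 * k ^ 3))))"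

lemma smoothing_properties:
  fixes f :: "'a::euclidean_space \<Rightarrow> ereal"
  assumes f: "f \<in> convex_lsc" and co: "0 < a" "\<And>x. ereal (a * norm x - b) \<le> f x" and k: "a \<le> k"
  shows "smoothing k f \<in> convex_lsc" "smoothing k f x \<noteq> \<infinity>" "conjugate (smoothing k f) y \<noteq> \<infinity>"
    "lipreg k f x \<le> smoothing k f x"
    "lipreg k (conjugate f) y \<le> conjugate (smoothing k f) y + ereal (1 / (2 * k))"
proof -
  note L = lipreg_properties[OF f co k]
  have kpos: "0 < k" using co k by linarith
  define A where "A x = lipreg k f x + ereal (norm x ^ 2 / (2 * k ^ 3))" for x
  have sm: "smoothing k f = conjugate (conjugate A)" by (simp add: smoothing_def A_def[abs_def])
  have Lr: "lipreg k f x = ereal (real_of_ereal (lipreg k f x))" for x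
    using L(3)[of x] convex_lscD(3)[OF L(1), of x] by (cases "lipreg k f x") auto
  have Ar: "A x = ereal (real_of_ereal (lipreg k f x) + norm x ^ 2 / (2 * k ^ 3))" for x
    unfolding A_def by (subst Lr) simp
  have LA: "lipreg k f x \<le> A x" for x unfolding Ar by (subst Lr) (use kpos in simp)
  obtain y1 c1 where m: "\<And>z. ereal (z \<bullet> y1 - c1) \<le> lipreg k f z" using affine_minorant[OF L(1)] by blast
  have cA: "conjugate A \<in> convex_lsc"
  proof (rule conjugate_convex_lscI)
    show "A 0 = ereal (real_of_ereal (lipreg k f 0) + norm (0::'a) ^ 2 / (2 * k ^ 3))" by (rule Ar)
    show "ereal (z \<bullet> y1 - c1) \<le> A z" for z using m LA order_trans by blast
  qed
  show "smoothing k f \<in> convex_lsc" unfolding sm by (rule conjugate_convex_lsc[OF cA])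
  have "smoothing k f x \<le> A x" for x unfolding sm by (rule biconjugate_le)
  then show "smoothing k f x \<noteq> \<infinity>" using Ar[of x] by (metis ereal_infty_less_eq(1) PInfty_neq_ereal(1))
  have conj: "conjugate (smoothing k f) = conjugate A" unfolding sm by (rule biconjugate[OF cA])
  have "conjugate A y \<le> conjugate (lipreg k f) y" for y by (rule conjugate_mono) (rule LA)
  then have "conjugate (conjugate (lipreg k f)) x \<le> smoothing k f x" unfolding sm by (rule conjugate_mono)
  then show "lipreg k f x \<le> smoothing k f x" by (simp add: biconjugate[OF L(1)])
  define M where "M = c1 + k ^ 3 * norm (y - y1) ^ 2 / 2"
  have "conjugate (smoothing k f) y \<le> ereal M"
    unfolding conj conjugate_le_iff
  proof
    fix x
    have l: "x \<bullet> y1 - c1 \<le> real_of_ereal (lipreg k f x)" using m[of x] by (subst (asm) Lr) simp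
    have "x \<bullet> (y - y1) \<le> norm x * norm (y - y1)" by (rule norm_cauchy_schwarz)
    also have "\<dots> \<le> norm x ^ 2 / (2 * k ^ 3) + k ^ 3 * norm (y - y1) ^ 2 / 2"
    proof -
      have "0 \<le> (norm x - k ^ 3 * norm (y - y1)) ^ 2 / (2 * k ^ 3)" using kpos by simp
      also have "\<dots> = norm x ^ 2 / (2 * k ^ 3) - norm x * norm (y - y1) + k ^ 3 * norm (y - y1) ^ 2 / 2"
        using kpos by (simp add: power2_eq_square field_simps)
      finally show ?thesis by simp
    qed
    finally show "ereal (x \<bullet> y - M) \<le> A x" using l unfolding Ar by (simp add: M_def inner_diff_right)
  qed
  then show "conjugate (smoothing k f) y \<noteq> \<infinity>" by auto
  show "lipreg k (conjugate f) y \<le> conjugate (smoothing k f) y + ereal (1 / (2 * k))"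
  proof -
    have "ereal (x \<bullet> y) - cutoff k f x \<le> conjugate A y + ereal (1 / (2 * k))" for x
    proof (cases "norm x \<le> k \<and> f x \<noteq> \<infinity>")
      case True
      then obtain r where r: "f x = ereal r" using convex_lscD(3)[OF f, of x] by (cases "f x") auto
      have "real_of_ereal (lipreg k f x) \<le> r" using lipreg_le[OF f, of k x] r by (subst (asm) Lr) simp
      moreover have "norm x ^ 2 / (2 * k ^ 3) \<le> 1 / (2 * k)"
      proof -
        have "norm x ^ 2 \<le> k ^ 2" using True by (intro power_mono) auto
        then have "norm x ^ 2 / (2 * k ^ 3) \<le> k ^ 2 / (2 * k ^ 3)" using kpos by (intro divide_right_mono) auto
        also have "\<dots> = 1 / (2 * k)" using kpos by (simp add: power2_eq_square power3_eq_cube)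
        finally show ?thesis .
      qed
      ultimately have "A x \<le> ereal (r + 1 / (2 * k))" unfolding Ar by simp
      then have "ereal (x \<bullet> y - (r + 1 / (2 * k))) \<le> conjugate A y" by (rule conjugate_lower_bound)
      from add_right_mono[OF this, of "ereal (1 / (2 * k))"] show ?thesis
        using True r by (simp add: cutoff_def)
    next
      case False
      then have "cutoff k f x = \<infinity>" by (auto simp: cutoff_def)
      then show ?thesis by simp
    qed
    then show ?thesis unfolding lipreg_def conj biconjugate[OF f] conjugate_def[of "cutoff k f"] by (intro SUP_least)
  qed
qed

lemma invariant_smoothing:
  assumes \<Gamma>: "involution_group \<Gamma>" and f: "invariant_fun \<Gamma> f" shows "invariant_fun \<Gamma> (smoothing k f)"
proof -
  have "invariant_fun \<Gamma> (lipreg k f)"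
    unfolding lipreg_def by (intro invariant_conjugate[OF \<Gamma>] invariant_cutoff[OF \<Gamma>] f)
  then have "invariant_fun \<Gamma> (\<lambda>x. lipreg k f x + ereal (norm x ^ 2 / (2 * k ^ 3)))"
    using involution_groupD(5)[OF \<Gamma>] by (simp add: invariant_fun_def)
  then show ?thesis unfolding smoothing_def by (intro invariant_conjugate[OF \<Gamma>])
qed

section \<open>From the inverse Santalo inequality to transport\<close>

text \<open>
  For a competitor with finite cost and positive masses, multiply the exponentiated tangent inequality
  for \<open>V2\<close> at \<open>h\<close> with that for \<open>V1\<close> at the conjugate of
  \<open>h\<close>, and compare with the inverse Santalo inequality.
\<close>
lemma transport_bound_of_santalo:
  fixes V1 V2 :: "real^'n \<Rightarrow> ereal"
  assumes c: "0 < c" and \<Gamma>: "involution_group \<Gamma>"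
    and santalo: "inverse_santalo {f \<in> convex_lsc. invariant_fun \<Gamma> f} c"
    and 1: "log_concave_prob \<eta>1 V1" "\<And>x0. ray_regular V1 x0" "\<And>g. g \<in> \<Gamma> \<Longrightarrow> distr \<eta>1 \<eta>1 g = \<eta>1"
    and 2: "log_concave_prob \<eta>2 V2" "\<And>x0. ray_regular V2 x0" "\<And>g. g \<in> \<Gamma> \<Longrightarrow> distr \<eta>2 \<eta>2 g = \<eta>2"
  shows "ereal_integral (moment_measure V1) (conjugate V1) + ereal_integral (moment_measure V2) (conjugate V2)
    \<le> ereal (- (real CARD('n) * ln c)) + transport (moment_measure V1) (moment_measure V2)"
proof -
  define a1 where "a1 = real CARD('n) - (\<integral>x. real_of_ereal (V1 x) * gibbs V1 x \<partial>lborel)"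
  define a2 where "a2 = real CARD('n) - (\<integral>x. real_of_ereal (V2 x) * gibbs V2 x \<partial>lborel)"
  let ?n1 = "moment_measure V1" and ?n2 = "moment_measure V2"
  note m1 = finite_first_moment_moment_measure[OF 1(1,2)] and m2 = finite_first_moment_moment_measure[OF 2(1,2)]
  have "ereal (a1 + a2 + real CARD('n) * ln c) \<le> transport ?n1 ?n2"
    unfolding transport_def
  proof (rule INF_greatest)
    fix f :: "real^'n \<Rightarrow> ereal" assume f: "f \<in> convex_lsc"
    have fc: "conjugate f \<in> convex_lsc" by (rule conjugate_convex_lsc[OF f])
    note I1 = ereal_integral_convex_lsc[OF m1 f] and I2 = ereal_integral_convex_lsc[OF m2 fc]
    show "ereal (a1 + a2 + real CARD('n) * ln c) \<le> ereal_integral ?n1 f + ereal_integral ?n2 (conjugate f)"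
    proof (cases "ereal_integral ?n1 f < \<infinity> \<and> ereal_integral ?n2 (conjugate f) < \<infinity>")
      case False
      then have inf: "ereal_integral ?n1 f + ereal_integral ?n2 (conjugate f) = \<infinity>"
        using I1(1) I2(1) by (auto simp: not_less)
      show ?thesis unfolding inf by simp
    next
      case True
      then obtain r s where r: "ereal_integral ?n1 f = ereal r" and s: "ereal_integral ?n2 (conjugate f) = ereal s"
        using I1(4) I2(4) by blast
      define M where "M = (\<integral>x. norm x \<partial>?n1) + (\<integral>x. norm x \<partial>?n2)"
      have "a1 + a2 + real CARD('n) * ln c \<le> r + s + e * M" if e: "0 < e" for e
      proof -
        obtain h where h: "h \<in> convex_lsc" "invariant_fun \<Gamma> h"
          "0 < exp_mass h" "0 < exp_mass (conjugate h)"
          and hr: "ereal_integral ?n1 h \<le> ereal (r + e * (\<integral>x. norm x \<partial>?n1))"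
          and hs: "ereal_integral ?n2 (conjugate h) \<le> ereal (s + e * (\<integral>x. norm x \<partial>?n2))"
          using regular_symmetric_competitor[OF \<Gamma> m1 invariant_moment_measure[OF \<Gamma> 1(1,3)]
              m2 invariant_moment_measure[OF \<Gamma> 2(1,3)] f r s e] by metis
        have hc: "conjugate h \<in> convex_lsc" by (rule conjugate_convex_lsc[OF h(1)])
        have z2: "exp_mass h \<le> ennreal (exp (s + e * (\<integral>x. norm x \<partial>?n2) - a2))"
          unfolding a2_def by (rule exp_integral_le_moment_measure[OF 2(1,2) h(1) hs])
        have z1: "exp_mass (conjugate h) \<le> ennreal (exp (r + e * (\<integral>x. norm x \<partial>?n1) - a1))"
          unfolding a1_def by (rule exp_integral_le_moment_measure[OF 1(1,2) hc]) (use hr biconjugate[OF h(1)] in simp)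
        have "ennreal (c ^ CARD('n)) \<le> exp_mass h * exp_mass (conjugate h)"
          using santalo h unfolding inverse_santalo_def by blast
        also have "\<dots> \<le> ennreal (exp (s + e * (\<integral>x. norm x \<partial>?n2) - a2)) * ennreal (exp (r + e * (\<integral>x. norm x \<partial>?n1) - a1))"
          using z1 z2 by (intro mult_mono) auto
        also have "\<dots> = ennreal (exp (r + s + e * M - (a1 + a2)))"
          by (simp add: ennreal_mult[symmetric] M_def algebra_simps flip: exp_add)
        finally have "c ^ CARD('n) \<le> exp (r + s + e * M - (a1 + a2))" by (subst (asm) ennreal_le_iff) auto
        moreover have "c ^ CARD('n) = exp (real CARD('n) * ln c)" using c by (simp add: exp_of_nat_mult)
        ultimately show ?thesis by simp
      qed
      then have ev: "\<forall>\<^sub>F e in at_right 0. a1 + a2 + real CARD('n) * ln c \<le> r + s + e * M"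
        using eventually_at_right_less[of "0::real"] by (auto elim: eventually_mono)
      have "((\<lambda>e. r + s + e * M) \<longlongrightarrow> r + s + 0 * M) (at_right 0)" by (intro tendsto_intros)
      from tendsto_lowerbound[OF this ev] have "a1 + a2 + real CARD('n) * ln c \<le> r + s" by simp
      then show ?thesis by (simp add: r s)
    qed
  qed
  then have "ereal (- (real CARD('n) * ln c)) + ereal (a1 + a2 + real CARD('n) * ln c)
    \<le> ereal (- (real CARD('n) * ln c)) + transport ?n1 ?n2" by (rule add_left_mono)
  then show ?thesis
    by (simp add: ereal_integral_conjugate_moment_measure[OF 1(1,2)] ereal_integral_conjugate_moment_measure[OF 2(1,2)]
        a1_def[symmetric] a2_def[symmetric])
qed

section \<open>From transport to the inverse Santalo inequality\<close>

lemma hausdorff_measure_empty: "hausdorff_measure k {} = 0"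
proof -
  have "(INF U\<in>{U :: nat \<Rightarrow> 'a::metric_space set. {} \<subseteq> (\<Union>i. U i) \<and> (\<forall>i. bounded (U i) \<and> diameter (U i) \<le> \<delta>)}.
      (\<Sum>i. hausdorff_weight k (U i))) = 0" if "0 < \<delta>" for \<delta> :: real
  proof -
    have "(INF U\<in>{U :: nat \<Rightarrow> 'a set. {} \<subseteq> (\<Union>i. U i) \<and> (\<forall>i. bounded (U i) \<and> diameter (U i) \<le> \<delta>)}.
      (\<Sum>i. hausdorff_weight k (U i))) \<le> (\<Sum>i. hausdorff_weight k ({} :: 'a set))"
      by (rule INF_lower2[of "\<lambda>_. {}"]) (use that in \<open>auto simp: diameter_def\<close>)
    then show ?thesis by (simp add: hausdorff_weight_def)
  qed
  then show ?thesis unfolding hausdorff_measure_def by (simp add: SUP_eq_const)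
qed

lemma finite_imp_essentially_continuous:
  fixes V :: "real^'n \<Rightarrow> ereal"
  assumes V: "V \<in> convex_lsc" and fin: "\<And>x. V x \<noteq> \<infinity>"
  shows "essentially_continuous V"
proof -
  have dom: "effective_dom V = UNIV" using fin by (auto simp: effective_dom_def less_top)
  have Vr: "V = (\<lambda>x. ereal (real_of_ereal (V x)))"
    using effective_dom_real[OF V] dom by auto
  have "continuous_on UNIV (\<lambda>x. real_of_ereal (V x))"
    using continuous_on_real_of_convex_lsc[OF V] by (simp add: dom)
  then have "isCont (\<lambda>x. ereal (real_of_ereal (V x))) x" for x
    by (simp add: continuous_on_eq_continuous_at isCont_def)
  then have "{x. \<not> isCont V x} = {}" using Vr by auto
  then show ?thesis by (simp only: essentially_continuous_def hausdorff_measure_empty)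
qed

lemma add_const_convex_lsc:
  fixes g :: "'a::real_normed_vector \<Rightarrow> ereal"
  assumes g: "g \<in> convex_lsc" shows "(\<lambda>x. g x + ereal l) \<in> convex_lsc"
proof -
  have "convex_ereal (\<lambda>x. g x + ereal l)"
    unfolding convex_ereal_def
  proof (intro allI ballI)
    fix x y :: 'a and t :: real assume t: "t \<in> {0..1}"
    have "g ((1 - t) *\<^sub>R x + t *\<^sub>R y) + ereal l \<le> ereal (1 - t) * g x + ereal t * g y + ereal l"
      using convex_lscD(1)[OF g] t unfolding convex_ereal_def by (intro add_right_mono) auto
    also have "\<dots> = ereal (1 - t) * (g x + ereal l) + ereal t * (g y + ereal l)"
      using t convex_lscD(3)[OF g, of x] convex_lscD(3)[OF g, of y]
      by (cases "g x"; cases "g y") (auto simp: algebra_simps)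
    finally show "g ((1 - t) *\<^sub>R x + t *\<^sub>R y) + ereal l \<le> ereal (1 - t) * (g x + ereal l) + ereal t * (g y + ereal l)" .
  qed
  moreover have "lsc (\<lambda>x. g x + ereal l)"
    unfolding lsc_iff_eventually
  proof (intro allI impI)
    fix x a assume "a < g x + ereal l"
    moreover have sh: "a < z + ereal l \<longleftrightarrow> a - ereal l < z" for z by (cases a; cases z) auto
    ultimately show "\<forall>\<^sub>F y in nhds x. a < g y + ereal l"
      using convex_lscD(2)[OF g] unfolding lsc_iff_eventually by (simp add: sh)
  qed
  moreover have "g x + ereal l \<noteq> -\<infinity>" for x using convex_lscD(3)[OF g, of x] by (cases "g x") auto
  moreover have "\<exists>x. g x + ereal l \<noteq> \<infinity>"
  proof -
    obtain x r where "g x = ereal r" using convex_lscD(4)[OF g] by blast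
    then have "g x + ereal l \<noteq> \<infinity>" by simp
    then show ?thesis by blast
  qed
  ultimately show ?thesis by (simp add: convex_lsc_def)
qed

lemma conjugate_add_const:
  fixes g :: "'a::euclidean_space \<Rightarrow> ereal"
  shows "conjugate (\<lambda>x. g x + ereal l) y = conjugate g y - ereal l"
proof -
  have *: "conjugate (\<lambda>x. g x + ereal l) y \<le> ereal c \<longleftrightarrow> conjugate g y - ereal l \<le> ereal c" for c
  proof -
    have "ereal (x \<bullet> y - c) \<le> g x + ereal l \<longleftrightarrow> ereal (x \<bullet> y - (c + l)) \<le> g x" for x by (cases "g x") auto
    then have "conjugate (\<lambda>x. g x + ereal l) y \<le> ereal c \<longleftrightarrow> conjugate g y \<le> ereal (c + l)"
      by (simp add: conjugate_le_iff)
    also have "\<dots> \<longleftrightarrow> conjugate g y - ereal l \<le> ereal c" by (cases "conjugate g y") auto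
    finally show ?thesis .
  qed
  show ?thesis by (rule antisym; rule ereal_le_real; simp add: *)
qed

lemma normalized_log_concave_prob:
  fixes g :: "real^'n \<Rightarrow> ereal"
  assumes g: "g \<in> convex_lsc" and i: "integrable lborel (gibbs g)" and Z: "0 < gibbs_mass g"
  defines "V \<equiv> \<lambda>x. g x + ereal (ln (gibbs_mass g))"
  shows "log_concave_prob (density lborel (\<lambda>x. exp_minus (V x))) V"
proof -
  define z where "z = gibbs_mass g"
  have V: "V \<in> convex_lsc" unfolding V_def by (rule add_const_convex_lsc[OF g])
  have gV: "exp_minus (V x) = ennreal (gibbs g x / z)" for x
    using convex_lscD(3)[OF g, of x] Z by (cases "g x") (auto simp: V_def exp_minus_def gibbs_simps exp_diff exp_minus z_def[symmetric] field_simps)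
  have "exp_mass V = ennreal (\<integral>x. gibbs g x / z \<partial>lborel)"
    unfolding gV using i Z by (intro nn_integral_eq_integral) (auto simp: z_def)
  also have "\<dots> = 1" using i Z by (simp add: z_def)
  finally have "prob_space (density lborel (\<lambda>x. exp_minus (V x)))"
    by (intro prob_spaceI) (simp add: emeasure_density borel_measurable_exp_minus_convex_lsc[OF V])
  then show ?thesis using V by (simp add: log_concave_prob_def)
qed

text \<open>
  Normalise \<open>g\<close> and its conjugate to potentials of probability measures; both are
  continuous, so the transport bound applies. The conjugate of \<open>g\<close> is an admissible
  competitor in the transport cost, and its cost differs from the left-hand side of the bound by exactly
  the logarithms of the two masses.
\<close>
lemma santalo_of_transport_bound_finite:
  fixes g :: "real^'n \<Rightarrow> ereal"
  assumes c: "0 < c" and \<Gamma>: "involution_group \<Gamma>"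
    and bound: "\<And>\<eta>1 \<eta>2 V1 V2. (\<And>\<gamma>. \<gamma> \<in> \<Gamma> \<Longrightarrow> distr \<eta>1 \<eta>1 \<gamma> = \<eta>1) \<Longrightarrow> (\<And>\<gamma>. \<gamma> \<in> \<Gamma> \<Longrightarrow> distr \<eta>2 \<eta>2 \<gamma> = \<eta>2) \<Longrightarrow>
      log_concave_prob \<eta>1 V1 \<Longrightarrow> essentially_continuous V1 \<Longrightarrow> log_concave_prob \<eta>2 V2 \<Longrightarrow> essentially_continuous V2 \<Longrightarrow>
      ereal_integral (moment_measure V1) (conjugate V1) + ereal_integral (moment_measure V2) (conjugate V2)
        \<le> ereal (- (real CARD('n) * ln c)) + transport (moment_measure V1) (moment_measure V2)"
    and g: "g \<in> convex_lsc" "invariant_fun \<Gamma> g" and fin: "\<And>x. g x \<noteq> \<infinity>" "\<And>y. conjugate g y \<noteq> \<infinity>"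
    and i: "integrable lborel (gibbs g)" "integrable lborel (gibbs (conjugate g))"
  shows "c ^ CARD('n) \<le> gibbs_mass g * gibbs_mass (conjugate g)"
proof -
  have gc: "conjugate g \<in> convex_lsc" by (rule conjugate_convex_lsc[OF g(1)])
  define z1 where "z1 = gibbs_mass g"
  define z2 where "z2 = gibbs_mass (conjugate g)"
  have z: "0 < z1" "0 < z2"
    unfolding z1_def z2_def
    using integral_gibbs_pos[OF g(1) i(1), of 1 0] integral_gibbs_pos[OF gc i(2), of 1 0] fin by (auto simp: less_top)
  define V1 where "V1 x = g x + ereal (ln z1)" for x
  define V2 where "V2 x = conjugate g x + ereal (ln z2)" for x
  define \<eta>1 where "\<eta>1 = density lborel (\<lambda>x. exp_minus (V1 x))"
  define \<eta>2 where "\<eta>2 = density lborel (\<lambda>x. exp_minus (V2 x))"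
  have lc1: "log_concave_prob \<eta>1 V1" unfolding \<eta>1_def V1_def[abs_def] z1_def
    by (rule normalized_log_concave_prob[OF g(1) i(1)]) (use z in \<open>simp add: z1_def\<close>)
  have lc2: "log_concave_prob \<eta>2 V2" unfolding \<eta>2_def V2_def[abs_def] z2_def
    by (rule normalized_log_concave_prob[OF gc i(2)]) (use z in \<open>simp add: z2_def\<close>)
  have fV: "V1 x \<noteq> \<infinity>" "V2 x \<noteq> \<infinity>" for x using fin by (auto simp: V1_def V2_def)
  have inv: "distr (density lborel (\<lambda>x. exp_minus (V x))) (density lborel (\<lambda>x. exp_minus (V x))) \<gamma> = density lborel (\<lambda>x. exp_minus (V x))"
    if V: "V \<in> convex_lsc" "invariant_fun \<Gamma> V" and \<gamma>: "\<gamma> \<in> \<Gamma>" for V :: "real^'n \<Rightarrow> ereal" and \<gamma>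
  proof -
    let ?d = "density lborel (\<lambda>x. exp_minus (V x))"
    have "distr ?d ?d \<gamma> = distr ?d borel \<gamma>" by (rule distr_cong) simp_all
    also have "\<dots> = density lborel (\<lambda>x. exp_minus (V (\<gamma> x)))"
      by (rule distr_density_involution[OF \<Gamma> \<gamma> borel_measurable_exp_minus_convex_lsc(1)[OF V(1)]])
    finally show ?thesis using V(2) \<gamma> by (simp add: invariant_fun_def)
  qed
  have s1: "invariant_fun \<Gamma> V1" using g(2) by (simp add: invariant_fun_def V1_def)
  have s2: "invariant_fun \<Gamma> V2" using invariant_conjugate[OF \<Gamma> g(2)] by (simp add: invariant_fun_def V2_def)
  note D1 = log_concave_probD[OF lc1] and D2 = log_concave_probD[OF lc2]
  have r1: "\<And>x0. ray_regular V1 x0" and r2: "\<And>x0. ray_regular V2 x0" using finite_imp_ray_regular fV by blast+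
  have main: "ereal_integral (moment_measure V1) (conjugate V1) + ereal_integral (moment_measure V2) (conjugate V2)
        \<le> ereal (- (real CARD('n) * ln c)) + transport (moment_measure V1) (moment_measure V2)"
    by (rule bound[of \<eta>1 \<eta>2])
       (use lc1 lc2 inv[OF D1(1) s1] inv[OF D2(1) s2] finite_imp_essentially_continuous[OF D1(1) fV(1)]
          finite_imp_essentially_continuous[OF D2(1) fV(2)] in \<open>auto simp: \<eta>1_def \<eta>2_def\<close>)
  note m1 = finite_first_moment_moment_measure[OF lc1 r1] and m2 = finite_first_moment_moment_measure[OF lc2 r2]
  define a1 where "a1 = real CARD('n) - (\<integral>x. real_of_ereal (V1 x) * gibbs V1 x \<partial>lborel)"
  define a2 where "a2 = real CARD('n) - (\<integral>x. real_of_ereal (V2 x) * gibbs V2 x \<partial>lborel)"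
  have e1: "ereal_integral (moment_measure V1) (conjugate V1) = ereal a1"
    unfolding a1_def by (rule ereal_integral_conjugate_moment_measure[OF lc1 r1])
  have e2: "ereal_integral (moment_measure V2) (conjugate V2) = ereal a2"
    unfolding a2_def by (rule ereal_integral_conjugate_moment_measure[OF lc2 r2])
  have shift: "ereal_integral \<mu> h = ereal (a + l)"
    if m: "finite_first_moment \<mu>" and h': "h' \<in> convex_lsc" "ereal_integral \<mu> h' = ereal a" and hh: "\<And>y. h' y = h y - ereal l"
    for \<mu> and h h' :: "real^'n \<Rightarrow> ereal" and a l
  proof -
    interpret prob_space \<mu> using m by (simp add: finite_first_moment_def)
    have lt: "ereal_integral \<mu> h' < \<infinity>" using h' by simp
    note I = ereal_integral_convex_lsc[OF m h'(1)]
    have "AE y in \<mu>. h y = ereal (real_of_ereal (h' y) + l)"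
      using I(2)[OF lt]
    proof eventually_elim
      case (elim y)
      then show ?case using hh[of y] convex_lscD(3)[OF h'(1), of y] by (cases "h y") auto
    qed
    then have "ereal_integral \<mu> h = ereal (\<integral>y. real_of_ereal (h' y) + l \<partial>\<mu>)"
      using I(3)[OF lt] by (intro ereal_integral_eqI) auto
    also have "(\<integral>y. real_of_ereal (h' y) + l \<partial>\<mu>) = a + l"
      using I(3,4)[OF lt] h'(2) by (simp add: prob_space)
    finally show ?thesis .
  qed
  have i1: "ereal_integral (moment_measure V1) (conjugate g) = ereal (a1 + ln z1)"
    by (rule shift[OF m1 conjugate_convex_lsc[OF D1(1)] e1]) (simp add: V1_def[abs_def] conjugate_add_const)
  have i2: "ereal_integral (moment_measure V2) g = ereal (a2 + ln z2)"
    by (rule shift[OF m2 conjugate_convex_lsc[OF D2(1)] e2])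
       (simp add: V2_def[abs_def] conjugate_add_const biconjugate[OF g(1)])
  have "transport (moment_measure V1) (moment_measure V2)
    \<le> ereal_integral (moment_measure V1) (conjugate g) + ereal_integral (moment_measure V2) (conjugate (conjugate g))"
    unfolding transport_def by (rule INF_lower[OF gc])
  also have "\<dots> = ereal (a1 + ln z1 + (a2 + ln z2))" by (simp add: biconjugate[OF g(1)] i1 i2)
  finally have T: "transport (moment_measure V1) (moment_measure V2) \<le> ereal (a1 + ln z1 + (a2 + ln z2))" .
  have "ereal (a1 + a2) \<le> ereal (- (real CARD('n) * ln c)) + transport (moment_measure V1) (moment_measure V2)"
    using main by (simp add: e1 e2)
  also have "\<dots> \<le> ereal (- (real CARD('n) * ln c)) + ereal (a1 + ln z1 + (a2 + ln z2))" using T by (rule add_left_mono)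
  finally have "real CARD('n) * ln c \<le> ln z1 + ln z2" by simp
  then have "exp (real CARD('n) * ln c) \<le> exp (ln z1 + ln z2)" by simp
  then show ?thesis using z c by (simp add: exp_of_nat_mult exp_add z1_def z2_def)
qed

text \<open>
  Apply the finite case to the smoothings of \<open>f\<close>. Their masses and dual masses are bounded
  by those of the Lipschitz regularisations of \<open>f\<close> and of its conjugate, up to a factor
  that tends to \<open>1\<close>, and the latter converge as the Lipschitz constant grows.
\<close>
lemma santalo_of_transport_bound:
  fixes \<Gamma> :: "(real^'n \<Rightarrow> real^'n) set"
  assumes c: "0 < c" and \<Gamma>: "involution_group \<Gamma>"
    and bound: "\<And>\<eta>1 \<eta>2 V1 V2. (\<And>\<gamma>. \<gamma> \<in> \<Gamma> \<Longrightarrow> distr \<eta>1 \<eta>1 \<gamma> = \<eta>1) \<Longrightarrow> (\<And>\<gamma>. \<gamma> \<in> \<Gamma> \<Longrightarrow> distr \<eta>2 \<eta>2 \<gamma> = \<eta>2) \<Longrightarrow>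
      log_concave_prob \<eta>1 V1 \<Longrightarrow> essentially_continuous V1 \<Longrightarrow> log_concave_prob \<eta>2 V2 \<Longrightarrow> essentially_continuous V2 \<Longrightarrow>
      ereal_integral (moment_measure V1) (conjugate V1) + ereal_integral (moment_measure V2) (conjugate V2)
        \<le> ereal (- (real CARD('n) * ln c)) + transport (moment_measure V1) (moment_measure V2)"
  shows "inverse_santalo {f \<in> convex_lsc. invariant_fun \<Gamma> f} c"
  unfolding inverse_santalo_def
proof (intro ballI impI, elim conjE)
  fix f :: "real^'n \<Rightarrow> ereal"
  assume "f \<in> {f \<in> convex_lsc. invariant_fun \<Gamma> f}"
  then have f: "f \<in> convex_lsc" and inv: "invariant_fun \<Gamma> f" by auto
  assume pos: "0 < exp_mass f" "0 < exp_mass (conjugate f)"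
  have fc: "conjugate f \<in> convex_lsc" by (rule conjugate_convex_lsc[OF f])
  show "ennreal (c ^ CARD('n)) \<le> exp_mass f * exp_mass (conjugate f)"
  proof (cases "exp_mass f < \<infinity> \<and> exp_mass (conjugate f) < \<infinity>")
    case False
    then have "exp_mass f * exp_mass (conjugate f) = \<top>"
      using pos by (auto simp: ennreal_mult_eq_top_iff less_top[symmetric] simp del: not_gr_zero)
    then show ?thesis by simp
  next
    case True
    obtain a b where co: "0 < a" "\<And>x. ereal (a * norm x - b) \<le> f x"
      using convex_lsc_coercive[OF f pos(1)] True by metis
    obtain a' b' where co': "0 < a'" "\<And>x. ereal (a' * norm x - b') \<le> conjugate f x"
      using convex_lsc_coercive[OF fc pos(2)] True by metis
    obtain k0 :: nat where k0: "max a a' \<le> real k0" using real_arch_simple by blast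
    define L where "L k = lipreg (real (k + k0)) f" for k
    define L' where "L' k = lipreg (real (k + k0)) (conjugate f)" for k
    define g where "g k = smoothing (real (k + k0)) f" for k
    have ak: "a \<le> real (k + k0)" "a' \<le> real (k + k0)" for k using k0 by auto
    note Lp = lipreg_properties[OF f co ak(1), folded L_def] and Lp' = lipreg_properties[OF fc co' ak(2), folded L'_def]
    note gp = smoothing_properties[OF f co ak(1), folded g_def L_def L'_def]
    have gc: "conjugate (g k) \<in> convex_lsc" for k by (rule conjugate_convex_lsc[OF gp(1)])
    have iL: "integrable lborel (gibbs (L k))" for k
      by (rule integrable_gibbs_coercive[OF borel_measurable_convex_lsc[OF Lp(1)] co(1) Lp(2)])
    have iL': "integrable lborel (gibbs (L' k))" for k
      by (rule integrable_gibbs_coercive[OF borel_measurable_convex_lsc[OF Lp'(1)] co'(1) Lp'(2)])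
    define \<epsilon> where "\<epsilon> k = 1 / (2 * real (k + k0))" for k
    have up1: "gibbs (g k) x \<le> gibbs (L k) x" for k x
      by (rule gibbs_mono, rule gp(4), rule convex_lscD(3)[OF Lp(1)])
    have up2: "gibbs (conjugate (g k)) x \<le> exp (\<epsilon> k) * gibbs (L' k) x" for k x
      using gp(5)[of k x] convex_lscD(3)[OF Lp'(1), of k x] Lp'(3)[of k x] convex_lscD(3)[OF gc, of k x]
      by (cases "L' k x"; cases "conjugate (g k) x") (auto simp: gibbs_simps \<epsilon>_def simp flip: exp_add)
    have ig: "integrable lborel (gibbs (g k))" for k
      by (rule Bochner_Integration.integrable_bound[OF iL[of k]])
         (use up1 in \<open>auto simp: borel_measurable_gibbs borel_measurable_convex_lsc[OF gp(1)]\<close>)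
    have ig': "integrable lborel (gibbs (conjugate (g k)))" for k
      by (rule Bochner_Integration.integrable_bound[OF integrable_mult_right[OF iL'[of k], of "exp (\<epsilon> k)"]])
         (use up2 in \<open>auto simp: borel_measurable_gibbs borel_measurable_convex_lsc[OF gc]\<close>)
    define u where "u k = gibbs_mass (L k)" for k
    define w where "w k = gibbs_mass (L' k)" for k
    have step: "c ^ CARD('n) \<le> u k * (exp (\<epsilon> k) * w k)" for k
    proof -
      have "c ^ CARD('n) \<le> gibbs_mass (g k) * gibbs_mass (conjugate (g k))"
        by (rule santalo_of_transport_bound_finite[OF c \<Gamma> bound gp(1) _ gp(2,3) ig ig'])
           (use invariant_smoothing[OF \<Gamma> inv] in \<open>auto simp: g_def\<close>)
      also have "\<dots> \<le> u k * (exp (\<epsilon> k) * w k)"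
      proof (rule mult_mono)
        show "gibbs_mass (g k) \<le> u k" unfolding u_def by (intro integral_mono ig iL up1)
        have "gibbs_mass (conjugate (g k)) \<le> (\<integral>x. exp (\<epsilon> k) * gibbs (L' k) x \<partial>lborel)"
          by (intro integral_mono ig' integrable_mult_right iL' up2)
        then show "gibbs_mass (conjugate (g k)) \<le> exp (\<epsilon> k) * w k" by (simp add: w_def)
      qed (auto simp: u_def)
      finally show ?thesis .
    qed
    have "\<epsilon> \<longlonglongrightarrow> 0"
    proof -
      have "(\<lambda>k. (1/2) * inverse (real (k + k0))) \<longlonglongrightarrow> (1/2) * 0"
        using LIMSEQ_ignore_initial_segment[OF lim_inverse_n, of k0] by (intro tendsto_mult tendsto_const) auto
      then show ?thesis by (simp add: \<epsilon>_def[abs_def] inverse_eq_divide)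
    qed
    moreover have "u \<longlonglongrightarrow> gibbs_mass f"
      unfolding u_def[abs_def] L_def using k0 by (intro integral_gibbs_lipreg_LIMSEQ[OF f co]) auto
    moreover have "w \<longlonglongrightarrow> gibbs_mass (conjugate f)"
      unfolding w_def[abs_def] L'_def using k0 by (intro integral_gibbs_lipreg_LIMSEQ[OF fc co']) auto
    ultimately have "(\<lambda>k. u k * (exp (\<epsilon> k) * w k)) \<longlonglongrightarrow> gibbs_mass f * (exp 0 * gibbs_mass (conjugate f))"
      by (intro tendsto_intros)
    then have "c ^ CARD('n) \<le> gibbs_mass f * (exp 0 * gibbs_mass (conjugate f))"
      by (rule LIMSEQ_le_const) (use step in blast)
    then have "ennreal (c ^ CARD('n)) \<le> ennreal (gibbs_mass f) * ennreal (gibbs_mass (conjugate f))"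
      by (simp add: ennreal_leI flip: ennreal_mult)
    also have "ennreal (gibbs_mass f) = exp_mass f"
      unfolding nn_integral_exp_minus_eq[OF f]
      by (rule nn_integral_eq_integral[symmetric, OF integrable_gibbs_coercive[OF borel_measurable_convex_lsc[OF f] co]]) simp
    also have "ennreal (gibbs_mass (conjugate f)) = exp_mass (conjugate f)"
      unfolding nn_integral_exp_minus_eq[OF fc]
      by (rule nn_integral_eq_integral[symmetric, OF integrable_gibbs_coercive[OF borel_measurable_convex_lsc[OF fc] co']]) simp
    finally show ?thesis .
  qed
qed

section \<open>The three symmetry classes\<close>

lemma involution_group_trivial: "involution_group {id :: 'a::euclidean_space \<Rightarrow> 'a}"
proof -
  have "distr lborel borel (id :: 'a \<Rightarrow> 'a) = lborel" by (simp add: id_def distr_id2)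
  then show ?thesis by (simp add: involution_group_def linear_id)
qed

lemma involution_group_uminus: "involution_group {id, uminus :: 'a::euclidean_space \<Rightarrow> 'a}"
proof -
  have "distr lborel borel (uminus :: 'a \<Rightarrow> 'a) = lborel"
    using lborel_affine[of "-1" "0 :: 'a"] by (simp add: density_1)
  moreover have "distr lborel borel (id :: 'a \<Rightarrow> 'a) = lborel" by (simp add: id_def distr_id2)
  moreover have "linear (uminus :: 'a \<Rightarrow> 'a)" by (auto intro: linearI)
  moreover have "(uminus :: 'a \<Rightarrow> 'a) \<circ> uminus = id" by (auto simp: fun_eq_iff)
  ultimately show ?thesis by (auto simp: involution_group_def linear_id)
qed

lemma sign_change_eq_sum:
  "sign_change e x = (\<Sum>j\<in>Basis. ((e \<bullet> j) * (x \<bullet> j)) *\<^sub>R j)" for x :: "real^'n"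
proof (rule euclidean_eqI)
  fix b :: "real^'n" assume b: "b \<in> Basis"
  then obtain i where i: "b = axis i 1" by (auto simp: Basis_vec_def)
  have "(\<Sum>j\<in>Basis. ((e \<bullet> j) * (x \<bullet> j)) *\<^sub>R j) \<bullet> b = (e \<bullet> b) * (x \<bullet> b)"
    using b by (simp add: inner_sum_left inner_Basis if_distrib sum.delta cong: if_cong)
  then show "sign_change e x \<bullet> b = (\<Sum>j\<in>Basis. ((e \<bullet> j) * (x \<bullet> j)) *\<^sub>R j) \<bullet> b"
    by (simp add: i sign_change_def inner_axis)
qed

lemma involution_group_sign_changes:
  "involution_group (sign_change ` {e :: real^'n. \<forall>i. e $ i \<in> {-1, 1}})"
proof -
  let ?E = "{e :: real^'n. \<forall>i. e $ i \<in> {-1, 1}}"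
  have "?E \<subseteq> vec_lambda ` (PiE UNIV (\<lambda>_. {-1, 1}))"
  proof
    fix e assume "e \<in> ?E"
    then have "vec_nth e \<in> PiE UNIV (\<lambda>_. {-1, 1})" "e = vec_lambda (vec_nth e)" by auto
    then show "e \<in> vec_lambda ` (PiE UNIV (\<lambda>_. {-1, 1}))" by blast
  qed
  moreover have "finite (PiE (UNIV :: 'n set) (\<lambda>_. {-1, 1 :: real}))" by (intro finite_PiE) auto
  ultimately have "finite ?E" by (meson finite_imageI finite_subset)
  moreover have "id \<in> sign_change ` ?E"
    by (rule image_eqI[of _ _ "\<chi> i. 1"]) (auto simp: fun_eq_iff sign_change_def vec_eq_iff)
  moreover have "sign_change e \<circ> sign_change e' \<in> sign_change ` ?E" if "e \<in> ?E" "e' \<in> ?E" for e e'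
  proof (rule image_eqI[of _ _ "\<chi> i. e $ i * e' $ i"])
    show "(\<chi> i. e $ i * e' $ i) \<in> ?E"
    proof -
      have "e $ i * e' $ i \<in> {-1, 1}" for i using that by (auto dest!: spec[of _ i])
      then show ?thesis by simp
    qed
  qed (auto simp: fun_eq_iff sign_change_def vec_eq_iff)
  moreover have "linear (sign_change e) \<and> (\<forall>x. sign_change e (sign_change e x) = x)
      \<and> (\<forall>x y. sign_change e x \<bullet> y = x \<bullet> sign_change e y) \<and> distr lborel borel (sign_change e) = lborel"
    if e: "e \<in> ?E" for e
  proof (intro conjI allI)
    show "linear (sign_change e)" by (rule linearI) (auto simp: sign_change_def vec_eq_iff algebra_simps)
    have sq: "e $ i * (e $ i * z) = z" for i z
    proof -
      have "e $ i = -1 \<or> e $ i = 1" using e by auto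
      then show ?thesis by auto
    qed
    show "sign_change e (sign_change e x) = x" for x by (simp add: sign_change_def vec_eq_iff sq)
    show "sign_change e x \<bullet> y = x \<bullet> sign_change e y" for x y
      by (simp add: sign_change_def inner_vec_def mult.commute mult.left_commute)
    have abs: "\<bar>e \<bullet> j\<bar> = 1" if j: "j \<in> Basis" for j
    proof -
      obtain i where "j = axis i 1" using j by (auto simp: Basis_vec_def)
      moreover have "e $ i = -1 \<or> e $ i = 1" using e by auto
      ultimately show ?thesis by (auto simp: inner_axis)
    qed
    have "lborel = density (distr lborel borel (\<lambda>x. 0 + (\<Sum>j\<in>Basis. ((e \<bullet> j) * (x \<bullet> j)) *\<^sub>R j))) (\<lambda>_. \<Prod>j\<in>Basis. \<bar>e \<bullet> j\<bar>)"
      by (rule lborel_affine_euclidean) (use abs in fastforce)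
    also have "(\<lambda>x. 0 + (\<Sum>j\<in>Basis. ((e \<bullet> j) * (x \<bullet> j)) *\<^sub>R j)) = sign_change e"
      by (auto simp: sign_change_eq_sum)
    also have "(\<Prod>j\<in>Basis. \<bar>e \<bullet> j\<bar>) = 1" by (simp add: abs)
    finally show "distr lborel borel (sign_change e) = lborel" by (simp add: density_1)
  qed
  ultimately show ?thesis unfolding involution_group_def by auto
qed

section \<open>The equivalence\<close>

theorem corollary3:
  fixes c :: real
    and G :: "(real^'n \<Rightarrow> ereal) set"
    and Q :: "(real^'n) measure set"
  assumes "c > 0"
    and "(G, Q) \<in> {(convex_lsc, UNIV), (convex_lsc_uncond, measures_uncond), (convex_lsc_sym, measures_sym)}"
  shows
    "(inverse_santalo G c \<longleftrightarrow>
       (\<forall>\<eta>\<^sub>1\<in>Q. \<forall>\<eta>\<^sub>2\<in>Q. \<forall>V\<^sub>1 V\<^sub>2.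
          log_concave_prob \<eta>\<^sub>1 V\<^sub>1 \<and> essentially_continuous V\<^sub>1 \<and>
          log_concave_prob \<eta>\<^sub>2 V\<^sub>2 \<and> essentially_continuous V\<^sub>2 \<longrightarrow>
          transport (moment_measure V\<^sub>1) \<eta>\<^sub>1 + entropy_Leb \<eta>\<^sub>1
            + transport (moment_measure V\<^sub>2) \<eta>\<^sub>2 + entropy_Leb \<eta>\<^sub>2
          \<le> ereal (- (real CARD('n) * ln c)) + transport (moment_measure V\<^sub>1) (moment_measure V\<^sub>2)))
     \<and>
     (inverse_santalo G c \<longleftrightarrow>
       (\<forall>\<eta>\<^sub>1\<in>Q. \<forall>\<eta>\<^sub>2\<in>Q. \<forall>V\<^sub>1 V\<^sub>2.
          log_concave_prob \<eta>\<^sub>1 V\<^sub>1 \<and> essentially_continuous V\<^sub>1 \<and>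
          log_concave_prob \<eta>\<^sub>2 V\<^sub>2 \<and> essentially_continuous V\<^sub>2 \<longrightarrow>
          ereal_integral (moment_measure V\<^sub>1) (conjugate V\<^sub>1)
            + ereal_integral (moment_measure V\<^sub>2) (conjugate V\<^sub>2)
          \<le> ereal (- (real CARD('n) * ln c)) + transport (moment_measure V\<^sub>1) (moment_measure V\<^sub>2)))
     \<and>
     (\<forall>\<eta>\<^sub>1\<in>Q. \<forall>\<eta>\<^sub>2\<in>Q. \<forall>V\<^sub>1 V\<^sub>2.
        log_concave_prob \<eta>\<^sub>1 V\<^sub>1 \<and> (\<forall>x. V\<^sub>1 x \<noteq> \<infinity>) \<and>
        log_concave_prob \<eta>\<^sub>2 V\<^sub>2 \<and> (\<forall>x. V\<^sub>2 x \<noteq> \<infinity>) \<longrightarrow>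
        (transport (moment_measure V\<^sub>1) \<eta>\<^sub>1 + entropy_Leb \<eta>\<^sub>1
            + transport (moment_measure V\<^sub>2) \<eta>\<^sub>2 + entropy_Leb \<eta>\<^sub>2
          \<le> ereal (- (real CARD('n) * ln c)) + transport (moment_measure V\<^sub>1) (moment_measure V\<^sub>2)
         \<longleftrightarrow>
         entropy_Leb \<eta>\<^sub>1 + entropy_Leb \<eta>\<^sub>2
          \<le> ereal (- (real CARD('n) * ln (exp 2 * c))) + transport (moment_measure V\<^sub>1) (moment_measure V\<^sub>2)))"
proof -
  define n where "n = real CARD('n)"
  obtain \<Gamma> :: "(real^'n \<Rightarrow> real^'n) set" where \<Gamma>: "involution_group \<Gamma>"
    and G: "G = {f \<in> convex_lsc. invariant_fun \<Gamma> f}"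
    and Q: "Q = {\<eta>. \<forall>\<gamma>\<in>\<Gamma>. distr \<eta> \<eta> \<gamma> = \<eta>}"
  proof -
    consider "G = convex_lsc" "Q = UNIV" | "G = convex_lsc_uncond" "Q = measures_uncond"
      | "G = convex_lsc_sym" "Q = measures_sym"
      using assms(2) by auto
    then show thesis
    proof cases
      case 1
      then show ?thesis
        by (intro that[of "{id}"] involution_group_trivial) (auto simp: invariant_fun_def id_def distr_id)
    next
      case 2
      then show ?thesis
        by (intro that[OF involution_group_sign_changes])
           (auto simp: invariant_fun_def convex_lsc_uncond_def measures_uncond_def)
    next
      case 3
      then show ?thesis
        by (intro that[OF involution_group_uminus])
           (auto simp: invariant_fun_def convex_lsc_sym_def measures_sym_def id_def distr_id)
    qed
  qed
  define B where "B V = (\<integral>x. real_of_ereal (V x) * gibbs V x \<partial>lborel)" for V :: "real^'n \<Rightarrow> ereal"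
  have terms: "transport (moment_measure V) \<eta> = ereal n" "entropy_Leb \<eta> = ereal (- B V)"
    "ereal_integral (moment_measure V) (conjugate V) = ereal (n - B V)"
    if "log_concave_prob \<eta> V" "\<And>x0. ray_regular V x0" for \<eta> V
    using transport_moment_measure[OF that] entropy_Leb_log_concave[OF that] ereal_integral_conjugate_moment_measure[OF that]
    by (simp_all add: n_def B_def)
  \<comment> \<open>transport cost and entropy add up to \<open>n - B V\<close>, so both formulations bound the same real number\<close>
  have lhs: "transport (moment_measure V\<^sub>1) \<eta>\<^sub>1 + entropy_Leb \<eta>\<^sub>1 + transport (moment_measure V\<^sub>2) \<eta>\<^sub>2 + entropy_Leb \<eta>\<^sub>2
      = ereal_integral (moment_measure V\<^sub>1) (conjugate V\<^sub>1) + ereal_integral (moment_measure V\<^sub>2) (conjugate V\<^sub>2)"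
    if "log_concave_prob \<eta>\<^sub>1 V\<^sub>1" "essentially_continuous V\<^sub>1" "log_concave_prob \<eta>\<^sub>2 V\<^sub>2" "essentially_continuous V\<^sub>2"
    for \<eta>\<^sub>1 \<eta>\<^sub>2 :: "(real^'n) measure" and V\<^sub>1 V\<^sub>2
    using terms[OF that(1) essentially_continuous_imp_ray_regular[OF that(2)]]
      terms[OF that(3) essentially_continuous_imp_ray_regular[OF that(4)]] by simp
  have main: "inverse_santalo G c \<longleftrightarrow>
       (\<forall>\<eta>\<^sub>1\<in>Q. \<forall>\<eta>\<^sub>2\<in>Q. \<forall>V\<^sub>1 V\<^sub>2.
          log_concave_prob \<eta>\<^sub>1 V\<^sub>1 \<and> essentially_continuous V\<^sub>1 \<and>
          log_concave_prob \<eta>\<^sub>2 V\<^sub>2 \<and> essentially_continuous V\<^sub>2 \<longrightarrow>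
          ereal_integral (moment_measure V\<^sub>1) (conjugate V\<^sub>1)
            + ereal_integral (moment_measure V\<^sub>2) (conjugate V\<^sub>2)
          \<le> ereal (- (real CARD('n) * ln c)) + transport (moment_measure V\<^sub>1) (moment_measure V\<^sub>2))"
  proof (intro iffI ballI allI impI)
    fix \<eta>\<^sub>1 \<eta>\<^sub>2 :: "(real^'n) measure" and V\<^sub>1 V\<^sub>2
    assume "inverse_santalo G c" "\<eta>\<^sub>1 \<in> Q" "\<eta>\<^sub>2 \<in> Q"
      "log_concave_prob \<eta>\<^sub>1 V\<^sub>1 \<and> essentially_continuous V\<^sub>1 \<and> log_concave_prob \<eta>\<^sub>2 V\<^sub>2 \<and> essentially_continuous V\<^sub>2"
    then show "ereal_integral (moment_measure V\<^sub>1) (conjugate V\<^sub>1) + ereal_integral (moment_measure V\<^sub>2) (conjugate V\<^sub>2)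
          \<le> ereal (- (real CARD('n) * ln c)) + transport (moment_measure V\<^sub>1) (moment_measure V\<^sub>2)"
      by (intro transport_bound_of_santalo[OF assms(1) \<Gamma>])
         (auto simp: G Q intro: essentially_continuous_imp_ray_regular)
  next
    assume *: "\<forall>\<eta>\<^sub>1\<in>Q. \<forall>\<eta>\<^sub>2\<in>Q. \<forall>V\<^sub>1 V\<^sub>2.
          log_concave_prob \<eta>\<^sub>1 V\<^sub>1 \<and> essentially_continuous V\<^sub>1 \<and>
          log_concave_prob \<eta>\<^sub>2 V\<^sub>2 \<and> essentially_continuous V\<^sub>2 \<longrightarrow>
          ereal_integral (moment_measure V\<^sub>1) (conjugate V\<^sub>1)
            + ereal_integral (moment_measure V\<^sub>2) (conjugate V\<^sub>2)
          \<le> ereal (- (real CARD('n) * ln c)) + transport (moment_measure V\<^sub>1) (moment_measure V\<^sub>2)"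
    show "inverse_santalo G c"
      unfolding G
    proof (rule santalo_of_transport_bound[OF assms(1) \<Gamma>])
      fix \<eta>\<^sub>1 \<eta>\<^sub>2 :: "(real^'n) measure" and V\<^sub>1 V\<^sub>2
      assume "\<And>\<gamma>. \<gamma> \<in> \<Gamma> \<Longrightarrow> distr \<eta>\<^sub>1 \<eta>\<^sub>1 \<gamma> = \<eta>\<^sub>1" "\<And>\<gamma>. \<gamma> \<in> \<Gamma> \<Longrightarrow> distr \<eta>\<^sub>2 \<eta>\<^sub>2 \<gamma> = \<eta>\<^sub>2"
      then have "\<eta>\<^sub>1 \<in> Q" "\<eta>\<^sub>2 \<in> Q" by (auto simp: Q)
      moreover assume "log_concave_prob \<eta>\<^sub>1 V\<^sub>1" "essentially_continuous V\<^sub>1" "log_concave_prob \<eta>\<^sub>2 V\<^sub>2" "essentially_continuous V\<^sub>2"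
      ultimately show "ereal_integral (moment_measure V\<^sub>1) (conjugate V\<^sub>1) + ereal_integral (moment_measure V\<^sub>2) (conjugate V\<^sub>2)
          \<le> ereal (- (real CARD('n) * ln c)) + transport (moment_measure V\<^sub>1) (moment_measure V\<^sub>2)"
        using * by blast
    qed
  qed
  have finite_case: "transport (moment_measure V\<^sub>1) \<eta>\<^sub>1 + entropy_Leb \<eta>\<^sub>1
            + transport (moment_measure V\<^sub>2) \<eta>\<^sub>2 + entropy_Leb \<eta>\<^sub>2
          \<le> ereal (- (real CARD('n) * ln c)) + transport (moment_measure V\<^sub>1) (moment_measure V\<^sub>2)
         \<longleftrightarrow>
         entropy_Leb \<eta>\<^sub>1 + entropy_Leb \<eta>\<^sub>2
          \<le> ereal (- (real CARD('n) * ln (exp 2 * c))) + transport (moment_measure V\<^sub>1) (moment_measure V\<^sub>2)"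
    if "log_concave_prob \<eta>\<^sub>1 V\<^sub>1" "\<And>x. V\<^sub>1 x \<noteq> \<infinity>" "log_concave_prob \<eta>\<^sub>2 V\<^sub>2" "\<And>x. V\<^sub>2 x \<noteq> \<infinity>"
    for \<eta>\<^sub>1 \<eta>\<^sub>2 :: "(real^'n) measure" and V\<^sub>1 V\<^sub>2
  proof -
    note t = terms[OF that(1) finite_imp_ray_regular[OF that(2)]] terms[OF that(3) finite_imp_ray_regular[OF that(4)]]
    have "ln (exp 2 * c) = 2 + ln c" using assms(1) by (simp add: ln_mult)
    then have l: "- (n * ln (exp 2 * c)) = - (n * ln c) - 2 * n" by (simp add: algebra_simps)
    show ?thesis
      unfolding t n_def[symmetric] l
      by (cases "transport (moment_measure V\<^sub>1) (moment_measure V\<^sub>2)") (auto simp: algebra_simps)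
  qed
  have first: "inverse_santalo G c \<longleftrightarrow>
       (\<forall>\<eta>\<^sub>1\<in>Q. \<forall>\<eta>\<^sub>2\<in>Q. \<forall>V\<^sub>1 V\<^sub>2.
          log_concave_prob \<eta>\<^sub>1 V\<^sub>1 \<and> essentially_continuous V\<^sub>1 \<and>
          log_concave_prob \<eta>\<^sub>2 V\<^sub>2 \<and> essentially_continuous V\<^sub>2 \<longrightarrow>
          transport (moment_measure V\<^sub>1) \<eta>\<^sub>1 + entropy_Leb \<eta>\<^sub>1
            + transport (moment_measure V\<^sub>2) \<eta>\<^sub>2 + entropy_Leb \<eta>\<^sub>2
          \<le> ereal (- (real CARD('n) * ln c)) + transport (moment_measure V\<^sub>1) (moment_measure V\<^sub>2))"
    unfolding main by (intro ball_cong refl all_cong1 imp_cong) (simp add: lhs)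
  show ?thesis using first main finite_case by blast
qed

end
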